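(* Let $d=1$, let $\mu$ be the Gaussian measure with respect to the harmonic oscillator $\mathcal L=-\partial_x^2+x^2$ on $\mathbb R$ described in the context, and for $u$ distributed according to $\mu$ write $u_N=\mathbf P_N u$. For $K>0$, $p>2$, $N\in\mathbb N$ let $$\mathcal Z_{K,N}=\int \mathbf 1_{\{|\int_{\mathbb R}:|u_N|^2:\,dx|\le K\}}\,e^{\frac1p\|u_N\|_{L^p(\mathbb R)}^p}\,d\mu(u),\qquad d\rho_{N,K}(u)=\mathcal Z_{K,N}^{-1}\mathbf 1_{\{|\int_{\mathbb R}:|u_N|^2:\,dx|\le K\}}\,e^{\frac1p\|u_N\|_{L^p(\mathbb R)}^p}\,d\mu(u),$$ $$\mathcal Z_{K}=\int \mathbf 1_{\{|\int_{\mathbb R}:|u|^2:\,dx|\le K\}}\,e^{\frac1p\|u\|_{L^p(\mathbb R)}^p}\,d\mu(u).$$ Then the following hold. (i) (subcritical case) Let $K>0$ and $2<p<6$. For every finite $r\ge1$, $$\sup_{N\in\mathbb N}\Big\|\mathbf 1_{\{|\int_{\mathbb R}:|u_N|^2:\,dx|\le K\}}\,e^{\frac1p\|u_N\|_{L^p(\mathbb R)}^p}\Big\|_{L^r(\mu)}<\infty,$$ and moreover $$\lim_{N\to\infty}\mathbf 1_{\{|\int_{\mathbb R}:|u_N|^2:\,dx|\le K\}}\,e^{\frac1p\|u_N\|_{L^p(\mathbb R)}^p}=\mathbf 1_{\{|\int_{\mathbb R}:|u|^2:\,dx|\le K\}}\,e^{\frac1p\|u\|_{L^p(\mathbb R)}^p}\quad\text{in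 }L^r(\mu).$$ As a consequence, $\rho_{N,K}$ converges in total variation, as $N\to\infty$, to the probability measure $\rho$ defined by $$d\rho(u)=\mathcal Z_K^{-1}\mathbf 1_{\{|\int_{\mathbb R}:|u|^2:\,dx|\le K\}}\,e^{\frac1p\|u\|_{L^p(\mathbb R)}^p}\,d\mu(u),$$ and $\rho$ is absolutely continuous with respect to $\mu$. (ii) (critical/supercritical cases) Let $p\ge6$. Then for every $K>0$, $$\sup_{N\in\mathbb N}\mathcal Z_{K,N}=\sup_{N\in\mathbb N}\Big\|\mathbf 1_{\{|\int_{\mathbb R}:|u_N|^2:\,dx|\le K\}}\,e^{\frac1p\|u_N\|_{L^p(\mathbb R)}^p}\Big\|_{L^1(\mu)}=\infty ,$$ and likewise $\mathcal Z_K=\infty$. As a consequence, for $p\ge 6$ the measure $\mathbf 1_{\{|\int_{\mathbb R}:|u|^2:\,dx|\le K\}}\,e^{\frac1p\|u\|_{L^p(\mathbb R)}^p}\,d\mu(u)$ cannot be normalized to a probability measure.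
   Context: $\mathcal L=-\partial_x^2+x^2$ on $L^2(\mathbb R)$ has the orthonormal basis of real eigenfunctions (Hermite functions) $h_n(x)=(-1)^n c_n e^{x^2/2}\frac{d^n}{dx^n}(e^{-x^2})$, $c_n=(n!)^{-1/2}2^{-n/2}\pi^{-1/4}$, $n\ge0$, with $\mathcal L h_n=\lambda_n^2h_n$, $\lambda_n=\sqrt{1+2n}$. The harmonic Sobolev space $\mathcal H^s(\mathbb R)$ has norm $\|\sum_n c_nh_n\|_{\mathcal H^s}^2=\sum_n\lambda_n^{2s}|c_n|^2$. Let $\{g_n\}_{n\ge0}$ be independent standard complex-valued Gaussian random variables ($\mathbb E g_n=0$, $\mathbb E|g_n|^2=1$, rotationally invariant). The Gaussian measure $\mu$ is the law of the random distribution $u^\omega=\sum_{n\ge0}\frac{g_n(\omega)}{\lambda_n}h_n$, which converges in $L^2(\Omega;\mathcal H^{-s}(\mathbb R))$ for every $s>0$. The spectral projector is $\mathbf P_N(\sum_{n\ge0}u_nh_n)=\sum_{n=0}^Nu_nh_n$. Under $\mu$, set $\sigma_N(x)=\mathbb E_\mu[|u_N(x)|^2]=\sum_{n=0}^N\frac{h_n(x)^2}{\lambda_n^2}$ and $:|u_N|^2:\;=|u_N|^2-\sigma_N$. The random variables $\int_{\mathbb R}:|u_N|^2:\,dx$ form a Cauchy sequence in $L^2(\mu)$, and $\int_{\mathbb R}:|u|^2:\,dx$ denotes their limit. For $p>2$, $\|u\|_{L^p(\mathbb R)}<\infty$ for $\mu$-almost every $u$. *)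

theory Defs
  imports "HOL-Probability.Probability"
begin

definition hermite_fun :: "nat \<Rightarrow> real \<Rightarrow> real" where
  "hermite_fun n x =
     (- 1) ^ n * (fact n powr (- 1 / 2) * 2 powr (- real n / 2) * pi powr (- 1 / 4))
       * exp (x\<^sup>2 / 2) * (deriv ^^ n) (\<lambda>y. exp (- y\<^sup>2)) x"

definition freq :: "nat \<Rightarrow> real" where
  "freq n = sqrt (1 + 2 * real n)"

definition Lp_norm :: "'a measure \<Rightarrow> real \<Rightarrow> ('a \<Rightarrow> 'b::real_normed_vector) \<Rightarrow> ennreal" where
  "Lp_norm M p f =
     (let I = \<integral>\<^sup>+ x. ennreal (norm (f x) powr p) \<partial>M
      in if I = \<top> then \<top> else ennreal (enn2real I powr (1 / p)))"

(* Elements of L^p are classes modulo null sets; a representative only has to be measurable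
   up to a null set, i.e. with respect to the completed measure. *)
definition in_Lp :: "'a measure \<Rightarrow> real \<Rightarrow> ('a \<Rightarrow> 'b::real_normed_vector) \<Rightarrow> bool" where
  "in_Lp M p f \<longleftrightarrow> f \<in> borel_measurable (completion M) \<and> Lp_norm M p f < \<top>"

definition tendsto_Lp ::
  "'a measure \<Rightarrow> real \<Rightarrow> (nat \<Rightarrow> 'a \<Rightarrow> 'b::real_normed_vector) \<Rightarrow> ('a \<Rightarrow> 'b) \<Rightarrow> bool" where
  "tendsto_Lp M p F G \<longleftrightarrow>
     (\<forall>N. in_Lp M p (F N)) \<and> in_Lp M p G \<and>
     (\<lambda>N. Lp_norm M p (\<lambda>x. F N x - G x)) \<longlonglongrightarrow> 0"

definition total_variation_dist :: "'a measure \<Rightarrow> 'a measure \<Rightarrow> ennreal" where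
  "total_variation_dist M M' = (SUP A\<in>sets M. ennreal \<bar>measure M A - measure M' A\<bar>)"

(* Density 1/pi * exp(-|z|^2) on the plane: the centred rotationally invariant Gaussian law
   with second absolute moment 1 (real and imaginary parts independent with variance 1/2). *)
definition std_complex_gaussian :: "'a measure \<Rightarrow> ('a \<Rightarrow> complex) \<Rightarrow> bool" where
  "std_complex_gaussian M X \<longleftrightarrow>
     distributed M lborel X (\<lambda>z. ennreal (exp (- (cmod z)\<^sup>2) / pi))"

(* A distribution u = (SUM n. u n * h_n) in the union of the harmonic Sobolev spaces is encoded
   by its sequence of Hermite coefficients u :: nat => complex.  The Borel sigma-algebra of each
   Sobolev space H^{-s} is the trace of the product sigma-algebra, so the law of the random series
   with coefficients g n / freq n is a measure on the product space; for every s > 0 it is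
   carried by the sequences with (SUM n. freq n powr (-2 * s) * |u n|^2) < infinity. *)
definition gauss_law :: "'a measure \<Rightarrow> (nat \<Rightarrow> 'a \<Rightarrow> complex) \<Rightarrow> (nat \<Rightarrow> complex) measure" where
  "gauss_law M g =
     distr M (PiM UNIV (\<lambda>_. borel)) (\<lambda>\<omega> n. g n \<omega> / of_real (freq n))"

definition proj :: "nat \<Rightarrow> (nat \<Rightarrow> complex) \<Rightarrow> real \<Rightarrow> complex" where
  "proj N u x = (\<Sum>n=0..N. u n * of_real (hermite_fun n x))"

(* L^p norm of a distribution: infinite unless the distribution is given by an L^p function f,
   i.e. f has the prescribed Hermite coefficients.  For p \<ge> 1 two L^p functions with the same
   Hermite coefficients agree almost everywhere, so the infimum then is the norm of f. *)
definition distribution_Lp_norm :: "real \<Rightarrow> (nat \<Rightarrow> complex) \<Rightarrow> ennreal" where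
  "distribution_Lp_norm p u =
     (INF f \<in> {f \<in> borel_measurable lborel. \<forall>n.
          integrable lborel (\<lambda>x. f x * of_real (hermite_fun n x)) \<and>
          (\<integral>x. f x * of_real (hermite_fun n x) \<partial>lborel) = u n}.
        Lp_norm lborel p f)"

definition sigma :: "(nat \<Rightarrow> complex) measure \<Rightarrow> nat \<Rightarrow> real \<Rightarrow> real" where
  "sigma \<mu> N x = (\<integral>u. (cmod (proj N u x))\<^sup>2 \<partial>\<mu>)"

definition wick_mass_trunc :: "(nat \<Rightarrow> complex) measure \<Rightarrow> nat \<Rightarrow> (nat \<Rightarrow> complex) \<Rightarrow> real" where
  "wick_mass_trunc \<mu> N u = (\<integral>x. ((cmod (proj N u x))\<^sup>2 - sigma \<mu> N x) \<partial>lborel)"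

(* A representative of the L^2 limit, which is determined up to a null set. *)
definition wick_mass :: "(nat \<Rightarrow> complex) measure \<Rightarrow> (nat \<Rightarrow> complex) \<Rightarrow> real" where
  "wick_mass \<mu> = (SOME W. tendsto_Lp \<mu> 2 (wick_mass_trunc \<mu>) W)"

definition weight_trunc ::
  "(nat \<Rightarrow> complex) measure \<Rightarrow> real \<Rightarrow> real \<Rightarrow> nat \<Rightarrow> (nat \<Rightarrow> complex) \<Rightarrow> real" where
  "weight_trunc \<mu> K p N u =
     indicator {v. \<bar>wick_mass_trunc \<mu> N v\<bar> \<le> K} u
       * exp (1 / p * enn2real (Lp_norm lborel p (proj N u)) powr p)"

(* For p > 2 the norm is finite almost surely, so the value of enn2real at infinity is
   irrelevant. *)
definition weight ::
  "(nat \<Rightarrow> complex) measure \<Rightarrow> real \<Rightarrow> real \<Rightarrow> (nat \<Rightarrow> complex) \<Rightarrow> real" where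
  "weight \<mu> K p u =
     indicator {v. \<bar>wick_mass \<mu> v\<bar> \<le> K} u
       * exp (1 / p * enn2real (distribution_Lp_norm p u) powr p)"

definition Z_trunc :: "(nat \<Rightarrow> complex) measure \<Rightarrow> real \<Rightarrow> real \<Rightarrow> nat \<Rightarrow> ennreal" where
  "Z_trunc \<mu> K p N = (\<integral>\<^sup>+ u. ennreal (weight_trunc \<mu> K p N u) \<partial>\<mu>)"

definition Z_full :: "(nat \<Rightarrow> complex) measure \<Rightarrow> real \<Rightarrow> real \<Rightarrow> ennreal" where
  "Z_full \<mu> K p = (\<integral>\<^sup>+ u. ennreal (weight \<mu> K p u) \<partial>\<mu>)"

definition rho_trunc ::
  "(nat \<Rightarrow> complex) measure \<Rightarrow> real \<Rightarrow> real \<Rightarrow> nat \<Rightarrow> (nat \<Rightarrow> complex) measure" where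
  "rho_trunc \<mu> K p N = density \<mu> (\<lambda>u. ennreal (weight_trunc \<mu> K p N u) / Z_trunc \<mu> K p N)"

definition rho :: "(nat \<Rightarrow> complex) measure \<Rightarrow> real \<Rightarrow> real \<Rightarrow> (nat \<Rightarrow> complex) measure" where
  "rho \<mu> K p = density \<mu> (\<lambda>u. ennreal (weight \<mu> K p u) / Z_full \<mu> K p)"

end

theory Submission imports Defs "HOL-Real_Asymp.Real_Asymp" begin

text \<open>The diagonal Green function \<open>G\<^sub>I(x, x) = \<Sum>n\<in>I. h\<^sub>n(x)\<^sup>2 / \<lambda>\<^sub>n\<^sup>2\<close> of the modes in \<open>I \<subseteq> {m..}\<close> is at most
  \<open>min (2 / \<lambda>\<^sub>m) (3 / (1 + |x|))\<close>: it is the energy of \<open>y \<mapsto> G\<^sub>I(x, y)\<close>, and the energy controls pointwise values.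
  Hence \<open>\<parallel>u\<parallel>\<^sub>p\<close> is finite almost surely for \<open>p > 2\<close>, with Gaussian tails that improve with the frequency, and the
  truncated weights converge almost surely along subsequences.

  For \<open>p < 6\<close>, convergence in \<open>L\<^sup>r\<close> reduces to uniform exponential moments. The cutoff bounds the mass of the
  modes below a frequency by a logarithm. On the event of a large \<open>L\<^sup>p\<close> norm the modes are split into three ranges:
  the low ones are controlled by their mass, the middle ones by their mass and a Gaussian tail for the part exceeding a
  suitable height, and the high ones by the Gaussian tail alone; subcriticality makes the tail beat \<open>e\<^bsup>r s / p\<^esup>\<close>.

  For \<open>p \<ge> 6\<close>, translate \<open>\<mu>\<close> by a profile of mass \<open>m\<close> concentrated at scale \<open>1 / \<lambda>\<close>. The Cameron--Martin
  theorem gives a cost \<open>O(m \<lambda>\<^sup>2)\<close>, while the weight gains at least \<open>exp (c m\<^bsup>p/2\<^esup> \<lambda>\<^sup>2)\<close>. The gain wins for large \<open>m\<close>, since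
  an event on which the random low modes compensate the additional mass keeps a probability independent of \<open>\<lambda>\<close>.\<close>

section \<open>Hermite functions\<close>

text \<open>The threshold 6 is a scaling balance: a profile of mass m at scale 1 / \<lambda> has
  energy of order m \<lambda>^2, while the p-th power of its L^p norm is of order m^(p/2)
  \<lambda>^(p/2 - 1), and p/2 - 1 = 2 at p = 6. The obstacle for p < 6 is that the mass itself is
  almost surely infinite, its mean growing like a logarithm of the frequency, and only its
  renormalized value is cut off. A Gagliardo-Nirenberg bound therefore applies only below a
  frequency, with a logarithmic loss, and the rest must be paid for by probability. For the same
  reason the limit field is almost surely not in L^2, so identifying it with its coefficient
  sequence requires uniqueness of Hermite coefficients in L^p with p > 2. The cutoff is
  discontinuous, so convergence of the weights also requires that the limiting mass has no atom at K
  or -K. For p \<ge> 6, Fatou's lemma bounds \<open>Z_full\<close> from the wrong side; divergence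
  is therefore proved for weights capped at a constant, which pass to the limit by dominated
  convergence.\<close>

fun hermite_pol :: "nat \<Rightarrow> real \<Rightarrow> real" where
  "hermite_pol 0 x = 1"
| "hermite_pol (Suc 0) x = 2 * x"
| "hermite_pol (Suc (Suc n)) x = 2 * x * hermite_pol (Suc n) x - 2 * (real n + 1) * hermite_pol n x"

text \<open>At \<open>n = 0\<close> the truncated \<open>n - 1\<close> is harmless because the
  factor \<open>real n\<close> vanishes; the ladder formulas below rely on the same convention. The
  recurrence has order two, so the induction is a strong one.\<close>

lemma hermite_pol_deriv:
  "(hermite_pol n has_real_derivative 2 * real n * hermite_pol (n - 1) x) (at x)"
proof (induction n arbitrary: x rule: less_induct)
  case (less n)
  consider "n = 0" | "n = Suc 0" | k where "n = Suc (Suc k)"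
    by (metis not0_implies_Suc)
  then show ?case
  proof cases
    case 1
    have "hermite_pol 0 = (\<lambda>x. 1)" by auto
    with 1 show ?thesis by simp
  next
    case 2
    have "hermite_pol (Suc 0) = (\<lambda>x. 2 * x)" by auto
    with 2 show ?thesis by (auto intro!: derivative_eq_intros)
  next
    case 3
    have e: "hermite_pol n = (\<lambda>x. 2 * x * hermite_pol (Suc k) x - 2 * (real k + 1) * hermite_pol k x)"
      using 3 by auto
    have d1: "(hermite_pol (Suc k) has_real_derivative 2 * real (Suc k) * hermite_pol k x) (at x)"
      using less[of "Suc k" x] 3 by simp
    have d2: "(hermite_pol k has_real_derivative 2 * real k * hermite_pol (k - 1) x) (at x)"
      using less[of k x] 3 by simp
    have rec: "2 * real n * hermite_pol (n - 1) x = 2 * hermite_pol (Suc k) x + 2 * (real k + 1) * hermite_pol (Suc k) x"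
      using 3 by (simp add: algebra_simps)
    have rec2: "hermite_pol (Suc k) x = 2 * x * hermite_pol k x - 2 * real k * hermite_pol (k - 1) x"
      by (cases k) (auto simp: algebra_simps)
    show ?thesis unfolding e
      apply (rule derivative_eq_intros d1 d2 refl)+
      unfolding rec by (subst (2) rec2) (simp add: algebra_simps)
  qed
qed

lemma hermite_pol_rec:
  "hermite_pol (Suc n) x = 2 * x * hermite_pol n x - 2 * real n * hermite_pol (n - 1) x"
  by (cases n) (auto simp: algebra_simps)

lemma deriv_gaussian:
  "(deriv ^^ n) (\<lambda>y::real. exp (- y\<^sup>2)) = (\<lambda>x. (- 1) ^ n * hermite_pol n x * exp (- x\<^sup>2))"
proof (induction n)
  case (Suc n)
  have "((\<lambda>x. (- 1) ^ n * hermite_pol n x * exp (- x\<^sup>2)) has_real_derivative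
      (- 1) ^ Suc n * hermite_pol (Suc n) x * exp (- x\<^sup>2)) (at x)" for x
    by (rule derivative_eq_intros hermite_pol_deriv refl | simp)+
       (simp add: hermite_pol_rec algebra_simps)
  then show ?case using Suc by (auto intro!: ext DERIV_imp_deriv)
qed auto

section \<open>Normalization and ladder relations\<close>

definition hermite_const :: "nat \<Rightarrow> real" where
  "hermite_const n = fact n powr (- 1 / 2) * 2 powr (- real n / 2) * pi powr (- 1 / 4)"

lemma hermite_const_Suc: "hermite_const (Suc n) * sqrt (2 * (real n + 1)) = hermite_const n"
proof -
  have a: "(fact (Suc n) :: real) powr (- 1 / 2) = (real n + 1) powr (-1/2) * fact n powr (-1/2)"
    by (simp add: powr_mult add.commute)
  have b: "2 powr (- real (Suc n) / 2) = 2 powr (- real n / 2) * 2 powr (-1/2)"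
    by (simp add: powr_add [symmetric] field_simps)
  have c: "sqrt (2 * (real n + 1)) = 2 powr (1/2) * (real n + 1) powr (1/2)"
    by (simp add: powr_half_sqrt flip: real_sqrt_mult)
  have d: "2 powr (-1/2) * 2 powr (1/2) = (1::real)" "(real n + 1) powr (-1/2) * (real n + 1) powr (1/2) = 1"
    by (simp_all add: powr_add [symmetric])
  have "hermite_const (Suc n) * sqrt (2 * (real n + 1)) =
    (2 powr (-1/2) * 2 powr (1/2)) * ((real n + 1) powr (-1/2) * (real n + 1) powr (1/2)) * hermite_const n"
    unfolding hermite_const_def a b c by (simp only: mult_ac)
  then show ?thesis by (simp only: d mult_1)
qed

text \<open>Rodrigues' formula brings its own sign and Gaussian: the two signs cancel, and exp
  (x^2/2) and exp (-x^2) merge into exp (-x^2/2).\<close>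

lemma hermite_fun_eq: "hermite_fun n x = hermite_const n * hermite_pol n x * exp (- x\<^sup>2 / 2)"
proof -
  have "exp (x\<^sup>2 / 2) * exp (- x\<^sup>2) = exp (- x\<^sup>2 / 2)"
    by (simp add: exp_add [symmetric] field_simps)
  then have "exp (x\<^sup>2 / 2) * ((- 1) ^ n * hermite_pol n x * exp (- x\<^sup>2)) = (- 1) ^ n * hermite_pol n x * exp (- x\<^sup>2 / 2)"
    by (metis mult.assoc mult.commute)
  then show ?thesis
    unfolding hermite_fun_def deriv_gaussian hermite_const_def
    by (simp add: mult_ac)
qed

lemma hermite_pol_const_shift:
  "hermite_const n * 2 * real n * hermite_pol (n - 1) x = 2 * sqrt (real n / 2) * (hermite_const (n - 1) * hermite_pol (n - 1) x)"
proof (cases n)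
  case (Suc k)
  have "hermite_const k = hermite_const n * sqrt (2 * (real k + 1))"
    using hermite_const_Suc[of k] Suc by simp
  moreover have "sqrt (real n / 2) * sqrt (2 * (real k + 1)) = real n"
  proof -
    have "real n / 2 * (2 * (real k + 1)) = real n * real n" using Suc by (simp add: field_simps)
    then have "sqrt (real n / 2 * (2 * (real k + 1))) = sqrt (real n * real n)" by (rule arg_cong)
    then have "sqrt (real n / 2 * (2 * (real k + 1))) = real n"
      unfolding real_sqrt_abs2 by simp
    then show ?thesis by (simp only: real_sqrt_mult)
  qed
  ultimately show ?thesis using Suc
    by (metis (no_types, opaque_lifting) diff_Suc_1 mult.assoc mult.commute)
qed auto

lemma hermite_const_up: "hermite_const n * hermite_pol (Suc n) x = 2 * sqrt (real (Suc n) / 2) * (hermite_const (Suc n) * hermite_pol (Suc n) x)"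
proof -
  have "2 * sqrt (real (Suc n) / 2) = sqrt (2 * (real n + 1))"
  proof -
    have "2 * sqrt (real (Suc n) / 2) = sqrt (2\<^sup>2 * (real (Suc n) / 2))"
      unfolding real_sqrt_mult by simp
    also have "2\<^sup>2 * (real (Suc n) / 2) = 2 * (real n + 1)" by simp
    finally show ?thesis .
  qed
  then show ?thesis using hermite_const_Suc[of n] by (metis mult.assoc mult.commute)
qed

text \<open>Multiplication by x is the sum of the lowering and the raising operator, and
  differentiation in \<open>hermite_fun_deriv\<close> is their difference. Orthogonality and the
  energy identity rest on this pair; the second-order eigenvalue equation is never formed.\<close>

lemma hermite_fun_mult_x:
  "x * hermite_fun n x = sqrt (real n / 2) * hermite_fun (n - 1) x + sqrt (real (Suc n) / 2) * hermite_fun (Suc n) x"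
proof -
  have "2 * x * (hermite_const n * hermite_pol n x) = hermite_const n * hermite_pol (Suc n) x + hermite_const n * 2 * real n * hermite_pol (n - 1) x"
    by (simp add: hermite_pol_rec algebra_simps)
  then show ?thesis
    unfolding hermite_pol_const_shift hermite_const_up
  proof -
    assume a: "2 * x * (hermite_const n * hermite_pol n x) =
      2 * sqrt (real (Suc n) / 2) * (hermite_const (Suc n) * hermite_pol (Suc n) x) +
      2 * sqrt (real n / 2) * (hermite_const (n - 1) * hermite_pol (n - 1) x)"
    have "x * hermite_fun n x = (2 * x * (hermite_const n * hermite_pol n x)) * exp (- x\<^sup>2 / 2) / 2"
      unfolding hermite_fun_eq by simp
    also have "\<dots> = sqrt (real n / 2) * hermite_fun (n - 1) x + sqrt (real (Suc n) / 2) * hermite_fun (Suc n) x"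
      unfolding a hermite_fun_eq by (simp add: ring_distribs)
    finally show ?thesis .
  qed
qed

lemma hermite_fun_deriv:
  "(hermite_fun n has_real_derivative sqrt (real n / 2) * hermite_fun (n - 1) x - sqrt (real (Suc n) / 2) * hermite_fun (Suc n) x) (at x)"
proof -
  have *: "2 * sqrt (real n / 2) * hermite_fun (n - 1) x = hermite_const n * (2 * real n * hermite_pol (n - 1) x) * exp (- x\<^sup>2 / 2)"
  proof -
    have "2 * sqrt (real n / 2) * (hermite_const (n - 1) * hermite_pol (n - 1) x) = hermite_const n * (2 * real n * hermite_pol (n - 1) x)"
      using hermite_pol_const_shift[of n x] by (simp only: mult_ac)
    then show ?thesis unfolding hermite_fun_eq by (metis mult.assoc)
  qed
  have "(hermite_fun n has_real_derivative 2 * sqrt (real n / 2) * hermite_fun (n - 1) x - x * hermite_fun n x) (at x)"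
    unfolding * unfolding hermite_fun_eq[abs_def]
    by (rule derivative_eq_intros hermite_pol_deriv refl | simp add: algebra_simps)+
  then show ?thesis unfolding hermite_fun_mult_x by (simp add: algebra_simps)
qed

text \<open>A class closed under sums and products that contains all Hermite functions and makes
  integrability and boundary terms at infinity automatic. The rate 1/4 instead of 1/2 leaves room to
  absorb polynomial and exponential factors.\<close>

definition gauss_decay :: "(real \<Rightarrow> real) \<Rightarrow> bool" where
  "gauss_decay f \<longleftrightarrow> continuous_on UNIV f \<and> (\<exists>C. \<forall>x. \<bar>f x\<bar> \<le> C * exp (- x\<^sup>2 / 4))"

lemma gauss_decayI: "continuous_on UNIV f \<Longrightarrow> (\<And>x. \<bar>f x\<bar> \<le> C * exp (- x\<^sup>2 / 4)) \<Longrightarrow> gauss_decay f"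
  unfolding gauss_decay_def by blast

lemma gauss_decay_bound:
  assumes "gauss_decay f"
  shows "\<exists>C>0. continuous_on UNIV f \<and> (\<forall>x. \<bar>f x\<bar> \<le> C * exp (- x\<^sup>2 / 4))"
proof -
  from assms obtain C where C: "continuous_on UNIV f" "\<And>x. \<bar>f x\<bar> \<le> C * exp (- x\<^sup>2 / 4)"
    unfolding gauss_decay_def by blast
  have "C * exp (- x\<^sup>2 / 4) \<le> (\<bar>C\<bar> + 1) * exp (- x\<^sup>2 / 4)" for x
    by (intro mult_right_mono) auto
  with C have "\<bar>f x\<bar> \<le> (\<bar>C\<bar> + 1) * exp (- x\<^sup>2 / 4)" for x
    using order_trans by blast
  with C(1) show ?thesis by (intro exI[of _ "\<bar>C\<bar> + 1"]) auto
qed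

lemma gauss_decay_measurable [measurable_dest]: "gauss_decay f \<Longrightarrow> f \<in> borel_measurable borel"
  unfolding gauss_decay_def by (auto intro: borel_measurable_continuous_onI)

lemma gauss_decay_add [intro]:
  assumes "gauss_decay f" "gauss_decay g" shows "gauss_decay (\<lambda>x. f x + g x)"
proof -
  obtain C where C: "continuous_on UNIV f" "C > 0" "\<And>x. \<bar>f x\<bar> \<le> C * exp (- x\<^sup>2 / 4)"
    using gauss_decay_bound[OF assms(1)] by blast
  obtain D where D: "continuous_on UNIV g" "D > 0" "\<And>x. \<bar>g x\<bar> \<le> D * exp (- x\<^sup>2 / 4)"
    using gauss_decay_bound[OF assms(2)] by blast
  show ?thesis
    by (rule gauss_decayI[where C = "C + D"])
       (use C D in \<open>auto intro!: continuous_intros order_trans[OF abs_triangle_ineq] add_mono simp: ring_distribs\<close>)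
qed

lemma gauss_decay_cmult [intro]: assumes "gauss_decay f" shows "gauss_decay (\<lambda>x. c * f x)"
proof -
  obtain C where C: "continuous_on UNIV f" "C > 0" "\<And>x. \<bar>f x\<bar> \<le> C * exp (- x\<^sup>2 / 4)"
    using gauss_decay_bound[OF assms(1)] by blast
  show ?thesis
    by (rule gauss_decayI[where C = "\<bar>c\<bar> * C"])
       (use C in \<open>auto intro!: continuous_intros mult_left_mono simp: abs_mult mult.assoc\<close>)
qed

lemma gauss_decay_mult [intro]:
  assumes "gauss_decay f" "gauss_decay g" shows "gauss_decay (\<lambda>x. f x * g x)"
proof -
  obtain C where C: "continuous_on UNIV f" "C > 0" "\<And>x. \<bar>f x\<bar> \<le> C * exp (- x\<^sup>2 / 4)"
    using gauss_decay_bound[OF assms(1)] by blast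
  obtain D where D: "continuous_on UNIV g" "D > 0" "\<And>x. \<bar>g x\<bar> \<le> D * exp (- x\<^sup>2 / 4)"
    using gauss_decay_bound[OF assms(2)] by blast
  have "\<bar>g x\<bar> \<le> D" for x
  proof -
    have "D * exp (- x\<^sup>2 / 4) \<le> D * 1" using D(2) by (intro mult_left_mono) auto
    with D(3)[of x] show ?thesis by simp
  qed
  then have "\<bar>f x * g x\<bar> \<le> (C * exp (- x\<^sup>2 / 4)) * D" for x :: real
    unfolding abs_mult using C by (intro mult_mono) auto
  then show ?thesis using C D
    by (intro gauss_decayI[where C = "C * D"]) (auto intro!: continuous_intros simp: mult_ac)
qed

lemma gauss_decay_uminus [intro]: "gauss_decay f \<Longrightarrow> gauss_decay (\<lambda>x. - f x)"
  using gauss_decay_cmult[of f "-1"] by simp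

lemma gauss_decay_diff [intro]: "gauss_decay f \<Longrightarrow> gauss_decay g \<Longrightarrow> gauss_decay (\<lambda>x. f x - g x)"
  using gauss_decay_add[of f "\<lambda>x. - g x"] by auto

lemma gauss_decay_zero [intro, simp]: "gauss_decay (\<lambda>x. 0)"
  by (rule gauss_decayI[where C = 0]) auto

lemma gauss_decay_sum [intro]: "(\<And>i. i \<in> I \<Longrightarrow> gauss_decay (f i)) \<Longrightarrow> gauss_decay (\<lambda>x. \<Sum>i\<in>I. f i x)"
  by (induction I rule: infinite_finite_induct) auto

lemma gauss_decay_abs [intro]: "gauss_decay f \<Longrightarrow> gauss_decay (\<lambda>x. \<bar>f x\<bar>)"
  unfolding gauss_decay_def by (auto intro: continuous_intros)

lemma gauss_decay_power2 [intro]: "gauss_decay f \<Longrightarrow> gauss_decay (\<lambda>x. (f x)\<^sup>2)"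
  unfolding power2_eq_square by auto

lemma integrable_gauss_quarter: "integrable lborel (\<lambda>x::real. exp (- x\<^sup>2 / 4))"
proof -
  have "integrable lborel (\<lambda>x. sqrt (2 * pi * (sqrt 2)\<^sup>2) * normal_density 0 (sqrt 2) x)"
    by (intro integrable_mult_right integrable_normal_density) auto
  also have "(\<lambda>x. sqrt (2 * pi * (sqrt 2)\<^sup>2) * normal_density 0 (sqrt 2) x) = (\<lambda>x. exp (- x\<^sup>2 / 4))"
    by (auto simp: normal_density_def)
  finally show ?thesis .
qed

lemma gauss_decay_integrable: assumes "gauss_decay f" shows "integrable lborel f"
proof -
  obtain C where C: "continuous_on UNIV f" "C > 0" "\<And>x. \<bar>f x\<bar> \<le> C * exp (- x\<^sup>2 / 4)"
    using gauss_decay_bound[OF assms] by blast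
  show ?thesis
    by (rule Bochner_Integration.integrable_bound[of _ "\<lambda>x. C * exp (- x\<^sup>2 / 4)"])
       (use C assms integrable_gauss_quarter in \<open>auto intro: gauss_decay_measurable\<close>)
qed

lemma gauss_decay_bounded: assumes "gauss_decay f" obtains C where "C > 0" "\<And>x. \<bar>f x\<bar> \<le> C"
proof -
  obtain C where C: "C > 0" "\<And>x. \<bar>f x\<bar> \<le> C * exp (- x\<^sup>2 / 4)"
    using gauss_decay_bound[OF assms] by blast
  have "C * exp (- x\<^sup>2 / 4) \<le> C * 1" for x using C by (intro mult_left_mono) auto
  then have "\<bar>f x\<bar> \<le> C" for x using C(2)[of x] order_trans by fastforce
  with C(1) show thesis by (rule that)
qed

lemma gauss_decay_tendsto:
  assumes "gauss_decay f" shows "(f \<longlongrightarrow> 0) at_top" "(f \<longlongrightarrow> 0) at_bot"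
proof -
  obtain C where C: "C > 0" "\<And>x. \<bar>f x\<bar> \<le> C * exp (- x\<^sup>2 / 4)"
    using gauss_decay_bound[OF assms] by blast
  have 1: "((\<lambda>x. C * exp (- x\<^sup>2 / 4)) \<longlongrightarrow> 0) at_top"
    by real_asymp
  have 2: "((\<lambda>x. C * exp (- x\<^sup>2 / 4)) \<longlongrightarrow> 0) at_bot"
    by real_asymp
  show "(f \<longlongrightarrow> 0) at_top" by (rule Lim_null_comparison[OF _ 1]) (use C in auto)
  show "(f \<longlongrightarrow> 0) at_bot" by (rule Lim_null_comparison[OF _ 2]) (use C in auto)
qed

lemma hermite_pol_bound: "\<exists>C. \<forall>x. \<bar>hermite_pol n x\<bar> \<le> C * exp (real n * \<bar>x\<bar>)"
proof (induction n rule: less_induct)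
  case (less m)
  consider "m = 0" | "m = Suc 0" | n where "m = Suc (Suc n)"
    by (metis not0_implies_Suc)
  then show ?case
  proof cases
  case 1
  then show ?thesis by (intro exI[of _ 1]) auto
next
  case 2
  have "\<bar>y\<bar> \<le> exp \<bar>y\<bar>" for y :: real using exp_ge_add_one_self[of "\<bar>y\<bar>"] by linarith
  then show ?thesis using 2 by (intro exI[of _ 2]) (auto simp: abs_mult)
next
  case 3
  then obtain C D where C: "\<And>x. \<bar>hermite_pol (Suc n) x\<bar> \<le> C * exp (real (Suc n) * \<bar>x\<bar>)"
    and D: "\<And>x. \<bar>hermite_pol n x\<bar> \<le> D * exp (real n * \<bar>x\<bar>)" using less[of n] less[of "Suc n"] by auto
  have "\<bar>hermite_pol (Suc (Suc n)) y\<bar> \<le> (2 * C + 2 * (real n + 1) * D) * exp (real (Suc (Suc n)) * \<bar>y\<bar>)" for y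
  proof -
    have y: "\<bar>y\<bar> \<le> exp \<bar>y\<bar>" using exp_ge_add_one_self[of "\<bar>y\<bar>"] by linarith
    have "0 \<le> D * exp (real n * \<bar>y\<bar>)" using D[of y] by linarith
    then have D0: "D \<ge> 0" by (simp add: zero_le_mult_iff)
    have "\<bar>hermite_pol (Suc (Suc n)) y\<bar> \<le> 2 * (\<bar>y\<bar> * \<bar>hermite_pol (Suc n) y\<bar>) + 2 * (real n + 1) * \<bar>hermite_pol n y\<bar>"
      by (auto simp: abs_mult intro!: order_trans[OF abs_triangle_ineq4])
    also have "\<dots> \<le> 2 * (C * exp (real (Suc (Suc n)) * \<bar>y\<bar>)) + 2 * (real n + 1) * (D * exp (real (Suc (Suc n)) * \<bar>y\<bar>))"
    proof (intro add_mono mult_left_mono)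
      have "\<bar>y\<bar> * \<bar>hermite_pol (Suc n) y\<bar> \<le> exp \<bar>y\<bar> * (C * exp (real (Suc n) * \<bar>y\<bar>))"
        using C[of y] y by (intro mult_mono) auto
      also have "\<dots> = C * exp (real (Suc (Suc n)) * \<bar>y\<bar>)"
        by (simp add: exp_add [symmetric] algebra_simps)
      finally show "\<bar>y\<bar> * \<bar>hermite_pol (Suc n) y\<bar> \<le> C * exp (real (Suc (Suc n)) * \<bar>y\<bar>)" .
      show "\<bar>hermite_pol n y\<bar> \<le> D * exp (real (Suc (Suc n)) * \<bar>y\<bar>)"
        by (rule order_trans[OF D[of y]]) (use D0 in \<open>auto intro!: mult_left_mono mult_right_mono\<close>)
    qed auto
    finally show ?thesis by (simp add: algebra_simps)
  qed
  then show ?thesis unfolding 3 by blast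
  qed
qed

text \<open>Completing the square turns any linear exponent into a constant at the price of half the
  Gaussian rate. The free factor exp (t |x|) is needed for completeness, where it dominates the
  exponential series of a Fourier transform.\<close>

lemma hermite_fun_strong_decay: "\<exists>C. \<forall>x. \<bar>hermite_fun n x\<bar> * exp (t * \<bar>x\<bar>) \<le> C * exp (- x\<^sup>2 / 4)"
proof -
  obtain C where C: "\<And>x. \<bar>hermite_pol n x\<bar> \<le> C * exp (real n * \<bar>x\<bar>)" using hermite_pol_bound by blast
  have C0: "C \<ge> 0" using C[of 0] by auto
  define s where "s = real n + t"
  have "\<bar>hermite_fun n x\<bar> * exp (t * \<bar>x\<bar>) \<le> (\<bar>hermite_const n\<bar> * C * exp (s\<^sup>2)) * exp (- x\<^sup>2 / 4)" for x
  proof -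
    have "0 \<le> (s - \<bar>x\<bar> / 2)\<^sup>2" by simp
    then have q: "s * \<bar>x\<bar> - x\<^sup>2 / 2 \<le> s\<^sup>2 - x\<^sup>2 / 4" by (simp add: power2_eq_square algebra_simps)
    have "\<bar>hermite_fun n x\<bar> * exp (t * \<bar>x\<bar>) = \<bar>hermite_const n\<bar> * (\<bar>hermite_pol n x\<bar> * (exp (- x\<^sup>2 / 2) * exp (t * \<bar>x\<bar>)))"
      by (simp add: hermite_fun_eq abs_mult)
    also have "\<dots> \<le> \<bar>hermite_const n\<bar> * ((C * exp (real n * \<bar>x\<bar>)) * (exp (- x\<^sup>2 / 2) * exp (t * \<bar>x\<bar>)))"
      by (intro mult_left_mono mult_right_mono C) auto
    also have "\<dots> = \<bar>hermite_const n\<bar> * C * exp (s * \<bar>x\<bar> - x\<^sup>2 / 2)"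
      by (simp add: exp_add [symmetric] s_def algebra_simps)
    also have "\<dots> \<le> \<bar>hermite_const n\<bar> * C * exp (s\<^sup>2 - x\<^sup>2 / 4)"
      using q C0 by (intro mult_left_mono) auto
    also have "\<dots> = (\<bar>hermite_const n\<bar> * C * exp (s\<^sup>2)) * exp (- x\<^sup>2 / 4)"
      by (simp add: exp_add [symmetric])
    finally show ?thesis .
  qed
  then show ?thesis by blast
qed

lemma continuous_hermite_fun [continuous_intros]: "continuous_on A (hermite_fun n)"
  using hermite_fun_deriv DERIV_isCont continuous_at_imp_continuous_on by blast

lemma gauss_decay_hermite [intro, simp]: "gauss_decay (hermite_fun n)"
  using hermite_fun_strong_decay[of n 0] continuous_hermite_fun[of UNIV n] by (auto simp: gauss_decay_def)

lemma hermite_fun_measurable [measurable]: "hermite_fun n \<in> borel_measurable borel"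
  by (rule gauss_decay_measurable) simp

text \<open>The whole-line form is integration by parts, used for orthogonality; the half-line form
  recovers a single value of F, used for the pointwise bounds.\<close>

lemma gauss_decay_FTC:
  assumes F: "gauss_decay F" and f: "gauss_decay f" and d: "\<And>x. (F has_real_derivative f x) (at x)"
  shows "(\<integral>x. f x \<partial>lborel) = 0" and "(\<integral>y. indicator {x<..} y * f y \<partial>lborel) = - F x"
proof -
  have c: "isCont f x" for x using f unfolding gauss_decay_def continuous_on_eq_continuous_at[OF open_UNIV] by auto
  have d': "(F has_vector_derivative f x) (at x)" for x
    using d has_real_derivative_iff_has_vector_derivative by blast
  have i: "integrable lborel f" using f by (rule gauss_decay_integrable)
  have t: "((F \<circ> real_of_ereal) \<longlongrightarrow> 0) (at_left \<infinity>)" "((F \<circ> real_of_ereal) \<longlongrightarrow> 0) (at_right (-\<infinity>))"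
    using gauss_decay_tendsto[OF F] by (auto simp: ereal_tendsto_simps)
  have "(LBINT x=-\<infinity>..\<infinity>. f x) = 0 - 0"
    by (rule interval_integral_FTC_integrable[where F = F]) (use c d' i t in \<open>auto simp: set_integrable_def\<close>)
  then show "(\<integral>x. f x \<partial>lborel) = 0" by (simp add: interval_lebesgue_integral_def set_lebesgue_integral_def)
  have Fx: "((F \<circ> real_of_ereal) \<longlongrightarrow> F x) (at_right (ereal x))"
  proof -
    have "isCont F x" using d DERIV_isCont by blast
    then have "(F \<longlongrightarrow> F x) (at_right x)"
      by (simp add: isCont_def filterlim_at_split)
    then show ?thesis by (simp add: ereal_tendsto_simps)
  qed
  have "set_integrable lborel (einterval (ereal x) \<infinity>) f"
    unfolding set_integrable_def using i integrable_mult_indicator[of "{x<..}" lborel f] by auto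
  then have "(LBINT y=ereal x..\<infinity>. f y) = 0 - F x"
    by (intro interval_integral_FTC_integrable[where F = F]) (use c d' t Fx in auto)
  then show "(\<integral>y. indicator {x<..} y * f y \<partial>lborel) = - F x"
    by (simp add: interval_lebesgue_integral_def set_lebesgue_integral_def)
qed

lemma hermite_fun_0: "hermite_fun 0 x = pi powr (- 1 / 4) * exp (- x\<^sup>2 / 2)"
  by (simp add: hermite_fun_eq hermite_const_def)

text \<open>The relation \<open>adj\<close> says that raising and lowering are adjoint; it comes
  from integrating the derivative of h_n h_m. It lowers both indices, so every inner product reduces
  to the Gaussian integral \<open>ip 0 0\<close> or to a term with a vanishing factor.\<close>

lemma hermite_orthonormal:
  "(\<integral>x. hermite_fun n x * hermite_fun m x \<partial>lborel) = (if n = m then 1 else 0)"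
proof -
  define ip where "ip n m = (\<integral>x. hermite_fun n x * hermite_fun m x \<partial>lborel)" for n m
  have ii: "integrable lborel (\<lambda>x. hermite_fun n x * hermite_fun m x)" for n m
    by (intro gauss_decay_integrable) auto
  have aux: "0 = 2 * (x - y) \<Longrightarrow> y = x" for x y :: real by simp
  have adj: "sqrt (real (Suc n) / 2) * ip (Suc n) m = sqrt (real m / 2) * ip n (m - 1)" for n m
  proof -
    let ?f = "\<lambda>x. (sqrt (real n / 2) * hermite_fun (n - 1) x - sqrt (real (Suc n) / 2) * hermite_fun (Suc n) x) * hermite_fun m x
        + hermite_fun n x * (sqrt (real m / 2) * hermite_fun (m - 1) x - sqrt (real (Suc m) / 2) * hermite_fun (Suc m) x)"
    have "0 = (\<integral>x. ?f x \<partial>lborel)"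
      apply (rule sym)
      apply (rule gauss_decay_FTC(1)[where F = "\<lambda>x. hermite_fun n x * hermite_fun m x"])
      apply (intro gauss_decay_mult gauss_decay_hermite)
       apply (intro gauss_decay_add gauss_decay_diff gauss_decay_cmult[OF gauss_decay_hermite] gauss_decay_mult[OF _ gauss_decay_hermite] gauss_decay_mult[OF gauss_decay_hermite])
      apply (rule derivative_eq_intros hermite_fun_deriv refl)+
      apply (simp add: algebra_simps)
      done
    \<comment> \<open>The terms with h_{n-1} and h_{m+1} are eliminated by the formula for
      multiplication by x; the two products x h_n h_m then cancel.\<close>
    also have "?f = (\<lambda>x. 2 * (sqrt (real m / 2) * (hermite_fun n x * hermite_fun (m - 1) x) - sqrt (real (Suc n) / 2) * (hermite_fun (Suc n) x * hermite_fun m x)))"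
    proof
      fix x
      have a: "sqrt (real n / 2) * hermite_fun (n - 1) x = x * hermite_fun n x - sqrt (real (Suc n) / 2) * hermite_fun (Suc n) x"
        using hermite_fun_mult_x[of x n] by simp
      have b: "sqrt (real (Suc m) / 2) * hermite_fun (Suc m) x = x * hermite_fun m x - sqrt (real m / 2) * hermite_fun (m - 1) x"
        using hermite_fun_mult_x[of x m] by simp
      show "?f x = 2 * (sqrt (real m / 2) * (hermite_fun n x * hermite_fun (m - 1) x) - sqrt (real (Suc n) / 2) * (hermite_fun (Suc n) x * hermite_fun m x))"
        unfolding a b by (simp add: algebra_simps)
    qed
    also have "(\<integral>x. 2 * (sqrt (real m / 2) * (hermite_fun n x * hermite_fun (m - 1) x) - sqrt (real (Suc n) / 2) * (hermite_fun (Suc n) x * hermite_fun m x)) \<partial>lborel)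
        = 2 * (sqrt (real m / 2) * ip n (m - 1) - sqrt (real (Suc n) / 2) * ip (Suc n) m)"
      unfolding ip_def
      by (simp only: integral_mult_right_zero Bochner_Integration.integral_diff[OF integrable_mult_right[OF ii] integrable_mult_right[OF ii]])
    finally have "0 = 2 * (sqrt (real m / 2) * ip n (m - 1) - sqrt (real (Suc n) / 2) * ip (Suc n) m)" .
    then show ?thesis by (rule aux)
  qed
  have ip0: "ip 0 0 = 1"
  proof -
    have "hermite_fun 0 x * hermite_fun 0 x = normal_density 0 (sqrt (1/2)) x" for x
    proof -
      have "pi powr (- 1 / 4) * pi powr (- 1 / 4) = 1 / sqrt pi"
      proof -
        have "pi powr (- 1 / 4) * pi powr (- 1 / 4) = pi powr (- (1 / 2))"
          by (simp add: powr_add [symmetric])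
        also have "\<dots> = 1 / sqrt pi"
          using powr_minus_divide[of pi "1 / 2"] powr_half_sqrt[of pi] by simp
        finally show ?thesis .
      qed
      moreover have "exp (- x\<^sup>2 / 2) * exp (- x\<^sup>2 / 2) = exp (- x\<^sup>2)"
        by (simp add: exp_add [symmetric])
      moreover have "hermite_fun 0 x * hermite_fun 0 x = (pi powr (- 1 / 4) * pi powr (- 1 / 4)) * (exp (- x\<^sup>2 / 2) * exp (- x\<^sup>2 / 2))"
        unfolding hermite_fun_0 by (simp only: mult_ac)
      ultimately show ?thesis by (simp add: normal_density_def)
    qed
    then have "ip 0 0 = (\<integral>x. normal_density 0 (sqrt (1/2)) x \<partial>lborel)" by (simp add: ip_def)
    also have "\<dots> = 1" by (rule integral_normal_density) simp
    finally show ?thesis .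
  qed
  have "ip n m = (if n = m then 1 else 0)" for n m
  proof (induction n arbitrary: m)
    case 0
    show ?case
    proof (cases m)
      case (Suc k)
      have "sqrt (real (Suc k) / 2) * ip (Suc k) 0 = 0" using adj[of k 0] by simp
      then have "ip (Suc k) 0 = 0" by simp
      then show ?thesis using Suc by (simp add: ip_def mult.commute)
    qed (use ip0 in simp)
  next
    case (Suc n)
    have "ip (Suc n) m = sqrt (real m / 2) * ip n (m - 1) / sqrt (real (Suc n) / 2)"
      using adj[of n m] by (simp add: field_simps)
    then show ?case using Suc[of "m - 1"] by (cases m) auto
  qed
  then show ?thesis by (simp add: ip_def)
qed

section \<open>Mass, energy and pointwise bounds of finite Hermite sums\<close>

lemma freq_pos [simp]: "freq n > 0" by (simp add: freq_def)

lemma freq_nonneg [simp]: "0 \<le> freq n" and freq_nonzero [simp]: "freq n \<noteq> 0"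
  using freq_pos[of n] by linarith+

lemma freq_power2: "(freq n)\<^sup>2 = 1 + 2 * real n" by (simp add: freq_def)

lemma freq_mono: "m \<le> n \<Longrightarrow> freq m \<le> freq n" by (simp add: freq_def)

lemma freq_ge_1: "freq n \<ge> 1" by (simp add: freq_def)

text \<open>Orthogonality is required only after multiplication by the coefficients: in the lowered
  family h_{n-1} the indices 0 and 1 give the same function, and only the coefficient sqrt (0/2) = 0
  separates them.\<close>

lemma integral_square_orthogonal:
  fixes k :: "nat \<Rightarrow> real \<Rightarrow> real"
  assumes "finite I" and i: "\<And>n m. integrable lborel (\<lambda>x. k n x * k m x)"
    and o: "\<And>n m. c n * c m * (\<integral>x. k n x * k m x \<partial>lborel) = (if n = m then (c n)\<^sup>2 else 0)"
  shows "(\<integral>x. (\<Sum>n\<in>I. c n * k n x)\<^sup>2 \<partial>lborel) = (\<Sum>n\<in>I. (c n)\<^sup>2)"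
proof -
  have "(\<integral>x. (\<Sum>n\<in>I. c n * k n x)\<^sup>2 \<partial>lborel) = (\<integral>x. (\<Sum>n\<in>I. \<Sum>m\<in>I. c n * c m * (k n x * k m x)) \<partial>lborel)"
    by (simp add: power2_eq_square sum_product mult_ac)
  also have "\<dots> = (\<Sum>n\<in>I. \<Sum>m\<in>I. c n * c m * (\<integral>x. k n x * k m x \<partial>lborel))"
    using i by (simp add: Bochner_Integration.integral_sum Bochner_Integration.integrable_sum)
  also have "\<dots> = (\<Sum>n\<in>I. (c n)\<^sup>2)"
    unfolding o using \<open>finite I\<close> by simp
  finally show ?thesis .
qed

definition hermite_sum :: "nat set \<Rightarrow> (nat \<Rightarrow> real) \<Rightarrow> real \<Rightarrow> real" where
  "hermite_sum I a x = (\<Sum>n\<in>I. a n * hermite_fun n x)"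

definition hermite_sum_deriv :: "nat set \<Rightarrow> (nat \<Rightarrow> real) \<Rightarrow> real \<Rightarrow> real" where
  "hermite_sum_deriv I a x = (\<Sum>n\<in>I. a n * (sqrt (real n / 2) * hermite_fun (n - 1) x - sqrt (real (Suc n) / 2) * hermite_fun (Suc n) x))"

lemma hermite_sum_has_deriv: "(hermite_sum I a has_real_derivative hermite_sum_deriv I a x) (at x)"
  unfolding hermite_sum_def[abs_def] hermite_sum_deriv_def
  by (intro DERIV_sum DERIV_cmult hermite_fun_deriv)

lemma gauss_decay_hermite_sum [intro, simp]: "gauss_decay (hermite_sum I a)"
  unfolding hermite_sum_def[abs_def] by (intro gauss_decay_sum gauss_decay_cmult gauss_decay_hermite)

lemma gauss_decay_hermite_sum_deriv [intro, simp]: "gauss_decay (hermite_sum_deriv I a)"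
  unfolding hermite_sum_deriv_def[abs_def]
  by (intro gauss_decay_sum gauss_decay_cmult gauss_decay_diff gauss_decay_hermite)

lemma gauss_decay_x_hermite_sum [intro, simp]: "gauss_decay (\<lambda>x. x * hermite_sum I a x)"
proof -
  have "(\<lambda>x. x * hermite_sum I a x) = (\<lambda>x. \<Sum>n\<in>I. a n * (sqrt (real n / 2) * hermite_fun (n - 1) x + sqrt (real (Suc n) / 2) * hermite_fun (Suc n) x))"
    unfolding hermite_sum_def sum_distrib_left hermite_fun_mult_x [symmetric] by (simp add: mult_ac)
  then show ?thesis
    by (simp only:) (intro gauss_decay_sum gauss_decay_cmult gauss_decay_add gauss_decay_hermite)
qed

lemma hermite_sum_L2: "finite I \<Longrightarrow> (\<integral>x. (hermite_sum I a x)\<^sup>2 \<partial>lborel) = (\<Sum>n\<in>I. (a n)\<^sup>2)"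
  unfolding hermite_sum_def
  by (rule integral_square_orthogonal)
     (auto intro!: gauss_decay_integrable simp: hermite_orthonormal power2_eq_square)

text \<open>The quadratic form of the harmonic oscillator. With A the lowered and B the raised part,
  f' = A - B and x f = A + B, so the cross terms cancel and n + (n + 1) is the eigenvalue.\<close>

lemma hermite_sum_energy:
  assumes "finite I"
  shows "(\<integral>x. (hermite_sum_deriv I a x)\<^sup>2 + (x * hermite_sum I a x)\<^sup>2 \<partial>lborel) = (\<Sum>n\<in>I. (freq n)\<^sup>2 * (a n)\<^sup>2)"
proof -
  define A where "A x = (\<Sum>n\<in>I. (a n * sqrt (real n / 2)) * hermite_fun (n - 1) x)" for x
  define B where "B x = (\<Sum>n\<in>I. (a n * sqrt (real (Suc n) / 2)) * hermite_fun (Suc n) x)" for x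
  have d: "hermite_sum_deriv I a x = A x - B x" for x
    unfolding hermite_sum_deriv_def A_def B_def sum_subtractf [symmetric] by (simp add: algebra_simps)
  have x: "x * hermite_sum I a x = A x + B x" for x
    unfolding hermite_sum_def A_def B_def sum.distrib [symmetric] sum_distrib_left
    by (intro sum.cong refl) (subst mult.left_commute, subst hermite_fun_mult_x, simp add: algebra_simps)
  have "gauss_decay A" "gauss_decay B" unfolding A_def[abs_def] B_def[abs_def]
    by (intro gauss_decay_sum gauss_decay_cmult gauss_decay_hermite)+
  then have i: "integrable lborel (\<lambda>x. (A x)\<^sup>2)" "integrable lborel (\<lambda>x. (B x)\<^sup>2)"
    by (auto intro!: gauss_decay_integrable)
  have "(\<integral>x. (hermite_sum_deriv I a x)\<^sup>2 + (x * hermite_sum I a x)\<^sup>2 \<partial>lborel) = (\<integral>x. 2 * (A x)\<^sup>2 + 2 * (B x)\<^sup>2 \<partial>lborel)"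
    unfolding d x by (intro Bochner_Integration.integral_cong refl) (simp add: power2_eq_square algebra_simps)
  also have "\<dots> = 2 * (\<integral>x. (A x)\<^sup>2 \<partial>lborel) + 2 * (\<integral>x. (B x)\<^sup>2 \<partial>lborel)"
    using i by simp
  also have "(\<integral>x. (A x)\<^sup>2 \<partial>lborel) = (\<Sum>n\<in>I. (a n * sqrt (real n / 2))\<^sup>2)"
    unfolding A_def
    by (rule integral_square_orthogonal[OF assms])
       (auto intro!: gauss_decay_integrable simp: hermite_orthonormal power2_eq_square)
  also have "(\<integral>x. (B x)\<^sup>2 \<partial>lborel) = (\<Sum>n\<in>I. (a n * sqrt (real (Suc n) / 2))\<^sup>2)"
    unfolding B_def
    by (rule integral_square_orthogonal[OF assms])
       (auto intro!: gauss_decay_integrable simp: hermite_orthonormal power2_eq_square)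
  also have "2 * (\<Sum>n\<in>I. (a n * sqrt (real n / 2))\<^sup>2) + 2 * (\<Sum>n\<in>I. (a n * sqrt (real (Suc n) / 2))\<^sup>2)
      = (\<Sum>n\<in>I. (freq n)\<^sup>2 * (a n)\<^sup>2)"
    unfolding sum_distrib_left sum.distrib [symmetric]
    by (intro sum.cong refl) (simp add: power_mult_distrib freq_power2 field_simps)
  finally show ?thesis .
qed

lemma integrable_hermite_energy:
  "integrable lborel (\<lambda>x. (hermite_sum_deriv I a x)\<^sup>2 + (x * hermite_sum I a x)\<^sup>2)"
  "integrable lborel (\<lambda>x. (hermite_sum I a x)\<^sup>2)"
  "integrable lborel (\<lambda>x. (hermite_sum_deriv I a x)\<^sup>2)"
  by (intro gauss_decay_integrable gauss_decay_add gauss_decay_power2 gauss_decay_hermite_sum gauss_decay_x_hermite_sum gauss_decay_hermite_sum_deriv)+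

lemma hermite_sum_deriv_L2_le:
  assumes "finite I"
  shows "(\<integral>x. (hermite_sum_deriv I a x)\<^sup>2 \<partial>lborel) \<le> (\<Sum>n\<in>I. (freq n)\<^sup>2 * (a n)\<^sup>2)"
  unfolding hermite_sum_energy[OF assms, symmetric]
  by (intro integral_mono integrable_hermite_energy) auto

text \<open>f(x)^2 is the integral of -2 f f' to the right of x, and Young's inequality splits the
  product. The parameter s stays free: setting it to the frequency of the modes balances mass
  against energy.\<close>

lemma hermite_sum_sup_bound:
  assumes "finite I" "s > 0"
  shows "(hermite_sum I a x)\<^sup>2 \<le> s * (\<Sum>n\<in>I. (a n)\<^sup>2) + (\<Sum>n\<in>I. (freq n)\<^sup>2 * (a n)\<^sup>2) / s"
proof -
  let ?f = "hermite_sum I a" and ?d = "hermite_sum_deriv I a"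
  have "(\<integral>y. indicator {x<..} y * (2 * (?f y * ?d y)) \<partial>lborel) = - (?f x)\<^sup>2"
  proof (rule gauss_decay_FTC(2))
    show "((\<lambda>x. (?f x)\<^sup>2) has_real_derivative 2 * (?f x * ?d x)) (at x)" for x
      using DERIV_power[OF hermite_sum_has_deriv[of I a x], of 2] by (simp add: mult_ac)
    show "gauss_decay (\<lambda>x. (?f x)\<^sup>2)" by (intro gauss_decay_power2 gauss_decay_hermite_sum)
    show "gauss_decay (\<lambda>y. 2 * (?f y * ?d y))"
      by (intro gauss_decay_cmult gauss_decay_mult gauss_decay_hermite_sum gauss_decay_hermite_sum_deriv)
  qed
  then have "(?f x)\<^sup>2 = (\<integral>y. - (indicator {x<..} y * (2 * (?f y * ?d y))) \<partial>lborel)"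
    by simp
  also have "\<dots> \<le> (\<integral>y. s * (?f y)\<^sup>2 + (?d y)\<^sup>2 / s \<partial>lborel)"
  proof (rule integral_mono')
    show "integrable lborel (\<lambda>y. s * (?f y)\<^sup>2 + (?d y)\<^sup>2 / s)"
      using integrable_hermite_energy[of I a] by auto
    fix y
    have "0 \<le> (sqrt s * ?f y + ?d y / sqrt s)\<^sup>2" by simp
    also have "(sqrt s * ?f y + ?d y / sqrt s)\<^sup>2 = s * (?f y)\<^sup>2 + (?d y)\<^sup>2 / s + 2 * (?f y * ?d y)"
      using assms(2) by (simp add: power2_sum power_mult_distrib power_divide)
    finally show "- (indicator {x<..} y * (2 * (?f y * ?d y))) \<le> s * (?f y)\<^sup>2 + (?d y)\<^sup>2 / s"
      using assms(2) by (auto simp: indicator_def)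
    show "0 \<le> s * (?f y)\<^sup>2 + (?d y)\<^sup>2 / s" using assms(2) by auto
  qed
  also have "\<dots> = s * (\<integral>y. (?f y)\<^sup>2 \<partial>lborel) + (\<integral>y. (?d y)\<^sup>2 \<partial>lborel) / s"
    using integrable_hermite_energy[of I a] by simp
  also have "\<dots> \<le> s * (\<Sum>n\<in>I. (a n)\<^sup>2) + (\<Sum>n\<in>I. (freq n)\<^sup>2 * (a n)\<^sup>2) / s"
    using hermite_sum_deriv_L2_le[OF assms(1), of a] hermite_sum_L2[OF assms(1), of a] assms(2)
    by (simp add: divide_right_mono)
  finally show ?thesis .
qed

text \<open>The confining potential gives spatial decay: to the right of x the weight x may be
  replaced by y, and x |f f'| is then at most |y f| |f'|, which the energy density controls.\<close>

lemma hermite_sum_weighted_bound: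
  assumes "finite I" "x \<ge> 0"
  shows "x * (hermite_sum I a x)\<^sup>2 \<le> (\<Sum>n\<in>I. (freq n)\<^sup>2 * (a n)\<^sup>2)"
proof -
  let ?f = "hermite_sum I a" and ?d = "hermite_sum_deriv I a"
  have "(\<integral>y. indicator {x<..} y * (2 * (?f y * ?d y)) \<partial>lborel) = - (?f x)\<^sup>2"
  proof (rule gauss_decay_FTC(2))
    show "((\<lambda>x. (?f x)\<^sup>2) has_real_derivative 2 * (?f x * ?d x)) (at x)" for x
      using DERIV_power[OF hermite_sum_has_deriv[of I a x], of 2] by (simp add: mult_ac)
    show "gauss_decay (\<lambda>x. (?f x)\<^sup>2)" by (intro gauss_decay_power2 gauss_decay_hermite_sum)
    show "gauss_decay (\<lambda>y. 2 * (?f y * ?d y))"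
      by (intro gauss_decay_cmult gauss_decay_mult gauss_decay_hermite_sum gauss_decay_hermite_sum_deriv)
  qed
  then have "x * (?f x)\<^sup>2 = (\<integral>y. - x * (indicator {x<..} y * (2 * (?f y * ?d y))) \<partial>lborel)"
    by simp
  also have "\<dots> \<le> (\<integral>y. (?d y)\<^sup>2 + (y * ?f y)\<^sup>2 \<partial>lborel)"
  proof (rule integral_mono')
    show "integrable lborel (\<lambda>y. (?d y)\<^sup>2 + (y * ?f y)\<^sup>2)"
      by (rule integrable_hermite_energy)
    fix y
    show "- x * (indicator {x<..} y * (2 * (?f y * ?d y))) \<le> (?d y)\<^sup>2 + (y * ?f y)\<^sup>2"
    proof (cases "x < y")
      case True
      have "- x * (2 * (?f y * ?d y)) \<le> x * (2 * \<bar>?f y * ?d y\<bar>)"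
        using assms(2) mult_left_mono[of "- (?f y * ?d y)" "\<bar>?f y * ?d y\<bar>" x] by auto
      also have "\<dots> \<le> y * (2 * \<bar>?f y * ?d y\<bar>)" using True by (intro mult_right_mono) auto
      also have "\<dots> = 2 * \<bar>y * ?f y\<bar> * \<bar>?d y\<bar>" using True assms(2) by (simp add: abs_mult)
      also have "\<dots> \<le> \<bar>y * ?f y\<bar>\<^sup>2 + \<bar>?d y\<bar>\<^sup>2" by (rule sum_squares_bound)
      finally show ?thesis using True by simp
    qed auto
  qed auto
  finally show ?thesis using hermite_sum_energy[OF assms(1), of a] by simp
qed

text \<open>Also the variance at x of the random field with modes in I, which is how it enters every
  moment bound.\<close>

definition green_diag :: "nat set \<Rightarrow> real \<Rightarrow> real" where
  "green_diag I x = (\<Sum>n\<in>I. (hermite_fun n x)\<^sup>2 / (freq n)\<^sup>2)"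

lemma green_diag_nonneg: "green_diag I x \<ge> 0"
  unfolding green_diag_def by (intro sum_nonneg) auto

lemma gauss_decay_green_diag: "gauss_decay (green_diag I)"
proof -
  have "green_diag I = (\<lambda>x. \<Sum>n\<in>I. (1 / (freq n)\<^sup>2) * (hermite_fun n x * hermite_fun n x))"
    unfolding green_diag_def by (auto simp: power2_eq_square)
  then show ?thesis
    by (simp only:) (intro gauss_decay_sum gauss_decay_cmult gauss_decay_mult gauss_decay_hermite)
qed

lemma green_diag_measurable [measurable]: "green_diag I \<in> borel_measurable borel"
  by (rule gauss_decay_measurable[OF gauss_decay_green_diag])

lemma hermite_fun_minus: "hermite_fun n (- x) = (- 1) ^ n * hermite_fun n x"
proof -
  have "hermite_pol n (- x) = (- 1) ^ n * hermite_pol n x"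
  proof (induction n rule: less_induct)
    case (less n)
    then show ?case by (cases n; cases "n - 1") (auto simp: algebra_simps)
  qed
  then show ?thesis by (simp add: hermite_fun_eq)
qed

lemma green_diag_minus: "green_diag I (- x) = green_diag I x"
  unfolding green_diag_def hermite_fun_minus by (simp add: power_mult_distrib flip: power_mult)

text \<open>Both bounds apply the pointwise estimates to \<open>y \<mapsto> G\<^sub>I(x, y)\<close>, whose value at \<open>x\<close> and whose
  energy both equal \<open>G\<^sub>I(x, x)\<close>.\<close>

lemma
  assumes "finite I" "I \<subseteq> {m..}"
  shows green_diag_le_freq: "green_diag I x \<le> 2 / freq m"
    and green_diag_decay: "(1 + \<bar>x\<bar>) * green_diag I x \<le> 3"
proof -
  let ?g = "green_diag I x"
  define a where "a n = hermite_fun n x / (freq n)\<^sup>2" for n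
  have v: "hermite_sum I a x = ?g"
    unfolding hermite_sum_def green_diag_def a_def by (simp add: power2_eq_square)
  have e: "(\<Sum>n\<in>I. (freq n)\<^sup>2 * (a n)\<^sup>2) = ?g"
    unfolding green_diag_def a_def by (intro sum.cong refl) (simp add: power_divide power2_eq_square)
  have l2: "(\<Sum>n\<in>I. (a n)\<^sup>2) \<le> ?g / (freq k)\<^sup>2" if "I \<subseteq> {k..}" for k
    unfolding e [symmetric] sum_divide_distrib
  proof (intro sum_mono)
    fix n assume "n \<in> I"
    then have "freq k \<le> freq n" using that by (intro freq_mono) auto
    then have "(freq k)\<^sup>2 \<le> (freq n)\<^sup>2" using freq_pos[of k] by (intro power_mono) (auto intro: less_imp_le)
    then have "1 \<le> (freq n)\<^sup>2 / (freq k)\<^sup>2" by (simp add: freq_power2)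
    from mult_right_mono[OF this, of "(a n)\<^sup>2"] show "(a n)\<^sup>2 \<le> (freq n)\<^sup>2 * (a n)\<^sup>2 / (freq k)\<^sup>2" by simp
  qed
  have *: "?g \<le> 2 / freq k" if "I \<subseteq> {k..}" for k
  proof -
    have "?g * ?g \<le> freq k * (\<Sum>n\<in>I. (a n)\<^sup>2) + ?g / freq k"
      using hermite_sum_sup_bound[OF assms(1) freq_pos[of k], of a x] unfolding v e by (simp add: power2_eq_square)
    also have "\<dots> \<le> freq k * (?g / (freq k)\<^sup>2) + ?g / freq k"
      using l2[OF that] freq_pos[of k] by (intro add_right_mono mult_left_mono) (auto intro: less_imp_le)
    also have "\<dots> = ?g * (2 / freq k)" by (simp add: power2_eq_square)
    finally show ?thesis
      using green_diag_nonneg[of I x] mult_le_cancel_left_pos[of ?g ?g "2 / freq k"]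
      by (cases "?g = 0") auto
  qed
  from *[OF assms(2)] show "?g \<le> 2 / freq m" .
  \<comment> \<open>Every index set lies in {0..}, and freq 0 = 1. This 2 and the bound 1 for |x| G
    add up to the constant 3.\<close>
  have g2: "?g \<le> 2" using *[of 0] by (simp add: freq_def)
  have "y * green_diag I y \<le> 1" if y: "y \<ge> 0" "green_diag I y = ?g" "y = x \<or> y = - x" for y
  proof -
    define b where "b n = hermite_fun n y / (freq n)\<^sup>2" for n
    have v: "hermite_sum I b y = green_diag I y"
      unfolding hermite_sum_def green_diag_def b_def by (simp add: power2_eq_square)
    have e: "(\<Sum>n\<in>I. (freq n)\<^sup>2 * (b n)\<^sup>2) = green_diag I y"
      unfolding green_diag_def b_def by (intro sum.cong refl) (simp add: power_divide power2_eq_square)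
    have "green_diag I y * (y * green_diag I y) \<le> green_diag I y * 1"
      using hermite_sum_weighted_bound[OF assms(1) y(1), of b] unfolding v e by (simp add: power2_eq_square mult_ac)
    then show ?thesis using green_diag_nonneg[of I y]
      by (cases "green_diag I y = 0") (auto simp: mult_le_cancel_left)
  qed
  from this[of "\<bar>x\<bar>"] have "\<bar>x\<bar> * ?g \<le> 1"
    using green_diag_minus[of I x] by (auto simp: abs_if split: if_splits)
  then show "(1 + \<bar>x\<bar>) * ?g \<le> 3" using g2 by (simp add: algebra_simps)
qed

text \<open>A Bernstein inequality: the function with coefficients h_n(x) has at x a value equal to
  its mass, and energy at most (freq m)^2 times that mass, so \<open>hermite_sum_sup_bound\<close>
  with s = freq m closes on itself.\<close>

lemma hermite_diag_le:
  assumes "finite I" "I \<subseteq> {..m}"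
  shows "(\<Sum>n\<in>I. (hermite_fun n x)\<^sup>2) \<le> 2 * freq m"
proof -
  let ?D = "\<Sum>n\<in>I. (hermite_fun n x)\<^sup>2"
  have D0: "?D \<ge> 0" by (intro sum_nonneg) auto
  have v: "hermite_sum I (\<lambda>n. hermite_fun n x) x = ?D"
    unfolding hermite_sum_def by (simp add: power2_eq_square)
  have "(\<Sum>n\<in>I. (freq n)\<^sup>2 * (hermite_fun n x)\<^sup>2) \<le> (\<Sum>n\<in>I. (freq m)\<^sup>2 * (hermite_fun n x)\<^sup>2)"
    using assms(2) by (intro sum_mono mult_right_mono) (auto simp: freq_power2)
  also have "\<dots> = (freq m)\<^sup>2 * ?D" by (simp add: sum_distrib_left)
  finally have e: "(\<Sum>n\<in>I. (freq n)\<^sup>2 * (hermite_fun n x)\<^sup>2) \<le> (freq m)\<^sup>2 * ?D" .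
  have "?D * ?D \<le> freq m * ?D + (\<Sum>n\<in>I. (freq n)\<^sup>2 * (hermite_fun n x)\<^sup>2) / freq m"
    using hermite_sum_sup_bound[OF assms(1) freq_pos[of m], of "\<lambda>n. hermite_fun n x" x] unfolding v by (simp add: power2_eq_square)
  also have "\<dots> \<le> freq m * ?D + ((freq m)\<^sup>2 * ?D) / freq m"
    using e freq_pos[of m] by (intro add_left_mono divide_right_mono) (auto intro: less_imp_le)
  also have "\<dots> = ?D * (2 * freq m)" by (simp add: power2_eq_square)
  finally show ?thesis using D0 freq_pos[of m]
    by (cases "?D = 0") (auto simp: mult_le_cancel_left)
qed

text \<open>The increment is the integral of the derivative, with Young's inequality in place of
  Cauchy-Schwarz so that s can be tuned. It serves to show that a kernel stays large near its
  centre.\<close>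

lemma hermite_sum_diff_bound:
  assumes "finite I" "s > 0"
  shows "\<bar>hermite_sum I a y - hermite_sum I a x\<bar> \<le> (s * \<bar>y - x\<bar> + (\<Sum>n\<in>I. (freq n)\<^sup>2 * (a n)\<^sup>2) / s) / 2"
proof -
  let ?f = "hermite_sum I a" and ?d = "hermite_sum_deriv I a"
  let ?E = "\<Sum>n\<in>I. (freq n)\<^sup>2 * (a n)\<^sup>2"
  have *: "\<bar>?f y - ?f x\<bar> \<le> (s * (y - x) + ?E / s) / 2" if "x \<le> y" for x y
  proof -
    have cont: "continuous_on {x..y} ?d"
      using gauss_decay_hermite_sum_deriv[of I a] unfolding gauss_decay_def by (auto intro: continuous_on_subset)
    have "?f y - ?f x = (\<integral>t. indicator {x..y} t *\<^sub>R ?d t \<partial>lborel)"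
      by (rule integral_FTC_atLeastAtMost[symmetric])
         (use that cont hermite_sum_has_deriv[of I a] in
           \<open>auto simp: has_real_derivative_iff_has_vector_derivative [symmetric] intro: has_field_derivative_at_within\<close>)
    also have "\<bar>\<dots>\<bar> \<le> (\<integral>t. \<bar>indicator {x..y} t *\<^sub>R ?d t\<bar> \<partial>lborel)"
      by (rule integral_abs_bound)
    also have "\<dots> \<le> (\<integral>t. (s * indicator {x..y} t + (?d t)\<^sup>2 / s) / 2 \<partial>lborel)"
    proof (rule integral_mono')
      show "integrable lborel (\<lambda>t. (s * indicator {x..y} t + (?d t)\<^sup>2 / s) / 2)"
        using integrable_hermite_energy(3)[of I a] by (auto intro!: integrable_real_indicator simp: emeasure_lborel_Icc_eq)
      fix t
      have "2 * sqrt s * (\<bar>?d t\<bar> / sqrt s) \<le> (sqrt s)\<^sup>2 + (\<bar>?d t\<bar> / sqrt s)\<^sup>2" by (rule sum_squares_bound)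
      then have "2 * \<bar>?d t\<bar> \<le> s + (?d t)\<^sup>2 / s" using assms(2) by (simp add: power_divide)
      moreover have "0 \<le> (?d t)\<^sup>2 / s" using assms(2) by simp
      ultimately show "\<bar>indicator {x..y} t *\<^sub>R ?d t\<bar> \<le> (s * indicator {x..y} t + (?d t)\<^sup>2 / s) / 2"
        by (cases "t \<in> {x..y}") auto
      show "0 \<le> (s * indicator {x..y} t + (?d t)\<^sup>2 / s) / 2"
        using assms(2) by (intro divide_nonneg_pos add_nonneg_nonneg mult_nonneg_nonneg) auto
    qed
    also have "\<dots> = (s * (y - x) + (\<integral>t. (?d t)\<^sup>2 \<partial>lborel) / s) / 2"
      using integrable_hermite_energy(3)[of I a] that
      by (simp add: integrable_real_indicator emeasure_lborel_Icc_eq)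
    also have "\<dots> \<le> (s * (y - x) + ?E / s) / 2"
      using hermite_sum_deriv_L2_le[OF assms(1), of a] assms(2) by (simp add: divide_right_mono)
    finally show ?thesis .
  qed
  show ?thesis
  proof (cases "x \<le> y")
    case True then show ?thesis using *[of x y] by simp
  next
    case False then show ?thesis using *[of y x] by (simp add: abs_minus_commute)
  qed
qed

text \<open>At the origin, multiplication by x links h_{2k+2} to h_{2k}, and the resulting
  Wallis-type ratio makes the right-hand side nondecreasing in k, with value 1 at k = 0. The
  function value is squared twice to avoid roots; 4 k + 1 is
  \<open>(freq (2 * k))\<^sup>2\<close>.\<close>

lemma hermite_fun_even_at_0: "1 \<le> pi * ((hermite_fun (2 * k) 0)\<^sup>2)\<^sup>2 * (4 * real k + 1)"
proof (induction k)
  case 0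
  have "((hermite_fun 0 0)\<^sup>2)\<^sup>2 = pi powr (- 1 / 4 * 4)"
    unfolding hermite_fun_0 by (simp only: power_mult [symmetric]) (simp add: powr_power)
  also have "\<dots> = 1 / pi" by (simp add: powr_minus_divide)
  finally show ?case by simp
next
  case (Suc k)
  define b where "b = (hermite_fun (2 * k) 0)\<^sup>2"
  define b' where "b' = (hermite_fun (2 * Suc k) 0)\<^sup>2"
  have "sqrt (real (2 * k + 2) / 2) * hermite_fun (2 * Suc k) 0 = - (sqrt (real (2 * k + 1) / 2) * hermite_fun (2 * k) 0)"
    using hermite_fun_mult_x[of 0 "2 * k + 1"] by simp
  then have "(sqrt (real (2 * k + 2) / 2) * hermite_fun (2 * Suc k) 0)\<^sup>2 = (sqrt (real (2 * k + 1) / 2) * hermite_fun (2 * k) 0)\<^sup>2"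
    by (simp only: power2_minus)
  then have "(2 * real k + 2) * b' = (2 * real k + 1) * b"
    unfolding power_mult_distrib b_def b'_def by (simp add: field_simps)
  then have b': "b' = (2 * real k + 1) * b / (2 * real k + 2)" by (simp add: field_simps)
  have "(4 * real k + 1) * (2 * real k + 2)\<^sup>2 \<le> (2 * real k + 1)\<^sup>2 * (4 * real k + 5)"
    by (simp add: power2_eq_square algebra_simps)
  then have "4 * real k + 1 \<le> ((2 * real k + 1) / (2 * real k + 2))\<^sup>2 * (4 * real k + 5)"
    by (simp add: power_divide field_simps)
  then have "pi * b\<^sup>2 * (4 * real k + 1) \<le> pi * b\<^sup>2 * (((2 * real k + 1) / (2 * real k + 2))\<^sup>2 * (4 * real k + 5))"
    by (intro mult_left_mono) auto
  also have "\<dots> = pi * b'\<^sup>2 * (4 * real (Suc k) + 1)"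
  proof -
    have "b'\<^sup>2 = b\<^sup>2 * ((2 * real k + 1) / (2 * real k + 2))\<^sup>2"
      unfolding b' by (simp only: power_mult_distrib [symmetric] times_divide_eq_right mult.commute)
    then show ?thesis by (simp add: mult_ac)
  qed
  finally show ?case using Suc unfolding b_def b'_def by linarith
qed

text \<open>Only the k + 1 even modes are counted, each contributing at least 1 / (sqrt pi freq (2
  k)). The order matches the upper bound of \<open>hermite_diag_le\<close>, so a kernel centred at 0
  is as tall as its frequency allows.\<close>

lemma hermite_diag_0_ge: "freq (2 * k) / (4 * sqrt pi) \<le> (\<Sum>n\<in>{..2 * k}. (hermite_fun n 0)\<^sup>2)"
proof -
  have *: "1 / (sqrt pi * freq (2 * j)) \<le> (hermite_fun (2 * j) 0)\<^sup>2" for j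
  proof (rule power2_le_imp_le)
    have "(sqrt pi * freq (2 * j))\<^sup>2 = pi * (4 * real j + 1)" by (simp add: power_mult_distrib freq_power2)
    then show "(1 / (sqrt pi * freq (2 * j)))\<^sup>2 \<le> ((hermite_fun (2 * j) 0)\<^sup>2)\<^sup>2"
      unfolding power_divide using hermite_fun_even_at_0[of j] by (simp add: divide_le_eq mult_ac add_pos_nonneg)
  qed auto
  have "freq (2 * k) / (4 * sqrt pi) = (freq (2 * k))\<^sup>2 / (4 * sqrt pi * freq (2 * k))"
    using freq_pos[of "2 * k"] by (simp add: power2_eq_square field_simps)
  also have "\<dots> \<le> (4 * (real k + 1)) / (4 * sqrt pi * freq (2 * k))"
    using freq_pos[of "2 * k"] by (intro divide_right_mono) (auto simp: freq_power2 less_imp_le)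
  also have "\<dots> = (\<Sum>j\<in>{..k}. 1 / (sqrt pi * freq (2 * k)))" by (simp add: field_simps)
  also have "\<dots> \<le> (\<Sum>j\<in>{..k}. (hermite_fun (2 * j) 0)\<^sup>2)"
  proof (intro sum_mono)
    fix j assume "j \<in> {..k}"
    then have "freq (2 * j) \<le> freq (2 * k)" by (intro freq_mono) auto
    then have "1 / (sqrt pi * freq (2 * k)) \<le> 1 / (sqrt pi * freq (2 * j))"
      using freq_pos[of "2 * j"] by (intro divide_left_mono mult_left_mono) auto
    with *[of j] show "1 / (sqrt pi * freq (2 * k)) \<le> (hermite_fun (2 * j) 0)\<^sup>2" by linarith
  qed
  also have "\<dots> = (\<Sum>n\<in>(\<lambda>j. 2 * j) ` {..k}. (hermite_fun n 0)\<^sup>2)"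
    by (subst sum.reindex) (auto simp: inj_on_def)
  also have "\<dots> \<le> (\<Sum>n\<in>{..2 * k}. (hermite_fun n 0)\<^sup>2)"
    by (intro sum_mono2) auto
  finally show ?thesis .
qed

lemma hermite_kernel_lower:
  fixes k :: nat
  defines "D \<equiv> (\<Sum>n\<in>{..k}. (hermite_fun n 0)\<^sup>2)"
  assumes "\<bar>y\<bar> \<le> D / (4 * (freq k)\<^sup>2)"
  shows "D / 2 \<le> hermite_sum {..k} (\<lambda>n. hermite_fun n 0) y"
proof -
  let ?e = "hermite_sum {..k} (\<lambda>n. hermite_fun n 0)"
  have e0: "?e 0 = D" unfolding hermite_sum_def D_def by (simp add: power2_eq_square)
  have "(\<Sum>n\<in>{..k}. (freq n)\<^sup>2 * (hermite_fun n 0)\<^sup>2) \<le> (\<Sum>n\<in>{..k}. (freq k)\<^sup>2 * (hermite_fun n 0)\<^sup>2)"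
    by (intro sum_mono mult_right_mono) (auto simp: freq_power2)
  also have "\<dots> = (freq k)\<^sup>2 * D" by (simp add: sum_distrib_left D_def)
  finally have E: "(\<Sum>n\<in>{..k}. (freq n)\<^sup>2 * (hermite_fun n 0)\<^sup>2) \<le> (freq k)\<^sup>2 * D" .
  have F: "(freq k)\<^sup>2 > 0" using freq_pos[of k] by simp
  \<comment> \<open>The choice s = 2 (freq k)^2 makes both terms of the bound at most D/2 on the
    given interval.\<close>
  have "\<bar>?e y - ?e 0\<bar> \<le> (2 * (freq k)\<^sup>2 * \<bar>y - 0\<bar> + (\<Sum>n\<in>{..k}. (freq n)\<^sup>2 * (hermite_fun n 0)\<^sup>2) / (2 * (freq k)\<^sup>2)) / 2"
    using F by (intro hermite_sum_diff_bound) auto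
  also have "\<dots> \<le> (2 * (freq k)\<^sup>2 * (D / (4 * (freq k)\<^sup>2)) + ((freq k)\<^sup>2 * D) / (2 * (freq k)\<^sup>2)) / 2"
    using F E assms(2) by (intro divide_right_mono add_mono mult_left_mono) auto
  also have "\<dots> = D / 2" using F by (simp add: field_simps)
  finally show ?thesis unfolding e0 by linarith
qed

text \<open>The integral of (3 / (1 + |x|))^\<kappa> over the whole line.\<close>

definition decay_const :: "real \<Rightarrow> real" where
  "decay_const \<kappa> = 2 * (3 powr \<kappa> / (\<kappa> - 1))"

lemma decay_const_pos: "\<kappa> > 1 \<Longrightarrow> decay_const \<kappa> > 0"
  unfolding decay_const_def by simp

lemma nn_integral_decay:
  assumes "\<kappa> > 1"
  shows "(\<integral>\<^sup>+x. ennreal ((3 / (1 + \<bar>x\<bar>)) powr \<kappa>) \<partial>lborel) \<le> ennreal (decay_const \<kappa>)"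
proof -
  define f where "f x = ennreal ((3 / (1 + \<bar>x\<bar>)) powr \<kappa>)" for x :: real
  have [measurable]: "f \<in> borel_measurable borel" unfolding f_def by measurable
  have half: "(\<integral>\<^sup>+x. f x * indicator {0..} x \<partial>lborel) = ennreal (3 powr \<kappa> / (\<kappa> - 1))"
  proof -
    define F where "F x = - (3 powr \<kappa> / (\<kappa> - 1)) * (1 + x) powr (1 - \<kappa>)" for x :: real
    have "(\<integral>\<^sup>+x. f x * indicator {0..} x \<partial>lborel) = (\<integral>\<^sup>+x. ennreal (3 powr \<kappa> * (1 + x) powr (- \<kappa>)) * indicator {0..} x \<partial>lborel)"
      by (intro nn_integral_cong) (auto simp: f_def powr_divide powr_minus_divide indicator_def)
    also have "\<dots> = ennreal (0 - F 0)"
    proof (rule nn_integral_FTC_atLeast)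
      show "(F has_real_derivative 3 powr \<kappa> * (1 + x) powr (- \<kappa>)) (at x)" if "0 \<le> x" for x
        unfolding F_def by (rule derivative_eq_intros refl | use that assms in \<open>simp add: field_simps\<close>)+
      have "1 - \<kappa> < 0" using assms by simp
      then have "((\<lambda>x. (1 + x) powr (1 - \<kappa>)) \<longlongrightarrow> 0) at_top" by real_asymp
      from tendsto_mult_left[OF this, of "- (3 powr \<kappa> / (\<kappa> - 1))"] show "(F \<longlongrightarrow> 0) at_top" unfolding F_def by simp
    qed auto
    finally show ?thesis by (simp add: F_def)
  qed
  have "(\<integral>\<^sup>+x. f x \<partial>lborel) \<le> (\<integral>\<^sup>+x. f x * indicator {0..} x + f x * indicator {0..} (- x) \<partial>lborel)"
    by (intro nn_integral_mono) (auto simp: indicator_def)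
  also have "\<dots> = (\<integral>\<^sup>+x. f x * indicator {0..} x \<partial>lborel) + (\<integral>\<^sup>+x. f x * indicator {0..} (- x) \<partial>lborel)"
    by (intro nn_integral_add) measurable
  also have "(\<integral>\<^sup>+x. f x * indicator {0..} (- x) \<partial>lborel) = (\<integral>\<^sup>+x. f x * indicator {0..} x \<partial>lborel)"
    by (subst nn_integral_real_affine[where c = "-1" and t = 0]) (auto simp: f_def)
  finally have "(\<integral>\<^sup>+x. f x \<partial>lborel) \<le> ennreal (3 powr \<kappa> / (\<kappa> - 1)) + ennreal (3 powr \<kappa> / (\<kappa> - 1))"
    unfolding half .
  also have "\<dots> = ennreal (decay_const \<kappa>)"
    unfolding decay_const_def using assms by (subst ennreal_plus [symmetric]) auto
  finally show ?thesis unfolding f_def .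
qed

text \<open>\<kappa> powers of the diagonal use spatial decay, integrable because \<kappa> > 1, and
  the remaining s - \<kappa> powers give smallness in frequency. With s = p/2 both gains are
  possible exactly for p > 2.\<close>

lemma nn_integral_green_diag:
  assumes "finite I" "I \<subseteq> {m..}" "\<kappa> > 1" "\<kappa> \<le> s"
  shows "(\<integral>\<^sup>+x. ennreal (green_diag I x powr s) \<partial>lborel) \<le> ennreal ((2 / freq m) powr (s - \<kappa>) * decay_const \<kappa>)"
proof -
  have "green_diag I x powr s \<le> (2 / freq m) powr (s - \<kappa>) * (3 / (1 + \<bar>x\<bar>)) powr \<kappa>" for x
  proof -
    have g: "0 \<le> green_diag I x" by (rule green_diag_nonneg)
    have "green_diag I x \<le> 3 / (1 + \<bar>x\<bar>)"
      using green_diag_decay[OF assms(1,2), of x] by (simp add: field_simps)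
    then have "green_diag I x powr \<kappa> \<le> (3 / (1 + \<bar>x\<bar>)) powr \<kappa>"
      using g assms(3) by (intro powr_mono2) auto
    moreover have "green_diag I x powr (s - \<kappa>) \<le> (2 / freq m) powr (s - \<kappa>)"
      using g assms(4) green_diag_le_freq[OF assms(1,2), of x] by (intro powr_mono2) auto
    ultimately have "green_diag I x powr (s - \<kappa>) * green_diag I x powr \<kappa> \<le> (2 / freq m) powr (s - \<kappa>) * (3 / (1 + \<bar>x\<bar>)) powr \<kappa>"
      by (intro mult_mono) auto
    then show ?thesis by (simp add: powr_add [symmetric])
  qed
  then have "(\<integral>\<^sup>+x. ennreal (green_diag I x powr s) \<partial>lborel) \<le> (\<integral>\<^sup>+x. ennreal ((2 / freq m) powr (s - \<kappa>)) * ennreal ((3 / (1 + \<bar>x\<bar>)) powr \<kappa>) \<partial>lborel)"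
    by (intro nn_integral_mono) (simp add: ennreal_mult' [symmetric] ennreal_leI)
  also have "\<dots> = ennreal ((2 / freq m) powr (s - \<kappa>)) * (\<integral>\<^sup>+x. ennreal ((3 / (1 + \<bar>x\<bar>)) powr \<kappa>) \<partial>lborel)"
    by (intro nn_integral_cmult) measurable
  also have "\<dots> \<le> ennreal ((2 / freq m) powr (s - \<kappa>)) * ennreal (decay_const \<kappa>)"
    by (intro mult_left_mono nn_integral_decay assms) auto
  finally show ?thesis using decay_const_pos[OF assms(3)] by (simp add: ennreal_mult' [symmetric])
qed

section \<open>Functions in \<open>L\<^sup>p\<close> and their Hermite coefficients\<close>

text \<open>The dichotomy is b \<le> \<eta> a or not. The coefficient of the first term can be
  brought as close to 1 as desired, which lets this replace Minkowski's inequality in the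
  convergence of norms.\<close>

lemma powr_add_bound:
  fixes a b p \<eta> :: real
  assumes "0 \<le> a" "0 \<le> b" "0 < p" "0 < \<eta>"
  shows "(a + b) powr p \<le> (1 + \<eta>) powr p * a powr p + (1 + 1 / \<eta>) powr p * b powr p"
proof (cases "b \<le> \<eta> * a")
  case True
  then have "(a + b) powr p \<le> ((1 + \<eta>) * a) powr p"
    using assms by (intro powr_mono2) (auto simp: algebra_simps)
  also have "\<dots> = (1 + \<eta>) powr p * a powr p" using assms by (simp add: powr_mult)
  finally show ?thesis by (simp add: add_increasing2)
next
  case False
  then have "(a + b) powr p \<le> ((1 + 1 / \<eta>) * b) powr p"
    using assms by (intro powr_mono2) (auto simp: field_simps)
  also have "\<dots> = (1 + 1 / \<eta>) powr p * b powr p" using assms by (simp add: powr_mult)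
  finally show ?thesis by (simp add: add_increasing)
qed

lemma powr_add_le:
  fixes a b p :: real
  assumes "0 \<le> a" "0 \<le> b" "0 < p"
  shows "(a + b) powr p \<le> 2 powr p * (a powr p + b powr p)"
  using powr_add_bound[OF assms, of 1] by (simp add: algebra_simps)

lemma nn_integral_powr_triangle:
  fixes f g :: "'a \<Rightarrow> 'b::{real_normed_vector, second_countable_topology}"
  assumes [measurable]: "f \<in> borel_measurable M" "g \<in> borel_measurable M" and p: "0 < p" and "0 < \<eta>"
  shows "(\<integral>\<^sup>+x. ennreal (norm (f x) powr p) \<partial>M) \<le>
    ennreal ((1 + \<eta>) powr p) * (\<integral>\<^sup>+x. ennreal (norm (g x) powr p) \<partial>M) +
    ennreal ((1 + 1 / \<eta>) powr p) * (\<integral>\<^sup>+x. ennreal (norm (f x - g x) powr p) \<partial>M)"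
proof -
  have "norm (f x) powr p \<le> (1 + \<eta>) powr p * norm (g x) powr p + (1 + 1 / \<eta>) powr p * norm (f x - g x) powr p" for x
  proof -
    have "norm (f x) \<le> norm (g x) + norm (f x - g x)" by (metis add_diff_cancel_left' norm_triangle_sub diff_add_cancel)
    then have "norm (f x) powr p \<le> (norm (g x) + norm (f x - g x)) powr p" using p by (intro powr_mono2) auto
    also note powr_add_bound[OF norm_ge_zero norm_ge_zero assms(3,4)]
    finally show ?thesis .
  qed
  then have "(\<integral>\<^sup>+x. ennreal (norm (f x) powr p) \<partial>M) \<le>
    (\<integral>\<^sup>+x. ennreal ((1 + \<eta>) powr p) * ennreal (norm (g x) powr p) + ennreal ((1 + 1 / \<eta>) powr p) * ennreal (norm (f x - g x) powr p) \<partial>M)"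
    by (intro nn_integral_mono) (simp add: ennreal_mult' [symmetric] ennreal_leI flip: ennreal_plus)
  also have "\<dots> = ennreal ((1 + \<eta>) powr p) * (\<integral>\<^sup>+x. ennreal (norm (g x) powr p) \<partial>M) +
    ennreal ((1 + 1 / \<eta>) powr p) * (\<integral>\<^sup>+x. ennreal (norm (f x - g x) powr p) \<partial>M)"
    by (subst nn_integral_add) (auto simp: nn_integral_cmult)
  finally show ?thesis .
qed

text \<open>First n tends to infinity with \<eta> fixed, which removes the term with B \<eta>; then
  \<eta> tends to 0.\<close>

lemma real_tendsto_of_powr_bounds:
  fixes x d :: "nat \<Rightarrow> real"
  assumes d: "d \<longlonglongrightarrow> 0"
    and up: "\<And>\<eta> n. \<eta> > 0 \<Longrightarrow> x n \<le> (1 + \<eta>) powr p * y + B \<eta> * d n"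
    and lo: "\<And>\<eta> n. \<eta> > 0 \<Longrightarrow> y \<le> (1 + \<eta>) powr p * x n + B \<eta> * d n"
  shows "x \<longlonglongrightarrow> y"
proof (rule order_tendstoI)
  have lim: "((\<lambda>\<eta>. (1 + \<eta>) powr p * c) \<longlongrightarrow> c) (at_right 0)" for c
  proof -
    have "((\<lambda>\<eta>. (1 + \<eta>) powr p * c) \<longlongrightarrow> (1 + 0) powr p * c) (at_right 0)"
      by (intro tendsto_intros) auto
    then show ?thesis by simp
  qed
  have dB: "(\<lambda>n. B \<eta> * d n) \<longlonglongrightarrow> 0" for \<eta> using tendsto_mult_right_zero[OF d] by simp
  { fix a assume "a < y"
    then have "eventually (\<lambda>\<eta>. (1 + \<eta>) powr p * a < y) (at_right 0)"
      using order_tendstoD(2)[OF lim[of a]] by auto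
    moreover have "eventually (\<lambda>\<eta>. \<eta> > (0::real)) (at_right 0)" by (simp add: eventually_at_right_less)
    ultimately have "eventually (\<lambda>\<eta>. (1 + \<eta>) powr p * a < y \<and> \<eta> > 0) (at_right 0)" by eventually_elim auto
    then obtain \<eta> where \<eta>: "(1 + \<eta>) powr p * a < y" "\<eta> > 0"
      using eventually_happens[of _ "at_right (0::real)"] trivial_limit_at_right_real by blast
    then have "eventually (\<lambda>n. B \<eta> * d n < y - (1 + \<eta>) powr p * a) sequentially"
      using order_tendstoD(2)[OF dB[of \<eta>], of "y - (1 + \<eta>) powr p * a"] by auto
    then show "eventually (\<lambda>n. a < x n) sequentially"
    proof eventually_elim
      case (elim n)
      with lo[OF \<eta>(2), of n] have "(1 + \<eta>) powr p * a < (1 + \<eta>) powr p * x n" by linarith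
      then show ?case using \<eta>(2) by (simp add: mult_less_cancel_left)
    qed }
  { fix a assume "y < a"
    then have "eventually (\<lambda>\<eta>. (1 + \<eta>) powr p * y < a) (at_right 0)"
      using order_tendstoD(2)[OF lim[of y]] by auto
    moreover have "eventually (\<lambda>\<eta>. \<eta> > (0::real)) (at_right 0)" by (simp add: eventually_at_right_less)
    ultimately have "eventually (\<lambda>\<eta>. (1 + \<eta>) powr p * y < a \<and> \<eta> > 0) (at_right 0)" by eventually_elim auto
    then obtain \<eta> where \<eta>: "(1 + \<eta>) powr p * y < a" "\<eta> > 0"
      using eventually_happens[of _ "at_right (0::real)"] trivial_limit_at_right_real by blast
    then have "eventually (\<lambda>n. B \<eta> * d n < a - (1 + \<eta>) powr p * y) sequentially"
      using order_tendstoD(2)[OF dB[of \<eta>], of "a - (1 + \<eta>) powr p * y"] by auto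
    then show "eventually (\<lambda>n. x n < a) sequentially"
    proof eventually_elim
      case (elim n)
      with up[OF \<eta>(2), of n] show ?case by linarith
    qed }
qed

lemma nn_integral_powr_tendsto:
  fixes f :: "nat \<Rightarrow> 'a \<Rightarrow> 'b::{real_normed_vector, second_countable_topology}"
  assumes [measurable]: "\<And>n. f n \<in> borel_measurable M" "g \<in> borel_measurable M" and p: "0 < p"
    and fin: "\<And>n. (\<integral>\<^sup>+x. ennreal (norm (f n x) powr p) \<partial>M) < \<top>" "(\<integral>\<^sup>+x. ennreal (norm (g x) powr p) \<partial>M) < \<top>"
    and lim: "(\<lambda>n. \<integral>\<^sup>+x. ennreal (norm (f n x - g x) powr p) \<partial>M) \<longlonglongrightarrow> 0"
  shows "(\<lambda>n. enn2real (\<integral>\<^sup>+x. ennreal (norm (f n x) powr p) \<partial>M)) \<longlonglongrightarrow> enn2real (\<integral>\<^sup>+x. ennreal (norm (g x) powr p) \<partial>M)"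
proof -
  define X where "X n = (\<integral>\<^sup>+x. ennreal (norm (f n x) powr p) \<partial>M)" for n
  define Y where "Y = (\<integral>\<^sup>+x. ennreal (norm (g x) powr p) \<partial>M)"
  define D where "D n = (\<integral>\<^sup>+x. ennreal (norm (f n x - g x) powr p) \<partial>M)" for n
  have D': "D n < \<top>" for n
  proof -
    have "D n \<le> ennreal ((1 + 1) powr p) * X n + ennreal ((1 + 1 / 1) powr p) * (\<integral>\<^sup>+x. ennreal (norm ((f n x - g x) - f n x) powr p) \<partial>M)"
      unfolding D_def X_def by (rule nn_integral_powr_triangle) (use p in auto)
    also have "\<dots> < \<top>" using fin by (auto simp: X_def ennreal_mult_less_top)
    finally show ?thesis .
  qed
  define xn where "xn n = enn2real (X n)" for n
  have xn: "X n = ennreal (xn n)" "0 \<le> xn n" for n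
    using fin(1)[of n] by (auto simp: xn_def X_def)
  define y where "y = enn2real Y"
  have y: "Y = ennreal y" "0 \<le> y"
    using fin(2) by (auto simp: y_def Y_def)
  define d where "d n = enn2real (D n)" for n
  have d: "D n = ennreal (d n)" "0 \<le> d n" for n
    using D'[of n] by (auto simp: d_def)
  have "d \<longlonglongrightarrow> 0"
    using lim d unfolding D_def [symmetric] ennreal_0 [symmetric] by (simp del: ennreal_0 add: tendsto_ennreal_iff)
  then have "xn \<longlonglongrightarrow> y"
  proof (rule real_tendsto_of_powr_bounds)
    fix \<eta> :: real and n assume \<eta>: "\<eta> > 0"
    have "ennreal (xn n) \<le> ennreal ((1 + \<eta>) powr p) * ennreal y + ennreal ((1 + 1 / \<eta>) powr p) * ennreal (d n)"
      unfolding xn(1) [symmetric] y(1) [symmetric] d(1) [symmetric] X_def Y_def D_def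
      by (rule nn_integral_powr_triangle) (use p \<eta> in auto)
    also have "\<dots> = ennreal ((1 + \<eta>) powr p * y + (1 + 1 / \<eta>) powr p * d n)"
      using y d by (simp add: ennreal_mult' [symmetric] flip: ennreal_plus)
    finally show "xn n \<le> (1 + \<eta>) powr p * y + (1 + 1 / \<eta>) powr p * d n"
      using y(2) d(2)[of n] by (subst (asm) ennreal_le_iff) auto
    have "ennreal y \<le> ennreal ((1 + \<eta>) powr p) * ennreal (xn n) + ennreal ((1 + 1 / \<eta>) powr p) * ennreal (d n)"
      unfolding xn(1) [symmetric] y(1) [symmetric] d(1) [symmetric] X_def Y_def D_def norm_minus_commute[of "f n _"]
      by (rule nn_integral_powr_triangle) (use p \<eta> in auto)
    also have "\<dots> = ennreal ((1 + \<eta>) powr p * xn n + (1 + 1 / \<eta>) powr p * d n)"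
      using xn(2) d by (simp add: ennreal_mult' [symmetric] flip: ennreal_plus)
    finally show "y \<le> (1 + \<eta>) powr p * xn n + (1 + 1 / \<eta>) powr p * d n"
      using xn(2)[of n] d(2)[of n] by (subst (asm) ennreal_le_iff) auto
  qed
  then show ?thesis using xn y by (simp add: X_def Y_def)
qed

text \<open>Riesz-Fischer on an arbitrary measure space: for the field it is applied on the product
  of the probability space with the line, so that the limit comes out jointly measurable.\<close>

lemma Lp_complete:
  fixes f :: "nat \<Rightarrow> 'a \<Rightarrow> 'b::{banach, second_countable_topology}"
  assumes [measurable]: "\<And>n. f n \<in> borel_measurable M" and p: "0 < p"
    and cauchy: "\<And>e::real. e > 0 \<Longrightarrow> \<exists>N. \<forall>m\<ge>N. \<forall>n\<ge>N. (\<integral>\<^sup>+x. ennreal (norm (f m x - f n x) powr p) \<partial>M) \<le> ennreal e"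
  shows "\<exists>g\<in>borel_measurable M. (\<lambda>n. \<integral>\<^sup>+x. ennreal (norm (f n x - g x) powr p) \<partial>M) \<longlonglongrightarrow> 0"
proof -
  define I where "I m n = (\<integral>\<^sup>+x. ennreal (norm (f m x - f n x) powr p) \<partial>M)" for m n
  have "\<exists>N. \<forall>m\<ge>N. \<forall>n\<ge>N. I m n \<le> ennreal ((1 / 4) ^ k)" for k
    using cauchy[of "(1 / 4) ^ k"] by (simp add: I_def)
  then obtain N where N: "\<And>k m n. m \<ge> N k \<Longrightarrow> n \<ge> N k \<Longrightarrow> I m n \<le> ennreal ((1 / 4) ^ k)" by metis
  define r where "r k = (\<Sum>i\<le>k. N i) + k" for k
  have rN: "r j \<ge> N k" if "k \<le> j" for k j
  proof -
    have "N k \<le> (\<Sum>i\<le>j. N i)" using that by (intro member_le_sum) auto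
    then show ?thesis by (simp add: r_def)
  qed
  have r_ge: "r k \<ge> k" for k by (simp add: r_def)
  \<comment> \<open>The integrals of \<open>h k\<close> are at most 4^(-k). Weighting with 2^k keeps
    their sum finite, and finiteness at x forces \<open>h k x\<close> below C 2^(-k), hence
    geometric increments along the subsequence.\<close>
  define h where "h k x = norm (f (r (Suc k)) x - f (r k) x) powr p" for k x
  have hm [measurable]: "h k \<in> borel_measurable M" for k unfolding h_def[abs_def] by measurable
  have "(\<integral>\<^sup>+x. (\<Sum>k. ennreal (2 ^ k * h k x)) \<partial>M) = (\<Sum>k. \<integral>\<^sup>+x. ennreal (2 ^ k * h k x) \<partial>M)"
    by (rule nn_integral_suminf) measurable
  also have "\<dots> \<le> (\<Sum>k. ennreal ((1 / 2) ^ k))"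
  proof (intro suminf_le)
    fix k
    have "(\<integral>\<^sup>+x. ennreal (2 ^ k * h k x) \<partial>M) = ennreal (2 ^ k) * I (r (Suc k)) (r k)"
      unfolding I_def h_def by (subst nn_integral_cmult [symmetric]) (auto simp: ennreal_mult')
    also have "\<dots> \<le> ennreal (2 ^ k) * ennreal ((1 / 4) ^ k)"
      by (intro mult_left_mono N rN) auto
    also have "\<dots> = ennreal ((1 / 2) ^ k)"
      by (simp add: ennreal_mult' [symmetric] power_mult_distrib [symmetric])
    finally show "(\<integral>\<^sup>+x. ennreal (2 ^ k * h k x) \<partial>M) \<le> ennreal ((1 / 2) ^ k)" .
  qed auto
  also have "\<dots> < \<top>"
    by (subst suminf_ennreal2) (auto intro!: summable_geometric)
  finally have "AE x in M. (\<Sum>k. ennreal (2 ^ k * h k x)) \<noteq> \<infinity>"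
    by (intro nn_integral_PInf_AE) auto
  then have conv: "AE x in M. convergent (\<lambda>k. f (r k) x)"
  proof eventually_elim
    case (elim x)
    then obtain C where C: "(\<Sum>k. ennreal (2 ^ k * h k x)) = ennreal C" "C \<ge> 0"
      by (metis enn2real_nonneg ennreal_enn2real infinity_ennreal_def top.not_eq_extremum)
    have hk: "norm (f (r (Suc k)) x - f (r k) x) \<le> C powr (1 / p) * ((1 / 2) powr (1 / p)) ^ k" for k
    proof -
      have "ennreal (2 ^ k * h k x) \<le> (\<Sum>k. ennreal (2 ^ k * h k x))"
        using sum_le_suminf[of "\<lambda>k. ennreal (2 ^ k * h k x)" "{k}"] by auto
      then have "2 ^ k * h k x \<le> C" unfolding C using C(2) by (simp add: ennreal_le_iff)
      then have "h k x \<le> C * (1 / 2) ^ k" by (simp add: field_simps)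
      then have "(h k x) powr (1 / p) \<le> (C * (1 / 2) ^ k) powr (1 / p)"
        using p by (intro powr_mono2) (auto simp: h_def)
      moreover have "(h k x) powr (1 / p) = norm (f (r (Suc k)) x - f (r k) x)"
        unfolding h_def using p by (simp add: powr_powr)
      moreover have "((1 / 2 :: real) ^ k) powr (1 / p) = ((1 / 2) powr (1 / p)) ^ k"
        by (simp add: powr_realpow [symmetric] powr_powr mult.commute)
      ultimately show ?thesis using C(2) by (simp add: powr_mult)
    qed
    have "(1 / 2 :: real) powr (1 / p) < 1"
      using p powr_less_mono2[of "1 / p" "1 / 2" 1] by simp
    then have "summable (\<lambda>k. C powr (1 / p) * ((1 / 2) powr (1 / p)) ^ k)"
      by (intro summable_mult summable_geometric) auto
    then have "summable (\<lambda>k. f (r (Suc k)) x - f (r k) x)"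
      by (rule summable_comparison_test'[where N = 0, OF _ hk])
    then have "convergent (\<lambda>n. \<Sum>k<n. f (r (Suc k)) x - f (r k) x)"
      by (simp add: summable_iff_convergent)
    then have "convergent (\<lambda>n. f (r n) x - f (r 0) x)"
      by (subst (asm) sum_lessThan_telescope)
    then obtain l where "(\<lambda>n. f (r n) x - f (r 0) x) \<longlonglongrightarrow> l" by (auto simp: convergent_def)
    from tendsto_add[OF this tendsto_const[of "f (r 0) x"]] show ?case by (auto simp: convergent_def)
  qed
  define g where "g x = lim (\<lambda>k. f (r k) x)" for x
  have [measurable]: "g \<in> borel_measurable M" unfolding g_def[abs_def] by measurable
  have "(\<lambda>n. \<integral>\<^sup>+x. ennreal (norm (f n x - g x) powr p) \<partial>M) \<longlonglongrightarrow> 0"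
    unfolding ennreal_0 [symmetric]
  proof (rule order_tendstoI)
    fix a :: ennreal assume "ennreal 0 < a"
    then obtain b where b: "0 < b" "b < a" using dense by auto
    then obtain e where e: "0 < e" "ennreal e < a"
      by (cases b) auto
    from cauchy[OF e(1)] obtain N1 where N1: "\<And>m n. m \<ge> N1 \<Longrightarrow> n \<ge> N1 \<Longrightarrow> I m n \<le> ennreal e"
      unfolding I_def by blast
    have "(\<integral>\<^sup>+x. ennreal (norm (f n x - g x) powr p) \<partial>M) \<le> ennreal e" if "n \<ge> N1" for n
    proof -
      have "(\<integral>\<^sup>+x. ennreal (norm (f n x - g x) powr p) \<partial>M) = (\<integral>\<^sup>+x. liminf (\<lambda>k. ennreal (norm (f n x - f (r k) x) powr p)) \<partial>M)"
      proof (rule nn_integral_cong_AE, use conv in eventually_elim)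
        case (elim x)
        then have "(\<lambda>k. f (r k) x) \<longlonglongrightarrow> g x" unfolding g_def by (simp add: convergent_LIMSEQ_iff)
        then have "(\<lambda>k. ennreal (norm (f n x - f (r k) x) powr p)) \<longlonglongrightarrow> ennreal (norm (f n x - g x) powr p)"
          using p by (intro tendsto_intros tendsto_ennrealI) auto
        from lim_imp_Liminf[OF sequentially_bot this] show ?case by simp
      qed
      also have "\<dots> \<le> liminf (\<lambda>k. I n (r k))"
        unfolding I_def by (rule nn_integral_liminf) measurable
      also have "\<dots> \<le> ennreal e"
      proof (rule Liminf_le)
        show "eventually (\<lambda>k. I n (r k) \<le> ennreal e) sequentially"
          using eventually_ge_at_top[of N1] by eventually_elim (intro N1 that order_trans[OF _ r_ge])
      qed auto
      finally show ?thesis .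
    qed
    then show "eventually (\<lambda>n. (\<integral>\<^sup>+x. ennreal (norm (f n x - g x) powr p) \<partial>M) < a) sequentially"
      using e(2) by (intro eventually_sequentiallyI[of N1]) (blast intro: le_less_trans)
  qed auto
  then show ?thesis by auto
qed

lemma gauss_decay_power_hermite: "gauss_decay (\<lambda>x. x ^ j * hermite_fun n x)"
proof (induction j arbitrary: n)
  case (Suc j)
  have "(\<lambda>x. x ^ Suc j * hermite_fun n x) =
    (\<lambda>x. sqrt (real n / 2) * (x ^ j * hermite_fun (n - 1) x) + sqrt (real (Suc n) / 2) * (x ^ j * hermite_fun (Suc n) x))"
  proof
    fix x
    have "x ^ Suc j * hermite_fun n x = x ^ j * (x * hermite_fun n x)" by simp
    then show "x ^ Suc j * hermite_fun n x = sqrt (real n / 2) * (x ^ j * hermite_fun (n - 1) x) + sqrt (real (Suc n) / 2) * (x ^ j * hermite_fun (Suc n) x)"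
      unfolding hermite_fun_mult_x by (simp add: algebra_simps)
  qed
  then show ?case by (simp only:) (intro gauss_decay_add gauss_decay_cmult Suc)
qed auto

text \<open>Replaces Hoelder's inequality against a bounded integrable b: where a \<le> \<delta> the
  product is small compared with b, and elsewhere a is at most a multiple of its p-th power.\<close>

lemma powr_pairing_bound:
  fixes a b B \<delta> p :: real
  assumes "0 \<le> a" "0 \<le> b" "b \<le> B" "1 \<le> p" "0 < \<delta>"
  shows "a * b \<le> \<delta> * b + \<delta> powr (1 - p) * B * a powr p"
proof (cases "a \<le> \<delta>")
  case True
  then have "a * b \<le> \<delta> * b" using assms by (intro mult_right_mono) auto
  also have "\<dots> \<le> \<delta> * b + \<delta> powr (1 - p) * B * a powr p" using assms by simp
  finally show ?thesis .
next
  case False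
  then have "1 \<le> (a / \<delta>) powr (p - 1)" using assms by (intro ge_one_powr_ge_zero) auto
  then have "a * b * 1 \<le> a * b * (a / \<delta>) powr (p - 1)" using assms by (intro mult_left_mono) auto
  also have "\<dots> = b * (\<delta> powr (1 - p) * a powr p)"
    using assms False by (simp add: powr_divide powr_diff field_simps)
  also have "\<dots> \<le> B * (\<delta> powr (1 - p) * a powr p)" using assms by (intro mult_right_mono) auto
  also have "\<dots> \<le> \<delta> * b + \<delta> powr (1 - p) * B * a powr p" using assms by (simp add: mult_ac)
  finally show ?thesis by simp
qed

lemma integrable_Lp_mult_gauss_decay:
  fixes f :: "real \<Rightarrow> 'b::{banach, second_countable_topology}"
  assumes [measurable]: "f \<in> borel_measurable borel" and "1 \<le> p"
    and fin: "(\<integral>\<^sup>+x. ennreal (norm (f x) powr p) \<partial>lborel) < \<top>" and b: "gauss_decay b"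
  shows "integrable lborel (\<lambda>x. b x *\<^sub>R f x)"
proof -
  obtain B where B: "B > 0" "\<And>x. \<bar>b x\<bar> \<le> B" using gauss_decay_bounded[OF b] by blast
  have [measurable]: "b \<in> borel_measurable borel" using b by (rule gauss_decay_measurable)
  have "integrable lborel (\<lambda>x. norm (f x) powr p)"
    using fin by (intro integrableI_nonneg) auto
  then have i: "integrable lborel (\<lambda>x. 1 * \<bar>b x\<bar> + 1 powr (1 - p) * B * norm (f x) powr p)"
    using gauss_decay_integrable[OF b] by auto
  show ?thesis
  proof (rule Bochner_Integration.integrable_bound[OF i], goal_cases)
    case 2
    have "norm (f x) * \<bar>b x\<bar> \<le> 1 * \<bar>b x\<bar> + 1 powr (1 - p) * B * norm (f x) powr p" for x
      using powr_pairing_bound[OF norm_ge_zero abs_ge_zero B(2) assms(2), of 1] by simp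
    then show ?case by (auto simp: mult.commute intro: order_trans[OF _ abs_ge_self])
  qed measurable
qed

text \<open>Used for the Hermite coefficients of a limit. In the proof \<delta> is fixed first, so
  that the coefficient of \<open>d n\<close> is a constant.\<close>

lemma Lp_pairing_tendsto:
  fixes f :: "nat \<Rightarrow> real \<Rightarrow> 'b::{banach, second_countable_topology}"
  assumes [measurable]: "\<And>n. f n \<in> borel_measurable borel" "g \<in> borel_measurable borel" and p: "1 \<le> p"
    and fin: "\<And>n. (\<integral>\<^sup>+x. ennreal (norm (f n x) powr p) \<partial>lborel) < \<top>" "(\<integral>\<^sup>+x. ennreal (norm (g x) powr p) \<partial>lborel) < \<top>"
    and lim: "(\<lambda>n. \<integral>\<^sup>+x. ennreal (norm (f n x - g x) powr p) \<partial>lborel) \<longlonglongrightarrow> 0"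
    and b: "gauss_decay b"
  shows "(\<lambda>n. \<integral>x. b x *\<^sub>R f n x \<partial>lborel) \<longlonglongrightarrow> (\<integral>x. b x *\<^sub>R g x \<partial>lborel)"
proof -
  obtain B where B: "B > 0" "\<And>x. \<bar>b x\<bar> \<le> B" using gauss_decay_bounded[OF b] by blast
  have [measurable]: "b \<in> borel_measurable borel" using b by (rule gauss_decay_measurable)
  define D where "D n = (\<integral>\<^sup>+x. ennreal (norm (f n x - g x) powr p) \<partial>lborel)" for n
  have D': "D n < \<top>" for n
  proof -
    have "D n \<le> ennreal ((1 + 1) powr p) * (\<integral>\<^sup>+x. ennreal (norm (f n x) powr p) \<partial>lborel) + ennreal ((1 + 1 / 1) powr p) * (\<integral>\<^sup>+x. ennreal (norm ((f n x - g x) - f n x) powr p) \<partial>lborel)"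
      unfolding D_def by (rule nn_integral_powr_triangle) (use p in auto)
    also have "\<dots> < \<top>" using fin by (auto simp: ennreal_mult_less_top)
    finally show ?thesis .
  qed
  have iD: "integrable lborel (\<lambda>x. norm (f n x - g x) powr p)" for n
    using D'[of n] unfolding D_def by (intro integrableI_nonneg) auto
  define d where "d n = (\<integral>x. norm (f n x - g x) powr p \<partial>lborel)" for n
  have Dd: "D n = ennreal (d n)" for n unfolding D_def d_def by (intro nn_integral_eq_integral iD) auto
  have d0: "d n \<ge> 0" for n unfolding d_def by (intro integral_nonneg_AE) auto
  have dlim: "d \<longlonglongrightarrow> 0"
    using lim d0 unfolding D_def [symmetric] Dd ennreal_0 [symmetric] by (simp del: ennreal_0 add: tendsto_ennreal_iff)
  define b1 where "b1 = (\<integral>x. \<bar>b x\<bar> \<partial>lborel)"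
  have b10: "b1 \<ge> 0" unfolding b1_def by simp
  have bound: "norm ((\<integral>x. b x *\<^sub>R f n x \<partial>lborel) - (\<integral>x. b x *\<^sub>R g x \<partial>lborel)) \<le> \<delta> * b1 + \<delta> powr (1 - p) * B * d n" if "\<delta> > 0" for \<delta> n
  proof -
    have i1: "integrable lborel (\<lambda>x. b x *\<^sub>R f n x)" "integrable lborel (\<lambda>x. b x *\<^sub>R g x)"
      by (rule integrable_Lp_mult_gauss_decay[OF _ p _ b]; use fin in simp)+
    have "(\<integral>x. b x *\<^sub>R f n x \<partial>lborel) - (\<integral>x. b x *\<^sub>R g x \<partial>lborel) = (\<integral>x. b x *\<^sub>R f n x - b x *\<^sub>R g x \<partial>lborel)"
      using i1 by simp
    also have "norm \<dots> \<le> (\<integral>x. norm (b x *\<^sub>R f n x - b x *\<^sub>R g x) \<partial>lborel)"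
      by (rule integral_norm_bound)
    also have "\<dots> \<le> (\<integral>x. \<delta> * \<bar>b x\<bar> + \<delta> powr (1 - p) * B * norm (f n x - g x) powr p \<partial>lborel)"
    proof (rule integral_mono)
      show "integrable lborel (\<lambda>x. norm (b x *\<^sub>R f n x - b x *\<^sub>R g x))" using i1 by auto
      show "integrable lborel (\<lambda>x. \<delta> * \<bar>b x\<bar> + \<delta> powr (1 - p) * B * norm (f n x - g x) powr p)"
        using iD[of n] gauss_decay_integrable[OF b] by auto
      fix x
      show "norm (b x *\<^sub>R f n x - b x *\<^sub>R g x) \<le> \<delta> * \<bar>b x\<bar> + \<delta> powr (1 - p) * B * norm (f n x - g x) powr p"
        using powr_pairing_bound[OF norm_ge_zero abs_ge_zero B(2) p that, of "f n x - g x" x]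
        by (simp add: scaleR_diff_right [symmetric] mult.commute)
    qed
    also have "\<dots> = \<delta> * b1 + \<delta> powr (1 - p) * B * d n"
      unfolding b1_def d_def using iD[of n] gauss_decay_integrable[OF b] by simp
    finally show ?thesis .
  qed
  show ?thesis
  proof (rule LIMSEQ_I)
    fix e :: real assume e: "e > 0"
    define \<delta> where "\<delta> = e / (2 * (b1 + 1))"
    have \<delta>: "\<delta> > 0" using e b10 by (auto simp: \<delta>_def)
    have \<delta>b: "\<delta> * b1 < e / 2" using e b10 by (simp add: \<delta>_def field_simps)
    have "(\<lambda>n. \<delta> powr (1 - p) * B * d n) \<longlonglongrightarrow> 0" using tendsto_mult_right_zero[OF dlim] by simp
    from order_tendstoD(2)[OF this, of "e / 2"] e
    obtain N where N: "\<And>n. n \<ge> N \<Longrightarrow> \<delta> powr (1 - p) * B * d n < e / 2" by (auto simp: eventually_sequentially)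
    show "\<exists>N. \<forall>n\<ge>N. norm ((\<integral>x. b x *\<^sub>R f n x \<partial>lborel) - (\<integral>x. b x *\<^sub>R g x \<partial>lborel)) < e"
      using bound[OF \<delta>] \<delta>b N by (intro exI[of _ N]) (fastforce intro: le_less_trans)
  qed
qed

text \<open>The function \<open>f h\<^sub>0\<close> has vanishing moments and exponential tails, so its Fourier transform
  vanishes; Levy's uniqueness theorem then applies to its positive and negative parts.\<close>

lemma hermite_complete_real:
  fixes f :: "real \<Rightarrow> real"
  assumes fm [measurable]: "f \<in> borel_measurable borel" and p: "1 \<le> p"
    and fin: "(\<integral>\<^sup>+x. ennreal (norm (f x) powr p) \<partial>lborel) < \<top>"
    and zero: "\<And>n. (\<integral>x. hermite_fun n x * f x \<partial>lborel) = 0"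
  shows "AE x in lborel. f x = 0"
proof -
  have int: "integrable lborel (\<lambda>x. b x * f x)" if "gauss_decay b" for b
    using integrable_Lp_mult_gauss_decay[OF fm p fin that] by simp
  have mom: "(\<integral>x. x ^ j * hermite_fun n x * f x \<partial>lborel) = 0" for j n
  proof (induction j arbitrary: n)
    case (Suc j)
    have e: "x ^ Suc j * hermite_fun n x * f x =
      sqrt (real n / 2) * (x ^ j * hermite_fun (n - 1) x * f x) + sqrt (real (Suc n) / 2) * (x ^ j * hermite_fun (Suc n) x * f x)" for x
    proof -
      have "x ^ Suc j * hermite_fun n x * f x = x ^ j * (x * hermite_fun n x) * f x" by simp
      then show ?thesis unfolding hermite_fun_mult_x by (simp add: algebra_simps)
    qed
    show ?case unfolding e
      using int[OF gauss_decay_power_hermite[of j "n - 1"]] int[OF gauss_decay_power_hermite[of j "Suc n"]] Suc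
      by simp
  qed (simp add: zero)
  define G where "G x = hermite_fun 0 x * f x" for x
  have Gm [measurable]: "G \<in> borel_measurable borel" unfolding G_def[abs_def] by measurable
  have Gi: "integrable lborel G" unfolding G_def[abs_def] by (intro int gauss_decay_hermite)
  have Gexp: "integrable lborel (\<lambda>x. exp (t * \<bar>x\<bar>) * \<bar>G x\<bar>)" for t
  proof -
    have "gauss_decay (\<lambda>x. exp (t * \<bar>x\<bar>) * hermite_fun 0 x)"
      using hermite_fun_strong_decay[of 0 t]
      by (auto simp: gauss_decay_def abs_mult mult.commute intro!: continuous_intros)
    from integrable_norm[OF int[OF this]] show ?thesis by (simp add: G_def abs_mult mult_ac)
  qed
  have Gmom: "(\<integral>x. x ^ j * G x \<partial>lborel) = 0" for j
    using mom[of j 0] by (simp add: G_def mult.assoc)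
  have fourier: "(\<integral>x. G x *\<^sub>R iexp (t * x) \<partial>lborel) = 0" for t
  proof -
    \<comment> \<open>Partial sums of the exponential series: each integrates to zero by the
      vanishing moments, and exp (|t| |x|) |G| dominates them all.\<close>
    define S where "S k x = (\<Sum>j<k. G x *\<^sub>R ((\<i> * of_real (t * x)) ^ j /\<^sub>R fact j))" for k x
    have bound: "norm (S k x) \<le> exp (\<bar>t\<bar> * \<bar>x\<bar>) * \<bar>G x\<bar>" for k x
    proof -
      have "norm (S k x) \<le> (\<Sum>j<k. \<bar>G x\<bar> * ((\<bar>t\<bar> * \<bar>x\<bar>) ^ j /\<^sub>R fact j))"
        unfolding S_def by (rule order_trans[OF norm_sum]) (auto intro!: sum_mono simp: norm_mult norm_power abs_mult)
      also have "\<dots> = \<bar>G x\<bar> * (\<Sum>j<k. (\<bar>t\<bar> * \<bar>x\<bar>) ^ j /\<^sub>R fact j)" by (simp add: sum_distrib_left)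
      also have "\<dots> \<le> \<bar>G x\<bar> * exp (\<bar>t\<bar> * \<bar>x\<bar>)"
        unfolding exp_def by (intro mult_left_mono sum_le_suminf summable_exp_generic) auto
      finally show ?thesis by (simp add: mult.commute)
    qed
    have lim: "(\<lambda>k. S k x) \<longlonglongrightarrow> G x *\<^sub>R iexp (t * x)" for x
      using exp_converges[of "\<i> * of_real (t * x)"] unfolding S_def sums_def scaleR_sum_right [symmetric]
      by (intro tendsto_intros)
    have "(\<lambda>k. \<integral>x. S k x \<partial>lborel) \<longlonglongrightarrow> (\<integral>x. G x *\<^sub>R iexp (t * x) \<partial>lborel)"
      by (rule integral_dominated_convergence[where w = "\<lambda>x. exp (\<bar>t\<bar> * \<bar>x\<bar>) * \<bar>G x\<bar>"])
         (use bound lim Gexp in \<open>auto simp: S_def\<close>)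
    moreover have "(\<integral>x. S k x \<partial>lborel) = 0" for k
    proof -
      have e: "G x *\<^sub>R ((\<i> * of_real (t * x)) ^ j /\<^sub>R fact j) = ((\<i> * of_real t) ^ j /\<^sub>R fact j) * of_real (x ^ j * G x)" for x j
        by (simp add: scaleR_conv_of_real power_mult_distrib field_simps)
      have "integrable lborel (\<lambda>x. x ^ j * G x)" for j
        using int[OF gauss_decay_power_hermite[of j 0]] by (simp add: G_def mult.assoc)
      then have ic: "integrable lborel (\<lambda>x. ((\<i> * of_real t) ^ j /\<^sub>R fact j) * complex_of_real (x ^ j * G x))" for j
        by (intro integrable_mult_right integrable_of_real)
      show ?thesis unfolding S_def e
        by (subst Bochner_Integration.integral_sum[OF ic]) (simp only: integral_mult_right_zero integral_complex_of_real Gmom of_real_0 mult_zero_right sum.neutral_const)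
    qed
    ultimately show ?thesis by (simp add: LIMSEQ_const_iff)
  qed
  define P where "P x = max (G x) 0" for x
  define Q where "Q x = max (- G x) 0" for x
  have PQm [measurable]: "P \<in> borel_measurable borel" "Q \<in> borel_measurable borel" unfolding P_def[abs_def] Q_def[abs_def] by measurable
  have PQi: "integrable lborel P" "integrable lborel Q" unfolding P_def[abs_def] Q_def[abs_def]
    using Gi by (auto intro!: integrable_max)
  have PQ0: "P x \<ge> 0" "Q x \<ge> 0" for x by (auto simp: P_def Q_def)
  have PQ: "G x = P x - Q x" for x by (auto simp: P_def Q_def)
  have ci: "integrable lborel (\<lambda>x. R x *\<^sub>R iexp (t * x))" if "integrable lborel R" for R t
    using that by (rule Bochner_Integration.integrable_bound) (use that in auto)
  have PQf: "(\<integral>x. P x *\<^sub>R iexp (t * x) \<partial>lborel) = (\<integral>x. Q x *\<^sub>R iexp (t * x) \<partial>lborel)" for t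
    using fourier[of t] ci[OF PQi(1), of t] ci[OF PQi(2), of t] unfolding PQ scaleR_diff_left by simp
  \<comment> \<open>Levy's theorem compares probability measures. The moment of order 0 shows that
    the positive and negative parts have the same mass, so one constant normalizes both unless it is
    0.\<close>
  define m where "m = (\<integral>x. P x \<partial>lborel)"
  have mQ: "(\<integral>x. Q x \<partial>lborel) = m" using Gmom[of 0] PQi unfolding PQ m_def by simp
  have "AE x in lborel. P x = Q x"
  proof (cases "m = 0")
    case True
    have "AE x in lborel. P x = 0" "AE x in lborel. Q x = 0"
      using integral_nonneg_eq_0_iff_AE[OF PQi(1)] integral_nonneg_eq_0_iff_AE[OF PQi(2)] PQ0 True mQ
      by (simp_all add: m_def)
    then show ?thesis by eventually_elim auto
  next
    case False
    moreover have "m \<ge> 0" unfolding m_def using PQ0 by simp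
    ultimately have m: "m > 0" by simp
    define N where "N R = density lborel (\<lambda>x. ennreal (R x / m))" for R :: "real \<Rightarrow> real"
    have rd: "real_distribution (N R)" if [measurable]: "R \<in> borel_measurable borel" and R: "integrable lborel R" "\<And>x. R x \<ge> 0" "(\<integral>x. R x \<partial>lborel) = m" for R
    proof -
      have "emeasure (N R) (space (N R)) = (\<integral>\<^sup>+x. ennreal (R x / m) \<partial>lborel)"
        unfolding N_def by (simp add: emeasure_density)
      also have "\<dots> = ennreal (\<integral>x. R x / m \<partial>lborel)"
        using R m by (intro nn_integral_eq_integral) auto
      also have "\<dots> = 1" using R m by simp
      finally have "prob_space (N R)" by (rule prob_spaceI)
      then show ?thesis by (simp add: real_distribution_def real_distribution_axioms_def N_def)
    qed
    have ch: "char (N R) t = (\<integral>x. R x *\<^sub>R iexp (t * x) \<partial>lborel) /\<^sub>R m"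
      if [measurable]: "R \<in> borel_measurable borel" and R: "\<And>x. R x \<ge> 0" for R t
    proof -
      have "char (N R) t = (\<integral>x. (R x / m) *\<^sub>R iexp (t * x) \<partial>lborel)"
        unfolding char_def N_def using R m by (subst integral_density) auto
      also have "\<dots> = (\<integral>x. (1 / m) *\<^sub>R (R x *\<^sub>R iexp (t * x)) \<partial>lborel)" by simp
      also have "\<dots> = (\<integral>x. R x *\<^sub>R iexp (t * x) \<partial>lborel) /\<^sub>R m"
        by (subst integral_scaleR_right) (simp add: divide_inverse)
      finally show ?thesis .
    qed
    have "N P = N Q"
      by (rule Levy_uniqueness) (use rd PQm PQi PQ0 mQ ch PQf in \<open>auto simp: m_def\<close>)
    then have "AE x in lborel. ennreal (P x / m) = ennreal (Q x / m)"
      unfolding N_def by (subst (asm) sigma_finite_measure.density_unique_iff[OF lborel.sigma_finite_measure_axioms]) auto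
    then show ?thesis
      by eventually_elim (use m PQ0 in \<open>simp add: ennreal_inj\<close>)
  qed
  then show ?thesis
  proof eventually_elim
    case (elim x)
    then have "hermite_fun 0 x * f x = 0" using PQ[of x] by (simp add: G_def)
    then show ?case by (simp add: hermite_fun_0)
  qed
qed

lemma hermite_complete:
  fixes f :: "real \<Rightarrow> complex"
  assumes fm [measurable]: "f \<in> borel_measurable borel" and p: "1 \<le> p"
    and fin: "(\<integral>\<^sup>+x. ennreal (norm (f x) powr p) \<partial>lborel) < \<top>"
    and zero: "\<And>n. (\<integral>x. hermite_fun n x *\<^sub>R f x \<partial>lborel) = 0"
  shows "AE x in lborel. f x = 0"
proof -
  have int: "integrable lborel (\<lambda>x. hermite_fun n x *\<^sub>R f x)" for n
    using integrable_Lp_mult_gauss_decay[OF fm p fin] by auto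
  have le: "(\<integral>\<^sup>+x. ennreal (norm (g x) powr p) \<partial>lborel) < \<top>" if "\<And>x. \<bar>g x\<bar> \<le> norm (f x)" for g :: "real \<Rightarrow> real"
    by (rule le_less_trans[OF nn_integral_mono fin]) (use that p in \<open>auto intro!: ennreal_leI powr_mono2\<close>)
  have "AE x in lborel. Re (f x) = 0"
  proof (rule hermite_complete_real[OF _ p le])
    show "(\<integral>x. hermite_fun n x * Re (f x) \<partial>lborel) = 0" for n
      using integral_Re[OF int[of n]] zero[of n] by simp
  qed (auto intro: abs_Re_le_cmod)
  moreover have "AE x in lborel. Im (f x) = 0"
  proof (rule hermite_complete_real[OF _ p le])
    show "(\<integral>x. hermite_fun n x * Im (f x) \<partial>lborel) = 0" for n
      using integral_Im[OF int[of n]] zero[of n] by simp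
  qed (auto intro: abs_Im_le_cmod)
  ultimately show ?thesis by eventually_elim (auto simp: complex_eq_iff)
qed

section \<open>The L^p norm of a distribution\<close>

lemma Lp_norm_eq: "(\<integral>\<^sup>+x. ennreal (norm (f x) powr p) \<partial>M) < \<top> \<Longrightarrow>
   Lp_norm M p f = ennreal (enn2real (\<integral>\<^sup>+x. ennreal (norm (f x) powr p) \<partial>M) powr (1 / p))"
  unfolding Lp_norm_def Let_def by auto

lemma Lp_norm_powr:
  assumes "(\<integral>\<^sup>+x. ennreal (norm (f x) powr p) \<partial>M) < \<top>" "p > 0"
  shows "enn2real (Lp_norm M p f) powr p = enn2real (\<integral>\<^sup>+x. ennreal (norm (f x) powr p) \<partial>M)"
  unfolding Lp_norm_eq[OF assms(1)] using assms(2) by (simp add: powr_powr)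

text \<open>Two functions of finite norm with the same coefficients differ by an L^p function with
  all coefficients zero, so completeness makes them equal almost everywhere; a competitor of
  infinite norm cannot lower the infimum.\<close>

lemma distribution_Lp_norm_eq:
  fixes U :: "real \<Rightarrow> complex"
  assumes Um [measurable]: "U \<in> borel_measurable borel" and p: "1 \<le> p"
    and fin: "(\<integral>\<^sup>+x. ennreal (norm (U x) powr p) \<partial>lborel) < \<top>"
    and coeff: "\<And>n. (\<integral>x. hermite_fun n x *\<^sub>R U x \<partial>lborel) = u n"
  shows "distribution_Lp_norm p u = Lp_norm lborel p U"
proof -
  let ?A = "{f \<in> borel_measurable lborel. \<forall>n. integrable lborel (\<lambda>x. f x * complex_of_real (hermite_fun n x)) \<and>
          (\<integral>x. f x * of_real (hermite_fun n x) \<partial>lborel) = u n}"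
  have eq: "f x * complex_of_real (hermite_fun n x) = hermite_fun n x *\<^sub>R f x" for f n x
    by (simp add: scaleR_conv_of_real mult.commute)
  have inA: "U \<in> ?A" unfolding eq using coeff integrable_Lp_mult_gauss_decay[OF Um p fin] by auto
  have ge: "Lp_norm lborel p U \<le> Lp_norm lborel p f" if f: "f \<in> ?A" for f
  proof (cases "(\<integral>\<^sup>+x. ennreal (norm (f x) powr p) \<partial>lborel) < \<top>")
    case True
    from f have fm [measurable]: "f \<in> borel_measurable borel" by auto
    have "(\<integral>\<^sup>+x. ennreal (norm (f x - U x) powr p) \<partial>lborel) \<le>
        ennreal ((1 + 1) powr p) * (\<integral>\<^sup>+x. ennreal (norm (f x) powr p) \<partial>lborel) + ennreal ((1 + 1 / 1) powr p) * (\<integral>\<^sup>+x. ennreal (norm ((f x - U x) - f x) powr p) \<partial>lborel)"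
      by (rule nn_integral_powr_triangle) (use p in auto)
    also have "\<dots> < \<top>" using True fin by (auto simp: ennreal_mult_less_top)
    finally have "AE x in lborel. f x - U x = 0"
    proof (intro hermite_complete[OF _ p])
      fix n
      have "integrable lborel (\<lambda>x. hermite_fun n x *\<^sub>R f x)" "(\<integral>x. hermite_fun n x *\<^sub>R f x \<partial>lborel) = u n"
        using f unfolding eq by auto
      then show "(\<integral>x. hermite_fun n x *\<^sub>R (f x - U x) \<partial>lborel) = 0"
        using coeff[of n] integrable_Lp_mult_gauss_decay[OF Um p fin gauss_decay_hermite[of n]]
        by (simp add: scaleR_diff_right)
    qed auto
    then have "(\<integral>\<^sup>+x. ennreal (norm (f x) powr p) \<partial>lborel) = (\<integral>\<^sup>+x. ennreal (norm (U x) powr p) \<partial>lborel)"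
      by (intro nn_integral_cong_AE) (auto elim: eventually_mono)
    then show ?thesis by (simp add: Lp_norm_def)
  next
    case False
    then show ?thesis by (simp add: Lp_norm_def Let_def less_top)
  qed
  show ?thesis unfolding distribution_Lp_norm_def
    by (rule antisym) (use inA ge in \<open>auto intro!: INF_lower INF_greatest\<close>)
qed

section \<open>The Gaussian measure\<close>

definition cgauss :: "complex measure" where
  "cgauss = density lborel (\<lambda>z. ennreal (exp (- (cmod z)\<^sup>2) / pi))"

lemma sets_cgauss [simp, measurable_cong]: "sets cgauss = sets borel"
  and space_cgauss [simp]: "space cgauss = UNIV"
  by (simp_all add: cgauss_def)

definition half_normal :: "real \<Rightarrow> real" where
  "half_normal x = exp (- x\<^sup>2) / sqrt pi"

lemma half_normal_nonneg [simp]: "0 \<le> half_normal x"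
  by (simp add: half_normal_def)

lemma half_normal_measurable [measurable]: "half_normal \<in> borel_measurable borel"
  unfolding half_normal_def[abs_def] by measurable

lemma half_normal_eq: "half_normal x = normal_density 0 (sqrt (1 / 2)) x"
  by (simp add: half_normal_def normal_density_def)

lemma nn_integral_cgauss_prod:
  fixes f g :: "real \<Rightarrow> ennreal"
  assumes [measurable]: "f \<in> borel_measurable borel" "g \<in> borel_measurable borel"
  shows "(\<integral>\<^sup>+z. f (Re z) * g (Im z) \<partial>cgauss) =
    (\<integral>\<^sup>+x. f x * ennreal (half_normal x) \<partial>lborel) * (\<integral>\<^sup>+x. g x * ennreal (half_normal x) \<partial>lborel)"
proof -
  define F where "F b x = (if b = 1 then f x else g x) * ennreal (half_normal x)" for b :: complex and x
  have [measurable]: "F b \<in> borel_measurable borel" for b unfolding F_def[abs_def] by measurable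
  have B: "(\<Prod>b\<in>Basis. G b) = G 1 * G \<i>" for G :: "complex \<Rightarrow> ennreal"
    by (simp add: Basis_complex_def)
  have "(\<integral>\<^sup>+z. f (Re z) * g (Im z) \<partial>cgauss) = (\<integral>\<^sup>+z. ennreal (exp (- (cmod z)\<^sup>2) / pi) * (f (Re z) * g (Im z)) \<partial>lborel)"
    unfolding cgauss_def by (rule nn_integral_density) measurable
  also have "\<dots> = (\<integral>\<^sup>+z. (\<Prod>b\<in>Basis. F b (z \<bullet> b)) \<partial>lborel)"
  proof (intro nn_integral_cong)
    fix z :: complex
    have "exp (- (cmod z)\<^sup>2) / pi = half_normal (Re z) * half_normal (Im z)"
      by (simp add: half_normal_def cmod_power2 exp_add [symmetric] exp_diff exp_minus field_simps)
    then have "ennreal (exp (- (cmod z)\<^sup>2) / pi) = ennreal (half_normal (Re z)) * ennreal (half_normal (Im z))"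
      by (simp add: ennreal_mult')
    then show "ennreal (exp (- (cmod z)\<^sup>2) / pi) * (f (Re z) * g (Im z)) = (\<Prod>b\<in>Basis. F b (z \<bullet> b))"
      unfolding B F_def by (simp add: mult_ac complex_inner_1_right complex_inner_i_right complex_i_not_one)
  qed
  also have "\<dots> = (\<Prod>b\<in>Basis. \<integral>\<^sup>+x. F b x \<partial>lborel)"
    by (rule nn_integral_lborel_prod) auto
  also have "\<dots> = (\<integral>\<^sup>+x. f x * ennreal (half_normal x) \<partial>lborel) * (\<integral>\<^sup>+x. g x * ennreal (half_normal x) \<partial>lborel)"
    unfolding B F_def by (simp add: complex_i_not_one)
  finally show ?thesis .
qed

lemma nn_integral_normal_density: "\<sigma> > 0 \<Longrightarrow> (\<integral>\<^sup>+x. ennreal (normal_density \<mu> \<sigma> x) \<partial>lborel) = 1"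
  by (subst nn_integral_eq_integral) (auto intro: integrable_normal_density simp: integral_normal_density)

lemma nn_integral_half_normal: "(\<integral>\<^sup>+x. ennreal (half_normal x) \<partial>lborel) = 1"
  unfolding half_normal_eq by (rule nn_integral_normal_density) simp

lemma nn_integral_exp_linear: "(\<integral>\<^sup>+x. ennreal (exp (2 * a * x)) * ennreal (half_normal x) \<partial>lborel) = ennreal (exp (a\<^sup>2))"
proof -
  have "exp (2 * a * x) * half_normal x = exp (a\<^sup>2) * normal_density a (sqrt (1 / 2)) x" for x
    by (simp add: half_normal_def normal_density_def exp_add [symmetric] power2_eq_square algebra_simps)
  then have "(\<integral>\<^sup>+x. ennreal (exp (2 * a * x)) * ennreal (half_normal x) \<partial>lborel) = (\<integral>\<^sup>+x. ennreal (exp (a\<^sup>2)) * ennreal (normal_density a (sqrt (1 / 2)) x) \<partial>lborel)"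
    by (simp add: ennreal_mult' [symmetric])
  also have "\<dots> = ennreal (exp (a\<^sup>2))"
    by (subst nn_integral_cmult) (auto simp: nn_integral_normal_density)
  finally show ?thesis .
qed

lemma nn_integral_exp_square:
  assumes "t < 1"
  shows "(\<integral>\<^sup>+x. ennreal (exp (t * x\<^sup>2)) * ennreal (half_normal x) \<partial>lborel) = ennreal (1 / sqrt (1 - t))"
proof -
  define s where "s = sqrt (1 / (2 * (1 - t)))"
  have s: "s > 0" "s\<^sup>2 = 1 / (2 * (1 - t))" using assms by (auto simp: s_def)
  have "exp (t * x\<^sup>2) * half_normal x = 1 / sqrt (1 - t) * normal_density 0 s x" for x
  proof -
    have "2 * pi * s\<^sup>2 = pi / (1 - t)" unfolding s(2) using assms by (simp add: field_simps)
    then have "sqrt (2 * pi * s\<^sup>2) = sqrt pi / sqrt (1 - t)" by (simp only: real_sqrt_divide)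
    moreover have "2 * s\<^sup>2 = 1 / (1 - t)" unfolding s(2) using assms by (simp add: field_simps)
    then have "- x\<^sup>2 / (2 * s\<^sup>2) = t * x\<^sup>2 + - x\<^sup>2" by (simp add: algebra_simps)
    ultimately show ?thesis using assms
      by (simp add: half_normal_def normal_density_def exp_add [symmetric])
  qed
  then have "(\<integral>\<^sup>+x. ennreal (exp (t * x\<^sup>2)) * ennreal (half_normal x) \<partial>lborel) = (\<integral>\<^sup>+x. ennreal (1 / sqrt (1 - t)) * ennreal (normal_density 0 s x) \<partial>lborel)"
    using assms by (simp add: ennreal_mult' [symmetric] ennreal_mult'' [symmetric])
  also have "\<dots> = ennreal (1 / sqrt (1 - t))"
    using s by (subst nn_integral_cmult) (auto simp: nn_integral_normal_density)
  finally show ?thesis .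
qed

lemma nn_integral_half_normal_moment: "(\<integral>\<^sup>+x. ennreal (x ^ (2 * k)) * ennreal (half_normal x) \<partial>lborel) = ennreal (fact (2 * k) / (4 ^ k * fact k))"
proof -
  have "has_bochner_integral lborel (\<lambda>x. normal_density 0 (sqrt (1 / 2)) x * (x - 0) ^ (2 * k)) (fact (2 * k) / ((2 / (sqrt (1 / 2))\<^sup>2) ^ k * fact k))"
    by (rule normal_moment_even) simp
  then have h: "has_bochner_integral lborel (\<lambda>x. x ^ (2 * k) * half_normal x) (fact (2 * k) / (4 ^ k * fact k))"
    by (simp add: half_normal_eq mult.commute)
  have "(\<integral>\<^sup>+x. ennreal (x ^ (2 * k)) * ennreal (half_normal x) \<partial>lborel) = (\<integral>\<^sup>+x. ennreal (x ^ (2 * k) * half_normal x) \<partial>lborel)"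
    by (simp add: ennreal_mult' [symmetric] power_mult)
  also have "\<dots> = ennreal (\<integral>x. x ^ (2 * k) * half_normal x \<partial>lborel)"
    using h by (intro nn_integral_eq_integral) (auto simp: power_mult has_bochner_integral_iff)
  finally show ?thesis using h by (simp add: has_bochner_integral_iff)
qed

lemma prob_space_cgauss: "prob_space cgauss"
proof (rule prob_spaceI)
  have "emeasure cgauss (space cgauss) = (\<integral>\<^sup>+z. 1 * 1 \<partial>cgauss)" by simp
  also have "\<dots> = 1" by (subst nn_integral_cgauss_prod) (auto simp: nn_integral_half_normal)
  finally show "emeasure cgauss (space cgauss) = 1" .
qed

lemma cgauss_mgf: "(\<integral>\<^sup>+z. ennreal (exp (2 * Re (cnj w * z))) \<partial>cgauss) = ennreal (exp ((cmod w)\<^sup>2))"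
proof -
  have "(\<integral>\<^sup>+z. ennreal (exp (2 * Re (cnj w * z))) \<partial>cgauss) = (\<integral>\<^sup>+z. ennreal (exp (2 * Re w * Re z)) * ennreal (exp (2 * Im w * Im z)) \<partial>cgauss)"
    by (simp add: ennreal_mult' [symmetric] exp_add [symmetric] algebra_simps)
  also have "\<dots> = ennreal (exp ((Re w)\<^sup>2)) * ennreal (exp ((Im w)\<^sup>2))"
    unfolding nn_integral_exp_linear [symmetric] by (rule nn_integral_cgauss_prod) auto
  also have "\<dots> = ennreal (exp ((cmod w)\<^sup>2))"
    by (simp add: ennreal_mult' [symmetric] exp_add [symmetric] cmod_power2)
  finally show ?thesis .
qed

lemma cgauss_exp_square:
  assumes "t < 1"
  shows "(\<integral>\<^sup>+z. ennreal (exp (t * (cmod z)\<^sup>2)) \<partial>cgauss) = ennreal (1 / (1 - t))"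
proof -
  have "(\<integral>\<^sup>+z. ennreal (exp (t * (cmod z)\<^sup>2)) \<partial>cgauss) = (\<integral>\<^sup>+z. ennreal (exp (t * (Re z)\<^sup>2)) * ennreal (exp (t * (Im z)\<^sup>2)) \<partial>cgauss)"
    by (simp add: ennreal_mult' [symmetric] exp_add [symmetric] cmod_power2 algebra_simps)
  also have "\<dots> = ennreal (1 / sqrt (1 - t)) * ennreal (1 / sqrt (1 - t))"
    unfolding nn_integral_exp_square[OF assms, symmetric] by (rule nn_integral_cgauss_prod) auto
  also have "\<dots> = ennreal (1 / (1 - t))"
    using assms by (simp add: ennreal_mult' [symmetric])
  finally show ?thesis .
qed

lemma cgauss_moments:
  "(\<integral>\<^sup>+z. ennreal ((Re z)\<^sup>2) \<partial>cgauss) = ennreal (1 / 2)"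
  "(\<integral>\<^sup>+z. ennreal ((Im z)\<^sup>2) \<partial>cgauss) = ennreal (1 / 2)"
  "(\<integral>\<^sup>+z. ennreal ((cmod z)\<^sup>2) \<partial>cgauss) = 1"
  "(\<integral>\<^sup>+z. ennreal ((cmod z) ^ 4) \<partial>cgauss) = 2"
proof -
  have m1: "(\<integral>\<^sup>+x. ennreal (x\<^sup>2) * ennreal (half_normal x) \<partial>lborel) = ennreal (1 / 2)"
    using nn_integral_half_normal_moment[of 1] by (simp add: fact_numeral)
  have m2: "(\<integral>\<^sup>+x. ennreal (x ^ 4) * ennreal (half_normal x) \<partial>lborel) = ennreal (3 / 4)"
    using nn_integral_half_normal_moment[of 2] by (simp add: fact_numeral)
  have r: "(\<integral>\<^sup>+z. ennreal ((Re z) ^ k) * ennreal ((Im z) ^ l) \<partial>cgauss) = (\<integral>\<^sup>+x. ennreal (x ^ k) * ennreal (half_normal x) \<partial>lborel) * (\<integral>\<^sup>+x. ennreal (x ^ l) * ennreal (half_normal x) \<partial>lborel)" for k l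
    by (rule nn_integral_cgauss_prod) auto
  have o: "(\<integral>\<^sup>+x. ennreal (x ^ 0) * ennreal (half_normal x) \<partial>lborel) = 1" by (simp add: nn_integral_half_normal)
  show a: "(\<integral>\<^sup>+z. ennreal ((Re z)\<^sup>2) \<partial>cgauss) = ennreal (1 / 2)"
    using r[of 2 0] unfolding m1 o by simp
  show b: "(\<integral>\<^sup>+z. ennreal ((Im z)\<^sup>2) \<partial>cgauss) = ennreal (1 / 2)"
    using r[of 0 2] unfolding m1 o by simp
  have "(\<integral>\<^sup>+z. ennreal ((cmod z)\<^sup>2) \<partial>cgauss) = (\<integral>\<^sup>+z. ennreal ((Re z)\<^sup>2) + ennreal ((Im z)\<^sup>2) \<partial>cgauss)"
    by (simp add: cmod_power2 flip: ennreal_plus)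
  also have "\<dots> = ennreal (1 / 2) + ennreal (1 / 2)" by (subst nn_integral_add) (auto simp: a b)
  also have "\<dots> = ennreal (1 / 2 + 1 / 2)" by (rule ennreal_plus [symmetric]) auto
  also have "\<dots> = 1" by simp
  finally show "(\<integral>\<^sup>+z. ennreal ((cmod z)\<^sup>2) \<partial>cgauss) = 1" .
  have "(\<integral>\<^sup>+z. ennreal ((cmod z) ^ 4) \<partial>cgauss) =
      (\<integral>\<^sup>+z. ennreal ((Re z) ^ 4) * ennreal ((Im z) ^ 0) + (2 * (ennreal ((Re z)\<^sup>2) * ennreal ((Im z)\<^sup>2)) + ennreal ((Re z) ^ 0) * ennreal ((Im z) ^ 4)) \<partial>cgauss)"
  proof (intro nn_integral_cong)
    fix z
    have "(cmod z) ^ 4 = ((Re z)\<^sup>2 + (Im z)\<^sup>2)\<^sup>2" by (simp flip: cmod_power2 power_mult)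
    also have "\<dots> = (Re z) ^ 4 * (Im z) ^ 0 + (2 * ((Re z)\<^sup>2 * (Im z)\<^sup>2) + (Re z) ^ 0 * (Im z) ^ 4)"
      by (simp add: power2_sum algebra_simps flip: power_mult)
    finally have e: "(cmod z) ^ 4 = (Re z) ^ 4 * (Im z) ^ 0 + (2 * ((Re z)\<^sup>2 * (Im z)\<^sup>2) + (Re z) ^ 0 * (Im z) ^ 4)" .
    have n: "0 \<le> (Re z) ^ 4 * (Im z) ^ 0" "0 \<le> 2 * ((Re z)\<^sup>2 * (Im z)\<^sup>2)" "0 \<le> (Re z) ^ 0 * (Im z) ^ 4" "0 \<le> (Re z) ^ 4" "0 \<le> (Re z)\<^sup>2" "0 \<le> (Re z) ^ 0"
      by simp_all
    have 2: "2 * (ennreal ((Re z)\<^sup>2) * ennreal ((Im z)\<^sup>2)) = ennreal (2 * ((Re z)\<^sup>2 * (Im z)\<^sup>2))"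
      by (simp only: ennreal_mult'[OF n(5)] ennreal_mult'[of 2] ennreal_numeral zero_le_numeral)
    show "ennreal ((cmod z) ^ 4) = ennreal ((Re z) ^ 4) * ennreal ((Im z) ^ 0) + (2 * (ennreal ((Re z)\<^sup>2) * ennreal ((Im z)\<^sup>2)) + ennreal ((Re z) ^ 0) * ennreal ((Im z) ^ 4))"
      unfolding e 2 ennreal_mult'[OF n(4), symmetric] ennreal_mult'[OF n(6), symmetric]
      using n by (simp only: ennreal_plus add_nonneg_nonneg)
  qed
  also have "\<dots> = ennreal (3 / 4) * 1 + (2 * (ennreal (1 / 2) * ennreal (1 / 2)) + 1 * ennreal (3 / 4))"
    by (subst nn_integral_add, simp, simp, subst nn_integral_add, simp, simp, subst nn_integral_cmult, simp)
       (simp only: r m1 m2 o)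
  also have "\<dots> = ennreal (3 / 4 + (2 * (1 / 2 * (1 / 2)) + 3 / 4))"
  proof -
    have "2 * (ennreal (1 / 2) * ennreal (1 / 2)) = ennreal 2 * ennreal (1 / 2 * (1 / 2))"
      by (subst ennreal_mult') auto
    also have "\<dots> = ennreal (2 * (1 / 2 * (1 / 2)))" by (rule ennreal_mult' [symmetric]) simp
    finally have e: "2 * (ennreal (1 / 2) * ennreal (1 / 2)) = ennreal (2 * (1 / 2 * (1 / 2)))" .
    show ?thesis unfolding e mult_1_right mult_1_left
      by (subst ennreal_plus, simp, simp, subst ennreal_plus) (simp_all add: add.assoc)
  qed
  finally show "(\<integral>\<^sup>+z. ennreal ((cmod z) ^ 4) \<partial>cgauss) = 2" by simp
qed

text \<open>A canonical model of the law as a product of coordinate laws. By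
  \<open>gauss_law_eq\<close> the given variables enter only through it, so all later estimates
  concern this one measure.\<close>

definition hermite_gauss :: "(nat \<Rightarrow> complex) measure" where
  "hermite_gauss = PiM UNIV (\<lambda>n. distr cgauss borel (\<lambda>z. z / of_real (freq n)))"

lemma sets_hermite_gauss [measurable_cong]: "sets hermite_gauss = sets (PiM UNIV (\<lambda>_. borel))"
  unfolding hermite_gauss_def by (intro sets_PiM_cong) auto

lemma space_hermite_gauss [simp]: "space hermite_gauss = UNIV"
  unfolding hermite_gauss_def by (simp add: space_PiM)

lemma scale_measurable [measurable]: "(\<lambda>z. z / of_real (freq n)) \<in> borel_measurable cgauss"
  by (subst measurable_cong_sets[OF sets_cgauss refl]) measurable

lemma prob_space_coordinate: "prob_space (distr cgauss borel (\<lambda>z. z / of_real (freq n)))"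
  by (intro prob_space.prob_space_distr prob_space_cgauss) simp

interpretation G: prob_space hermite_gauss
  unfolding hermite_gauss_def by (intro prob_space_PiM prob_space_coordinate)

lemma coordinate_measurable: "(\<lambda>u. u n) \<in> borel_measurable hermite_gauss"
  by (simp add: measurable_cong_sets[OF sets_hermite_gauss refl])

lemma distr_coordinate: "distr hermite_gauss borel (\<lambda>u. u n) = distr cgauss borel (\<lambda>z. z / of_real (freq n))"
proof -
  have "distr hermite_gauss (distr cgauss borel (\<lambda>z. z / of_real (freq n))) (\<lambda>u. u n) = distr cgauss borel (\<lambda>z. z / of_real (freq n))"
    unfolding hermite_gauss_def by (rule distr_PiM_component) (auto intro: prob_space_coordinate)
  then show ?thesis by (simp cong: distr_cong)
qed

lemma indep_coordinates: "G.indep_vars (\<lambda>_. borel) (\<lambda>n u. u n) UNIV"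
proof (subst G.indep_vars_iff_distr_eq_PiM)
  have "distr hermite_gauss (PiM UNIV (\<lambda>_. borel)) (\<lambda>x. \<lambda>i\<in>UNIV. x i) = distr hermite_gauss hermite_gauss (\<lambda>x. x)"
    by (intro distr_cong) (auto simp: sets_hermite_gauss)
  also have "\<dots> = hermite_gauss" by (rule distr_id)
  finally show "distr hermite_gauss (PiM UNIV (\<lambda>_. borel)) (\<lambda>x. \<lambda>i\<in>UNIV. x i) = PiM UNIV (\<lambda>i. distr hermite_gauss borel (\<lambda>u. u i))"
    unfolding distr_coordinate by (simp add: hermite_gauss_def)
qed auto

lemma gauss_law_eq:
  assumes "prob_space M" and "prob_space.indep_vars M (\<lambda>_. borel) g UNIV"
    and "\<And>n. std_complex_gaussian M (g n)"
  shows "gauss_law M g = hermite_gauss"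
proof -
  interpret prob_space M by fact
  have gm [measurable]: "g n \<in> borel_measurable M" for n
    using distributed_measurable[OF assms(3)[of n, unfolded std_complex_gaussian_def]] by simp
  have d: "distr M borel (g n) = cgauss" for n
    using assms(3)[of n] unfolding std_complex_gaussian_def distributed_def cgauss_def
    by (simp cong: distr_cong)
  have "indep_vars (\<lambda>_. borel) (\<lambda>n \<omega>. g n \<omega> / of_real (freq n)) UNIV"
    using indep_vars_compose2[OF assms(2), of "\<lambda>n z. z / of_real (freq n)" "\<lambda>_. borel"] by simp
  then have "distr M (PiM UNIV (\<lambda>_. borel)) (\<lambda>\<omega>. \<lambda>n\<in>UNIV. g n \<omega> / of_real (freq n)) = PiM UNIV (\<lambda>n. distr M borel (\<lambda>\<omega>. g n \<omega> / of_real (freq n)))"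
    by (subst (asm) indep_vars_iff_distr_eq_PiM) auto
  moreover have "distr M borel (\<lambda>\<omega>. g n \<omega> / of_real (freq n)) = distr cgauss borel (\<lambda>z. z / of_real (freq n))" for n
    unfolding d[of n, symmetric] by (subst distr_distr) (auto simp: comp_def)
  ultimately show ?thesis by (simp add: gauss_law_def hermite_gauss_def restrict_UNIV)
qed

lemma nn_integral_coordinate:
  "f \<in> borel_measurable borel \<Longrightarrow> (\<integral>\<^sup>+u. f (u n) \<partial>hermite_gauss) = (\<integral>\<^sup>+z. f (z / of_real (freq n)) \<partial>cgauss)"
  using nn_integral_distr[of "\<lambda>u. u n" hermite_gauss borel f] nn_integral_distr[of "\<lambda>z. z / of_real (freq n)" cgauss borel f]
  by (simp add: distr_coordinate scale_measurable)

lemma nn_integral_coordinates_prod: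
  fixes f :: "nat \<Rightarrow> complex \<Rightarrow> ennreal"
  assumes "finite I" and [measurable]: "\<And>n. f n \<in> borel_measurable borel"
  shows "(\<integral>\<^sup>+u. (\<Prod>n\<in>I. f n (u n)) \<partial>hermite_gauss) = (\<Prod>n\<in>I. \<integral>\<^sup>+z. f n (z / of_real (freq n)) \<partial>cgauss)"
proof -
  have "G.indep_vars (\<lambda>_. borel) (\<lambda>n u. f n (u n)) I"
    using G.indep_vars_compose2[OF G.indep_vars_subset[OF indep_coordinates, of I], of f "\<lambda>_. borel"] by simp
  from G.indep_vars_nn_integral[OF assms(1) this] show ?thesis
    by (simp add: nn_integral_coordinate)
qed

lemma nn_integral_exp_linear_sum:
  fixes a :: "nat \<Rightarrow> real"
  assumes "finite I"
  shows "(\<integral>\<^sup>+u. ennreal (exp (2 * Re (cnj w * (\<Sum>n\<in>I. u n * of_real (a n))))) \<partial>hermite_gauss) =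
    ennreal (exp ((cmod w)\<^sup>2 * (\<Sum>n\<in>I. (a n)\<^sup>2 / (freq n)\<^sup>2)))"
proof -
  have "ennreal (exp (2 * Re (cnj w * (\<Sum>n\<in>I. u n * of_real (a n))))) = (\<Prod>n\<in>I. ennreal (exp (2 * Re (cnj w * (u n * of_real (a n))))))" for u
    by (simp add: sum_distrib_left Re_sum exp_sum[OF assms] prod_ennreal del: Re_complex_div_gt_0)
  then have "(\<integral>\<^sup>+u. ennreal (exp (2 * Re (cnj w * (\<Sum>n\<in>I. u n * of_real (a n))))) \<partial>hermite_gauss) =
      (\<Prod>n\<in>I. \<integral>\<^sup>+z. ennreal (exp (2 * Re (cnj w * (z / of_real (freq n) * of_real (a n))))) \<partial>cgauss)"
    by (simp only:) (rule nn_integral_coordinates_prod[OF assms], measurable)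
  also have "\<dots> = (\<Prod>n\<in>I. ennreal (exp ((cmod w)\<^sup>2 * ((a n)\<^sup>2 / (freq n)\<^sup>2))))"
  proof (intro prod.cong refl)
    fix n
    have "cnj w * (z / of_real (freq n) * of_real (a n)) = cnj (of_real (a n / freq n) * w) * z" for z
      by (simp add: field_simps)
    then show "(\<integral>\<^sup>+z. ennreal (exp (2 * Re (cnj w * (z / of_real (freq n) * of_real (a n))))) \<partial>cgauss) = ennreal (exp ((cmod w)\<^sup>2 * ((a n)\<^sup>2 / (freq n)\<^sup>2)))"
      by (simp only: cgauss_mgf) (simp add: norm_mult power_mult_distrib norm_divide power_divide mult.commute)
  qed
  also have "\<dots> = ennreal (exp ((cmod w)\<^sup>2 * (\<Sum>n\<in>I. (a n)\<^sup>2 / (freq n)\<^sup>2)))"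
    by (simp add: sum_distrib_left exp_sum[OF assms] prod_ennreal)
  finally show ?thesis .
qed

interpretation GC: pair_sigma_finite hermite_gauss cgauss
  by (intro pair_sigma_finite.intro prob_space_imp_sigma_finite prob_space_cgauss G.prob_space_axioms)

interpretation GL: pair_sigma_finite hermite_gauss "lborel :: real measure"
  by (intro pair_sigma_finite.intro prob_space_imp_sigma_finite G.prob_space_axioms sigma_finite_lborel)

text \<open>Gaussian linearization: \<open>exp (s |v|\<^sup>2)\<close> is the average of \<open>exp (2 \<surd>s Re (z\<^bold>\<cdot>v))\<close> over an independent
  standard Gaussian \<open>z\<close>.\<close>

lemma nn_integral_exp_square_sum:
  fixes a :: "nat \<Rightarrow> real"
  assumes "finite I" and s: "0 \<le> s" "s * (\<Sum>n\<in>I. (a n)\<^sup>2 / (freq n)\<^sup>2) < 1"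
  shows "(\<integral>\<^sup>+u. ennreal (exp (s * (cmod (\<Sum>n\<in>I. u n * of_real (a n)))\<^sup>2)) \<partial>hermite_gauss) =
    ennreal (1 / (1 - s * (\<Sum>n\<in>I. (a n)\<^sup>2 / (freq n)\<^sup>2)))"
proof -
  have [measurable]: "cnj \<in> borel_measurable borel"
    by (intro borel_measurable_continuous_onI continuous_intros)
  define V where "V u = (\<Sum>n\<in>I. u n * complex_of_real (a n))" for u :: "nat \<Rightarrow> complex"
  have [measurable]: "V \<in> borel_measurable hermite_gauss" unfolding V_def[abs_def] by measurable
  define \<sigma> where "\<sigma> = (\<Sum>n\<in>I. (a n)\<^sup>2 / (freq n)\<^sup>2)"
  have [measurable]: "V \<in> borel_measurable (PiM UNIV (\<lambda>_. borel))" unfolding V_def[abs_def] by measurable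
  have Vm: "(\<lambda>(u, z). ennreal (exp (2 * Re (cnj (of_real (sqrt s) * V u) * z)))) \<in> borel_measurable (hermite_gauss \<Otimes>\<^sub>M cgauss)"
    by (subst measurable_cong_sets[OF sets_pair_measure_cong[OF sets_hermite_gauss sets_cgauss] refl]) measurable
  have e: "Re (cnj (of_real (sqrt s) * v) * z) = Re (cnj (of_real (sqrt s) * z) * v)" for v z
    by (simp add: algebra_simps)
  have "(\<integral>\<^sup>+u. ennreal (exp (s * (cmod (V u))\<^sup>2)) \<partial>hermite_gauss) =
      (\<integral>\<^sup>+u. \<integral>\<^sup>+z. ennreal (exp (2 * Re (cnj (of_real (sqrt s) * V u) * z))) \<partial>cgauss \<partial>hermite_gauss)"
    unfolding cgauss_mgf using s(1) by (simp add: norm_mult power_mult_distrib)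
  also have "\<dots> = (\<integral>\<^sup>+z. \<integral>\<^sup>+u. ennreal (exp (2 * Re (cnj (of_real (sqrt s) * V u) * z))) \<partial>hermite_gauss \<partial>cgauss)"
    by (rule GC.Fubini'[OF Vm, symmetric])
  also have "\<dots> = (\<integral>\<^sup>+z. ennreal (exp ((s * \<sigma>) * (cmod z)\<^sup>2)) \<partial>cgauss)"
    unfolding e V_def nn_integral_exp_linear_sum[OF assms(1)]
    using s(1) by (simp add: norm_mult power_mult_distrib \<sigma>_def mult_ac)
  also have "\<dots> = ennreal (1 / (1 - s * \<sigma>))"
    using s(2) by (intro cgauss_exp_square) (simp add: \<sigma>_def)
  finally show ?thesis unfolding V_def \<sigma>_def .
qed

text \<open>Equality holds at X = 2 r, the maximum of X^r exp (-X/2). The sharp constant matters: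
  the order of the moment is later chosen in terms of the height, and (2 r)^r exp (-r) then produces
  the Gaussian tail.\<close>

lemma powr_le_exp_half:
  fixes X r :: real
  assumes "0 \<le> X" "0 < r"
  shows "X powr r \<le> (2 * r) powr r * exp (- r) * exp (X / 2)"
proof -
  have "X / (2 * r) \<le> exp (X / (2 * r) - 1)" using exp_ge_add_one_self[of "X / (2 * r) - 1"] by simp
  then have "(X / (2 * r)) powr r \<le> exp (X / (2 * r) - 1) powr r" using assms by (intro powr_mono2) auto
  also have "\<dots> = exp (X / 2 - r)" using assms by (simp add: powr_def algebra_simps)
  finally have "(2 * r) powr r * (X / (2 * r)) powr r \<le> (2 * r) powr r * exp (X / 2 - r)"
    by (intro mult_left_mono) auto
  moreover have "exp (X / 2 - r) = exp (- r) * exp (X / 2)" by (simp add: exp_add [symmetric])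
  moreover have "(2 * r) powr r * (X / (2 * r)) powr r = X powr r"
    using assms by (simp add: powr_mult [symmetric])
  ultimately show ?thesis by (simp add: mult.assoc)
qed

text \<open>With \<sigma> the variance, the exponential moment of |V|^2 / (2 \<sigma>) equals 2,
  which is the leading factor. A vanishing \<sigma> forces the sum itself to vanish.\<close>

lemma nn_integral_powr_sum:
  fixes a :: "nat \<Rightarrow> real"
  assumes "finite I" and r: "0 < r"
  shows "(\<integral>\<^sup>+u. ennreal (cmod (\<Sum>n\<in>I. u n * of_real (a n)) powr (2 * r)) \<partial>hermite_gauss)
    \<le> ennreal (2 * (2 * r) powr r * exp (- r) * (\<Sum>n\<in>I. (a n)\<^sup>2 / (freq n)\<^sup>2) powr r)"
proof -
  define V where "V u = (\<Sum>n\<in>I. u n * complex_of_real (a n))" for u :: "nat \<Rightarrow> complex"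
  have [measurable]: "V \<in> borel_measurable hermite_gauss" unfolding V_def[abs_def] by measurable
  define \<sigma> where "\<sigma> = (\<Sum>n\<in>I. (a n)\<^sup>2 / (freq n)\<^sup>2)"
  have \<sigma>0: "\<sigma> \<ge> 0" unfolding \<sigma>_def by (intro sum_nonneg) auto
  show ?thesis
  proof (cases "\<sigma> = 0")
    case True
    then have "(a n)\<^sup>2 / (freq n)\<^sup>2 = 0" if "n \<in> I" for n
      unfolding \<sigma>_def using that assms(1) by (subst (asm) sum_nonneg_eq_0_iff) auto
    then have "V u = 0" for u unfolding V_def by (intro sum.neutral) auto
    then show ?thesis unfolding V_def [symmetric] by simp
  next
    case False
    with \<sigma>0 have \<sigma>: "\<sigma> > 0" by simp
    have "cmod (V u) powr (2 * r) \<le> (\<sigma> powr r * ((2 * r) powr r * exp (- r))) * exp (1 / (2 * \<sigma>) * (cmod (V u))\<^sup>2)" for u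
    proof -
      have "cmod (V u) powr (2 * r) = (\<sigma> * ((cmod (V u))\<^sup>2 / \<sigma>)) powr r"
        using \<sigma> by (simp add: powr_powr flip: powr_numeral)
      also have "\<dots> = \<sigma> powr r * ((cmod (V u))\<^sup>2 / \<sigma>) powr r" using \<sigma> by (subst powr_mult) auto
      also have "\<dots> \<le> \<sigma> powr r * ((2 * r) powr r * exp (- r) * exp ((cmod (V u))\<^sup>2 / \<sigma> / 2))"
        using \<sigma> r by (intro mult_left_mono powr_le_exp_half) auto
      finally show ?thesis by (simp add: mult_ac)
    qed
    then have "(\<integral>\<^sup>+u. ennreal (cmod (V u) powr (2 * r)) \<partial>hermite_gauss) \<le>
      (\<integral>\<^sup>+u. ennreal (\<sigma> powr r * ((2 * r) powr r * exp (- r))) * ennreal (exp (1 / (2 * \<sigma>) * (cmod (V u))\<^sup>2)) \<partial>hermite_gauss)"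
      by (intro nn_integral_mono) (simp add: ennreal_mult' [symmetric] ennreal_leI)
    also have "\<dots> = ennreal (\<sigma> powr r * ((2 * r) powr r * exp (- r))) * (\<integral>\<^sup>+u. ennreal (exp (1 / (2 * \<sigma>) * (cmod (V u))\<^sup>2)) \<partial>hermite_gauss)"
      by (rule nn_integral_cmult) measurable
    also have "(\<integral>\<^sup>+u. ennreal (exp (1 / (2 * \<sigma>) * (cmod (V u))\<^sup>2)) \<partial>hermite_gauss) = ennreal (1 / (1 - 1 / (2 * \<sigma>) * \<sigma>))"
      unfolding V_def \<sigma>_def by (rule nn_integral_exp_square_sum[OF assms(1)]) (use \<sigma> in \<open>auto simp: \<sigma>_def [symmetric]\<close>)
    also have "1 / (1 - 1 / (2 * \<sigma>) * \<sigma>) = 2" using \<sigma> by simp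
    also have "ennreal (\<sigma> powr r * ((2 * r) powr r * exp (- r))) * ennreal 2 = ennreal (2 * (2 * r) powr r * exp (- r) * \<sigma> powr r)"
      by (subst ennreal_mult' [symmetric]) (auto simp: mult_ac)
    finally show ?thesis unfolding V_def \<sigma>_def .
  qed
qed

section \<open>Random fields on sets of modes and their L^p mass\<close>

definition hermite_field :: "nat set \<Rightarrow> (nat \<Rightarrow> complex) \<Rightarrow> real \<Rightarrow> complex" where
  "hermite_field I u x = (\<Sum>n\<in>I. u n * of_real (hermite_fun n x))"

lemma proj_eq: "proj N u = hermite_field {0..N} u"
  by (simp add: proj_def hermite_field_def fun_eq_iff)

lemma hermite_field_measurable_pair [measurable]:
  "(\<lambda>(u, x). hermite_field I u x) \<in> borel_measurable (hermite_gauss \<Otimes>\<^sub>M lborel)"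
proof -
  have [measurable]: "(\<lambda>p. hermite_fun n (snd p)) \<in> borel_measurable (hermite_gauss \<Otimes>\<^sub>M lborel)" for n
    using hermite_fun_measurable[of n] by measurable
  have [measurable]: "(\<lambda>p. fst p n) \<in> borel_measurable (hermite_gauss \<Otimes>\<^sub>M lborel)" for n
    using measurable_compose[OF measurable_fst coordinate_measurable] .
  show ?thesis unfolding hermite_field_def case_prod_beta by measurable
qed

lemma hermite_field_measurable [measurable]: "hermite_field I u \<in> borel_measurable borel"
  unfolding hermite_field_def[abs_def] by measurable

lemma nn_integral_powr_field:
  assumes "finite I" and "0 < r"
  shows "(\<integral>\<^sup>+u. ennreal (cmod (hermite_field I u x) powr (2 * r)) \<partial>hermite_gauss)
    \<le> ennreal (2 * (2 * r) powr r * exp (- r) * green_diag I x powr r)"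
  using nn_integral_powr_sum[OF assms, of "\<lambda>n. hermite_fun n x"] unfolding hermite_field_def green_diag_def .

definition Lp_mass :: "real \<Rightarrow> nat set \<Rightarrow> (nat \<Rightarrow> complex) \<Rightarrow> ennreal" where
  "Lp_mass p I u = (\<integral>\<^sup>+x. ennreal (cmod (hermite_field I u x) powr p) \<partial>lborel)"

lemma Lp_mass_measurable [measurable]: "Lp_mass p I \<in> borel_measurable hermite_gauss"
  unfolding Lp_mass_def[abs_def] by measurable

text \<open>Convexity: a power lies above its tangent at \<alpha>. The case m = 1 is separate
  because the conjugate exponent would be infinite.\<close>

lemma powr_tangent:
  fixes B \<alpha> m :: real
  assumes "0 \<le> B" "0 < \<alpha>" "1 \<le> m"
  shows "m * \<alpha> powr (m - 1) * B \<le> B powr m + (m - 1) * \<alpha> powr m"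
proof (cases "m = 1")
  case False
  define q where "q = m / (m - 1)"
  have q: "q > 1" "1 / m + 1 / q = 1" using False assms by (auto simp: q_def field_simps)
  have "B * \<alpha> powr (m - 1) \<le> B powr m / m + (\<alpha> powr (m - 1)) powr q / q"
    using q False assms by (intro Youngs_inequality) auto
  also have "(\<alpha> powr (m - 1)) powr q / q = \<alpha> powr m * ((m - 1) / m)"
    using False assms by (simp add: powr_powr q_def)
  finally have "m * (B * \<alpha> powr (m - 1)) \<le> m * (B powr m / m + \<alpha> powr m * ((m - 1) / m))"
    using assms by (intro mult_left_mono) auto
  also have "\<dots> = B powr m + (m - 1) * \<alpha> powr m" using assms by (simp add: distrib_left)
  finally show ?thesis by (simp add: mult_ac)
qed (use assms in simp)

text \<open>Jensen's inequality, in the form of the tangent inequality above, reduces high moments of the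
  \<open>L\<^sup>q\<close> norm to those of the pointwise values; the order of the moment is then optimized.\<close>

lemma Lp_mass_tail:
  assumes I: "finite I" and q: "0 < q" and S: "0 < S"
    and le: "(\<integral>\<^sup>+x. ennreal (green_diag I x powr (q / 2)) \<partial>lborel) \<le> ennreal S" and y: "0 < y"
  shows "emeasure hermite_gauss {u. ennreal y \<le> Lp_mass q I u} \<le> ennreal (2 * exp (q / 2) * exp (- ((y / S) powr (2 / q)) / 2))"
proof (cases "(y / S) powr (2 / q) \<le> q")
  case True
  \<comment> \<open>For small y the prefactor makes the claimed bound at least 1.\<close>
  then have "1 \<le> exp (q / 2) * exp (- ((y / S) powr (2 / q)) / 2)"
    by (simp add: exp_add [symmetric] del: powr_divide)
  then have "ennreal 1 \<le> ennreal (2 * exp (q / 2) * exp (- ((y / S) powr (2 / q)) / 2))"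
    by (intro ennreal_leI) auto
  then show ?thesis using G.emeasure_le_1[of "{u. ennreal y \<le> Lp_mass q I u}"] unfolding ennreal_1 by (rule order_trans[rotated])
next
  case False
  define b where "b = (y / S) powr (2 / q)"
  \<comment> \<open>The moment has order 2 r, chosen so that \<alpha>^m = (2 r)^r; Markov's
    inequality then leaves exactly 2 exp (-r). The case b > q ensures m \<ge> 1.\<close>
  define r where "r = b / 2"
  define m where "m = 2 * r / q"
  define \<alpha> where "\<alpha> = y / S"
  have b: "b > q" using False by (simp add: b_def)
  have r: "r > 0" "r > q / 2" using b q by (auto simp: r_def)
  have m: "m \<ge> 1" using r q by (auto simp: m_def field_simps)
  have mr: "q / 2 * m = r" using q by (simp add: m_def)
  have \<alpha>: "\<alpha> > 0" using y S by (simp add: \<alpha>_def)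
  have \<alpha>m: "\<alpha> powr m = (2 * r) powr r"
  proof -
    have "b powr (q / 2) = (y / S) powr 1" using q unfolding b_def powr_powr by simp
    then have "\<alpha> = b powr (q / 2)" using y S by (simp add: \<alpha>_def del: powr_divide)
    then show ?thesis using mr by (simp add: powr_powr r_def)
  qed
  \<comment> \<open>Jensen is applied with respect to the measure \<open>green_diag\<close>^(q/2)
    dx, of mass at most S. Relative to it the integrand is |w|^q / \<open>green_diag\<close>^(q/2),
    whence the negative power q/2 - r. Where the diagonal vanishes, so does the field.\<close>
  define \<Phi> where "\<Phi> u = (\<integral>\<^sup>+x. ennreal (cmod (hermite_field I u x) powr (2 * r)) * ennreal (green_diag I x powr (q / 2 - r)) \<partial>lborel)" for u
  have \<Phi>m [measurable]: "\<Phi> \<in> borel_measurable hermite_gauss" unfolding \<Phi>_def[abs_def] by measurable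
  have pt: "m * \<alpha> powr (m - 1) * cmod (hermite_field I u x) powr q \<le>
     cmod (hermite_field I u x) powr (2 * r) * green_diag I x powr (q / 2 - r) + (m - 1) * \<alpha> powr m * green_diag I x powr (q / 2)" for u x
  proof (cases "green_diag I x = 0")
    case True
    then have "(hermite_fun n x)\<^sup>2 / (freq n)\<^sup>2 = 0" if "n \<in> I" for n
      unfolding green_diag_def using that I by (subst (asm) sum_nonneg_eq_0_iff) auto
    then have "hermite_field I u x = 0" unfolding hermite_field_def by (intro sum.neutral) auto
    then show ?thesis using True by simp
  next
    case False
    then have g: "green_diag I x > 0" using green_diag_nonneg[of I x] by simp
    let ?w = "cmod (hermite_field I u x)" and ?g = "green_diag I x"
    define B where "B = ?w powr q / ?g powr (q / 2)"
    have "m * \<alpha> powr (m - 1) * B \<le> B powr m + (m - 1) * \<alpha> powr m"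
      by (rule powr_tangent) (use \<alpha> m in \<open>auto simp: B_def\<close>)
    then have "(m * \<alpha> powr (m - 1) * B) * ?g powr (q / 2) \<le> (B powr m + (m - 1) * \<alpha> powr m) * ?g powr (q / 2)"
      by (rule mult_right_mono) simp
    moreover have "B * ?g powr (q / 2) = ?w powr q" using g by (simp add: B_def)
    moreover have "B powr m * ?g powr (q / 2) = ?w powr (2 * r) * ?g powr (q / 2 - r)"
    proof -
      have "B powr m = ?w powr (q * m) / ?g powr (q / 2 * m)" unfolding B_def by (simp add: powr_divide powr_powr)
      also have "q * m = 2 * r" using mr by simp
      finally show ?thesis unfolding mr using g by (simp add: powr_diff)
    qed
    ultimately show ?thesis by (simp only: mult.assoc distrib_right)
  qed
  have key: "ennreal (m * \<alpha> powr (m - 1)) * Lp_mass q I u \<le> \<Phi> u + ennreal ((m - 1) * \<alpha> powr m * S)" for u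
  proof -
    have "ennreal (m * \<alpha> powr (m - 1)) * Lp_mass q I u = (\<integral>\<^sup>+x. ennreal (m * \<alpha> powr (m - 1) * cmod (hermite_field I u x) powr q) \<partial>lborel)"
      unfolding Lp_mass_def using m by (subst nn_integral_cmult [symmetric]) (auto simp: ennreal_mult')
    also have "\<dots> \<le> (\<integral>\<^sup>+x. ennreal (cmod (hermite_field I u x) powr (2 * r)) * ennreal (green_diag I x powr (q / 2 - r)) + ennreal ((m - 1) * \<alpha> powr m) * ennreal (green_diag I x powr (q / 2)) \<partial>lborel)"
      using pt m by (intro nn_integral_mono) (simp add: ennreal_mult' [symmetric] ennreal_leI flip: ennreal_plus)
    also have "\<dots> = \<Phi> u + ennreal ((m - 1) * \<alpha> powr m) * (\<integral>\<^sup>+x. ennreal (green_diag I x powr (q / 2)) \<partial>lborel)"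
      unfolding \<Phi>_def by (subst nn_integral_add) (auto simp: nn_integral_cmult)
    also have "\<dots> \<le> \<Phi> u + ennreal ((m - 1) * \<alpha> powr m) * ennreal S"
      by (intro add_left_mono mult_left_mono le) auto
    finally show ?thesis using S m by (simp add: ennreal_mult')
  qed
  have ev: "ennreal (\<alpha> powr m * S) \<le> \<Phi> u" if "ennreal y \<le> Lp_mass q I u" for u
  proof -
    have "\<alpha> powr (m - 1) * y = \<alpha> powr m * S" using \<alpha> S y
      by (simp add: powr_diff \<alpha>_def)
    then have "ennreal (\<alpha> powr m * S) + ennreal ((m - 1) * \<alpha> powr m * S) = ennreal (m * \<alpha> powr (m - 1) * y)"
      using m S mult_right_mono[OF m, of "\<alpha> powr m"] by (subst ennreal_plus [symmetric]) (auto simp: algebra_simps)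
    also have "\<dots> = ennreal (m * \<alpha> powr (m - 1)) * ennreal y" using y by (simp add: ennreal_mult'')
    also have "\<dots> \<le> ennreal (m * \<alpha> powr (m - 1)) * Lp_mass q I u" using that by (intro mult_left_mono) auto
    also note key
    finally have "ennreal ((m - 1) * \<alpha> powr m * S) + ennreal (\<alpha> powr m * S) \<le> ennreal ((m - 1) * \<alpha> powr m * S) + \<Phi> u"
      by (simp only: add.commute)
    then show ?thesis by (simp add: ennreal_add_left_cancel_le)
  qed
  have E\<Phi>: "(\<integral>\<^sup>+u. \<Phi> u \<partial>hermite_gauss) \<le> ennreal (2 * (2 * r) powr r * exp (- r) * S)"
  proof -
    have "(\<integral>\<^sup>+u. \<Phi> u \<partial>hermite_gauss) = (\<integral>\<^sup>+x. \<integral>\<^sup>+u. ennreal (cmod (hermite_field I u x) powr (2 * r)) * ennreal (green_diag I x powr (q / 2 - r)) \<partial>hermite_gauss \<partial>lborel)"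
      unfolding \<Phi>_def by (rule GL.Fubini'[symmetric]) measurable
    also have "\<dots> = (\<integral>\<^sup>+x. (\<integral>\<^sup>+u. ennreal (cmod (hermite_field I u x) powr (2 * r)) \<partial>hermite_gauss) * ennreal (green_diag I x powr (q / 2 - r)) \<partial>lborel)"
      by (intro nn_integral_cong nn_integral_multc) measurable
    also have "\<dots> \<le> (\<integral>\<^sup>+x. ennreal (2 * (2 * r) powr r * exp (- r) * green_diag I x powr r) * ennreal (green_diag I x powr (q / 2 - r)) \<partial>lborel)"
      by (intro nn_integral_mono mult_right_mono nn_integral_powr_field I r) auto
    also have "\<dots> = (\<integral>\<^sup>+x. ennreal (2 * (2 * r) powr r * exp (- r)) * ennreal (green_diag I x powr (q / 2)) \<partial>lborel)"
      by (intro nn_integral_cong) (simp add: ennreal_mult' [symmetric] powr_add [symmetric] mult.assoc)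
    also have "\<dots> = ennreal (2 * (2 * r) powr r * exp (- r)) * (\<integral>\<^sup>+x. ennreal (green_diag I x powr (q / 2)) \<partial>lborel)"
      by (rule nn_integral_cmult) measurable
    also have "\<dots> \<le> ennreal (2 * (2 * r) powr r * exp (- r)) * ennreal S"
      by (intro mult_left_mono le) auto
    finally show ?thesis using S by (simp add: ennreal_mult')
  qed
  let ?A = "{u. ennreal y \<le> Lp_mass q I u}"
  have [measurable]: "?A \<in> sets hermite_gauss"
  proof -
    have "{u \<in> space hermite_gauss. ennreal y \<le> Lp_mass q I u} \<in> sets hermite_gauss" by measurable
    then show ?thesis by simp
  qed
  have "ennreal (\<alpha> powr m * S) * emeasure hermite_gauss ?A = (\<integral>\<^sup>+u. ennreal (\<alpha> powr m * S) * indicator ?A u \<partial>hermite_gauss)"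
    by (simp add: nn_integral_cmult_indicator)
  also have "\<dots> \<le> (\<integral>\<^sup>+u. \<Phi> u \<partial>hermite_gauss)"
    by (intro nn_integral_mono) (use ev in \<open>auto simp: indicator_def\<close>)
  also note E\<Phi>
  also have "2 * (2 * r) powr r * exp (- r) * S = (\<alpha> powr m * S) * (2 * exp (- r))" unfolding \<alpha>m by simp
  also have "ennreal \<dots> = ennreal (\<alpha> powr m * S) * ennreal (2 * exp (- r))" using S \<alpha> by (subst ennreal_mult') auto
  finally have "emeasure hermite_gauss ?A \<le> ennreal (2 * exp (- r))"
    using S \<alpha> by (subst (asm) ennreal_mult_le_mult_iff) auto
  also have "\<dots> \<le> ennreal (2 * exp (q / 2) * exp (- b / 2))"
    using q by (intro ennreal_leI) (auto simp: r_def)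
  finally show ?thesis by (simp add: b_def)
qed

definition wick :: "nat set \<Rightarrow> (nat \<Rightarrow> complex) \<Rightarrow> real" where
  "wick I u = (\<Sum>n\<in>I. (cmod (u n))\<^sup>2 - 1 / (freq n)\<^sup>2)"

lemma wick_measurable [measurable]: "wick I \<in> borel_measurable hermite_gauss"
  unfolding wick_def[abs_def] by measurable

text \<open>The left-hand side is the expectation of exp (y (1 - |z|^2)) for a standard complex
  Gaussian z, so this is a sub-Gaussian bound for the lower deviations of one mode.\<close>

lemma exp_div_one_plus_le: assumes "0 \<le> (y::real)" shows "exp y / (1 + y) \<le> exp (y\<^sup>2)"
proof -
  have "y - y\<^sup>2 \<le> ln (1 + y)"
  proof (cases "y \<le> 1")
    case False
    then have "y * 1 \<le> y * y" by (intro mult_left_mono) auto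
    moreover have "0 \<le> ln (1 + y)" using assms by simp
    ultimately show ?thesis by (simp add: power2_eq_square)
  qed (use assms ln_one_plus_pos_lower_bound in auto)
  then have "exp (y - y\<^sup>2) \<le> exp (ln (1 + y))" by simp
  also have "\<dots> = 1 + y" using assms by simp
  finally show ?thesis using assms by (simp add: exp_diff field_simps)
qed

text \<open>Telescoping with 2 / (1 + 2 n) - 2 / (3 + 2 n). The sum is the variance of the
  renormalized mass, so the modes from m on fluctuate by at most the order of 1 / freq m.\<close>

lemma sum_freq_pow4_le:
  assumes "finite I" "I \<subseteq> {m..}"
  shows "(\<Sum>n\<in>I. 1 / (freq n) ^ 4) \<le> 2 / (freq m)\<^sup>2"
proof -
  have step: "1 / (freq n) ^ 4 \<le> 2 / (1 + 2 * real n) - 2 / (1 + 2 * real (Suc n))" for n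
  proof -
    have "(freq n) ^ 4 = (1 + 2 * real n)\<^sup>2" by (simp add: freq_power2 [symmetric] flip: power_mult)
    moreover have "2 / (1 + 2 * real n) - 2 / (1 + 2 * real (Suc n)) = 4 / ((1 + 2 * real n) * (3 + 2 * real n))"
      by (simp add: field_simps)
    moreover have "1 / (1 + 2 * real n)\<^sup>2 \<le> 4 / ((1 + 2 * real n) * (3 + 2 * real n))"
      by (simp add: power2_eq_square divide_simps)
    ultimately show ?thesis by simp
  qed
  obtain k where k: "I \<subseteq> {m..<k + m}"
  proof -
    obtain K where "I \<subseteq> {..<K}" using finite_nat_bounded[OF assms(1)] by blast
    then show thesis using assms(2) by (intro that[of K]) fastforce
  qed
  have "(\<Sum>n\<in>I. 1 / (freq n) ^ 4) \<le> (\<Sum>n\<in>{m..<k + m}. 1 / (freq n) ^ 4)"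
    using k by (intro sum_mono2) auto
  also have "\<dots> \<le> (\<Sum>n\<in>{m..<k + m}. 2 / (1 + 2 * real n) - 2 / (1 + 2 * real (Suc n)))"
    by (intro sum_mono step)
  also have "\<dots> = 2 / (1 + 2 * real m) - 2 / (1 + 2 * real (k + m))"
    by (induction k) (auto simp: algebra_simps)
  also have "\<dots> \<le> 2 / (freq m)\<^sup>2" by (simp add: freq_power2)
  finally show ?thesis .
qed

text \<open>Chernoff's bound at t = (freq m)^2: by \<open>sum_freq_pow4_le\<close> the Laplace
  transform is at most exp (2 t), and the threshold 3 leaves exp (-t). Every t > 0 is admissible
  because the summands are bounded below.\<close>

lemma wick_lower_tail:
  assumes "finite I" "I \<subseteq> {m..}"
  shows "emeasure hermite_gauss {u. wick I u \<le> - 3} \<le> ennreal (exp (- (freq m)\<^sup>2))"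
proof -
  define t where "t = (freq m)\<^sup>2"
  have t: "t > 0" by (simp add: t_def)
  let ?A = "{u. wick I u \<le> - 3}"
  have [measurable]: "?A \<in> sets hermite_gauss"
  proof -
    have "{u \<in> space hermite_gauss. wick I u \<le> - 3} \<in> sets hermite_gauss" by measurable
    then show ?thesis by simp
  qed
  have e1: "(\<integral>\<^sup>+z. ennreal (exp (- t * ((cmod (z / of_real (freq n)))\<^sup>2 - 1 / (freq n)\<^sup>2))) \<partial>cgauss) \<le> ennreal (exp (t\<^sup>2 * (1 / freq n ^ 4)))" for n
  proof -
    define y where "y = t / (freq n)\<^sup>2"
    have y: "y \<ge> 0" using t by (simp add: y_def)
    have "exp (- t * ((cmod (z / of_real (freq n)))\<^sup>2 - 1 / (freq n)\<^sup>2)) = exp y * exp ((- y) * (cmod z)\<^sup>2)" for z :: complex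
      by (simp add: y_def norm_divide power_divide exp_add [symmetric] algebra_simps)
    then have "(\<integral>\<^sup>+z. ennreal (exp (- t * ((cmod (z / of_real (freq n)))\<^sup>2 - 1 / (freq n)\<^sup>2))) \<partial>cgauss) = ennreal (exp y) * (\<integral>\<^sup>+z. ennreal (exp ((- y) * (cmod z)\<^sup>2)) \<partial>cgauss)"
      by (subst nn_integral_cmult [symmetric], measurable) (auto simp: ennreal_mult')
    also have "\<dots> = ennreal (exp y) * ennreal (1 / (1 - (- y)))" using y by (subst cgauss_exp_square) auto
    also have "\<dots> = ennreal (exp y / (1 + y))" by (subst ennreal_mult' [symmetric]) auto
    also have "\<dots> \<le> ennreal (exp (y\<^sup>2))" by (intro ennreal_leI exp_div_one_plus_le y)
    also have "y\<^sup>2 = t\<^sup>2 * (1 / freq n ^ 4)" by (simp add: y_def power_divide flip: power_mult)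
    finally show ?thesis .
  qed
  have "ennreal (exp (3 * t)) * emeasure hermite_gauss ?A = (\<integral>\<^sup>+u. ennreal (exp (3 * t)) * indicator ?A u \<partial>hermite_gauss)"
    by (simp add: nn_integral_cmult_indicator)
  also have "\<dots> \<le> (\<integral>\<^sup>+u. ennreal (exp (- t * wick I u)) \<partial>hermite_gauss)"
  proof (intro nn_integral_mono)
    fix u
    have "exp (3 * t) \<le> exp (- t * wick I u)" if "wick I u \<le> - 3"
    proof -
      have "3 * t \<le> (- wick I u) * t" using that t by (intro mult_right_mono) auto
      then show ?thesis by (simp add: mult.commute)
    qed
    then show "ennreal (exp (3 * t)) * indicator ?A u \<le> ennreal (exp (- t * wick I u))"
      by (auto simp: indicator_def intro!: ennreal_leI)
  qed
  also have "\<dots> = (\<integral>\<^sup>+u. (\<Prod>n\<in>I. ennreal (exp (- t * ((cmod (u n))\<^sup>2 - 1 / (freq n)\<^sup>2)))) \<partial>hermite_gauss)"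
    unfolding wick_def sum_distrib_left exp_sum[OF assms(1)] by (simp add: prod_ennreal)
  also have "\<dots> = (\<Prod>n\<in>I. \<integral>\<^sup>+z. ennreal (exp (- t * ((cmod (z / of_real (freq n)))\<^sup>2 - 1 / (freq n)\<^sup>2))) \<partial>cgauss)"
    by (rule nn_integral_coordinates_prod[OF assms(1)]) measurable
  also have "\<dots> \<le> (\<Prod>n\<in>I. ennreal (exp (t\<^sup>2 * (1 / freq n ^ 4))))"
    by (intro prod_mono_ennreal e1)
  also have "\<dots> = ennreal (exp (t\<^sup>2 * (\<Sum>n\<in>I. 1 / freq n ^ 4)))"
    unfolding sum_distrib_left exp_sum[OF assms(1)] by (simp add: prod_ennreal)
  also have "\<dots> \<le> ennreal (exp (2 * t))"
  proof -
    have "t\<^sup>2 * (\<Sum>n\<in>I. 1 / freq n ^ 4) \<le> t\<^sup>2 * (2 / t)"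
      using sum_freq_pow4_le[OF assms] by (intro mult_left_mono) (auto simp: t_def)
    also have "\<dots> = 2 * t" using t by (simp add: power2_eq_square)
    finally show ?thesis by (intro ennreal_leI) simp
  qed
  also have "\<dots> = ennreal (exp (3 * t)) * ennreal (exp (- t))"
    by (simp add: ennreal_mult' [symmetric] exp_add [symmetric])
  finally show ?thesis unfolding t_def [symmetric] by (subst (asm) ennreal_mult_le_mult_iff) auto
qed

section \<open>Second moments of the mass and of linear functionals\<close>

lemma cgauss_uminus:
  fixes f :: "complex \<Rightarrow> real"
  assumes [measurable]: "f \<in> borel_measurable borel" and odd: "\<And>z. f (- z) = - f z"
  shows "(\<integral>z. f z \<partial>cgauss) = 0"
proof -
  have d: "(\<integral>z. f z \<partial>cgauss) = (\<integral>z. (exp (- (cmod z)\<^sup>2) / pi) *\<^sub>R f z \<partial>lborel)"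
    unfolding cgauss_def by (rule integral_density) auto
  have "(lborel :: complex measure) = distr lborel borel (\<lambda>x. - x)"
    using lborel_affine[of "-1" "0 :: complex"] by (simp add: density_1)
  then have "(\<integral>z. (exp (- (cmod z)\<^sup>2) / pi) *\<^sub>R f z \<partial>lborel) = (\<integral>z. (exp (- (cmod z)\<^sup>2) / pi) *\<^sub>R f z \<partial>(distr lborel borel (\<lambda>x. - x)))"
    by (rule arg_cong)
  also have "\<dots> = (\<integral>z. (exp (- (cmod (- z))\<^sup>2) / pi) *\<^sub>R f (- z) \<partial>lborel)"
    by (rule integral_distr) auto
  also have "\<dots> = - (\<integral>z. (exp (- (cmod z)\<^sup>2) / pi) *\<^sub>R f z \<partial>lborel)"
    unfolding odd by (simp del: Bochner_Integration.integral_mult_right_zero integral_divide_zero integral_mult_left_zero times_divide_eq_left)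
  finally show ?thesis unfolding d by simp
qed

lemma nn_integral_coordinate_real:
  fixes f :: "complex \<Rightarrow> real"
  assumes [measurable]: "f \<in> borel_measurable borel"
  shows "integrable hermite_gauss (\<lambda>u. f (u n)) \<longleftrightarrow> integrable cgauss (\<lambda>z. f (z / of_real (freq n)))"
    and "(\<integral>u. f (u n) \<partial>hermite_gauss) = (\<integral>z. f (z / of_real (freq n)) \<partial>cgauss)"
proof -
  have "integrable (distr hermite_gauss borel (\<lambda>u. u n)) f \<longleftrightarrow> integrable (distr cgauss borel (\<lambda>z. z / of_real (freq n))) f"
    by (simp only: distr_coordinate)
  then show "integrable hermite_gauss (\<lambda>u. f (u n)) \<longleftrightarrow> integrable cgauss (\<lambda>z. f (z / of_real (freq n)))"
    by (subst (asm) integrable_distr_eq, simp_all add: coordinate_measurable)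
       (subst (asm) integrable_distr_eq, simp_all add: scale_measurable)
  have "(\<integral>z. f z \<partial>(distr hermite_gauss borel (\<lambda>u. u n))) = (\<integral>z. f z \<partial>(distr cgauss borel (\<lambda>z. z / of_real (freq n))))"
    by (simp only: distr_coordinate)
  then show "(\<integral>u. f (u n) \<partial>hermite_gauss) = (\<integral>z. f (z / of_real (freq n)) \<partial>cgauss)"
    by (subst (asm) integral_distr, simp_all add: coordinate_measurable)
       (subst (asm) integral_distr, simp_all add: scale_measurable)
qed

lemma integral_square_indep_sum:
  fixes f :: "nat \<Rightarrow> complex \<Rightarrow> real"
  assumes I: "finite I" and fm [measurable]: "\<And>n. f n \<in> borel_measurable borel"
    and zero: "\<And>n. (\<integral>u. f n (u n) \<partial>hermite_gauss) = 0"
    and sq: "\<And>n. integrable hermite_gauss (\<lambda>u. (f n (u n))\<^sup>2)"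
  shows "integrable hermite_gauss (\<lambda>u. (\<Sum>n\<in>I. f n (u n))\<^sup>2)"
    and "(\<integral>u. (\<Sum>n\<in>I. f n (u n))\<^sup>2 \<partial>hermite_gauss) = (\<Sum>n\<in>I. \<integral>u. (f n (u n))\<^sup>2 \<partial>hermite_gauss)"
proof -
  have [measurable]: "(\<lambda>u. f n (u n)) \<in> borel_measurable hermite_gauss" for n
    by (rule measurable_compose[OF coordinate_measurable fm])
  have int: "integrable hermite_gauss (\<lambda>u. f n (u n))" for n
    by (rule G.square_integrable_imp_integrable[OF _ sq]) measurable
  have prod: "integrable hermite_gauss (\<lambda>u. f n (u n) * f m (u m))"
     "(\<integral>u. f n (u n) * f m (u m) \<partial>hermite_gauss) = (if n = m then \<integral>u. (f n (u n))\<^sup>2 \<partial>hermite_gauss else 0)" for n m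
  proof -
    have "integrable hermite_gauss (\<lambda>u. f n (u n) * f m (u m)) \<and>
      (\<integral>u. f n (u n) * f m (u m) \<partial>hermite_gauss) = (if n = m then \<integral>u. (f n (u n))\<^sup>2 \<partial>hermite_gauss else 0)"
    proof (cases "n = m")
      case True then show ?thesis using sq[of n] by (simp add: power2_eq_square)
    next
      case False
      have iv: "G.indep_vars (\<lambda>_. borel) (\<lambda>n u. f n (u n)) {n, m}"
        using G.indep_vars_compose2[OF G.indep_vars_subset[OF indep_coordinates, of "{n, m}"], of f "\<lambda>_. borel"] by simp
      have "integrable hermite_gauss (\<lambda>u. \<Prod>i\<in>{n, m}. f i (u i))"
        by (rule G.indep_vars_integrable[OF _ iv]) (auto intro: int)
      moreover have "(\<integral>u. (\<Prod>i\<in>{n, m}. f i (u i)) \<partial>hermite_gauss) = (\<Prod>i\<in>{n, m}. \<integral>u. f i (u i) \<partial>hermite_gauss)"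
        by (rule G.indep_vars_lebesgue_integral[OF _ iv]) (auto intro: int)
      ultimately show ?thesis using False zero by simp
    qed
    then show "integrable hermite_gauss (\<lambda>u. f n (u n) * f m (u m))"
     "(\<integral>u. f n (u n) * f m (u m) \<partial>hermite_gauss) = (if n = m then \<integral>u. (f n (u n))\<^sup>2 \<partial>hermite_gauss else 0)" by auto
  qed
  have e: "(\<Sum>n\<in>I. f n (u n))\<^sup>2 = (\<Sum>n\<in>I. \<Sum>m\<in>I. f n (u n) * f m (u m))" for u
    by (simp add: power2_eq_square sum_product)
  show "integrable hermite_gauss (\<lambda>u. (\<Sum>n\<in>I. f n (u n))\<^sup>2)"
    unfolding e by (intro Bochner_Integration.integrable_sum prod)
  have "(\<integral>u. (\<Sum>n\<in>I. f n (u n))\<^sup>2 \<partial>hermite_gauss) = (\<Sum>n\<in>I. \<Sum>m\<in>I. \<integral>u. f n (u n) * f m (u m) \<partial>hermite_gauss)"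
    unfolding e by (simp add: Bochner_Integration.integral_sum Bochner_Integration.integrable_sum prod(1))
  also have "\<dots> = (\<Sum>n\<in>I. \<integral>u. (f n (u n))\<^sup>2 \<partial>hermite_gauss)"
    unfolding prod(2) using I by simp
  finally show "(\<integral>u. (\<Sum>n\<in>I. f n (u n))\<^sup>2 \<partial>hermite_gauss) = (\<Sum>n\<in>I. \<integral>u. (f n (u n))\<^sup>2 \<partial>hermite_gauss)" .
qed

lemma cgauss_has_integral:
  "has_bochner_integral cgauss (\<lambda>z. (Re z)\<^sup>2) (1 / 2)"
  "has_bochner_integral cgauss (\<lambda>z. (Im z)\<^sup>2) (1 / 2)"
  "has_bochner_integral cgauss (\<lambda>z. (cmod z)\<^sup>2) 1"
  "has_bochner_integral cgauss (\<lambda>z. ((cmod z)\<^sup>2 - 1)\<^sup>2) 1"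
proof -
  have m: "f \<in> borel_measurable borel \<Longrightarrow> f \<in> borel_measurable cgauss" for f :: "complex \<Rightarrow> real"
    by (simp add: measurable_cong_sets[OF sets_cgauss refl])
  show "has_bochner_integral cgauss (\<lambda>z. (Re z)\<^sup>2) (1 / 2)" "has_bochner_integral cgauss (\<lambda>z. (Im z)\<^sup>2) (1 / 2)"
    "has_bochner_integral cgauss (\<lambda>z. (cmod z)\<^sup>2) 1"
    using cgauss_moments by (intro has_bochner_integral_nn_integral m; simp)+
  then have h: "has_bochner_integral cgauss (\<lambda>z. (cmod z)\<^sup>2) 1" by blast
  have h4: "has_bochner_integral cgauss (\<lambda>z. (cmod z) ^ 4) 2"
    using cgauss_moments by (intro has_bochner_integral_nn_integral m) simp_all
  interpret prob_space cgauss by (rule prob_space_cgauss)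
  have "has_bochner_integral cgauss (\<lambda>z. 1 :: real) 1"
    using prob_space by (simp add: has_bochner_integral_iff)
  from has_bochner_integral_add[OF has_bochner_integral_diff[OF h4 has_bochner_integral_mult_right[OF h, of 2]] this]
  have "has_bochner_integral cgauss (\<lambda>z. (cmod z) ^ 4 - 2 * (cmod z)\<^sup>2 + 1) 1" by simp
  moreover have "(cmod z) ^ 4 - 2 * (cmod z)\<^sup>2 + 1 = ((cmod z)\<^sup>2 - 1)\<^sup>2" for z
    by (simp add: power2_diff flip: power_mult)
  ultimately show "has_bochner_integral cgauss (\<lambda>z. ((cmod z)\<^sup>2 - 1)\<^sup>2) 1" by simp
qed

lemma coordinate_moments:
  "integrable hermite_gauss (\<lambda>u. (c * Re (u n))\<^sup>2)"
  "(\<integral>u. (c * Re (u n))\<^sup>2 \<partial>hermite_gauss) = c\<^sup>2 / (2 * (freq n)\<^sup>2)"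
  "(\<integral>u. c * Re (u n) \<partial>hermite_gauss) = 0"
  "integrable hermite_gauss (\<lambda>u. (c * Im (u n))\<^sup>2)"
  "(\<integral>u. (c * Im (u n))\<^sup>2 \<partial>hermite_gauss) = c\<^sup>2 / (2 * (freq n)\<^sup>2)"
  "(\<integral>u. c * Im (u n) \<partial>hermite_gauss) = 0"
  "integrable hermite_gauss (\<lambda>u. ((cmod (u n))\<^sup>2 - 1 / (freq n)\<^sup>2)\<^sup>2)"
  "(\<integral>u. ((cmod (u n))\<^sup>2 - 1 / (freq n)\<^sup>2)\<^sup>2 \<partial>hermite_gauss) = 1 / (freq n) ^ 4"
  "(\<integral>u. (cmod (u n))\<^sup>2 - 1 / (freq n)\<^sup>2 \<partial>hermite_gauss) = 0"
proof -
  note T = nn_integral_coordinate_real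
  have e1: "(c * Re (z / of_real (freq n)))\<^sup>2 = (c\<^sup>2 / (freq n)\<^sup>2) * (Re z)\<^sup>2" for z
    by (simp add: power_mult_distrib power_divide)
  have e2: "(c * Im (z / of_real (freq n)))\<^sup>2 = (c\<^sup>2 / (freq n)\<^sup>2) * (Im z)\<^sup>2" for z
    by (simp add: power_mult_distrib power_divide)
  have e3: "(cmod (z / of_real (freq n)))\<^sup>2 - 1 / (freq n)\<^sup>2 = (1 / (freq n)\<^sup>2) * ((cmod z)\<^sup>2 - 1)" for z
    by (simp add: norm_divide power_divide diff_divide_distrib)
  have e4: "((cmod (z / of_real (freq n)))\<^sup>2 - 1 / (freq n)\<^sup>2)\<^sup>2 = (1 / (freq n) ^ 4) * ((cmod z)\<^sup>2 - 1)\<^sup>2" for z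
    unfolding e3 by (simp add: power_mult_distrib power_divide flip: power_mult)
  note h = cgauss_has_integral[unfolded has_bochner_integral_iff]
  show "integrable hermite_gauss (\<lambda>u. (c * Re (u n))\<^sup>2)" using T(1)[of "\<lambda>z. (c * Re z)\<^sup>2" n] h(1) unfolding e1 by simp
  show "(\<integral>u. (c * Re (u n))\<^sup>2 \<partial>hermite_gauss) = c\<^sup>2 / (2 * (freq n)\<^sup>2)" using T(2)[of "\<lambda>z. (c * Re z)\<^sup>2" n] h(1) unfolding e1 by simp
  show "integrable hermite_gauss (\<lambda>u. (c * Im (u n))\<^sup>2)" using T(1)[of "\<lambda>z. (c * Im z)\<^sup>2" n] h(2) unfolding e2 by simp
  show "(\<integral>u. (c * Im (u n))\<^sup>2 \<partial>hermite_gauss) = c\<^sup>2 / (2 * (freq n)\<^sup>2)" using T(2)[of "\<lambda>z. (c * Im z)\<^sup>2" n] h(2) unfolding e2 by simp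
  show "(\<integral>u. c * Re (u n) \<partial>hermite_gauss) = 0" using T(2)[of "\<lambda>z. c * Re z" n] cgauss_uminus[of "\<lambda>z. c * Re (z / of_real (freq n))"] by simp
  show "(\<integral>u. c * Im (u n) \<partial>hermite_gauss) = 0" using T(2)[of "\<lambda>z. c * Im z" n] cgauss_uminus[of "\<lambda>z. c * Im (z / of_real (freq n))"] by simp
  show "integrable hermite_gauss (\<lambda>u. ((cmod (u n))\<^sup>2 - 1 / (freq n)\<^sup>2)\<^sup>2)"
    using T(1)[of "\<lambda>z. ((cmod z)\<^sup>2 - 1 / (freq n)\<^sup>2)\<^sup>2" n] h(4) unfolding e4 by simp
  show "(\<integral>u. ((cmod (u n))\<^sup>2 - 1 / (freq n)\<^sup>2)\<^sup>2 \<partial>hermite_gauss) = 1 / (freq n) ^ 4"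
    using T(2)[of "\<lambda>z. ((cmod z)\<^sup>2 - 1 / (freq n)\<^sup>2)\<^sup>2" n] h(4) unfolding e4 by simp
  interpret C: prob_space cgauss by (rule prob_space_cgauss)
  have "(\<integral>z. (1 / (freq n)\<^sup>2) * ((cmod z)\<^sup>2 - 1) \<partial>cgauss) = 0"
    using h(3) C.prob_space by simp
  then show "(\<integral>u. (cmod (u n))\<^sup>2 - 1 / (freq n)\<^sup>2 \<partial>hermite_gauss) = 0"
    using T(2)[of "\<lambda>z. (cmod z)\<^sup>2 - 1 / (freq n)\<^sup>2" n] unfolding e3 by simp
qed

lemma wick_second_moment:
  assumes "finite I"
  shows "integrable hermite_gauss (\<lambda>u. (wick I u)\<^sup>2)"
    and "(\<integral>u. (wick I u)\<^sup>2 \<partial>hermite_gauss) = (\<Sum>n\<in>I. 1 / (freq n) ^ 4)"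
  unfolding wick_def
  using integral_square_indep_sum[OF assms, of "\<lambda>n z. (cmod z)\<^sup>2 - 1 / (freq n)\<^sup>2"] by (simp_all add: coordinate_moments)

lemma linear_second_moment:
  assumes "finite I"
  shows "integrable hermite_gauss (\<lambda>u. (\<Sum>n\<in>I. c n * Re (u n))\<^sup>2)"
    and "(\<integral>u. (\<Sum>n\<in>I. c n * Re (u n))\<^sup>2 \<partial>hermite_gauss) = (\<Sum>n\<in>I. (c n)\<^sup>2 / (2 * (freq n)\<^sup>2))"
    and "integrable hermite_gauss (\<lambda>u. (\<Sum>n\<in>I. c n * Im (u n))\<^sup>2)"
    and "(\<integral>u. (\<Sum>n\<in>I. c n * Im (u n))\<^sup>2 \<partial>hermite_gauss) = (\<Sum>n\<in>I. (c n)\<^sup>2 / (2 * (freq n)\<^sup>2))"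
proof -
  note R = integral_square_indep_sum[OF assms, where f = "\<lambda>n z. c n * Re z", OF _ coordinate_moments(3) coordinate_moments(1)]
  note M = integral_square_indep_sum[OF assms, where f = "\<lambda>n z. c n * Im z", OF _ coordinate_moments(6) coordinate_moments(4)]
  show "integrable hermite_gauss (\<lambda>u. (\<Sum>n\<in>I. c n * Re (u n))\<^sup>2)"
    "(\<integral>u. (\<Sum>n\<in>I. c n * Re (u n))\<^sup>2 \<partial>hermite_gauss) = (\<Sum>n\<in>I. (c n)\<^sup>2 / (2 * (freq n)\<^sup>2))"
    using R by (simp_all add: coordinate_moments(2))
  show "integrable hermite_gauss (\<lambda>u. (\<Sum>n\<in>I. c n * Im (u n))\<^sup>2)"
    "(\<integral>u. (\<Sum>n\<in>I. c n * Im (u n))\<^sup>2 \<partial>hermite_gauss) = (\<Sum>n\<in>I. (c n)\<^sup>2 / (2 * (freq n)\<^sup>2))"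
    using M by (simp_all add: coordinate_moments(5))
qed

lemma cmod_field_eq:
  "(cmod (hermite_field I u x))\<^sup>2 = (hermite_sum I (\<lambda>n. Re (u n)) x)\<^sup>2 + (hermite_sum I (\<lambda>n. Im (u n)) x)\<^sup>2"
  unfolding hermite_field_def hermite_sum_def by (simp add: cmod_power2)

lemma sigma_eq: "sigma hermite_gauss N x = green_diag {0..N} x"
proof -
  have "sigma hermite_gauss N x = (\<integral>u. (\<Sum>n\<in>{0..N}. hermite_fun n x * Re (u n))\<^sup>2 + (\<Sum>n\<in>{0..N}. hermite_fun n x * Im (u n))\<^sup>2 \<partial>hermite_gauss)"
    unfolding sigma_def proj_eq cmod_field_eq hermite_sum_def by (simp add: mult.commute)
  also have "\<dots> = (\<Sum>n\<in>{0..N}. (hermite_fun n x)\<^sup>2 / (2 * (freq n)\<^sup>2)) + (\<Sum>n\<in>{0..N}. (hermite_fun n x)\<^sup>2 / (2 * (freq n)\<^sup>2))"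
    using linear_second_moment[of "{0..N}" "\<lambda>n. hermite_fun n x"] by simp
  also have "\<dots> = green_diag {0..N} x"
    unfolding green_diag_def sum.distrib [symmetric] by (intro sum.cong refl) (simp add: field_simps)
  finally show ?thesis .
qed

lemma integral_green_diag: "(\<integral>x. green_diag I x \<partial>lborel) = (\<Sum>n\<in>I. 1 / (freq n)\<^sup>2)"
proof -
  have i: "integrable lborel (\<lambda>x. (hermite_fun n x)\<^sup>2)" for n
    by (intro gauss_decay_integrable gauss_decay_power2 gauss_decay_hermite)
  have "(\<integral>x. (hermite_fun n x)\<^sup>2 \<partial>lborel) = 1" for n
    using hermite_orthonormal[of n n] by (simp add: power2_eq_square)
  then show ?thesis unfolding green_diag_def using i by simp
qed

lemma integrable_cmod_field: "integrable lborel (\<lambda>x. (cmod (hermite_field I u x))\<^sup>2)"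
  unfolding cmod_field_eq by (intro Bochner_Integration.integrable_add integrable_hermite_energy)

lemma integral_cmod_field:
  assumes "finite I"
  shows "(\<integral>x. (cmod (hermite_field I u x))\<^sup>2 \<partial>lborel) = (\<Sum>n\<in>I. (cmod (u n))\<^sup>2)"
  unfolding cmod_field_eq
  by (subst Bochner_Integration.integral_add[OF integrable_hermite_energy(2) integrable_hermite_energy(2)])
     (simp add: hermite_sum_L2[OF assms] cmod_power2 sum.distrib)

lemma wick_mass_trunc_eq: "wick_mass_trunc hermite_gauss N = wick {0..N}"
proof
  fix u
  have "wick_mass_trunc hermite_gauss N u = (\<integral>x. (cmod (hermite_field {0..N} u x))\<^sup>2 \<partial>lborel) - (\<integral>x. green_diag {0..N} x \<partial>lborel)"
    unfolding wick_mass_trunc_def sigma_eq proj_eq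
    by (rule Bochner_Integration.integral_diff[OF integrable_cmod_field gauss_decay_integrable[OF gauss_decay_green_diag]])
  then show "wick_mass_trunc hermite_gauss N u = wick {0..N} u"
    by (simp add: integral_cmod_field integral_green_diag wick_def sum_subtractf)
qed

lemma nn_integral_le_second_moment:
  assumes i: "integrable hermite_gauss (\<lambda>u. (F u)\<^sup>2)" and le: "(\<integral>u. (F u)\<^sup>2 \<partial>hermite_gauss) \<le> V"
    and [measurable]: "F \<in> borel_measurable hermite_gauss" and a: "0 < (a::real)"
  shows "G.prob {u. a \<le> \<bar>F u\<bar>} \<le> V / a\<^sup>2"
proof -
  have "G.prob {u \<in> space hermite_gauss. a\<^sup>2 \<le> (F u)\<^sup>2} \<le> (\<integral>u. (F u)\<^sup>2 \<partial>hermite_gauss) / a\<^sup>2"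
    by (rule integral_Markov_inequality_measure[OF i]) (use a in auto)
  also have "\<dots> \<le> V / a\<^sup>2" using le by (intro divide_right_mono) auto
  also have "{u \<in> space hermite_gauss. a\<^sup>2 \<le> (F u)\<^sup>2} = {u. a \<le> \<bar>F u\<bar>}"
    using a by (auto simp: abs_le_square_iff [symmetric])
  finally show ?thesis .
qed

text \<open>Conditioning in Fubini form: the block B is replaced by an independent copy and frozen,
  so that the inner integral involves the block A only.\<close>

lemma indep_split:
  fixes \<Phi> :: "(nat \<Rightarrow> complex) \<Rightarrow> (nat \<Rightarrow> complex) \<Rightarrow> ennreal"
  assumes AB: "A \<inter> B = {}"
    and [measurable]: "(\<lambda>(x, y). \<Phi> x y) \<in> borel_measurable (PiM A (\<lambda>_. borel) \<Otimes>\<^sub>M PiM B (\<lambda>_. borel))"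
  shows "(\<integral>\<^sup>+u. \<Phi> (restrict u A) (restrict u B) \<partial>hermite_gauss) =
    (\<integral>\<^sup>+v. \<integral>\<^sup>+u. \<Phi> (restrict u A) (restrict v B) \<partial>hermite_gauss \<partial>hermite_gauss)"
proof -
  let ?A = "PiM A (\<lambda>_. borel :: complex measure)" and ?B = "PiM B (\<lambda>_. borel :: complex measure)"
  have iv: "G.indep_var ?A (\<lambda>u. restrict u A) ?B (\<lambda>u. restrict u B)"
    using G.indep_var_restrict[OF indep_coordinates AB] by simp
  then have mA [measurable]: "(\<lambda>u. restrict u A) \<in> hermite_gauss \<rightarrow>\<^sub>M ?A" and mB [measurable]: "(\<lambda>u. restrict u B) \<in> hermite_gauss \<rightarrow>\<^sub>M ?B"
    using G.indep_var_rv1 G.indep_var_rv2 by blast+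
  let ?DA = "distr hermite_gauss ?A (\<lambda>u. restrict u A)" and ?DB = "distr hermite_gauss ?B (\<lambda>u. restrict u B)"
  interpret DA: prob_space ?DA by (rule G.prob_space_distr) measurable
  interpret DB: prob_space ?DB by (rule G.prob_space_distr) measurable
  interpret D: pair_sigma_finite ?DA ?DB by standard
  have [measurable]: "(\<lambda>(x, y). \<Phi> x y) \<in> borel_measurable (?DA \<Otimes>\<^sub>M ?DB)"
    using assms(2) by (subst measurable_cong_sets[OF sets_pair_measure_cong[OF sets_distr sets_distr] refl])
  have "(\<integral>\<^sup>+u. \<Phi> (restrict u A) (restrict u B) \<partial>hermite_gauss) = (\<integral>\<^sup>+p. (\<lambda>(x, y). \<Phi> x y) p \<partial>(distr hermite_gauss (?A \<Otimes>\<^sub>M ?B) (\<lambda>u. (restrict u A, restrict u B))))"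
    by (subst nn_integral_distr) auto
  also have "\<dots> = (\<integral>\<^sup>+p. (\<lambda>(x, y). \<Phi> x y) p \<partial>(?DA \<Otimes>\<^sub>M ?DB))"
    using iv unfolding G.indep_var_distribution_eq by simp
  also have "\<dots> = (\<integral>\<^sup>+y. \<integral>\<^sup>+x. \<Phi> x y \<partial>?DA \<partial>?DB)"
    by (subst D.nn_integral_snd [symmetric]) auto
  also have "\<dots> = (\<integral>\<^sup>+v. \<integral>\<^sup>+x. \<Phi> x (restrict v B) \<partial>?DA \<partial>hermite_gauss)"
    by (rule nn_integral_distr) measurable
  also have "\<dots> = (\<integral>\<^sup>+v. \<integral>\<^sup>+u. \<Phi> (restrict u A) (restrict v B) \<partial>hermite_gauss \<partial>hermite_gauss)"
  proof (rule nn_integral_cong)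
    fix v
    have "restrict v B \<in> space ?B" by (simp add: space_PiM)
    then have "(\<lambda>x. \<Phi> x (restrict v B)) \<in> borel_measurable ?A"
      using measurable_compose[OF measurable_Pair2'[of "restrict v B" ?B ?A] assms(2)] by simp
    then show "(\<integral>\<^sup>+x. \<Phi> x (restrict v B) \<partial>?DA) = (\<integral>\<^sup>+u. \<Phi> (restrict u A) (restrict v B) \<partial>hermite_gauss)"
      by (intro nn_integral_distr[OF mA]) simp
  qed
  finally show ?thesis .
qed

text \<open>The mean mass of the first k modes grows at most logarithmically; this is the price of
  renormalization in the subcritical estimate.\<close>

lemma sum_freq_le_ln: "(\<Sum>n<k. 1 / (freq n)\<^sup>2) \<le> 1 + ln (real k + 1)"
proof (induction k)
  case (Suc k)
  show ?case
  \<comment> \<open>The comparison of 1 / (1 + 2 k) with 1 / (k + 2) fails only at k = 0, which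
    accounts for the additive 1 in the bound.\<close>
  proof (cases "k = 0")
    case False
    have "(real k + 1) / (real k + 2) > 0" by simp
    then have "ln ((real k + 1) / (real k + 2)) \<le> (real k + 1) / (real k + 2) - 1"
      by (rule ln_le_minus_one)
    also have "\<dots> = - 1 / (real k + 2)" by (simp add: field_simps)
    finally have "ln (real k + 1) + 1 / (real k + 2) \<le> ln (real k + 2)" by (simp add: ln_div)
    moreover have "1 / (1 + 2 * real k) \<le> 1 / (real k + 2)" using False by (simp add: field_simps)
    ultimately show ?thesis using Suc by (simp add: freq_power2 add.commute)
  qed (simp add: freq_power2)
qed simp

lemma sum_freq_unbounded: "\<exists>N. \<forall>n\<ge>N. (m::real) \<le> (\<Sum>k\<in>{0..n}. 1 / (freq k)\<^sup>2)"
proof -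
  have *: "harm (Suc n) / 2 \<le> (\<Sum>k\<in>{0..n}. 1 / (freq k)\<^sup>2)" for n
  proof -
    have "harm (Suc n) / 2 = (\<Sum>k<Suc n. inverse (real (Suc k)) / 2)" unfolding harm_altdef sum_divide_distrib ..
    also have "\<dots> \<le> (\<Sum>k<Suc n. 1 / (freq k)\<^sup>2)"
      by (intro sum_mono) (simp add: freq_power2 field_simps)
    also have "{..<Suc n} = {0..n}" by auto
    finally show ?thesis .
  qed
  have "eventually (\<lambda>n. 2 * m \<le> (harm n :: real)) sequentially"
    using harm_at_top filterlim_at_top[of harm sequentially] by blast
  then obtain N where N: "\<And>n. n \<ge> N \<Longrightarrow> 2 * m \<le> (harm n :: real)" by (auto simp: eventually_sequentially)
  have "m \<le> (\<Sum>k\<in>{0..n}. 1 / (freq k)\<^sup>2)" if "n \<ge> N" for n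
    using *[of n] N[of "Suc n"] that by simp
  then show ?thesis by blast
qed

section \<open>Small balls and anticoncentration of the renormalized mass\<close>

lemma emeasure_cgauss_pos:
  assumes "open U" "U \<noteq> {}"
  shows "emeasure cgauss U > 0"
proof -
  have "emeasure cgauss U \<noteq> 0"
  proof
    assume "emeasure cgauss U = 0"
    then have "(\<integral>\<^sup>+z. ennreal (exp (- (cmod z)\<^sup>2) / pi) * indicator U z \<partial>lborel) = 0"
      unfolding cgauss_def using assms(1) by (subst (asm) emeasure_density) auto
    then have "AE z in lborel. ennreal (exp (- (cmod z)\<^sup>2) / pi) * indicator U z = 0"
      using assms(1) by (subst (asm) nn_integral_0_iff_AE) auto
    then have "AE z in lborel. z \<notin> U" by eventually_elim (auto simp: indicator_def)
    then have "U \<in> null_sets lborel" using assms(1) by (subst AE_iff_null_sets) auto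
    then show False using assms open_not_negligible negligible_iff_null_sets null_sets_completionI by blast
  qed
  then show ?thesis by (simp add: zero_less_iff_neq_zero)
qed

text \<open>Finitely many open conditions on independent coordinates: each has positive probability
  because the rescaled point sqrt (t n) lies in the open set, and independence multiplies the
  probabilities.\<close>

lemma coordinates_near_pos:
  assumes "\<And>n. t n \<ge> 0" "\<delta> > 0"
  shows "G.prob {u. \<forall>n\<le>M. \<bar>(cmod (u n))\<^sup>2 - t n\<bar> < \<delta>} > 0"
proof -
  define A where "A n = {z. \<bar>(cmod z)\<^sup>2 - t n\<bar> < \<delta>}" for n
  have op: "open (A n)" for n unfolding A_def by (intro open_Collect_less continuous_intros)
  then have [measurable]: "A n \<in> sets borel" for n by simp
  have "emeasure hermite_gauss {u. \<forall>n\<le>M. u n \<in> A n} = (\<integral>\<^sup>+u. indicator {u. \<forall>n\<le>M. u n \<in> A n} u \<partial>hermite_gauss)"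
  proof (rule nn_integral_indicator [symmetric])
    have [measurable]: "(\<lambda>u. u n) \<in> borel_measurable hermite_gauss" for n by (rule coordinate_measurable)
    have "{u \<in> space hermite_gauss. \<forall>n\<le>M. u n \<in> A n} \<in> sets hermite_gauss" by measurable
    then show "{u. \<forall>n\<le>M. u n \<in> A n} \<in> sets hermite_gauss" by simp
  qed
  also have "\<dots> = (\<integral>\<^sup>+u. (\<Prod>n\<in>{..M}. indicator (A n) (u n)) \<partial>hermite_gauss)"
  proof (intro nn_integral_cong)
    fix u show "indicator {u. \<forall>n\<le>M. u n \<in> A n} u = (\<Prod>n\<in>{..M}. indicator (A n) (u n) :: ennreal)"
    proof (cases "\<forall>n\<le>M. u n \<in> A n")
      case False
      then have "(\<Prod>n\<in>{..M}. indicator (A n) (u n) :: ennreal) = 0" by (intro prod_zero) (auto simp: indicator_def)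
      then show ?thesis using False by auto
    qed (auto intro!: prod.neutral[symmetric])
  qed
  also have "\<dots> = (\<Prod>n\<in>{..M}. \<integral>\<^sup>+z. indicator (A n) (z / of_real (freq n)) \<partial>cgauss)"
    by (rule nn_integral_coordinates_prod) auto
  also have "\<dots> > 0"
  proof -
    have "(\<integral>\<^sup>+z. indicator (A n) (z / of_real (freq n)) \<partial>cgauss) \<noteq> (0::ennreal)" for n
    proof -
      let ?B = "(\<lambda>z. z / of_real (freq n)) -` A n"
      have o: "open ?B" by (intro open_vimage op continuous_intros) auto
      have "of_real (freq n * sqrt (t n)) \<in> ?B" using assms by (simp add: A_def)
      then have "?B \<noteq> {}" by blast
      then have "emeasure cgauss ?B > 0" by (rule emeasure_cgauss_pos[OF o])
      moreover have "(\<integral>\<^sup>+z. indicator (A n) (z / of_real (freq n)) \<partial>cgauss) = (\<integral>\<^sup>+z. indicator ?B z \<partial>cgauss)"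
        by (intro nn_integral_cong) (auto simp: indicator_def)
      moreover have "\<dots> = emeasure cgauss ?B" using o by (intro nn_integral_indicator) simp
      ultimately show ?thesis by simp
    qed
    then show ?thesis by (simp add: zero_less_iff_neq_zero prod_zero_iff)
  qed
  finally show ?thesis by (simp add: A_def G.emeasure_eq_measure)
qed

text \<open>The weights \<open>1 / \<lambda>\<^sub>n\<^sup>2\<close> are not summable, so the low modes can absorb any prescribed amount \<open>m\<close>
  of mass, while the high modes contribute little.\<close>

lemma wick_small_ball:
  assumes K: "K > 0" and m: "m \<ge> 0"
  shows "\<exists>c>0. \<exists>N0. \<forall>N\<ge>N0. c \<le> G.prob {u. \<bar>wick {0..N} u + m\<bar> \<le> K}"
proof -
  obtain N1 where N1: "\<And>n. n \<ge> N1 \<Longrightarrow> m + 1 \<le> (\<Sum>k\<in>{0..n}. 1 / (freq k)\<^sup>2)" using sum_freq_unbounded by blast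
  \<comment> \<open>Beyond M the variance is then at most K^2 / 8, so Chebyshev's inequality at
    height K/2 leaves the high modes a probability of at least 1/2.\<close>
  obtain N2 :: nat where N2: "16 / K\<^sup>2 \<le> real N2" using real_arch_simple by blast
  define M where "M = max N1 N2"
  define S where "S = (\<Sum>k\<in>{0..M}. 1 / (freq k)\<^sup>2)"
  have S: "m + 1 \<le> S" using N1[of M] by (simp add: S_def M_def)
  \<comment> \<open>All low modes are shrunk by the common factor 1 - m/S, positive as S \<ge> m +
    1; the squares then add up to S - m, a renormalized mass of exactly -m.\<close>
  define t where "t n = (1 - m / S) * (1 / (freq n)\<^sup>2)" for n
  have t0: "t n \<ge> 0" for n unfolding t_def using S m by (intro mult_nonneg_nonneg) auto
  have tsum: "(\<Sum>n\<in>{0..M}. t n) = S - m"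
  proof -
    have "(\<Sum>n\<in>{0..M}. t n) = (1 - m / S) * S" unfolding t_def S_def by (simp add: sum_distrib_left)
    also have "\<dots> = S - m" using S m by (simp add: field_simps)
    finally show ?thesis .
  qed
  define \<delta> where "\<delta> = K / (2 * (real M + 1))"
  have \<delta>: "\<delta> > 0" using K by (simp add: \<delta>_def)
  define H where "H = {u. \<forall>n\<le>M. \<bar>(cmod (u n))\<^sup>2 - t n\<bar> < \<delta>}"
  have pH: "G.prob H > 0" unfolding H_def by (rule coordinates_near_pos[OF t0 \<delta>])
  have [measurable]: "(\<lambda>u. u n) \<in> borel_measurable hermite_gauss" for n by (rule coordinate_measurable)
  have Hm [measurable]: "H \<in> sets hermite_gauss"
  proof -
    have "{u \<in> space hermite_gauss. \<forall>n\<le>M. \<bar>(cmod (u n))\<^sup>2 - t n\<bar> < \<delta>} \<in> sets hermite_gauss" by measurable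
    then show ?thesis by (simp add: H_def)
  qed
  have head: "\<bar>wick {0..M} u + m\<bar> \<le> K / 2" if "u \<in> H" for u
  proof -
    have "wick {0..M} u + m = (\<Sum>n\<in>{0..M}. (cmod (u n))\<^sup>2 - t n)"
      unfolding wick_def sum_subtractf tsum S_def by simp
    also have "\<bar>\<dots>\<bar> \<le> (\<Sum>n\<in>{0..M}. \<bar>(cmod (u n))\<^sup>2 - t n\<bar>)" by (rule sum_abs)
    also have "\<dots> \<le> (\<Sum>n\<in>{0..M}. \<delta>)" using that by (intro sum_mono) (auto simp: H_def intro: less_imp_le)
    also have "\<dots> = K / 2" by (simp add: \<delta>_def field_simps)
    finally show ?thesis .
  qed
  have "G.prob H / 2 \<le> G.prob {u. \<bar>wick {0..N} u + m\<bar> \<le> K}" if N: "N \<ge> M" for N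
  proof -
    define T where "T = {u. \<bar>wick {M<..N} u\<bar> \<le> K / 2}"
    have Tm [measurable]: "T \<in> sets hermite_gauss"
    proof -
      have "{u \<in> space hermite_gauss. \<bar>wick {M<..N} u\<bar> \<le> K / 2} \<in> sets hermite_gauss" by measurable
      then show ?thesis by (simp add: T_def)
    qed
    have pT: "1 / 2 \<le> G.prob T"
    proof -
      have "(\<Sum>n\<in>{M<..N}. 1 / freq n ^ 4) \<le> 2 / (freq M)\<^sup>2"
        by (rule sum_freq_pow4_le) auto
      also have "\<dots> \<le> K\<^sup>2 / 8"
      proof -
        have "16 / K\<^sup>2 \<le> (freq M)\<^sup>2" using N2 by (simp add: freq_power2 M_def)
        then show ?thesis using K by (simp add: field_simps)
      qed
      finally have "G.prob {u. K / 2 \<le> \<bar>wick {M<..N} u\<bar>} \<le> (K\<^sup>2 / 8) / (K / 2)\<^sup>2"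
        using K by (intro nn_integral_le_second_moment wick_second_moment) (auto simp: wick_second_moment)
      also have "\<dots> = 1 / 2" using K by (simp add: power2_eq_square)
      finally have a: "G.prob {u. K / 2 \<le> \<bar>wick {M<..N} u\<bar>} \<le> 1 / 2" .
      have "G.prob (space hermite_gauss - T) \<le> G.prob {u. K / 2 \<le> \<bar>wick {M<..N} u\<bar>}"
      proof (rule G.finite_measure_mono)
        have "{u \<in> space hermite_gauss. K / 2 \<le> \<bar>wick {M<..N} u\<bar>} \<in> sets hermite_gauss" by measurable
        then show "{u. K / 2 \<le> \<bar>wick {M<..N} u\<bar>} \<in> sets hermite_gauss" by simp
      qed (auto simp: T_def)
      with a have "G.prob (space hermite_gauss - T) \<le> 1 / 2" by simp
      then show ?thesis using G.prob_compl[OF Tm] by simp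
    qed
    have indep: "G.prob (H \<inter> T) = G.prob H * G.prob T"
    proof -
      let ?XA = "{w \<in> space (PiM {..M} (\<lambda>_. borel :: complex measure)). \<forall>n\<in>{..M}. \<bar>(cmod (w n))\<^sup>2 - t n\<bar> < \<delta>}"
      let ?XB = "{w \<in> space (PiM {M<..} (\<lambda>_. borel :: complex measure)). \<bar>\<Sum>n\<in>{M<..N}. (cmod (w n))\<^sup>2 - 1 / (freq n)\<^sup>2\<bar> \<le> K / 2}"
      have iv: "G.indep_var (PiM {..M} (\<lambda>_. borel)) (\<lambda>u. restrict u {..M}) (PiM {M<..} (\<lambda>_. borel)) (\<lambda>u. restrict u {M<..})"
        by (rule G.indep_var_restrict[OF indep_coordinates]) auto
      have mA: "?XA \<in> sets (PiM {..M} (\<lambda>_. borel))" by measurable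
      have mB: "?XB \<in> sets (PiM {M<..} (\<lambda>_. borel))"
      proof -
        have [measurable]: "(\<lambda>w. w n) \<in> borel_measurable (PiM {M<..} (\<lambda>_. borel :: complex measure))" if "n \<in> {M<..N}" for n
          using that by (intro measurable_component_singleton) auto
        show ?thesis by measurable
      qed
      have vA: "(\<lambda>u. restrict u {..M}) -` ?XA \<inter> space hermite_gauss = H"
        by (auto simp: H_def space_PiM)
      have vB: "(\<lambda>u. restrict u {M<..}) -` ?XB \<inter> space hermite_gauss = T"
        by (auto simp: T_def space_PiM wick_def)
      have "(\<lambda>u. (restrict u {..M}, restrict u {M<..})) -` (?XA \<times> ?XB) \<inter> space hermite_gauss =
        ((\<lambda>u. restrict u {..M}) -` ?XA \<inter> space hermite_gauss) \<inter> ((\<lambda>u. restrict u {M<..}) -` ?XB \<inter> space hermite_gauss)"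
        by auto
      then show ?thesis using G.indep_varD[OF iv mA mB] unfolding vA vB by simp
    qed
    have "G.prob H / 2 \<le> G.prob (H \<inter> T)" unfolding indep using pT pH by (simp add: field_simps)
    also have "\<dots> \<le> G.prob {u. \<bar>wick {0..N} u + m\<bar> \<le> K}"
    proof (rule G.finite_measure_mono)
      have "{u \<in> space hermite_gauss. \<bar>wick {0..N} u + m\<bar> \<le> K} \<in> sets hermite_gauss" by measurable
      then show "{u. \<bar>wick {0..N} u + m\<bar> \<le> K} \<in> sets hermite_gauss" by simp
      have U: "{0..N} = {0..M} \<union> {M<..N}" using N by auto
      have split: "wick {0..N} u = wick {0..M} u + wick {M<..N} u" for u
        unfolding wick_def U by (rule sum.union_disjoint) auto
      show "H \<inter> T \<subseteq> {u. \<bar>wick {0..N} u + m\<bar> \<le> K}"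
      proof
        fix u assume "u \<in> H \<inter> T"
        then have "\<bar>wick {0..M} u + m\<bar> \<le> K / 2" "\<bar>wick {M<..N} u\<bar> \<le> K / 2"
          using head by (auto simp: T_def)
        then show "u \<in> {u. \<bar>wick {0..N} u + m\<bar> \<le> K}" unfolding split mem_Collect_eq by linarith
      qed
    qed
    finally show ?thesis .
  qed
  then show ?thesis using pH by (intro exI[of _ "G.prob H / 2"]) auto
qed

text \<open>The annulus has area at most 2 pi e and the Gaussian density is at most 1 / pi.\<close>

lemma emeasure_cgauss_annulus:
  assumes e: "0 < e"
  shows "emeasure cgauss {z. \<bar>(cmod z)\<^sup>2 - y\<bar> \<le> e} \<le> ennreal (2 * e)"
proof (cases "y + e \<ge> 0")
  case False
  then have "{z. \<bar>(cmod z)\<^sup>2 - y\<bar> \<le> e} = {}"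
    by (auto simp: abs_le_iff) (smt (verit) zero_le_power2)
  then show ?thesis by simp
next
  case True
  let ?A = "{z. \<bar>(cmod z)\<^sup>2 - y\<bar> \<le> e}"
  define R where "R = sqrt (y + e)"
  define r where "r = sqrt (max 0 (y - e))"
  have "emeasure cgauss ?A = (\<integral>\<^sup>+z. ennreal (exp (- (cmod z)\<^sup>2) / pi) * indicator ?A z \<partial>lborel)"
    unfolding cgauss_def by (rule emeasure_density) auto
  also have "\<dots> \<le> (\<integral>\<^sup>+z. ennreal (1 / pi) * indicator (cball 0 R - ball (0 :: complex) r) z \<partial>lborel)"
  proof (intro nn_integral_mono)
    fix z :: complex
    have "z \<in> cball 0 R - ball 0 r" if "z \<in> ?A"
    proof -
      have "(cmod z)\<^sup>2 \<le> y + e" "y - e \<le> (cmod z)\<^sup>2" using that by (auto simp: abs_le_iff)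
      then have "cmod z \<le> R" "r \<le> cmod z"
        unfolding R_def r_def by (auto intro: real_le_rsqrt real_le_lsqrt)
      then show ?thesis by simp
    qed
    moreover have "exp (- (cmod z)\<^sup>2) / pi \<le> 1 / pi" by (intro divide_right_mono) auto
    ultimately show "ennreal (exp (- (cmod z)\<^sup>2) / pi) * indicator ?A z \<le> ennreal (1 / pi) * indicator (cball 0 R - ball 0 r) z"
      by (auto simp: indicator_def intro!: ennreal_leI)
  qed
  also have "\<dots> = ennreal (1 / pi) * emeasure lborel (cball 0 R - ball (0::complex) r)"
    by (rule nn_integral_cmult_indicator) auto
  also have "emeasure lborel (cball 0 R - ball (0::complex) r) = ennreal (pi * R\<^sup>2 - pi * r\<^sup>2)"
  proof -
    have rR: "0 \<le> r" "r \<le> R" using e True by (auto simp: r_def R_def)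
    have eR: "emeasure lborel (cball 0 R :: complex set) = ennreal (pi * R\<^sup>2)"
      using rR by (simp add: emeasure_cball unit_ball_vol_2)
    have er: "emeasure lborel (ball 0 r :: complex set) = ennreal (pi * r\<^sup>2)"
      using rR by (simp add: emeasure_ball unit_ball_vol_2)
    have "emeasure lborel (cball 0 R - ball (0::complex) r) = emeasure lborel (cball 0 R :: complex set) - emeasure lborel (ball 0 r :: complex set)"
      using rR by (intro emeasure_Diff) (auto simp: er)
    also have "\<dots> = ennreal (pi * R\<^sup>2) - ennreal (pi * r\<^sup>2)" unfolding eR er ..
    finally show ?thesis by (simp add: ennreal_minus)
  qed
  also have "ennreal (1 / pi) * ennreal (pi * R\<^sup>2 - pi * r\<^sup>2) = ennreal (R\<^sup>2 - r\<^sup>2)"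
    by (subst ennreal_mult' [symmetric]) (simp_all add: diff_divide_distrib)
  also have "\<dots> \<le> ennreal (2 * e)"
    using True e by (intro ennreal_leI) (auto simp: R_def r_def max_def)
  finally show ?thesis .
qed

text \<open>Only the randomness of mode 0 is used, all other modes being frozen, so the bound does
  not depend on N and survives the limit. There it excludes atoms at the jumps of the
  cutoff.\<close>

lemma wick_anticoncentration:
  assumes e: "0 < e"
  shows "G.prob {u. \<bar>wick {0..N} u - c\<bar> \<le> e} \<le> 2 * e"
proof -
  let ?E = "{u. \<bar>wick {0..N} u - c\<bar> \<le> e}"
  have Em: "?E \<in> sets hermite_gauss"
  proof -
    have "{u \<in> space hermite_gauss. \<bar>wick {0..N} u - c\<bar> \<le> e} \<in> sets hermite_gauss" by measurable
    then show ?thesis by simp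
  qed
  define \<Phi> where "\<Phi> x y = (indicator {s. \<bar>s\<bar> \<le> e} ((cmod (x 0))\<^sup>2 - 1 + (\<Sum>n\<in>{0<..N}. (cmod (y n))\<^sup>2 - 1 / (freq n)\<^sup>2) - c) :: ennreal)"
    for x y :: "nat \<Rightarrow> complex"
  have [measurable]: "(\<lambda>(x, y). \<Phi> x y) \<in> borel_measurable (PiM {0} (\<lambda>_. borel) \<Otimes>\<^sub>M PiM {0<..} (\<lambda>_. borel))"
  proof -
    have [measurable]: "(\<lambda>p. snd p n) \<in> borel_measurable (PiM {0} (\<lambda>_. borel :: complex measure) \<Otimes>\<^sub>M PiM {0<..} (\<lambda>_. borel :: complex measure))" if "n \<in> {0<..N}" for n
      using that by (intro measurable_compose[OF measurable_snd measurable_component_singleton]) auto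
    have [measurable]: "(\<lambda>p. fst p 0) \<in> borel_measurable (PiM {0} (\<lambda>_. borel :: complex measure) \<Otimes>\<^sub>M PiM {0<..} (\<lambda>_. borel :: complex measure))"
      by (intro measurable_compose[OF measurable_fst measurable_component_singleton]) auto
    have [measurable]: "{s::real. \<bar>s\<bar> \<le> e} \<in> sets borel" by measurable
    show ?thesis unfolding \<Phi>_def case_prod_beta by measurable
  qed
  have f0: "freq 0 = 1" by (simp add: freq_def)
  have w: "wick {0..N} u = (cmod (u 0))\<^sup>2 - 1 + (\<Sum>n\<in>{0<..N}. (cmod (u n))\<^sup>2 - 1 / (freq n)\<^sup>2)" for u
  proof -
    have "{0..N} = insert 0 {0<..N}" by auto
    then show ?thesis unfolding wick_def by (simp add: f0)
  qed
  have "emeasure hermite_gauss ?E = (\<integral>\<^sup>+u. indicator ?E u \<partial>hermite_gauss)" using Em by simp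
  also have "\<dots> = (\<integral>\<^sup>+u. \<Phi> (restrict u {0}) (restrict u {0<..}) \<partial>hermite_gauss)"
    by (intro nn_integral_cong) (auto simp: \<Phi>_def w indicator_def)
  also have "\<dots> = (\<integral>\<^sup>+v. \<integral>\<^sup>+u. \<Phi> (restrict u {0}) (restrict v {0<..}) \<partial>hermite_gauss \<partial>hermite_gauss)"
    by (rule indep_split) auto
  also have "\<dots> \<le> (\<integral>\<^sup>+v. ennreal (2 * e) \<partial>hermite_gauss)"
  proof (intro nn_integral_mono)
    fix v
    define y where "y = c + 1 - (\<Sum>n\<in>{0<..N}. (cmod (v n))\<^sup>2 - 1 / (freq n)\<^sup>2)"
    have "(\<integral>\<^sup>+u. \<Phi> (restrict u {0}) (restrict v {0<..}) \<partial>hermite_gauss) = (\<integral>\<^sup>+u. indicator {z. \<bar>(cmod z)\<^sup>2 - y\<bar> \<le> e} (u 0) \<partial>hermite_gauss)"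
      by (intro nn_integral_cong) (auto simp: \<Phi>_def y_def indicator_def algebra_simps)
    also have "\<dots> = (\<integral>\<^sup>+z. indicator {z. \<bar>(cmod z)\<^sup>2 - y\<bar> \<le> e} (z / of_real (freq 0)) \<partial>cgauss)"
      by (rule nn_integral_coordinate) auto
    also have "\<dots> = emeasure cgauss {z. \<bar>(cmod z)\<^sup>2 - y\<bar> \<le> e}" by (simp add: f0)
    also have "\<dots> \<le> ennreal (2 * e)" by (rule emeasure_cgauss_annulus[OF e])
    finally show "(\<integral>\<^sup>+u. \<Phi> (restrict u {0}) (restrict v {0<..}) \<partial>hermite_gauss) \<le> ennreal (2 * e)" .
  qed
  also have "\<dots> = ennreal (2 * e)" by (simp add: G.emeasure_space_1[simplified])
  finally show ?thesis using e by (simp add: G.emeasure_eq_measure)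
qed

section \<open>Translations of the Gaussian measure\<close>

lemma cgauss_shift:
  fixes f :: "complex \<Rightarrow> ennreal"
  assumes [measurable]: "f \<in> borel_measurable borel"
  shows "(\<integral>\<^sup>+z. f (z + of_real b) * ennreal (exp (- 2 * b * Re z - b\<^sup>2)) \<partial>cgauss) = (\<integral>\<^sup>+z. f z \<partial>cgauss)"
proof -
  have e: "ennreal (exp (- (cmod z)\<^sup>2) / pi) * (f (z + of_real b) * ennreal (exp (- 2 * b * Re z - b\<^sup>2))) = ennreal (exp (- (cmod (of_real b + z))\<^sup>2) / pi) * f (of_real b + z)" for z
  proof -
    have "exp (- (cmod z)\<^sup>2) / pi * exp (- 2 * b * Re z - b\<^sup>2) = exp (- (cmod (of_real b + z))\<^sup>2) / pi"
      by (simp add: cmod_power2 exp_add [symmetric] power2_sum algebra_simps)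
    then have "ennreal (exp (- (cmod z)\<^sup>2) / pi) * ennreal (exp (- 2 * b * Re z - b\<^sup>2)) = ennreal (exp (- (cmod (of_real b + z))\<^sup>2) / pi)"
      by (subst ennreal_mult' [symmetric]) auto
    then show ?thesis by (metis add.commute mult.assoc mult.commute)
  qed
  have "(\<integral>\<^sup>+z. f (z + of_real b) * ennreal (exp (- 2 * b * Re z - b\<^sup>2)) \<partial>cgauss) =
    (\<integral>\<^sup>+z. ennreal (exp (- (cmod z)\<^sup>2) / pi) * (f (z + of_real b) * ennreal (exp (- 2 * b * Re z - b\<^sup>2))) \<partial>lborel)"
    unfolding cgauss_def by (rule nn_integral_density) auto
  also have "\<dots> = (\<integral>\<^sup>+z. ennreal (exp (- (cmod z)\<^sup>2) / pi) * f z \<partial>(distr lborel borel ((+) (complex_of_real b))))"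
    unfolding e by (subst nn_integral_distr) auto
  also have "\<dots> = (\<integral>\<^sup>+z. ennreal (exp (- (cmod z)\<^sup>2) / pi) * f z \<partial>lborel)" by (simp only: lborel_distr_plus)
  also have "\<dots> = (\<integral>\<^sup>+z. f z \<partial>cgauss)"
    unfolding cgauss_def by (rule nn_integral_density [symmetric]) auto
  finally show ?thesis .
qed

definition mode_shift :: "nat set \<Rightarrow> (nat \<Rightarrow> real) \<Rightarrow> (nat \<Rightarrow> complex) \<Rightarrow> nat \<Rightarrow> complex" where
  "mode_shift I a u n = (if n \<in> I then u n + of_real (a n) else u n)"

lemma mode_shift_measurable [measurable]: "mode_shift I a \<in> hermite_gauss \<rightarrow>\<^sub>M hermite_gauss"
proof -
  have "(\<lambda>u n. mode_shift I a u n) \<in> PiM UNIV (\<lambda>_. borel) \<rightarrow>\<^sub>M PiM UNIV (\<lambda>_. borel)"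
    unfolding mode_shift_def by (rule measurable_PiM_single') auto
  then show ?thesis by (simp add: measurable_cong_sets[OF sets_hermite_gauss sets_hermite_gauss])
qed

text \<open>In this pushforward form, the expectation of any functional becomes the weighted
  expectation of that functional after the shift. On cylinder sets the identity factorizes into
  shifts of single coordinates.\<close>

lemma cameron_martin:
  assumes I: "finite I"
  shows "distr (density hermite_gauss (\<lambda>u. ennreal (exp (- 2 * (\<Sum>n\<in>I. (freq n)\<^sup>2 * a n * Re (u n)) - (\<Sum>n\<in>I. (freq n)\<^sup>2 * (a n)\<^sup>2))))) hermite_gauss (mode_shift I a) = hermite_gauss"
    (is "distr (density _ ?w) _ _ = _")
proof -
  let ?D = "distr (density hermite_gauss ?w) hermite_gauss (mode_shift I a)"
  have [measurable]: "(\<lambda>u. u n) \<in> borel_measurable hermite_gauss" for n by (rule coordinate_measurable)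
  have wm [measurable]: "?w \<in> borel_measurable hermite_gauss" by measurable
  have sm [measurable]: "mode_shift I a \<in> density hermite_gauss ?w \<rightarrow>\<^sub>M hermite_gauss" by simp
  have "hermite_gauss = ?D"
  proof (rule measure_eqI_PiM_infinite[where I = UNIV and M = "\<lambda>_. borel"])
    fix A :: "nat \<Rightarrow> complex set" and J :: "nat set" assume J: "finite J" and A [measurable]: "\<And>i. i \<in> J \<Longrightarrow> A i \<in> sets borel"
    \<comment> \<open>Filling up with UNIV puts the constrained and the shifted coordinates into one
      product over I \<union> J.\<close>
    define B where "B n = (if n \<in> J then A n else UNIV)" for n
    have [measurable]: "B n \<in> sets borel" for n using A by (simp add: B_def)
    define X where "X = prod_emb UNIV (\<lambda>_. borel :: complex measure) J (Pi\<^sub>E J A)"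
    have X: "X = {u. \<forall>n\<in>I \<union> J. u n \<in> B n}"
      unfolding X_def B_def prod_emb_def by (auto simp: space_PiM PiE_def Pi_def)
    have Xm [measurable]: "X \<in> sets hermite_gauss"
      unfolding X_def sets_hermite_gauss using J A by (intro sets_PiM_I) auto
    have ind: "indicator X u = (\<Prod>n\<in>I \<union> J. indicator (B n) (u n) :: ennreal)" for u
    proof (cases "u \<in> X")
      case True then show ?thesis unfolding X by (auto intro!: prod.neutral[symmetric])
    next
      case False
      then have "(\<Prod>n\<in>I \<union> J. indicator (B n) (u n) :: ennreal) = 0"
        using I J unfolding X by (intro prod_zero) (auto simp: indicator_def)
      then show ?thesis using False by simp
    qed
    define f where "f n z = (indicator (B n) (if n \<in> I then z + of_real (a n) else z) * ennreal (if n \<in> I then exp (- 2 * ((freq n)\<^sup>2 * a n * Re z) - (freq n)\<^sup>2 * (a n)\<^sup>2) else 1) :: ennreal)" for n z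
    have fm [measurable]: "f n \<in> borel_measurable borel" for n unfolding f_def[abs_def] by measurable
    have w: "?w u = (\<Prod>n\<in>I \<union> J. ennreal (if n \<in> I then exp (- 2 * ((freq n)\<^sup>2 * a n * Re (u n)) - (freq n)\<^sup>2 * (a n)\<^sup>2) else 1))" for u
    proof -
      have "(\<Prod>n\<in>I \<union> J. ennreal (if n \<in> I then exp (- 2 * ((freq n)\<^sup>2 * a n * Re (u n)) - (freq n)\<^sup>2 * (a n)\<^sup>2) else 1))
        = (\<Prod>n\<in>I. ennreal (exp (- 2 * ((freq n)\<^sup>2 * a n * Re (u n)) - (freq n)\<^sup>2 * (a n)\<^sup>2)))"
        using I J by (intro prod.mono_neutral_cong_right) auto
      also have "\<dots> = ?w u"
        by (simp add: prod_ennreal exp_sum[OF I, symmetric] sum_subtractf sum_distrib_left)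
      finally show ?thesis ..
    qed
    have "emeasure ?D X = (\<integral>\<^sup>+u. indicator X u \<partial>?D)" by simp
    also have "\<dots> = (\<integral>\<^sup>+u. indicator X (mode_shift I a u) \<partial>density hermite_gauss ?w)"
      by (rule nn_integral_distr) auto
    also have "\<dots> = (\<integral>\<^sup>+u. ?w u * indicator X (mode_shift I a u) \<partial>hermite_gauss)"
      by (rule nn_integral_density) (auto intro!: measurable_compose[OF mode_shift_measurable])
    also have "\<dots> = (\<integral>\<^sup>+u. (\<Prod>n\<in>I \<union> J. f n (u n)) \<partial>hermite_gauss)"
      unfolding ind w prod.distrib [symmetric] by (intro nn_integral_cong prod.cong refl) (simp add: f_def mode_shift_def mult.commute)
    also have "\<dots> = (\<Prod>n\<in>I \<union> J. \<integral>\<^sup>+z. f n (z / of_real (freq n)) \<partial>cgauss)"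
      using I J by (intro nn_integral_coordinates_prod fm) auto
    also have "\<dots> = (\<Prod>n\<in>I \<union> J. \<integral>\<^sup>+z. indicator (B n) (z / of_real (freq n)) \<partial>cgauss)"
    proof (intro prod.cong refl)
      fix n
      show "(\<integral>\<^sup>+z. f n (z / of_real (freq n)) \<partial>cgauss) = (\<integral>\<^sup>+z. indicator (B n) (z / of_real (freq n)) \<partial>cgauss)"
      proof (cases "n \<in> I")
        case True
        have "f n (z / of_real (freq n)) = indicator (B n) ((z + of_real (freq n * a n)) / of_real (freq n)) * ennreal (exp (- 2 * (freq n * a n) * Re z - (freq n * a n)\<^sup>2))" for z
        proof -
          have "z / of_real (freq n) + of_real (a n) = (z + of_real (freq n * a n)) / of_real (freq n)"
            by (simp add: add_divide_distrib)
          moreover have "- 2 * ((freq n)\<^sup>2 * a n * Re (z / of_real (freq n))) - (freq n)\<^sup>2 * (a n)\<^sup>2 = - 2 * (freq n * a n) * Re z - (freq n * a n)\<^sup>2"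
            by (simp add: power2_eq_square)
          ultimately show ?thesis using True by (simp add: f_def)
        qed
        then show ?thesis
          using cgauss_shift[of "\<lambda>z. indicator (B n) (z / of_real (freq n))" "freq n * a n"] by simp
      qed (simp add: f_def)
    qed
    also have "\<dots> = (\<integral>\<^sup>+u. (\<Prod>n\<in>I \<union> J. indicator (B n) (u n)) \<partial>hermite_gauss)"
      using I J by (intro nn_integral_coordinates_prod [symmetric]) auto
    also have "\<dots> = emeasure hermite_gauss X" unfolding ind [symmetric] by simp
    finally show "emeasure hermite_gauss (prod_emb UNIV (\<lambda>_. borel) J (Pi\<^sub>E J A)) = emeasure ?D (prod_emb UNIV (\<lambda>_. borel) J (Pi\<^sub>E J A))"
      unfolding X_def ..
  qed (auto simp: sets_hermite_gauss intro: G.finite_measure_axioms)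
  then show ?thesis ..
qed

section \<open>Convergence of the truncated weights\<close>

lemma ennreal_tendsto_0_iff':
  fixes f :: "'a \<Rightarrow> ennreal"
  shows "(f \<longlongrightarrow> 0) F \<longleftrightarrow> (\<forall>e>0. eventually (\<lambda>x. f x < ennreal e) F)"
proof
  assume "(f \<longlongrightarrow> 0) F"
  then show "\<forall>e>0. eventually (\<lambda>x. f x < ennreal e) F" by (auto intro: order_tendstoD)
next
  assume e: "\<forall>e>0. eventually (\<lambda>x. f x < ennreal e) F"
  show "(f \<longlongrightarrow> 0) F"
  proof (rule order_tendstoI)
    fix a :: ennreal assume "0 < a"
    then obtain b where b: "0 < b" "b < a" using dense by auto
    then obtain r where "0 < r" "ennreal r < a" by (cases b) auto
    then show "eventually (\<lambda>x. f x < a) F" using e by (auto elim!: allE[of _ r] eventually_mono)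
  qed auto
qed

lemma ennreal_tendsto_0_less:
  fixes f :: "nat \<Rightarrow> ennreal"
  assumes "f \<longlonglongrightarrow> 0" "e > 0"
  shows "\<exists>N. f N < ennreal e"
  using assms unfolding ennreal_tendsto_0_iff' by (meson eventually_happens sequentially_bot)

lemma Lp_norm_less_iff:
  assumes "p > 0" "e > 0"
  shows "Lp_norm M p f < ennreal e \<longleftrightarrow> (\<integral>\<^sup>+x. ennreal (norm (f x) powr p) \<partial>M) < ennreal (e powr p)"
proof (cases "(\<integral>\<^sup>+x. ennreal (norm (f x) powr p) \<partial>M) = \<top>")
  case False
  define i where "i = enn2real (\<integral>\<^sup>+x. ennreal (norm (f x) powr p) \<partial>M)"
  have i: "(\<integral>\<^sup>+x. ennreal (norm (f x) powr p) \<partial>M) = ennreal i" "i \<ge> 0"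
    using False by (auto simp: i_def less_top)
  have "i powr (1 / p) < e \<longleftrightarrow> i < e powr p"
  proof
    assume "i powr (1 / p) < e"
    then have "(i powr (1 / p)) powr p < e powr p" using assms by (intro powr_less_mono2) auto
    then show "i < e powr p" using assms i by (simp add: powr_powr)
  next
    assume "i < e powr p"
    then have "i powr (1 / p) < (e powr p) powr (1 / p)" using assms i by (intro powr_less_mono2) auto
    then show "i powr (1 / p) < e" using assms by (simp add: powr_powr)
  qed
  then show ?thesis using i assms by (simp add: Lp_norm_def ennreal_less_iff)
qed (simp add: Lp_norm_def)

lemma Lp_norm_tendsto_0_iff:
  assumes "p > 0"
  shows "((\<lambda>N. Lp_norm M p (f N)) \<longlongrightarrow> 0) F \<longleftrightarrow> ((\<lambda>N. \<integral>\<^sup>+x. ennreal (norm (f N x) powr p) \<partial>M) \<longlongrightarrow> 0) F"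
  unfolding ennreal_tendsto_0_iff'
proof safe
  fix e :: real assume e: "e > 0"
  { assume "\<forall>e>0. \<forall>\<^sub>F N in F. Lp_norm M p (f N) < ennreal e"
    then have "\<forall>\<^sub>F N in F. Lp_norm M p (f N) < ennreal (e powr (1 / p))" using e by simp
    then show "\<forall>\<^sub>F N in F. (\<integral>\<^sup>+x. ennreal (norm (f N x) powr p) \<partial>M) < ennreal e"
      using e assms by (simp add: Lp_norm_less_iff powr_powr) }
  { assume "\<forall>e>0. \<forall>\<^sub>F N in F. (\<integral>\<^sup>+x. ennreal (norm (f N x) powr p) \<partial>M) < ennreal e"
    then have "\<forall>\<^sub>F N in F. (\<integral>\<^sup>+x. ennreal (norm (f N x) powr p) \<partial>M) < ennreal (e powr p)" using e by simp
    then show "\<forall>\<^sub>F N in F. Lp_norm M p (f N) < ennreal e"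
      using e assms by (simp add: Lp_norm_less_iff) }
qed

lemma Lp_norm_finite_iff: "Lp_norm M p f < \<top> \<longleftrightarrow> (\<integral>\<^sup>+x. ennreal (norm (f x) powr p) \<partial>M) < \<top>"
  by (auto simp: Lp_norm_def Let_def less_top)

lemma nn_integral_tendsto_0_AE_subseq:
  fixes X :: "nat \<Rightarrow> 'a \<Rightarrow> ennreal"
  assumes [measurable]: "\<And>n. X n \<in> borel_measurable M" and lim: "(\<lambda>n. \<integral>\<^sup>+x. X n x \<partial>M) \<longlonglongrightarrow> 0"
  shows "\<exists>r::nat \<Rightarrow> nat. strict_mono r \<and> (AE x in M. (\<lambda>k. X (r k) x) \<longlonglongrightarrow> 0)"
proof -
  have "\<exists>N. \<forall>n\<ge>N. (\<integral>\<^sup>+x. X n x \<partial>M) < ennreal ((1 / 2) ^ k)" for k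
    using lim unfolding ennreal_tendsto_0_iff' eventually_sequentially by (auto elim!: allE[of _ "(1 / 2) ^ k"])
  then obtain N where N: "\<And>k n. n \<ge> N k \<Longrightarrow> (\<integral>\<^sup>+x. X n x \<partial>M) < ennreal ((1 / 2) ^ k)" by metis
  define r where "r k = (\<Sum>i\<le>k. N i) + k" for k
  have r: "strict_mono r" unfolding strict_mono_Suc_iff r_def by simp
  have rN: "N k \<le> r k" for k
    using member_le_sum[of k "{..k}" N] by (simp add: r_def)
  have "(\<integral>\<^sup>+x. (\<Sum>k. X (r k) x) \<partial>M) = (\<Sum>k. \<integral>\<^sup>+x. X (r k) x \<partial>M)"
    by (rule nn_integral_suminf) measurable
  also have "\<dots> \<le> (\<Sum>k. ennreal ((1 / 2) ^ k))"
    by (intro suminf_le less_imp_le[OF N[OF rN]]) auto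
  also have "\<dots> < \<top>"
    by (subst suminf_ennreal2) (auto intro!: summable_geometric)
  finally have "AE x in M. (\<Sum>k. X (r k) x) \<noteq> \<infinity>"
    by (intro nn_integral_PInf_AE) auto
  then have "AE x in M. (\<lambda>k. X (r k) x) \<longlonglongrightarrow> 0"
  proof eventually_elim
    case (elim x)
    then have fin: "X (r k) x < \<top>" for k
      using ennreal_suminf_lessD[of "\<lambda>k. X (r k) x" \<top> k] by (simp add: less_top)
    define y where "y k = enn2real (X (r k) x)" for k
    have y: "X (r k) x = ennreal (y k)" "0 \<le> y k" for k using fin by (auto simp: y_def)
    have "summable y" using elim y by (intro summable_suminf_not_top) auto
    then have "y \<longlonglongrightarrow> 0" by (rule summable_LIMSEQ_zero)
    from tendsto_ennrealI[OF this] show ?case by (simp add: y)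
  qed
  with r show ?thesis by blast
qed

lemma tendsto_0_if_bounded_by:
  fixes f :: "nat \<Rightarrow> nat \<Rightarrow> ennreal"
  assumes le: "\<And>m n. n \<le> m \<Longrightarrow> f m n \<le> ennreal (b n)" and sym: "\<And>m n. f m n = f n m" and b: "b \<longlonglongrightarrow> 0" and e: "e > (0::real)"
  shows "\<exists>N. \<forall>m\<ge>N. \<forall>n\<ge>N. f m n \<le> ennreal e"
proof -
  from order_tendstoD(2)[OF b e] obtain N where N: "\<And>n. n \<ge> N \<Longrightarrow> b n < e" by (auto simp: eventually_sequentially)
  have *: "f m n \<le> ennreal e" if "N \<le> n" "n \<le> m" for m n
    using le[OF that(2)] N[OF that(1)] by (auto intro: order_trans ennreal_leI less_imp_le)
  have "f m n \<le> ennreal e" if "N \<le> m" "N \<le> n" for m n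
    using *[of n m] *[of m n] that sym[of m n] by (cases "n \<le> m") auto
  then show ?thesis by blast
qed

lemma freq_powr_tendsto_0: "s > 0 \<Longrightarrow> (\<lambda>n. (2 / freq n) powr s) \<longlonglongrightarrow> 0"
  unfolding freq_def by real_asymp

section \<open>Limits of the renormalized mass and of the field\<close>

lemma wick_limit:
  "\<exists>W\<in>borel_measurable hermite_gauss. (\<lambda>N. \<integral>\<^sup>+u. ennreal (norm (wick {0..N} u - W u) powr 2) \<partial>hermite_gauss) \<longlonglongrightarrow> 0"
proof (rule Lp_complete)
  fix e :: real assume "e > 0"
  then show "\<exists>N. \<forall>m\<ge>N. \<forall>n\<ge>N. (\<integral>\<^sup>+u. ennreal (norm (wick {0..m} u - wick {0..n} u) powr 2) \<partial>hermite_gauss) \<le> ennreal e"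
  proof (rule tendsto_0_if_bounded_by[rotated 3])
    show "(\<lambda>n. 2 / (freq n)\<^sup>2) \<longlonglongrightarrow> 0" unfolding freq_def by real_asymp
    show "(\<integral>\<^sup>+u. ennreal (norm (wick {0..m} u - wick {0..n} u) powr 2) \<partial>hermite_gauss) \<le> ennreal (2 / (freq n)\<^sup>2)" if "n \<le> m" for m n
    proof -
      have U: "{0..m} = {0..n} \<union> {n<..m}" using that by auto
      have d: "wick {0..m} u - wick {0..n} u = wick {n<..m} u" for u
      proof -
        have "wick {0..m} u = wick {0..n} u + wick {n<..m} u"
          unfolding wick_def U by (rule sum.union_disjoint) auto
        then show ?thesis by simp
      qed
      have "(\<integral>\<^sup>+u. ennreal (norm (wick {0..m} u - wick {0..n} u) powr 2) \<partial>hermite_gauss) = (\<integral>\<^sup>+u. ennreal ((wick {n<..m} u)\<^sup>2) \<partial>hermite_gauss)"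
        unfolding d by (simp add: powr_numeral)
      also have "\<dots> = ennreal (\<integral>u. (wick {n<..m} u)\<^sup>2 \<partial>hermite_gauss)"
        by (intro nn_integral_eq_integral wick_second_moment) auto
      also have "\<dots> \<le> ennreal (2 / (freq n)\<^sup>2)"
      proof (rule ennreal_leI)
        have "{n<..m} \<subseteq> {n..}" by auto
        then show "(\<integral>u. (wick {n<..m} u)\<^sup>2 \<partial>hermite_gauss) \<le> 2 / (freq n)\<^sup>2"
          using wick_second_moment(2)[of "{n<..m}"] sum_freq_pow4_le[of "{n<..m}" n] by simp
      qed
      finally show ?thesis .
    qed
  qed (subst norm_minus_commute, rule refl)
qed auto

text \<open>By Tonelli and the pointwise moments, a band of modes above n is governed by the
  integral of \<open>green_diag\<close>^(p/2), which tends to 0 once 1 < \<kappa> < p/2. Working on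
  the product space makes the limit jointly measurable in u and x.\<close>

lemma field_limit:
  assumes p: "p > 2"
  shows "\<exists>U. (\<lambda>(u, x). U u x) \<in> borel_measurable (hermite_gauss \<Otimes>\<^sub>M lborel) \<and>
    (\<lambda>N. \<integral>\<^sup>+u. \<integral>\<^sup>+x. ennreal (norm (hermite_field {0..N} u x - U u x) powr p) \<partial>lborel \<partial>hermite_gauss) \<longlonglongrightarrow> 0"
proof -
  define f where "f N = (\<lambda>(u, x). hermite_field {0..N} u x)" for N
  have fm [measurable]: "f N \<in> borel_measurable (hermite_gauss \<Otimes>\<^sub>M lborel)" for N unfolding f_def by measurable
  define \<kappa> where "\<kappa> = (1 + p / 2) / 2"
  have \<kappa>: "1 < \<kappa>" "\<kappa> < p / 2" using p by (auto simp: \<kappa>_def field_simps)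
  define c where "c = 2 * (2 * (p / 2)) powr (p / 2) * exp (- (p / 2))"
  have c: "c \<ge> 0" by (simp add: c_def)
  define b where "b n = c * ((2 / freq n) powr (p / 2 - \<kappa>) * decay_const \<kappa>)" for n
  have "\<exists>g\<in>borel_measurable (hermite_gauss \<Otimes>\<^sub>M lborel). (\<lambda>n. \<integral>\<^sup>+z. ennreal (norm (f n z - g z) powr p) \<partial>(hermite_gauss \<Otimes>\<^sub>M lborel)) \<longlonglongrightarrow> 0"
  proof (rule Lp_complete[OF fm])
    fix e :: real assume "e > 0"
    then show "\<exists>N. \<forall>m\<ge>N. \<forall>n\<ge>N. (\<integral>\<^sup>+z. ennreal (norm (f m z - f n z) powr p) \<partial>(hermite_gauss \<Otimes>\<^sub>M lborel)) \<le> ennreal e"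
    proof (rule tendsto_0_if_bounded_by[rotated 3])
      have "(\<lambda>n. (2 / freq n) powr (p / 2 - \<kappa>)) \<longlonglongrightarrow> 0" using \<kappa> by (intro freq_powr_tendsto_0) simp
      from tendsto_mult_left[OF this, of "c * decay_const \<kappa>"] show "b \<longlonglongrightarrow> 0" unfolding b_def by (simp add: mult_ac)
      show "(\<integral>\<^sup>+z. ennreal (norm (f m z - f n z) powr p) \<partial>(hermite_gauss \<Otimes>\<^sub>M lborel)) \<le> ennreal (b n)" if "n \<le> m" for m n
      proof -
        have U: "{0..m} = {0..n} \<union> {n<..m}" using that by auto
        have d: "hermite_field {0..m} u x - hermite_field {0..n} u x = hermite_field {n<..m} u x" for u x
        proof -
          have "hermite_field {0..m} u x = hermite_field {0..n} u x + hermite_field {n<..m} u x"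
            unfolding hermite_field_def U by (rule sum.union_disjoint) auto
          then show ?thesis by simp
        qed
        have "(\<integral>\<^sup>+z. ennreal (norm (f m z - f n z) powr p) \<partial>(hermite_gauss \<Otimes>\<^sub>M lborel)) = (\<integral>\<^sup>+u. \<integral>\<^sup>+x. ennreal (norm (hermite_field {n<..m} u x) powr p) \<partial>lborel \<partial>hermite_gauss)"
          by (subst lborel.nn_integral_fst [symmetric]) (auto simp: f_def d)
        also have "\<dots> = (\<integral>\<^sup>+x. \<integral>\<^sup>+u. ennreal (norm (hermite_field {n<..m} u x) powr (2 * (p / 2))) \<partial>hermite_gauss \<partial>lborel)"
          by (subst GL.Fubini') auto
        also have "\<dots> \<le> (\<integral>\<^sup>+x. ennreal (c * green_diag {n<..m} x powr (p / 2)) \<partial>lborel)"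
          using p unfolding c_def by (intro nn_integral_mono nn_integral_powr_field) auto
        also have "\<dots> = ennreal c * (\<integral>\<^sup>+x. ennreal (green_diag {n<..m} x powr (p / 2)) \<partial>lborel)"
          using c by (subst nn_integral_cmult [symmetric]) (auto simp: ennreal_mult')
        also have "\<dots> \<le> ennreal c * ennreal ((2 / freq n) powr (p / 2 - \<kappa>) * decay_const \<kappa>)"
          using \<kappa> by (intro mult_left_mono nn_integral_green_diag) auto
        also have "\<dots> = ennreal (b n)" unfolding b_def using c by (simp add: ennreal_mult')
        finally show ?thesis .
      qed
    qed (simp add: norm_minus_commute)
  qed (use p in auto)
  then obtain g where g [measurable]: "g \<in> borel_measurable (hermite_gauss \<Otimes>\<^sub>M lborel)"
    and l: "(\<lambda>n. \<integral>\<^sup>+z. ennreal (norm (f n z - g z) powr p) \<partial>(hermite_gauss \<Otimes>\<^sub>M lborel)) \<longlonglongrightarrow> 0" by blast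
  have "(\<integral>\<^sup>+z. ennreal (norm (f n z - g z) powr p) \<partial>(hermite_gauss \<Otimes>\<^sub>M lborel)) =
     (\<integral>\<^sup>+u. \<integral>\<^sup>+x. ennreal (norm (hermite_field {0..n} u x - g (u, x)) powr p) \<partial>lborel \<partial>hermite_gauss)" for n
    by (subst lborel.nn_integral_fst [symmetric]) (auto simp: f_def)
  with l have "(\<lambda>n. \<integral>\<^sup>+u. \<integral>\<^sup>+x. ennreal (norm (hermite_field {0..n} u x - g (u, x)) powr p) \<partial>lborel \<partial>hermite_gauss) \<longlonglongrightarrow> 0" by simp
  then show ?thesis using g by (intro exI[of _ "\<lambda>u x. g (u, x)"]) (simp add: case_prod_beta)
qed

lemma gauss_decay_cmod_field: "gauss_decay (\<lambda>x. cmod (hermite_field I u x))"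
proof -
  have g: "gauss_decay (\<lambda>x. \<bar>hermite_sum I (\<lambda>n. Re (u n)) x\<bar> + \<bar>hermite_sum I (\<lambda>n. Im (u n)) x\<bar>)"
    by (intro gauss_decay_add gauss_decay_abs gauss_decay_hermite_sum)
  have le: "cmod (hermite_field I u x) \<le> \<bar>hermite_sum I (\<lambda>n. Re (u n)) x\<bar> + \<bar>hermite_sum I (\<lambda>n. Im (u n)) x\<bar>" for x
    using cmod_le[of "hermite_field I u x"] unfolding hermite_field_def hermite_sum_def by (simp add: Re_sum Im_sum)
  have c: "continuous_on UNIV (\<lambda>x. cmod (hermite_field I u x))"
    unfolding hermite_field_def by (intro continuous_intros)
  from g obtain C where "\<And>x. \<bar>hermite_sum I (\<lambda>n. Re (u n)) x\<bar> + \<bar>hermite_sum I (\<lambda>n. Im (u n)) x\<bar> \<le> C * exp (- x\<^sup>2 / 4)"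
    unfolding gauss_decay_def using abs_le_D1 by blast
  then show ?thesis using le by (intro gauss_decayI[OF c, of C]) (auto intro: order_trans)
qed

lemma Lp_mass_finite:
  assumes p: "p \<ge> 1"
  shows "Lp_mass p I u < \<top>"
proof -
  have g: "gauss_decay (\<lambda>x. cmod (hermite_field I u x))" by (rule gauss_decay_cmod_field)
  obtain B where B: "B > 0" "\<And>x. \<bar>cmod (hermite_field I u x)\<bar> \<le> B" using gauss_decay_bounded[OF g] by blast
  have "cmod (hermite_field I u x) powr p \<le> B powr (p - 1) * cmod (hermite_field I u x)" for x
  proof -
    have "cmod (hermite_field I u x) powr p = cmod (hermite_field I u x) powr (p - 1) * cmod (hermite_field I u x) powr 1"
      by (subst powr_add [symmetric]) simp
    also have "\<dots> \<le> B powr (p - 1) * cmod (hermite_field I u x) powr 1"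
      using B p by (intro mult_right_mono powr_mono2) auto
    finally show ?thesis by simp
  qed
  then have "Lp_mass p I u \<le> (\<integral>\<^sup>+x. ennreal (B powr (p - 1) * cmod (hermite_field I u x)) \<partial>lborel)"
    unfolding Lp_mass_def by (intro nn_integral_mono ennreal_leI)
  also have "\<dots> = ennreal (\<integral>x. B powr (p - 1) * cmod (hermite_field I u x) \<partial>lborel)"
    using gauss_decay_integrable[OF g] by (intro nn_integral_eq_integral) auto
  finally show ?thesis by (rule order_le_less_trans) simp
qed

lemma weight_trunc_eq:
  assumes "p \<ge> 1"
  shows "weight_trunc hermite_gauss K p N u =
    indicator {v. \<bar>wick {0..N} v\<bar> \<le> K} u * exp (1 / p * enn2real (Lp_mass p {0..N} u))"
proof -
  have fin: "(\<integral>\<^sup>+x. ennreal (norm (hermite_field {0..N} u x) powr p) \<partial>lborel) < \<top>"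
    using Lp_mass_finite[OF assms, of "{0..N}" u] by (simp add: Lp_mass_def)
  have "p > 0" using assms by simp
  from Lp_norm_powr[OF fin this] show ?thesis
    unfolding weight_trunc_def wick_mass_trunc_eq proj_eq by (simp add: Lp_mass_def)
qed

lemma weight_trunc_measurable [measurable]:
  assumes "p \<ge> 1"
  shows "weight_trunc hermite_gauss K p N \<in> borel_measurable hermite_gauss"
proof -
  have "{v \<in> space hermite_gauss. \<bar>wick {0..N} v\<bar> \<le> K} \<in> sets hermite_gauss" by measurable
  then have [measurable]: "{v. \<bar>wick {0..N} v\<bar> \<le> K} \<in> sets hermite_gauss" by simp
  show ?thesis unfolding weight_trunc_eq[OF assms, abs_def] by measurable
qed

text \<open>\<open>wick_mass\<close> is an arbitrary choice among the L^2 limits and is measurable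
  only for the completion; a Borel version of it is compared with W by uniqueness of L^2
  limits.\<close>

lemma tendsto_Lp2_wick_mass:
  assumes Wm [measurable]: "W \<in> borel_measurable hermite_gauss"
    and lim: "(\<lambda>N. \<integral>\<^sup>+u. ennreal (norm (wick {0..N} u - W u) powr 2) \<partial>hermite_gauss) \<longlonglongrightarrow> 0"
  shows "AE u in hermite_gauss. wick_mass hermite_gauss u = W u"
proof -
  have wfin: "(\<integral>\<^sup>+u. ennreal (norm (wick {0..N} u) powr 2) \<partial>hermite_gauss) < \<top>" for N
  proof -
    have "(\<integral>\<^sup>+u. ennreal (norm (wick {0..N} u) powr 2) \<partial>hermite_gauss) = (\<integral>\<^sup>+u. ennreal ((wick {0..N} u)\<^sup>2) \<partial>hermite_gauss)"
      by (simp add: powr_numeral)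
    also have "\<dots> = ennreal (\<integral>u. (wick {0..N} u)\<^sup>2 \<partial>hermite_gauss)"
      by (intro nn_integral_eq_integral wick_second_moment) auto
    finally show ?thesis by simp
  qed
  have Wfin: "(\<integral>\<^sup>+u. ennreal (norm (W u) powr 2) \<partial>hermite_gauss) < \<top>"
  proof -
    obtain N where N: "(\<integral>\<^sup>+u. ennreal (norm (wick {0..N} u - W u) powr 2) \<partial>hermite_gauss) < ennreal 1"
      using ennreal_tendsto_0_less[OF lim, of 1] by auto
    have "(\<integral>\<^sup>+u. ennreal (norm (W u) powr 2) \<partial>hermite_gauss) \<le>
      ennreal ((1 + 1) powr 2) * (\<integral>\<^sup>+u. ennreal (norm (wick {0..N} u) powr 2) \<partial>hermite_gauss) + ennreal ((1 + 1 / 1) powr 2) * (\<integral>\<^sup>+u. ennreal (norm (W u - wick {0..N} u) powr 2) \<partial>hermite_gauss)"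
      by (rule nn_integral_powr_triangle) auto
    also have "\<dots> < \<top>" unfolding norm_minus_commute[of "W _"]
      using wfin[of N] less_trans[OF N, of \<top>] by (auto simp: ennreal_mult_less_top)
    finally show ?thesis .
  qed
  have "tendsto_Lp hermite_gauss 2 (wick_mass_trunc hermite_gauss) W"
    unfolding tendsto_Lp_def in_Lp_def wick_mass_trunc_eq Lp_norm_finite_iff
    using wfin Wfin lim by (auto simp: Lp_norm_tendsto_0_iff intro!: measurable_completion)
  then have "tendsto_Lp hermite_gauss 2 (wick_mass_trunc hermite_gauss) (wick_mass hermite_gauss)"
    unfolding wick_mass_def by (rule someI[where P = "tendsto_Lp hermite_gauss 2 (wick_mass_trunc hermite_gauss)"])
  then have c: "wick_mass hermite_gauss \<in> borel_measurable (completion hermite_gauss)"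
    and l: "(\<lambda>N. \<integral>\<^sup>+u. ennreal (norm (wick {0..N} u - wick_mass hermite_gauss u) powr 2) \<partial>hermite_gauss) \<longlonglongrightarrow> 0"
    unfolding tendsto_Lp_def in_Lp_def wick_mass_trunc_eq by (auto simp: Lp_norm_tendsto_0_iff)
  from completion_ex_borel_measurable_real[OF c] obtain V where [measurable]: "V \<in> borel_measurable hermite_gauss"
    and V: "AE u in hermite_gauss. wick_mass hermite_gauss u = V u" by blast
  have "(\<integral>\<^sup>+u. ennreal (norm (wick {0..N} u - wick_mass hermite_gauss u) powr 2) \<partial>hermite_gauss) = (\<integral>\<^sup>+u. ennreal (norm (wick {0..N} u - V u) powr 2) \<partial>hermite_gauss)" for N
    using V by (intro nn_integral_cong_AE) auto
  with l have l': "(\<lambda>N. \<integral>\<^sup>+u. ennreal (norm (wick {0..N} u - V u) powr 2) \<partial>hermite_gauss) \<longlonglongrightarrow> 0" by simp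
  let ?Z = "\<integral>\<^sup>+u. ennreal (norm (V u - W u) powr 2) \<partial>hermite_gauss"
  have b: "?Z \<le> ennreal ((1 + 1) powr 2) * (\<integral>\<^sup>+u. ennreal (norm (wick {0..N} u - W u) powr 2) \<partial>hermite_gauss) + ennreal ((1 + 1 / 1) powr 2) * (\<integral>\<^sup>+u. ennreal (norm (wick {0..N} u - V u) powr 2) \<partial>hermite_gauss)" for N
  proof -
    have "?Z \<le> ennreal ((1 + 1) powr 2) * (\<integral>\<^sup>+u. ennreal (norm (wick {0..N} u - W u) powr 2) \<partial>hermite_gauss) + ennreal ((1 + 1 / 1) powr 2) * (\<integral>\<^sup>+u. ennreal (norm ((V u - W u) - (wick {0..N} u - W u)) powr 2) \<partial>hermite_gauss)"
      by (rule nn_integral_powr_triangle) auto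
    moreover have "norm ((V u - W u) - (wick {0..N} u - W u)) = norm (wick {0..N} u - V u)" for u
      by (simp add: abs_minus_commute)
    ultimately show ?thesis by (simp only:)
  qed
  have "(\<lambda>N. ennreal ((1 + 1) powr 2) * (\<integral>\<^sup>+u. ennreal (norm (wick {0..N} u - W u) powr 2) \<partial>hermite_gauss) + ennreal ((1 + 1 / 1) powr 2) * (\<integral>\<^sup>+u. ennreal (norm (wick {0..N} u - V u) powr 2) \<partial>hermite_gauss)) \<longlonglongrightarrow> ennreal ((1 + 1) powr 2) * 0 + ennreal ((1 + 1 / 1) powr 2) * 0"
    by (intro tendsto_add ennreal_tendsto_cmult lim l') auto
  then have "?Z \<le> 0"
    by (intro LIMSEQ_le_const[where x = 0 and X = "\<lambda>N. ennreal ((1 + 1) powr 2) * (\<integral>\<^sup>+u. ennreal (norm (wick {0..N} u - W u) powr 2) \<partial>hermite_gauss) + ennreal ((1 + 1 / 1) powr 2) * (\<integral>\<^sup>+u. ennreal (norm (wick {0..N} u - V u) powr 2) \<partial>hermite_gauss)"])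
       (use b in auto)
  then have "AE u in hermite_gauss. ennreal (norm (V u - W u) powr 2) = 0"
    by (subst nn_integral_0_iff_AE [symmetric]) auto
  then show ?thesis using V
  proof eventually_elim
    case (elim u)
    then show ?case by (simp add: ennreal_eq_0_iff powr_eq_0_iff)
  qed
qed

lemma wick_limit_no_atom:
  assumes Wm [measurable]: "W \<in> borel_measurable hermite_gauss"
    and lim: "(\<lambda>N. \<integral>\<^sup>+u. ennreal (norm (wick {0..N} u - W u) powr 2) \<partial>hermite_gauss) \<longlonglongrightarrow> 0"
  shows "AE u in hermite_gauss. W u \<noteq> c"
proof -
  have Em: "{u. W u = c} \<in> sets hermite_gauss"
  proof -
    have "{u \<in> space hermite_gauss. W u = c} \<in> sets hermite_gauss" by measurable
    then show ?thesis by simp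
  qed
  have "emeasure hermite_gauss {u. W u = c} \<le> ennreal e" if e: "e > 0" for e
  proof -
    \<comment> \<open>Anticoncentration of the truncated mass gives 2 d = e/2, and Chebyshev's
      inequality for its distance to W gives the other half.\<close>
    define d where "d = e / 4"
    have d: "d > 0" using e by (simp add: d_def)
    obtain N where N: "(\<integral>\<^sup>+u. ennreal (norm (wick {0..N} u - W u) powr 2) \<partial>hermite_gauss) < ennreal (d\<^sup>2 * (e / 2))"
      using ennreal_tendsto_0_less[OF lim, of "d\<^sup>2 * (e / 2)"] d e by auto
    let ?A = "{u. \<bar>wick {0..N} u - c\<bar> \<le> d}" and ?B = "{u. d \<le> \<bar>wick {0..N} u - W u\<bar>}"
    have [measurable]: "?A \<in> sets hermite_gauss" "?B \<in> sets hermite_gauss"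
    proof -
      have "{u \<in> space hermite_gauss. \<bar>wick {0..N} u - c\<bar> \<le> d} \<in> sets hermite_gauss" "{u \<in> space hermite_gauss. d \<le> \<bar>wick {0..N} u - W u\<bar>} \<in> sets hermite_gauss" by measurable
      then show "?A \<in> sets hermite_gauss" "?B \<in> sets hermite_gauss" by simp_all
    qed
    have "ennreal (d\<^sup>2) * emeasure hermite_gauss ?B = (\<integral>\<^sup>+u. ennreal (d\<^sup>2) * indicator ?B u \<partial>hermite_gauss)"
      by (simp add: nn_integral_cmult_indicator)
    also have "\<dots> \<le> (\<integral>\<^sup>+u. ennreal (norm (wick {0..N} u - W u) powr 2) \<partial>hermite_gauss)"
    proof (intro nn_integral_mono)
      fix u
      have "d\<^sup>2 \<le> \<bar>wick {0..N} u - W u\<bar>\<^sup>2" if "d \<le> \<bar>wick {0..N} u - W u\<bar>" using that d by (intro power_mono) auto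
      then show "ennreal (d\<^sup>2) * indicator ?B u \<le> ennreal (norm (wick {0..N} u - W u) powr 2)"
        by (auto simp: indicator_def powr_numeral intro!: ennreal_leI)
    qed
    also have "\<dots> \<le> ennreal (d\<^sup>2 * (e / 2))" using N by (rule less_imp_le)
    also have "\<dots> = ennreal (d\<^sup>2) * ennreal (e / 2)" by (rule ennreal_mult') simp
    finally have B: "emeasure hermite_gauss ?B \<le> ennreal (e / 2)"
      using d by (subst (asm) ennreal_mult_le_mult_iff) auto
    have A: "emeasure hermite_gauss ?A \<le> ennreal (e / 2)"
      using wick_anticoncentration[OF d, of N c] by (simp add: G.emeasure_eq_measure d_def ennreal_leI)
    have "emeasure hermite_gauss {u. W u = c} \<le> emeasure hermite_gauss (?A \<union> ?B)"
      by (intro emeasure_mono) auto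
    also have "\<dots> \<le> emeasure hermite_gauss ?A + emeasure hermite_gauss ?B" by (intro emeasure_subadditive) auto
    also have "\<dots> \<le> ennreal (e / 2) + ennreal (e / 2)" by (intro add_mono A B)
    also have "\<dots> = ennreal e" using e by (subst ennreal_plus [symmetric]) auto
    finally show ?thesis .
  qed
  then have "emeasure hermite_gauss {u. W u = c} = 0"
    by (metis ennreal_le_epsilon add.left_neutral le_zero_eq)
  then have "{u. W u = c} \<in> null_sets hermite_gauss" using Em by auto
  from AE_not_in[OF this] show ?thesis by simp
qed

text \<open>A deterministic statement for one fixed u: convergence in L^p identifies V as the
  function with coefficients u, hence as the one that realizes
  \<open>distribution_Lp_norm\<close>.\<close>

lemma field_limit_AE:
  fixes V :: "real \<Rightarrow> complex"
  assumes p: "p > 2" and Um: "V \<in> borel_measurable borel" and r: "strict_mono r"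
    and lim: "(\<lambda>k. \<integral>\<^sup>+x. ennreal (norm (hermite_field {0..r k} u x - V x) powr p) \<partial>lborel) \<longlonglongrightarrow> 0"
  shows "enn2real (distribution_Lp_norm p u) powr p = enn2real (\<integral>\<^sup>+x. ennreal (norm (V x) powr p) \<partial>lborel)"
    and "(\<lambda>k. enn2real (Lp_mass p {0..r k} u)) \<longlonglongrightarrow> enn2real (\<integral>\<^sup>+x. ennreal (norm (V x) powr p) \<partial>lborel)"
proof -
  note [measurable] = Um
  have ffin: "(\<integral>\<^sup>+x. ennreal (norm (hermite_field {0..r k} u x) powr p) \<partial>lborel) < \<top>" for k
    using Lp_mass_finite[of p "{0..r k}" u] p by (simp add: Lp_mass_def)
  have Ufin: "(\<integral>\<^sup>+x. ennreal (norm (V x) powr p) \<partial>lborel) < \<top>"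
  proof -
    obtain k where k: "(\<integral>\<^sup>+x. ennreal (norm (hermite_field {0..r k} u x - V x) powr p) \<partial>lborel) < ennreal 1"
      using ennreal_tendsto_0_less[OF lim, of 1] by auto
    have "(\<integral>\<^sup>+x. ennreal (norm (V x) powr p) \<partial>lborel) \<le>
      ennreal ((1 + 1) powr p) * (\<integral>\<^sup>+x. ennreal (norm (hermite_field {0..r k} u x) powr p) \<partial>lborel) + ennreal ((1 + 1 / 1) powr p) * (\<integral>\<^sup>+x. ennreal (norm (V x - hermite_field {0..r k} u x) powr p) \<partial>lborel)"
      using p by (intro nn_integral_powr_triangle) auto
    also have "\<dots> < \<top>" using ffin[of k] k by (auto simp: ennreal_mult_less_top norm_minus_commute intro: less_trans)
    finally show ?thesis .
  qed
  show "(\<lambda>k. enn2real (Lp_mass p {0..r k} u)) \<longlonglongrightarrow> enn2real (\<integral>\<^sup>+x. ennreal (norm (V x) powr p) \<partial>lborel)"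
    unfolding Lp_mass_def using p by (intro nn_integral_powr_tendsto ffin Ufin lim) auto
  have coeff: "(\<integral>x. hermite_fun n x *\<^sub>R V x \<partial>lborel) = u n" for n
  proof -
    have l: "(\<lambda>k. \<integral>x. hermite_fun n x *\<^sub>R hermite_field {0..r k} u x \<partial>lborel) \<longlonglongrightarrow> (\<integral>x. hermite_fun n x *\<^sub>R V x \<partial>lborel)"
      using p by (intro Lp_pairing_tendsto[where p = p] ffin Ufin lim) auto
    have "(\<integral>x. hermite_fun n x *\<^sub>R hermite_field {0..r k} u x \<partial>lborel) = u n" if "k \<ge> n" for k
    proof -
      have "n \<le> r k" using that seq_suble[OF r, of k] by simp
      have i: "integrable lborel (\<lambda>x. u m * complex_of_real (hermite_fun n x * hermite_fun m x))" for m
        by (intro integrable_mult_right integrable_of_real gauss_decay_integrable gauss_decay_mult gauss_decay_hermite)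
      have "(\<integral>x. hermite_fun n x *\<^sub>R hermite_field {0..r k} u x \<partial>lborel) = (\<integral>x. (\<Sum>m\<in>{0..r k}. u m * complex_of_real (hermite_fun n x * hermite_fun m x)) \<partial>lborel)"
        unfolding hermite_field_def scaleR_sum_right by (intro Bochner_Integration.integral_cong sum.cong refl) (simp add: scaleR_conv_of_real)
      also have "\<dots> = (\<Sum>m\<in>{0..r k}. u m * complex_of_real (\<integral>x. hermite_fun n x * hermite_fun m x \<partial>lborel))"
        by (subst Bochner_Integration.integral_sum[OF i]) (simp only: integral_mult_right_zero integral_complex_of_real)
      also have "\<dots> = u n" unfolding hermite_orthonormal using \<open>n \<le> r k\<close> by (simp add: if_distrib cong: if_cong)
      finally show ?thesis .
    qed
    then have "(\<lambda>k. \<integral>x. hermite_fun n x *\<^sub>R hermite_field {0..r k} u x \<partial>lborel) \<longlonglongrightarrow> u n"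
      by (intro tendsto_eventually) (auto simp: eventually_sequentially)
    with l show ?thesis using LIMSEQ_unique by blast
  qed
  have "distribution_Lp_norm p u = Lp_norm lborel p (V)"
    using p by (intro distribution_Lp_norm_eq coeff Ufin) auto
  then show "enn2real (distribution_Lp_norm p u) powr p = enn2real (\<integral>\<^sup>+x. ennreal (norm (V x) powr p) \<partial>lborel)"
    using Lp_norm_powr[OF Ufin] p by simp
qed

text \<open>Mass and field converge in mean, hence almost everywhere only along subsequences, but F
  is the same for all of them; together with moment bounds this suffices for convergence in L^r. F
  is a Borel version of \<open>weight\<close>, which rests on a choice and an infimum.\<close>

lemma weight_convergence:
  assumes p: "p > 2"
  shows "\<exists>F\<in>borel_measurable hermite_gauss. (AE u in hermite_gauss. weight hermite_gauss K p u = F u) \<and> (\<forall>u. F u \<ge> 0) \<and>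
    (\<forall>\<phi>::nat \<Rightarrow> nat. strict_mono \<phi> \<longrightarrow> (\<exists>\<psi>::nat \<Rightarrow> nat. strict_mono \<psi> \<and> (AE u in hermite_gauss. (\<lambda>k. weight_trunc hermite_gauss K p (\<phi> (\<psi> k)) u) \<longlonglongrightarrow> F u)))"
proof -
  obtain W where Wm [measurable]: "W \<in> borel_measurable hermite_gauss"
    and Wlim: "(\<lambda>N. \<integral>\<^sup>+u. ennreal (norm (wick {0..N} u - W u) powr 2) \<partial>hermite_gauss) \<longlonglongrightarrow> 0"
    using wick_limit by blast
  obtain U where Um [measurable]: "(\<lambda>(u, x). U u x) \<in> borel_measurable (hermite_gauss \<Otimes>\<^sub>M lborel)"
    and Ulim: "(\<lambda>N. \<integral>\<^sup>+u. \<integral>\<^sup>+x. ennreal (norm (hermite_field {0..N} u x - U u x) powr p) \<partial>lborel \<partial>hermite_gauss) \<longlonglongrightarrow> 0"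
    using field_limit[OF p] by blast
  have Uum: "U u \<in> borel_measurable borel" for u
    using measurable_compose[OF measurable_Pair1'[of u hermite_gauss lborel] Um] by simp
  define F where "F u = indicator {v. \<bar>W v\<bar> \<le> K} u * exp (1 / p * enn2real (\<integral>\<^sup>+x. ennreal (norm (U u x) powr p) \<partial>lborel))" for u
  have [measurable]: "{v. \<bar>W v\<bar> \<le> K} \<in> sets hermite_gauss"
  proof -
    have "{v \<in> space hermite_gauss. \<bar>W v\<bar> \<le> K} \<in> sets hermite_gauss" by measurable
    then show ?thesis by simp
  qed
  have Fm: "F \<in> borel_measurable hermite_gauss" unfolding F_def[abs_def] by measurable
  \<comment> \<open>Off |W| = K the cutoff indicator is eventually constant along the
    subsequence.\<close>
  have atom: "AE u in hermite_gauss. \<bar>W u\<bar> \<noteq> K"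
    using wick_limit_no_atom[OF Wm Wlim, of K] wick_limit_no_atom[OF Wm Wlim, of "- K"] by eventually_elim auto
  have sub: "\<exists>\<psi>::nat \<Rightarrow> nat. strict_mono \<psi> \<and> (AE u in hermite_gauss. (\<lambda>k. wick {0..\<phi> (\<psi> k)} u) \<longlonglongrightarrow> W u) \<and>
     (AE u in hermite_gauss. (\<lambda>k. \<integral>\<^sup>+x. ennreal (norm (hermite_field {0..\<phi> (\<psi> k)} u x - U u x) powr p) \<partial>lborel) \<longlonglongrightarrow> 0)" if \<phi>: "strict_mono \<phi>" for \<phi> :: "nat \<Rightarrow> nat"
  proof -
    have "(\<lambda>N. \<integral>\<^sup>+u. ennreal (norm (wick {0..\<phi> N} u - W u) powr 2) \<partial>hermite_gauss) \<longlonglongrightarrow> 0"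
      using LIMSEQ_subseq_LIMSEQ[OF Wlim \<phi>] by (simp add: comp_def)
    from nn_integral_tendsto_0_AE_subseq[OF _ this] obtain r :: "nat \<Rightarrow> nat" where r: "strict_mono r"
      and rA: "AE u in hermite_gauss. (\<lambda>k. ennreal (norm (wick {0..\<phi> (r k)} u - W u) powr 2)) \<longlonglongrightarrow> 0" by auto
    have "(\<lambda>N. \<integral>\<^sup>+u. \<integral>\<^sup>+x. ennreal (norm (hermite_field {0..\<phi> (r N)} u x - U u x) powr p) \<partial>lborel \<partial>hermite_gauss) \<longlonglongrightarrow> 0"
      using LIMSEQ_subseq_LIMSEQ[OF Ulim strict_mono_o[OF \<phi> r]] by (simp add: comp_def)
    from nn_integral_tendsto_0_AE_subseq[OF _ this] obtain s :: "nat \<Rightarrow> nat" where s: "strict_mono s"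
      and sA: "AE u in hermite_gauss. (\<lambda>k. \<integral>\<^sup>+x. ennreal (norm (hermite_field {0..\<phi> (r (s k))} u x - U u x) powr p) \<partial>lborel) \<longlonglongrightarrow> 0" by auto
    from rA have rA': "AE u in hermite_gauss. (\<lambda>k. wick {0..\<phi> (r (s k))} u) \<longlonglongrightarrow> W u"
    proof eventually_elim
      case (elim u)
      from LIMSEQ_subseq_LIMSEQ[OF elim s] have "(\<lambda>k. ennreal (norm (wick {0..\<phi> (r (s k))} u - W u) powr 2)) \<longlonglongrightarrow> ennreal 0"
        by (simp add: comp_def)
      then have "(\<lambda>k. \<bar>wick {0..\<phi> (r (s k))} u - W u\<bar> powr 2) \<longlonglongrightarrow> 0"
        by (subst (asm) tendsto_ennreal_iff) auto
      then have "(\<lambda>k. (\<bar>wick {0..\<phi> (r (s k))} u - W u\<bar> powr 2) powr (1 / 2)) \<longlonglongrightarrow> 0 powr (1 / 2)"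
        by (intro tendsto_powr') auto
      then have "(\<lambda>k. \<bar>wick {0..\<phi> (r (s k))} u - W u\<bar>) \<longlonglongrightarrow> 0" by (simp add: powr_powr)
      then have "(\<lambda>k. wick {0..\<phi> (r (s k))} u - W u) \<longlonglongrightarrow> 0" by (rule tendsto_rabs_zero_cancel)
      then show ?case by (simp add: LIM_zero_iff)
    qed
    show ?thesis using rA' sA strict_mono_o[OF r s] by (intro exI[of _ "r \<circ> s"]) auto
  qed
  have conv: "\<exists>\<psi>::nat \<Rightarrow> nat. strict_mono \<psi> \<and> (AE u in hermite_gauss. (\<lambda>k. weight_trunc hermite_gauss K p (\<phi> (\<psi> k)) u) \<longlonglongrightarrow> F u)" if \<phi>: "strict_mono \<phi>" for \<phi> :: "nat \<Rightarrow> nat"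
  proof -
    from sub[OF \<phi>] obtain \<psi> :: "nat \<Rightarrow> nat" where \<psi>: "strict_mono \<psi>" and a: "AE u in hermite_gauss. (\<lambda>k. wick {0..\<phi> (\<psi> k)} u) \<longlonglongrightarrow> W u"
      and b: "AE u in hermite_gauss. (\<lambda>k. \<integral>\<^sup>+x. ennreal (norm (hermite_field {0..\<phi> (\<psi> k)} u x - U u x) powr p) \<partial>lborel) \<longlonglongrightarrow> 0" by blast
    have "AE u in hermite_gauss. (\<lambda>k. weight_trunc hermite_gauss K p (\<phi> (\<psi> k)) u) \<longlonglongrightarrow> F u"
      using a b atom
    proof eventually_elim
      case (elim u)
      have "strict_mono (\<lambda>k. \<phi> (\<psi> k))" using strict_mono_o[OF \<phi> \<psi>] by (simp add: comp_def)
      from field_limit_AE(2)[OF p Uum this elim(2)]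
      have e: "(\<lambda>k. exp (1 / p * enn2real (Lp_mass p {0..\<phi> (\<psi> k)} u))) \<longlonglongrightarrow> exp (1 / p * enn2real (\<integral>\<^sup>+x. ennreal (norm (U u x) powr p) \<partial>lborel))"
        by (intro tendsto_exp tendsto_mult_left)
      have ab: "(\<lambda>k. \<bar>wick {0..\<phi> (\<psi> k)} u\<bar>) \<longlonglongrightarrow> \<bar>W u\<bar>" using elim(1) by (rule tendsto_rabs)
      have "eventually (\<lambda>k. (indicator {v. \<bar>wick {0..\<phi> (\<psi> k)} v\<bar> \<le> K} u :: real) = indicator {v. \<bar>W v\<bar> \<le> K} u) sequentially"
      proof (cases "\<bar>W u\<bar> < K")
        case True
        from order_tendstoD(2)[OF ab True] show ?thesis by eventually_elim (use True in auto)
      next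
        case False
        with elim(3) have "K < \<bar>W u\<bar>" by simp
        from order_tendstoD(1)[OF ab this] show ?thesis by eventually_elim (use \<open>K < \<bar>W u\<bar>\<close> in auto)
      qed
      then have "(\<lambda>k. indicator {v. \<bar>wick {0..\<phi> (\<psi> k)} v\<bar> \<le> K} u :: real) \<longlonglongrightarrow> indicator {v. \<bar>W v\<bar> \<le> K} u"
        by (rule tendsto_eventually)
      from tendsto_mult[OF this e] show ?case using p by (simp add: weight_trunc_eq F_def)
    qed
    with \<psi> show ?thesis by blast
  qed
  have "AE u in hermite_gauss. weight hermite_gauss K p u = F u"
  proof -
    from sub[of id] obtain \<psi> :: "nat \<Rightarrow> nat" where \<psi>: "strict_mono \<psi>"
      and b: "AE u in hermite_gauss. (\<lambda>k. \<integral>\<^sup>+x. ennreal (norm (hermite_field {0..\<psi> k} u x - U u x) powr p) \<partial>lborel) \<longlonglongrightarrow> 0"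
      by (auto simp: strict_mono_def)
    show ?thesis using b tendsto_Lp2_wick_mass[OF Wm Wlim]
    proof eventually_elim
      case (elim u)
      show ?case using field_limit_AE(1)[OF p Uum \<psi> elim(1)] elim(2)
        by (simp add: weight_def F_def indicator_def)
    qed
  qed
  then show ?thesis using Fm conv by (intro bexI[of _ F]) (auto simp: F_def)
qed

section \<open>Divergence for \<open>p \<ge> 6\<close>\<close>

lemma nn_integral_Lp_mass:
  assumes I: "finite I" "I \<subseteq> {m..}" and \<kappa>: "1 < \<kappa>" "\<kappa> \<le> p / 2"
  shows "(\<integral>\<^sup>+u. Lp_mass p I u \<partial>hermite_gauss) \<le>
    ennreal (2 * p powr (p / 2) * exp (- (p / 2)) * ((2 / freq m) powr (p / 2 - \<kappa>) * decay_const \<kappa>))"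
proof -
  have p: "p > 0" using \<kappa> by simp
  define c where "c = 2 * p powr (p / 2) * exp (- (p / 2))"
  have c: "c \<ge> 0" by (simp add: c_def)
  have "(\<integral>\<^sup>+u. Lp_mass p I u \<partial>hermite_gauss) = (\<integral>\<^sup>+x. \<integral>\<^sup>+u. ennreal (cmod (hermite_field I u x) powr (2 * (p / 2))) \<partial>hermite_gauss \<partial>lborel)"
    unfolding Lp_mass_def by (subst GL.Fubini') auto
  also have "\<dots> \<le> (\<integral>\<^sup>+x. ennreal (2 * (2 * (p / 2)) powr (p / 2) * exp (- (p / 2)) * green_diag I x powr (p / 2)) \<partial>lborel)"
    using p by (intro nn_integral_mono nn_integral_powr_field I) auto
  also have "\<dots> = ennreal c * (\<integral>\<^sup>+x. ennreal (green_diag I x powr (p / 2)) \<partial>lborel)"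
    using c by (subst nn_integral_cmult [symmetric]) (auto simp: ennreal_mult' c_def)
  also have "\<dots> \<le> ennreal c * ennreal ((2 / freq m) powr (p / 2 - \<kappa>) * decay_const \<kappa>)"
    using \<kappa> by (intro mult_left_mono nn_integral_green_diag I) auto
  also have "\<dots> = ennreal (c * ((2 / freq m) powr (p / 2 - \<kappa>) * decay_const \<kappa>))" using c by (simp add: ennreal_mult')
  finally show ?thesis unfolding c_def .
qed

section \<open>Translated fields and the concentrated profile\<close>

lemma wick_mode_shift:
  assumes "I \<subseteq> J" "finite J"
  shows "wick J (mode_shift I a u) = wick J u + 2 * (\<Sum>n\<in>I. a n * Re (u n)) + (\<Sum>n\<in>I. (a n)\<^sup>2)"
proof -
  have "wick J (mode_shift I a u) - wick J u = (\<Sum>n\<in>J. if n \<in> I then 2 * (a n * Re (u n)) + (a n)\<^sup>2 else 0)"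
    unfolding wick_def sum_subtractf [symmetric]
    by (intro sum.cong refl) (auto simp: mode_shift_def cmod_power2 power2_sum algebra_simps)
  also have "\<dots> = (\<Sum>n\<in>I. 2 * (a n * Re (u n)) + (a n)\<^sup>2)"
    using assms by (intro sum.mono_neutral_cong_right) auto
  finally show ?thesis by (simp add: sum.distrib sum_distrib_left)
qed

lemma field_mode_shift:
  assumes "I \<subseteq> J" "finite J"
  shows "hermite_field J (mode_shift I a u) x = hermite_field J u x + of_real (hermite_sum I a x)"
proof -
  have "hermite_field J (mode_shift I a u) x - hermite_field J u x = (\<Sum>n\<in>J. if n \<in> I then of_real (a n * hermite_fun n x) else 0)"
    unfolding hermite_field_def sum_subtractf [symmetric]
    by (intro sum.cong refl) (auto simp: mode_shift_def algebra_simps)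
  also have "\<dots> = (\<Sum>n\<in>I. of_real (a n * hermite_fun n x))"
    using assms by (intro sum.mono_neutral_cong_right) auto
  finally show ?thesis by (simp add: hermite_sum_def algebra_simps)
qed

text \<open>The normalized reproducing kernel at 0: by Cauchy-Schwarz it has the largest value at 0
  among real sums of the modes up to k with mass m.\<close>

definition soliton_coeff :: "real \<Rightarrow> nat \<Rightarrow> nat \<Rightarrow> real" where
  "soliton_coeff m k n = sqrt (m / (\<Sum>j\<in>{..k}. (hermite_fun j 0)\<^sup>2)) * hermite_fun n 0"

lemma hermite_diag_0_pos: "(\<Sum>j\<in>{..k}. (hermite_fun j 0)\<^sup>2) > 0"
proof -
  have "0 < (hermite_fun 0 0)\<^sup>2" by (simp add: hermite_fun_0)
  also have "\<dots> \<le> (\<Sum>j\<in>{..k}. (hermite_fun j 0)\<^sup>2)" by (rule member_le_sum) auto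
  finally show ?thesis .
qed

lemma soliton_coeff_power2:
  "m \<ge> 0 \<Longrightarrow> (soliton_coeff m k n)\<^sup>2 = m / (\<Sum>j\<in>{..k}. (hermite_fun j 0)\<^sup>2) * (hermite_fun n 0)\<^sup>2"
  using hermite_diag_0_pos[of k] by (simp add: soliton_coeff_def power_mult_distrib)

lemma soliton_mass: "m \<ge> 0 \<Longrightarrow> (\<Sum>n\<in>{..k}. (soliton_coeff m k n)\<^sup>2) = m"
  using hermite_diag_0_pos[of k] by (simp only: soliton_coeff_power2 sum_distrib_left [symmetric]) simp

lemma soliton_energy: "m \<ge> 0 \<Longrightarrow> (\<Sum>n\<in>{..k}. (freq n)\<^sup>2 * (soliton_coeff m k n)\<^sup>2) \<le> m * (freq k)\<^sup>2"
proof -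
  assume m: "m \<ge> 0"
  have "(\<Sum>n\<in>{..k}. (freq n)\<^sup>2 * (soliton_coeff m k n)\<^sup>2) \<le> (\<Sum>n\<in>{..k}. (freq k)\<^sup>2 * (soliton_coeff m k n)\<^sup>2)"
    by (intro sum_mono mult_right_mono) (auto simp: freq_power2)
  also have "\<dots> = m * (freq k)\<^sup>2" using soliton_mass[OF m, of k] by (simp add: sum_distrib_left [symmetric])
  finally show ?thesis .
qed

text \<open>Twice the variance of the real pairing between the random field and the profile, which
  appears in the translated mass. It vanishes at high frequency because the normalizing sum grows
  like the frequency while the Green function at 0 stays below 2.\<close>

lemma soliton_weak: "m \<ge> 0 \<Longrightarrow> (\<Sum>n\<in>{..2 * k}. (soliton_coeff m (2 * k) n)\<^sup>2 / (freq n)\<^sup>2) \<le> 8 * sqrt pi * m / freq (2 * k)"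
proof -
  assume m: "m \<ge> 0"
  let ?D = "\<Sum>j\<in>{..2 * k}. (hermite_fun j 0)\<^sup>2"
  have "(\<Sum>n\<in>{..2 * k}. (soliton_coeff m (2 * k) n)\<^sup>2 / (freq n)\<^sup>2) = m / ?D * green_diag {..2 * k} 0"
    using m by (simp add: soliton_coeff_power2 green_diag_def sum_distrib_left)
  also have "\<dots> \<le> m / ?D * 2"
    using m hermite_diag_0_pos[of "2 * k"] green_diag_le_freq[of "{..2 * k}" 0 0] by (intro mult_left_mono) (auto simp: freq_def)
  also have "\<dots> \<le> m / (freq (2 * k) / (4 * sqrt pi)) * 2"
    using m hermite_diag_0_ge[of k] by (intro mult_right_mono divide_left_mono mult_pos_pos hermite_diag_0_pos) auto
  also have "\<dots> = 8 * sqrt pi * m / freq (2 * k)" by simp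
  finally show ?thesis .
qed

text \<open>The profile \<open>\<Sum> h\<^sub>n(0) h\<^sub>n\<close>, of mass \<open>m\<close> after normalization, is of size \<open>\<surd>(m \<lambda>)\<close> on an interval
  of length of order \<open>1/\<lambda>\<close>.\<close>

lemma soliton_Lp:
  assumes m: "m \<ge> 0" and p: "p \<ge> 6"
  shows "ennreal ((m / (16 * sqrt pi)) powr (p / 2) * (1 / (8 * sqrt pi)) * (freq (2 * k))\<^sup>2) \<le>
    (\<integral>\<^sup>+x. ennreal (\<bar>hermite_sum {..2 * k} (soliton_coeff m (2 * k)) x\<bar> powr p) \<partial>lborel)"
proof -
  define D where "D = (\<Sum>j\<in>{..2 * k}. (hermite_fun j 0)\<^sup>2)"
  define f where "f = freq (2 * k)"
  have f: "f \<ge> 1" using freq_ge_1 by (simp add: f_def)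
  have D: "D > 0" "f / (4 * sqrt pi) \<le> D" using hermite_diag_0_pos hermite_diag_0_ge[of k] by (auto simp: D_def f_def)
  \<comment> \<open>Half-length of the interval on which \<open>hermite_kernel_lower\<close> keeps
    the kernel above D/2.\<close>
  define l where "l = D / (4 * f\<^sup>2)"
  have l: "l > 0" using D f by (simp add: l_def)
  have s: "hermite_sum {..2 * k} (soliton_coeff m (2 * k)) x = sqrt (m / D) * hermite_sum {..2 * k} (\<lambda>n. hermite_fun n 0) x" for x
    unfolding hermite_sum_def soliton_coeff_def D_def by (simp add: sum_distrib_left mult.assoc)
  have low: "(m * D / 4) powr (p / 2) \<le> \<bar>hermite_sum {..2 * k} (soliton_coeff m (2 * k)) x\<bar> powr p" if "x \<in> {-l..l}" for x
  proof -
    have "\<bar>x\<bar> \<le> D / (4 * (freq (2 * k))\<^sup>2)" using that by (auto simp: l_def f_def abs_le_iff)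
    from hermite_kernel_lower[OF this[unfolded D_def]]
    have "sqrt (m / D) * (D / 2) \<le> sqrt (m / D) * hermite_sum {..2 * k} (\<lambda>n. hermite_fun n 0) x"
      using m D by (intro mult_left_mono) (auto simp: D_def)
    then have a: "sqrt (m / D) * (D / 2) \<le> \<bar>hermite_sum {..2 * k} (soliton_coeff m (2 * k)) x\<bar>" unfolding s by linarith
    have "sqrt (m / D) * (D / 2) = sqrt (m * D / 4)"
    proof -
      have "sqrt (m * D / 4) = sqrt ((m / D) * (D / 2)\<^sup>2)" using D by (simp add: power2_eq_square)
      also have "\<dots> = sqrt (m / D) * (D / 2)" unfolding real_sqrt_mult using D by simp
      finally show ?thesis ..
    qed
    with a have "sqrt (m * D / 4) powr p \<le> \<bar>hermite_sum {..2 * k} (soliton_coeff m (2 * k)) x\<bar> powr p"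
      using m D p by (intro powr_mono2) auto
    moreover have "sqrt (m * D / 4) powr p = (m * D / 4) powr (p / 2)"
      using m D by (simp add: powr_half_sqrt [symmetric] powr_powr)
    ultimately show ?thesis by simp
  qed
  have "(m / (16 * sqrt pi)) powr (p / 2) * (1 / (8 * sqrt pi)) * f\<^sup>2 \<le> (m / (16 * sqrt pi)) powr (p / 2) * (1 / (8 * sqrt pi)) * f powr (p / 2 - 1)"
  proof -
    have "f\<^sup>2 = f powr 2" using f by (simp add: powr_numeral)
    \<comment> \<open>Here p \<ge> 6 is decisive: height^p times length is of order f^(p/2 - 1),
      which must dominate the order f^2 of the energy.\<close>
    also have "\<dots> \<le> f powr (p / 2 - 1)" using f p by (intro powr_mono) auto
    finally show ?thesis by (intro mult_left_mono) auto
  qed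
  also have "\<dots> = (m * (f / (4 * sqrt pi)) / 4) powr (p / 2) * (1 / (8 * sqrt pi * f))"
  proof -
    have "(m * (f / (4 * sqrt pi)) / 4) powr (p / 2) = (m / (16 * sqrt pi)) powr (p / 2) * f powr (p / 2)"
      using m f by (subst powr_mult [symmetric]) (auto simp: mult_ac)
    moreover have "f powr (p / 2) = f powr (p / 2 - 1) * f" using f by (simp add: powr_diff)
    ultimately show ?thesis using f by simp
  qed
  also have "\<dots> \<le> (m * D / 4) powr (p / 2) * (2 * l)"
  proof (intro mult_mono powr_mono2)
    show "1 / (8 * sqrt pi * f) \<le> 2 * l"
    proof -
      have "1 / (8 * sqrt pi * f) = (f / (4 * sqrt pi)) / (2 * f\<^sup>2)" using f by (simp add: power2_eq_square)
      also have "\<dots> \<le> D / (2 * f\<^sup>2)" using D f by (intro divide_right_mono) auto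
      finally show ?thesis by (simp add: l_def)
    qed
    show "m * (f / (4 * sqrt pi)) / 4 \<le> m * D / 4" using m D by (intro divide_right_mono mult_left_mono) auto
  qed (use m f p l in auto)
  finally have "ennreal ((m / (16 * sqrt pi)) powr (p / 2) * (1 / (8 * sqrt pi)) * f\<^sup>2) \<le> ennreal ((m * D / 4) powr (p / 2) * (2 * l))"
    by (rule ennreal_leI)
  also have "\<dots> = ennreal ((m * D / 4) powr (p / 2)) * emeasure lborel {-l..l}"
    using l by (simp add: ennreal_mult')
  also have "\<dots> = (\<integral>\<^sup>+x. ennreal ((m * D / 4) powr (p / 2)) * indicator {-l..l} x \<partial>lborel)"
    by (rule nn_integral_cmult_indicator [symmetric]) auto
  also have "\<dots> \<le> (\<integral>\<^sup>+x. ennreal (\<bar>hermite_sum {..2 * k} (soliton_coeff m (2 * k)) x\<bar> powr p) \<partial>lborel)"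
  proof (intro nn_integral_mono)
    fix x
    show "ennreal ((m * D / 4) powr (p / 2)) * indicator {-l..l} x \<le> ennreal (\<bar>hermite_sum {..2 * k} (soliton_coeff m (2 * k)) x\<bar> powr p)"
      using low[of x] by (cases "x \<in> {-l..l}") (auto intro!: ennreal_leI)
  qed
  finally show ?thesis unfolding f_def .
qed

lemma freq_unbounded: "\<exists>k. B \<le> freq (2 * k)"
proof -
  obtain k :: nat where "B\<^sup>2 \<le> real k" using real_arch_simple by blast
  then have "B\<^sup>2 \<le> (freq (2 * k))\<^sup>2" by (simp add: freq_power2)
  then have "B \<le> freq (2 * k)" by (rule power2_le_imp_le) simp
  then show ?thesis ..
qed

lemma prob_ge_of_bad_events:
  assumes "A \<in> G.events" "B1 \<in> G.events" "B2 \<in> G.events" "B3 \<in> G.events"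
    and "c \<le> G.prob A" "G.prob B1 \<le> c / 4" "G.prob B2 \<le> c / 4" "G.prob B3 \<le> c / 4"
  shows "c / 4 \<le> G.prob (A - B1 - B2 - B3)"
proof -
  have "G.prob A \<le> G.prob ((A - B1 - B2 - B3) \<union> (B1 \<union> (B2 \<union> B3)))"
    using assms by (intro G.finite_measure_mono) auto
  also have "\<dots> \<le> G.prob (A - B1 - B2 - B3) + (G.prob B1 + (G.prob B2 + G.prob B3))"
    using assms by (intro order_trans[OF measure_Un_le] add_left_mono measure_Un_le) auto
  finally show ?thesis using assms by linarith
qed

text \<open>R and N0 depend on C but not on N, so the lower bound for the capped weights survives
  the limit of large N.\<close>

lemma truncated_weight_unbounded:
  assumes p: "p \<ge> 6" and K: "K > 0"
  shows "\<exists>R>0. \<exists>N0. \<forall>N\<ge>N0. ennreal C \<le> (\<integral>\<^sup>+u. ennreal (min (weight_trunc hermite_gauss K p N u) R) \<partial>hermite_gauss)"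
proof -
  \<comment> \<open>The gain per m^(p/2) f^2: the constant of \<open>soliton_Lp\<close>, reduced by
    2^(-p) for the triangle inequality and by the factor 1/p of the exponent.\<close>
  define q where "q = 2 powr (- p) * ((1 / (16 * sqrt pi)) powr (p / 2) * (1 / (8 * sqrt pi))) / p"
  have q: "q > 0" using p by (simp add: q_def)
  \<comment> \<open>Makes the gain q m^(p/2) f^2 exceed the Cameron-Martin cost m f^2 by at least
    f^2; this works because p/2 \<ge> 2.\<close>
  define m where "m = max 1 (2 / q)"
  have m: "m \<ge> 1" "2 \<le> q * m" using q by (auto simp: m_def max_def field_simps)
  have qm: "m + 1 \<le> q * m powr (p / 2)"
  proof -
    have "m + 1 \<le> 2 * m" using m by simp
    also have "\<dots> \<le> q * m * m" using m by (intro mult_right_mono) auto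
    also have "\<dots> = q * m powr 2" using m by (simp add: power2_eq_square powr_numeral)
    also have "\<dots> \<le> q * m powr (p / 2)" using m p q by (intro mult_left_mono powr_mono) auto
    finally show ?thesis .
  qed
  obtain c N1 where c: "c > 0" and N1: "\<And>N. N \<ge> N1 \<Longrightarrow> c \<le> G.prob {u. \<bar>wick {0..N} u + m\<bar> \<le> K / 2}"
    using wick_small_ball[of "K / 2" m] K m by auto
  define \<kappa> where "\<kappa> = (2::real)"
  define E where "E = 2 * p powr (p / 2) * exp (- (p / 2)) * ((2 / freq 0) powr (p / 2 - \<kappa>) * decay_const \<kappa>)"
  have E0: "E \<ge> 0" using decay_const_pos[of \<kappa>] by (simp add: E_def \<kappa>_def)
  \<comment> \<open>E bounds the mean L^p mass for all N, so by Markov's inequality the unshifted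
    field exceeds C0 with probability at most c/4.\<close>
  define C0 where "C0 = 4 * (E + 1) / c"
  have C0: "C0 > 0" using E0 c by (simp add: C0_def)
  \<comment> \<open>The random sum in the Cameron-Martin exponent has variance at most m f^2 / 2, so
    Chebyshev's inequality at height T f gives c/4 again.\<close>
  define T where "T = sqrt (2 * m / c)"
  have T: "T > 0" "T\<^sup>2 = 2 * m / c" using m c by (auto simp: T_def)
  \<comment> \<open>The three demands make, in order, the cross term in the mass small, f^2 - 2 T f
    at least f, and the final exponent large enough to beat C.\<close>
  obtain k where k: "max (1024 * sqrt pi * m / (c * K\<^sup>2)) (max (2 * T + 1) (C0 / p + ln (4 * (\<bar>C\<bar> + 1) / c))) \<le> freq (2 * k)"
    using freq_unbounded by blast
  define f where "f = freq (2 * k)"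
  have f1: "f \<ge> 1" using freq_ge_1 by (simp add: f_def)
  have fk: "1024 * sqrt pi * m / (c * K\<^sup>2) \<le> f" "2 * T + 1 \<le> f" "C0 / p + ln (4 * (\<bar>C\<bar> + 1) / c) \<le> f"
    using k by (auto simp: f_def)
  define a where "a = soliton_coeff m (2 * k)"
  define I where "I = {..2 * k}"
  \<comment> \<open>Lower bound for the L^p mass of the shifted field on the good event.\<close>
  define x where "x = 2 powr (- p) * (m powr (p / 2) * ((1 / (16 * sqrt pi)) powr (p / 2) * (1 / (8 * sqrt pi))) * f\<^sup>2) - C0"
  define R where "R = exp (1 / p * x)"
  have xq: "1 / p * x = q * m powr (p / 2) * f\<^sup>2 - C0 / p"
    unfolding x_def q_def using p by (simp add: field_simps)
  define N0 where "N0 = max N1 (2 * k)"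
  have main: "ennreal C \<le> (\<integral>\<^sup>+u. ennreal (min (weight_trunc hermite_gauss K p N u) R) \<partial>hermite_gauss)" if N: "N \<ge> N0" for N
  proof -
    have IN: "I \<subseteq> {0..N}" "finite I" using N by (auto simp: I_def N0_def)
    have [measurable]: "(\<lambda>u. u n) \<in> borel_measurable hermite_gauss" for n by (rule coordinate_measurable)
    \<comment> \<open>The shift adds m plus twice the cross term to the mass; K/2 here and K/4 in B1
      therefore add up to the cutoff K.\<close>
    define A where "A = {u. \<bar>wick {0..N} u + m\<bar> \<le> K / 2}"
    define B1 where "B1 = {u. K / 4 \<le> \<bar>\<Sum>n\<in>I. a n * Re (u n)\<bar>}"
    define B2 where "B2 = {u. T * f \<le> \<bar>\<Sum>n\<in>I. ((freq n)\<^sup>2 * a n) * Re (u n)\<bar>}"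
    define B3 where "B3 = {u. ennreal C0 \<le> Lp_mass p {0..N} u}"
    have Am: "A \<in> G.events" and B1m: "B1 \<in> G.events" and B2m: "B2 \<in> G.events" and B3m: "B3 \<in> G.events"
    proof -
      have "{u \<in> space hermite_gauss. \<bar>wick {0..N} u + m\<bar> \<le> K / 2} \<in> G.events"
        "{u \<in> space hermite_gauss. K / 4 \<le> \<bar>\<Sum>n\<in>I. a n * Re (u n)\<bar>} \<in> G.events"
        "{u \<in> space hermite_gauss. T * f \<le> \<bar>\<Sum>n\<in>I. ((freq n)\<^sup>2 * a n) * Re (u n)\<bar>} \<in> G.events"
        "{u \<in> space hermite_gauss. ennreal C0 \<le> Lp_mass p {0..N} u} \<in> G.events" by measurable
      then show "A \<in> G.events" "B1 \<in> G.events" "B2 \<in> G.events" "B3 \<in> G.events"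
        by (simp_all add: A_def B1_def B2_def B3_def)
    qed
    have pA: "c \<le> G.prob A" using N1[of N] N by (simp add: A_def N0_def)
    have pB1: "G.prob B1 \<le> c / 4"
    proof -
      have "(\<Sum>n\<in>I. (a n)\<^sup>2 / (2 * (freq n)\<^sup>2)) = (\<Sum>n\<in>I. (a n)\<^sup>2 / (freq n)\<^sup>2) / 2"
        by (simp add: sum_divide_distrib mult.commute)
      also have "\<dots> \<le> 8 * sqrt pi * m / f / 2"
        using soliton_weak[of m k] m by (intro divide_right_mono) (auto simp: a_def I_def f_def)
      finally have "G.prob B1 \<le> (8 * sqrt pi * m / f / 2) / (K / 4)\<^sup>2"
        unfolding B1_def using K IN by (intro nn_integral_le_second_moment linear_second_moment) (auto simp: linear_second_moment(2))
      also have "\<dots> \<le> c / 4"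
      proof -
        have "1024 * sqrt pi * m \<le> f * (c * K\<^sup>2)" using fk(1) c K by (simp add: pos_divide_le_eq)
        moreover have "0 \<le> f * (c * K\<^sup>2)" using f1 c by simp
        ultimately have "256 * (sqrt pi * m) \<le> f * (c * K\<^sup>2)" using m by simp
        then show ?thesis using f1 K c by (simp add: power2_eq_square field_simps)
      qed
      finally show ?thesis .
    qed
    have pB2: "G.prob B2 \<le> c / 4"
    proof -
      have "(\<Sum>n\<in>I. ((freq n)\<^sup>2 * a n)\<^sup>2 / (2 * (freq n)\<^sup>2)) = (\<Sum>n\<in>I. (freq n)\<^sup>2 * (a n)\<^sup>2) / 2"
        unfolding sum_divide_distrib by (intro sum.cong refl) (simp add: power2_eq_square)
      also have "\<dots> \<le> m * f\<^sup>2 / 2"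
        using soliton_energy[of m "2 * k"] m by (intro divide_right_mono) (auto simp: a_def I_def f_def)
      finally have "G.prob B2 \<le> (m * f\<^sup>2 / 2) / (T * f)\<^sup>2"
        unfolding B2_def using T f1 IN by (intro nn_integral_le_second_moment linear_second_moment) (auto simp: linear_second_moment(2))
      also have "\<dots> = c / 4" using f1 m c unfolding power_mult_distrib T(2) by (simp add: field_simps)
      finally show ?thesis .
    qed
    have pB3: "G.prob B3 \<le> c / 4"
    proof -
      have "ennreal C0 * emeasure hermite_gauss B3 = (\<integral>\<^sup>+u. ennreal C0 * indicator B3 u \<partial>hermite_gauss)"
        using B3m by (simp add: nn_integral_cmult_indicator)
      also have "\<dots> \<le> (\<integral>\<^sup>+u. Lp_mass p {0..N} u \<partial>hermite_gauss)"
        by (intro nn_integral_mono) (auto simp: B3_def indicator_def)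
      also have "\<dots> \<le> ennreal E"
        unfolding E_def using p by (intro nn_integral_Lp_mass) (auto simp: \<kappa>_def)
      also have "\<dots> \<le> ennreal (C0 * (c / 4))"
        using c by (intro ennreal_leI) (simp add: C0_def)
      also have "\<dots> = ennreal C0 * ennreal (c / 4)" using C0 by (intro ennreal_mult') simp
      finally have "emeasure hermite_gauss B3 \<le> ennreal (c / 4)"
        using C0 by (subst (asm) ennreal_mult_le_mult_iff) auto
      then show ?thesis using c by (simp add: G.emeasure_eq_measure)
    qed
    let ?B = "A - B1 - B2 - B3"
    have pB: "c / 4 \<le> G.prob ?B" by (rule prob_ge_of_bad_events[OF Am B1m B2m B3m pA pB1 pB2 pB3])
    have Bm: "?B \<in> G.events" using Am B1m B2m B3m by auto
    define w where "w u = ennreal (exp (- 2 * (\<Sum>n\<in>I. (freq n)\<^sup>2 * a n * Re (u n)) - (\<Sum>n\<in>I. (freq n)\<^sup>2 * (a n)\<^sup>2)))" for u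
    have wm [measurable]: "w \<in> borel_measurable hermite_gauss" unfolding w_def[abs_def] by measurable
    have good: "ennreal (R * exp (- 2 * (T * f) - m * f\<^sup>2)) \<le> w u * ennreal (min (weight_trunc hermite_gauss K p N (mode_shift I a u)) R)" if u: "u \<in> ?B" for u
    proof -
      have u1: "\<bar>wick {0..N} u + m\<bar> \<le> K / 2" "\<bar>\<Sum>n\<in>I. a n * Re (u n)\<bar> < K / 4"
        "\<bar>\<Sum>n\<in>I. ((freq n)\<^sup>2 * a n) * Re (u n)\<bar> < T * f" "Lp_mass p {0..N} u < ennreal C0"
        using u by (auto simp: A_def B1_def B2_def B3_def)
      have w: "ennreal (exp (- 2 * (T * f) - m * f\<^sup>2)) \<le> w u"
      proof -
        have "(\<Sum>n\<in>I. (freq n)\<^sup>2 * (a n)\<^sup>2) \<le> m * f\<^sup>2"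
          using soliton_energy[of m "2 * k"] m by (auto simp: a_def I_def f_def)
        then have "- 2 * (T * f) - m * f\<^sup>2 \<le> - 2 * (\<Sum>n\<in>I. (freq n)\<^sup>2 * a n * Re (u n)) - (\<Sum>n\<in>I. (freq n)\<^sup>2 * (a n)\<^sup>2)"
          using u1(3) by linarith
        then show ?thesis unfolding w_def by (intro ennreal_leI) simp
      qed
      have mass: "(\<Sum>n\<in>I. (a n)\<^sup>2) = m" using soliton_mass[of m "2 * k"] m by (simp add: a_def I_def)
      have W: "\<bar>wick {0..N} (mode_shift I a u)\<bar> \<le> K"
        using wick_mode_shift[OF IN(1), of a u] u1(1,2) unfolding mass by (simp only: finite_atLeastAtMost)
      have X: "x \<le> enn2real (Lp_mass p {0..N} (mode_shift I a u))"
      proof -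
        have "ennreal ((m / (16 * sqrt pi)) powr (p / 2) * (1 / (8 * sqrt pi)) * f\<^sup>2) \<le>
            (\<integral>\<^sup>+y. ennreal (norm (complex_of_real (hermite_sum I a y)) powr p) \<partial>lborel)"
          using soliton_Lp[of m p k] m p by (simp add: I_def a_def f_def)
        \<comment> \<open>The profile is the shifted field minus the original one; the choice \<eta>
          = 1 costs the factor 2^p.\<close>
        also have "\<dots> \<le> ennreal ((1 + 1) powr p) * (\<integral>\<^sup>+y. ennreal (norm (- hermite_field {0..N} u y) powr p) \<partial>lborel) +
           ennreal ((1 + 1 / 1) powr p) * (\<integral>\<^sup>+y. ennreal (norm (complex_of_real (hermite_sum I a y) - (- hermite_field {0..N} u y)) powr p) \<partial>lborel)"
        proof (rule nn_integral_powr_triangle)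
          have "hermite_sum I a \<in> borel_measurable borel" by (rule gauss_decay_measurable) simp
          then show "(\<lambda>y. complex_of_real (hermite_sum I a y)) \<in> borel_measurable lborel" by simp
        qed (use p in auto)
        also have "\<dots> = ennreal (2 powr p) * Lp_mass p {0..N} u + ennreal (2 powr p) * Lp_mass p {0..N} (mode_shift I a u)"
          unfolding Lp_mass_def field_mode_shift[OF IN(1) finite_atLeastAtMost] by (simp add: add.commute)
        also have "\<dots> \<le> ennreal (2 powr p) * ennreal C0 + ennreal (2 powr p) * ennreal (enn2real (Lp_mass p {0..N} (mode_shift I a u)))"
          using u1(4) Lp_mass_finite[of p "{0..N}" "mode_shift I a u"] p by (intro add_mono mult_left_mono) auto
        also have "\<dots> = ennreal (2 powr p * (C0 + enn2real (Lp_mass p {0..N} (mode_shift I a u))))"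
          using C0 by (simp add: ennreal_mult' [symmetric] distrib_left flip: ennreal_plus)
        finally have "(m / (16 * sqrt pi)) powr (p / 2) * (1 / (8 * sqrt pi)) * f\<^sup>2 \<le> 2 powr p * (C0 + enn2real (Lp_mass p {0..N} (mode_shift I a u)))"
          using C0 by (subst (asm) ennreal_le_iff) auto
        then have "2 powr (- p) * ((m / (16 * sqrt pi)) powr (p / 2) * (1 / (8 * sqrt pi)) * f\<^sup>2) \<le> 2 powr (- p) * (2 powr p * (C0 + enn2real (Lp_mass p {0..N} (mode_shift I a u))))"
          by (rule mult_left_mono) simp
        also have "\<dots> = C0 + enn2real (Lp_mass p {0..N} (mode_shift I a u))"
          by (simp add: mult.assoc [symmetric] powr_add [symmetric])
        also have "(m / (16 * sqrt pi)) powr (p / 2) = m powr (p / 2) * (1 / (16 * sqrt pi)) powr (p / 2)"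
          using m by (simp add: powr_divide)
        finally show ?thesis unfolding x_def by (simp add: mult.assoc)
      qed
      have "R \<le> weight_trunc hermite_gauss K p N (mode_shift I a u)"
        using W X p by (simp add: weight_trunc_eq R_def divide_right_mono)
      then have "min (weight_trunc hermite_gauss K p N (mode_shift I a u)) R = R" by simp
      then show ?thesis using mult_right_mono[OF w, of "ennreal R"] unfolding R_def
        by (simp add: ennreal_mult' [symmetric] mult.commute)
    qed
    have Rw: "C \<le> R * exp (- 2 * (T * f) - m * f\<^sup>2) * (c / 4)"
    proof -
      have "f \<le> f * (f - 2 * T)" using fk(2) f1 mult_left_mono[of 1 "f - 2 * T" f] by simp
      then have "f \<le> f\<^sup>2 - 2 * (T * f)" by (simp add: power2_eq_square algebra_simps)
      moreover have "(m + 1) * f\<^sup>2 \<le> q * m powr (p / 2) * f\<^sup>2" using qm by (intro mult_right_mono) auto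
      ultimately have "ln (4 * (\<bar>C\<bar> + 1) / c) \<le> 1 / p * x + (- 2 * (T * f) - m * f\<^sup>2)"
        using fk(3) unfolding xq by (simp add: algebra_simps)
      then have "exp (ln (4 * (\<bar>C\<bar> + 1) / c)) \<le> exp (1 / p * x + (- 2 * (T * f) - m * f\<^sup>2))" by simp
      then have "4 * (\<bar>C\<bar> + 1) / c \<le> R * exp (- 2 * (T * f) - m * f\<^sup>2)"
        using c unfolding R_def by (simp add: exp_add)
      then have "4 * (\<bar>C\<bar> + 1) / c * (c / 4) \<le> R * exp (- 2 * (T * f) - m * f\<^sup>2) * (c / 4)"
        using c by (intro mult_right_mono) auto
      then show ?thesis using c by simp
    qed
    have "ennreal C \<le> ennreal (R * exp (- 2 * (T * f) - m * f\<^sup>2)) * ennreal (c / 4)"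
      using Rw c by (simp add: ennreal_mult'' [symmetric] ennreal_leI)
    also have "\<dots> \<le> ennreal (R * exp (- 2 * (T * f) - m * f\<^sup>2)) * emeasure hermite_gauss ?B"
      using pB by (intro mult_left_mono) (auto simp: G.emeasure_eq_measure ennreal_leI)
    also have "\<dots> = (\<integral>\<^sup>+u. ennreal (R * exp (- 2 * (T * f) - m * f\<^sup>2)) * indicator ?B u \<partial>hermite_gauss)"
      using Bm by (simp add: nn_integral_cmult_indicator)
    also have "\<dots> \<le> (\<integral>\<^sup>+u. w u * ennreal (min (weight_trunc hermite_gauss K p N (mode_shift I a u)) R) \<partial>hermite_gauss)"
      by (intro nn_integral_mono) (use good in \<open>auto simp: indicator_def\<close>)
    also have "\<dots> = (\<integral>\<^sup>+u. ennreal (min (weight_trunc hermite_gauss K p N (mode_shift I a u)) R) \<partial>density hermite_gauss w)"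
      using p by (intro nn_integral_density [symmetric] wm measurable_compose[OF mode_shift_measurable]) measurable
    also have "\<dots> = (\<integral>\<^sup>+u. ennreal (min (weight_trunc hermite_gauss K p N u) R) \<partial>distr (density hermite_gauss w) hermite_gauss (mode_shift I a))"
      using p by (intro nn_integral_distr [symmetric]) (simp, measurable)
    also have "distr (density hermite_gauss w) hermite_gauss (mode_shift I a) = hermite_gauss"
      unfolding w_def by (rule cameron_martin[OF IN(2)])
    finally show ?thesis .
  qed
  have "R > 0" by (simp add: R_def)
  with main show ?thesis by blast
qed

section \<open>Uniform integrability for \<open>2 < p < 6\<close>\<close>

lemma eventually_le_powr: "0 < \<delta> \<Longrightarrow> eventually (\<lambda>s::real. A \<le> s powr \<delta>) at_top"
proof -
  assume "0 < \<delta>"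
  then have "filterlim (\<lambda>s::real. s powr \<delta>) at_top at_top" by real_asymp
  then show ?thesis by (auto simp: filterlim_at_top)
qed

lemma eventually_mult_powr_less:
  assumes "\<gamma> < \<gamma>'" "0 < B"
  shows "eventually (\<lambda>s::real. A * s powr \<gamma> < B * s powr \<gamma>') at_top"
proof -
  have "eventually (\<lambda>s::real. (\<bar>A\<bar> + 1) / B \<le> s powr (\<gamma>' - \<gamma>)) at_top"
    using assms by (intro eventually_le_powr) simp
  then show ?thesis using eventually_gt_at_top[of 0]
  proof eventually_elim
    case (elim s)
    then have "\<bar>A\<bar> + 1 \<le> B * s powr (\<gamma>' - \<gamma>)" using assms by (simp add: field_simps)
    then have "A < B * s powr (\<gamma>' - \<gamma>)" by linarith
    then have "A * s powr \<gamma> < B * s powr (\<gamma>' - \<gamma>) * s powr \<gamma>" using elim by (intro mult_strict_right_mono) auto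
    then show ?case by (simp add: mult.assoc powr_add [symmetric])
  qed
qed

lemma eventually_ln_le_powr:
  assumes "0 < \<eta>"
  shows "eventually (\<lambda>s::real. A + B * ln s \<le> s powr \<eta>) at_top"
proof -
  have "((\<lambda>s::real. (A + B * ln s) / s powr \<eta>) \<longlongrightarrow> 0) at_top" using assms by real_asymp
  then have "eventually (\<lambda>s::real. (A + B * ln s) / s powr \<eta> < 1) at_top" by (rule order_tendstoD) simp
  then show ?thesis using eventually_gt_at_top[of 0]
  proof eventually_elim
    case (elim s) then show ?case by (simp add: field_simps)
  qed
qed

section \<open>Splitting by frequency and by height\<close>

lemma Lp_mass_split:
  assumes I: "finite I1" "finite I2" "I1 \<inter> I2 = {}" and p: "0 < p"
  shows "Lp_mass p (I1 \<union> I2) u \<le> ennreal (2 powr p) * (Lp_mass p I1 u + Lp_mass p I2 u)"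
proof -
  have s: "hermite_field (I1 \<union> I2) u x = hermite_field I1 u x + hermite_field I2 u x" for x
    unfolding hermite_field_def using I by (rule sum.union_disjoint)
  have "cmod (hermite_field (I1 \<union> I2) u x) powr p \<le> 2 powr p * (cmod (hermite_field I1 u x) powr p + cmod (hermite_field I2 u x) powr p)" for x
  proof -
    have "cmod (hermite_field (I1 \<union> I2) u x) powr p \<le> (cmod (hermite_field I1 u x) + cmod (hermite_field I2 u x)) powr p"
      unfolding s using p by (intro powr_mono2 norm_triangle_ineq) auto
    also have "\<dots> \<le> 2 powr p * (cmod (hermite_field I1 u x) powr p + cmod (hermite_field I2 u x) powr p)"
      using p by (intro powr_add_le) auto
    finally show ?thesis .
  qed
  then have "Lp_mass p (I1 \<union> I2) u \<le> (\<integral>\<^sup>+x. ennreal (2 powr p) * (ennreal (cmod (hermite_field I1 u x) powr p) + ennreal (cmod (hermite_field I2 u x) powr p)) \<partial>lborel)"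
    unfolding Lp_mass_def by (intro nn_integral_mono) (simp add: ennreal_mult' [symmetric] ennreal_leI flip: ennreal_plus)
  also have "\<dots> = ennreal (2 powr p) * (Lp_mass p I1 u + Lp_mass p I2 u)"
    unfolding Lp_mass_def by (subst nn_integral_cmult) (auto simp: nn_integral_add)
  finally show ?thesis .
qed

lemma nn_integral_cmod_field:
  "finite I \<Longrightarrow> (\<integral>\<^sup>+x. ennreal ((cmod (hermite_field I u x))\<^sup>2) \<partial>lborel) = ennreal (\<Sum>n\<in>I. (cmod (u n))\<^sup>2)"
  by (subst nn_integral_eq_integral[OF integrable_cmod_field]) (auto simp: integral_cmod_field)

lemma Lp_mass_le_of_sup:
  assumes I: "finite I" and p: "2 \<le> p" and B: "0 < B" "\<And>x. cmod (hermite_field I u x) \<le> B"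
    and Q: "(\<Sum>n\<in>I. (cmod (u n))\<^sup>2) \<le> Q"
  shows "Lp_mass p I u \<le> ennreal (B powr (p - 2) * Q)"
proof -
  have "cmod (hermite_field I u x) powr p \<le> B powr (p - 2) * (cmod (hermite_field I u x))\<^sup>2" for x
  proof -
    have "cmod (hermite_field I u x) powr p = cmod (hermite_field I u x) powr (p - 2) * cmod (hermite_field I u x) powr 2"
      by (subst powr_add [symmetric]) simp
    also have "\<dots> \<le> B powr (p - 2) * cmod (hermite_field I u x) powr 2"
      using B p by (intro mult_right_mono powr_mono2) auto
    finally show ?thesis by (simp add: powr_numeral)
  qed
  then have "Lp_mass p I u \<le> (\<integral>\<^sup>+x. ennreal (B powr (p - 2)) * ennreal ((cmod (hermite_field I u x))\<^sup>2) \<partial>lborel)"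
    unfolding Lp_mass_def by (intro nn_integral_mono) (simp add: ennreal_mult' [symmetric] ennreal_leI)
  also have "\<dots> = ennreal (B powr (p - 2)) * ennreal (\<Sum>n\<in>I. (cmod (u n))\<^sup>2)"
    by (subst nn_integral_cmult) (auto simp: nn_integral_cmod_field[OF I])
  also have "\<dots> \<le> ennreal (B powr (p - 2)) * ennreal Q" by (intro mult_left_mono ennreal_leI Q) auto
  finally show ?thesis by (simp add: ennreal_mult')
qed

text \<open>Below the height B the p-th power is controlled by the square, above it by the q-th
  power, so only the large values are charged to the L^q norm.\<close>

lemma Lp_mass_interpolation:
  assumes I: "finite I" and p: "2 \<le> p" "p \<le> q" and B: "0 < B"
    and Q: "(\<Sum>n\<in>I. (cmod (u n))\<^sup>2) \<le> Q"
  shows "Lp_mass p I u \<le> ennreal (B powr (p - 2) * Q) + ennreal (B powr (p - q)) * Lp_mass q I u"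
proof -
  have pt: "w powr p \<le> B powr (p - 2) * w\<^sup>2 + B powr (p - q) * w powr q" if w: "0 \<le> w" for w
  proof (cases "w \<le> B")
    case True
    have "w powr p = w powr (p - 2) * w powr 2" by (subst powr_add [symmetric]) simp
    also have "\<dots> \<le> B powr (p - 2) * w powr 2" using w p True by (intro mult_right_mono powr_mono2) auto
    also have "\<dots> = B powr (p - 2) * w\<^sup>2" using w by (simp add: powr_numeral)
    also have "\<dots> \<le> B powr (p - 2) * w\<^sup>2 + B powr (p - q) * w powr q" by simp
    finally show ?thesis .
  next
    case False
    have "w powr p = w powr (p - q) * w powr q" by (subst powr_add [symmetric]) simp
    also have "\<dots> \<le> B powr (p - q) * w powr q"
      using w p False B by (intro mult_right_mono powr_mono2') auto
    also have "\<dots> \<le> B powr (p - 2) * w\<^sup>2 + B powr (p - q) * w powr q" by simp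
    finally show ?thesis .
  qed
  have "Lp_mass p I u \<le> (\<integral>\<^sup>+x. ennreal (B powr (p - 2)) * ennreal ((cmod (hermite_field I u x))\<^sup>2) + ennreal (B powr (p - q)) * ennreal (cmod (hermite_field I u x) powr q) \<partial>lborel)"
    unfolding Lp_mass_def using pt by (intro nn_integral_mono) (simp add: ennreal_mult' [symmetric] ennreal_leI flip: ennreal_plus)
  also have "\<dots> = ennreal (B powr (p - 2)) * ennreal (\<Sum>n\<in>I. (cmod (u n))\<^sup>2) + ennreal (B powr (p - q)) * Lp_mass q I u"
    unfolding Lp_mass_def by (subst nn_integral_add) (auto simp: nn_integral_cmult nn_integral_cmod_field[OF I])
  also have "\<dots> \<le> ennreal (B powr (p - 2)) * ennreal Q + ennreal (B powr (p - q)) * Lp_mass q I u"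
    by (intro add_right_mono mult_left_mono ennreal_leI Q) auto
  finally show ?thesis by (simp add: ennreal_mult')
qed

text \<open>Cauchy-Schwarz combined with the Bernstein-type bound
  \<open>hermite_diag_le\<close>.\<close>

lemma cmod_field_le:
  assumes I: "finite I" "I \<subseteq> {..m}" and Q: "(\<Sum>n\<in>I. (cmod (u n))\<^sup>2) \<le> Q"
  shows "cmod (hermite_field I u x) \<le> sqrt (2 * freq m * Q)"
proof -
  have "cmod (hermite_field I u x) \<le> (\<Sum>n\<in>I. cmod (u n) * \<bar>hermite_fun n x\<bar>)"
    unfolding hermite_field_def by (rule order_trans[OF norm_sum]) (simp add: norm_mult)
  also have "\<dots> \<le> L2_set (\<lambda>n. cmod (u n)) I * L2_set (\<lambda>n. hermite_fun n x) I"
    using L2_set_mult_ineq[of "\<lambda>n. cmod (u n)" "\<lambda>n. hermite_fun n x" I] by simp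
  also have "\<dots> = sqrt ((\<Sum>n\<in>I. (hermite_fun n x)\<^sup>2) * (\<Sum>n\<in>I. (cmod (u n))\<^sup>2))"
    by (simp add: L2_set_def real_sqrt_mult mult.commute)
  also have "\<dots> \<le> sqrt (2 * freq m * Q)"
    using hermite_diag_le[OF I, of x] Q by (intro real_sqrt_le_mono mult_mono sum_nonneg) auto
  finally show ?thesis .
qed

text \<open>Low modes are controlled deterministically by their mass, which the cutoff bounds by a
  logarithm; the truncation at height \<open>B\<close> trades the \<open>L\<^sup>p\<close> norm of the middle modes for the mass and an
  \<open>L\<^sup>q\<close> norm, whose tail is Gaussian.\<close>

lemma tail_inclusion:
  fixes N m1 m2 :: nat
  defines "I1 \<equiv> {0..N} \<inter> {..<m1}" and "I2 \<equiv> {0..N} \<inter> {m1..<m2}" and "I3 \<equiv> {0..N} \<inter> {m2..}"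
  assumes p: "2 < p" "p \<le> q" and m: "m1 \<le> m2" and s: "0 < s" and B: "0 < B"
    and Qdef: "Q = K + 4 + ln (real m2 + 1)"
    and low: "sqrt (2 * freq m1 * Q) powr (p - 2) * Q < 4 powr (- p) / 3 * s"
    and mid: "B powr (p - 2) * Q \<le> 4 powr (- p) / 6 * s"
    and K: "0 < K"
    and u: "\<bar>wick {0..N} u\<bar> \<le> K" "ennreal s \<le> Lp_mass p {0..N} u"
  shows "wick I3 u \<le> - 3 \<or> ennreal (B powr (q - p) * (4 powr (- p) / 6 * s)) \<le> Lp_mass q I2 u \<or> ennreal (4 powr (- p) / 3 * s) \<le> Lp_mass p I3 u"
proof (rule ccontr)
  \<comment> \<open>Two splittings cost 2^p each, and each of the three ranges is allotted a third
    of what remains; the middle range halves its share between small and large values.\<close>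
  define \<theta> where "\<theta> = 4 powr (- p) / 3"
  have \<theta>: "\<theta> > 0" by (simp add: \<theta>_def)
  assume "\<not> ?thesis"
  then have neg: "- 3 < wick I3 u" "Lp_mass q I2 u < ennreal (B powr (q - p) * (\<theta> / 2 * s))" "Lp_mass p I3 u < ennreal (\<theta> * s)"
    by (auto simp: \<theta>_def not_le)
  have fin: "finite I1" "finite I2" "finite I3" by (auto simp: I1_def I2_def I3_def)
  have un: "{0..N} = (I1 \<union> I2) \<union> I3" "(I1 \<union> I2) \<inter> I3 = {}" "I1 \<inter> I2 = {}"
    using m by (auto simp: I1_def I2_def I3_def)
  have "wick {0..N} u = wick (I1 \<union> I2) u + wick I3 u"
    unfolding un(1) wick_def by (rule sum.union_disjoint) (use fin un in auto)
  then have "wick (I1 \<union> I2) u \<le> K + 3" using neg(1) u(1) by linarith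
  moreover have "wick (I1 \<union> I2) u = (\<Sum>n\<in>I1 \<union> I2. (cmod (u n))\<^sup>2) - (\<Sum>n\<in>I1 \<union> I2. 1 / (freq n)\<^sup>2)"
    by (simp add: wick_def sum_subtractf)
  moreover have "(\<Sum>n\<in>I1 \<union> I2. 1 / (freq n)\<^sup>2) \<le> (\<Sum>n<m2. 1 / (freq n)\<^sup>2)"
    using m by (intro sum_mono2) (auto simp: I1_def I2_def)
  \<comment> \<open>Q collects K from the cutoff, 3 from the lower tail of the high modes, and 1
    plus a logarithm from the mean mass below m2.\<close>
  ultimately have mass: "(\<Sum>n\<in>I1 \<union> I2. (cmod (u n))\<^sup>2) \<le> Q"
    using sum_freq_le_ln[of m2] unfolding Qdef by linarith
  have mass1: "(\<Sum>n\<in>I1. (cmod (u n))\<^sup>2) \<le> Q" and mass2: "(\<Sum>n\<in>I2. (cmod (u n))\<^sup>2) \<le> Q"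
    using fin by (auto intro!: order_trans[OF sum_mono2 mass])
  have "0 \<le> ln (real m2 + 1)" by (intro ln_ge_zero) simp
  then have Q: "Q > 0" unfolding Qdef using K by linarith
  have "Lp_mass p I1 u \<le> ennreal (sqrt (2 * freq m1 * Q) powr (p - 2) * Q)"
  proof (rule Lp_mass_le_of_sup[OF fin(1) _ _ _ mass1])
    show "cmod (hermite_field I1 u x) \<le> sqrt (2 * freq m1 * Q)" for x
      by (rule cmod_field_le[OF fin(1) _ mass1]) (auto simp: I1_def)
  qed (use p Q in auto)
  also have "\<dots> < ennreal (\<theta> * s)" using low s by (intro ennreal_lessI) (auto simp: \<theta>_def)
  finally have L1: "Lp_mass p I1 u < ennreal (\<theta> * s)" .
  have "Lp_mass p I2 u \<le> ennreal (B powr (p - 2) * Q) + ennreal (B powr (p - q)) * Lp_mass q I2 u"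
    using p B by (intro Lp_mass_interpolation fin mass2) auto
  also have "\<dots> \<le> ennreal (\<theta> / 2 * s) + ennreal (B powr (p - q)) * ennreal (B powr (q - p) * (\<theta> / 2 * s))"
    using mid neg(2) by (intro add_mono mult_left_mono ennreal_leI) (auto simp: \<theta>_def)
  also have "ennreal (B powr (p - q)) * ennreal (B powr (q - p) * (\<theta> / 2 * s)) = ennreal (\<theta> / 2 * s)"
  proof -
    have "B powr (p - q) * (B powr (q - p) * (\<theta> / 2 * s)) = \<theta> / 2 * s"
      using B by (simp add: mult.assoc [symmetric] powr_add [symmetric])
    moreover have "ennreal (B powr (p - q)) * ennreal (B powr (q - p) * (\<theta> / 2 * s)) = ennreal (B powr (p - q) * (B powr (q - p) * (\<theta> / 2 * s)))"
      by (rule ennreal_mult' [symmetric]) simp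
    ultimately show ?thesis by (simp only:)
  qed
  also have "ennreal (\<theta> / 2 * s) + ennreal (\<theta> / 2 * s) = ennreal (\<theta> * s)"
    using \<theta> s by (subst ennreal_plus [symmetric]) auto
  finally have L2: "Lp_mass p I2 u \<le> ennreal (\<theta> * s)" .
  have "Lp_mass p {0..N} u \<le> ennreal (2 powr p) * (Lp_mass p (I1 \<union> I2) u + Lp_mass p I3 u)"
    unfolding un(1) using fin un p by (intro Lp_mass_split) auto
  also have "\<dots> \<le> ennreal (2 powr p) * (ennreal (2 powr p) * (Lp_mass p I1 u + Lp_mass p I2 u) + ennreal (2 powr p) * Lp_mass p I3 u)"
  proof (intro mult_left_mono add_mono Lp_mass_split)
    have "1 * Lp_mass p I3 u \<le> ennreal (2 powr p) * Lp_mass p I3 u"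
      using p ge_one_powr_ge_zero[of 2 p] by (intro mult_right_mono) (auto simp flip: ennreal_1 intro!: ennreal_leI)
    then show "Lp_mass p I3 u \<le> ennreal (2 powr p) * Lp_mass p I3 u" by simp
  qed (use fin un p in auto)
  also have "\<dots> = ennreal (4 powr p) * (Lp_mass p I1 u + Lp_mass p I2 u + Lp_mass p I3 u)"
  proof -
    have "ennreal (4 powr p) = ennreal (2 powr p) * ennreal (2 powr p)"
      by (subst ennreal_mult' [symmetric]) (auto simp: powr_mult [symmetric])
    then show ?thesis by (simp add: distrib_left mult.assoc)
  qed
  also have "\<dots> < ennreal (4 powr p) * (ennreal (\<theta> * s) + ennreal (\<theta> * s) + ennreal (\<theta> * s))"
  proof (rule ennreal_mult_strict_left_mono)
    have f: "Lp_mass p I u < \<top>" for I using p by (intro Lp_mass_finite) auto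
    define x where "x I = enn2real (Lp_mass p I u)" for I
    have x: "Lp_mass p I u = ennreal (x I)" "0 \<le> x I" for I using f[of I] by (auto simp: x_def)
    have "x I1 < \<theta> * s" "x I2 \<le> \<theta> * s" "x I3 < \<theta> * s"
      using L1 L2 neg(3) \<theta> s x(2)[of I1] x(2)[of I3] unfolding x(1) by (auto simp: ennreal_less_iff)
    then have "x I1 + x I2 + x I3 < \<theta> * s + \<theta> * s + \<theta> * s" by linarith
    then show "Lp_mass p I1 u + Lp_mass p I2 u + Lp_mass p I3 u < ennreal (\<theta> * s) + ennreal (\<theta> * s) + ennreal (\<theta> * s)"
      unfolding x(1) using x(2) \<theta> s by (simp add: ennreal_less_iff flip: ennreal_plus)
  qed auto
  also have "\<dots> = ennreal (4 powr p * (\<theta> * s + \<theta> * s + \<theta> * s))"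
  proof -
    have "ennreal (\<theta> * s + \<theta> * s + \<theta> * s) = ennreal (\<theta> * s) + ennreal (\<theta> * s) + ennreal (\<theta> * s)"
      using \<theta> s by (simp only: ennreal_plus add_nonneg_nonneg mult_nonneg_nonneg less_imp_le)
    then show ?thesis by (simp only: ennreal_mult'[OF powr_ge_zero])
  qed
  also have "4 powr p * (\<theta> * s + \<theta> * s + \<theta> * s) = s"
    by (simp add: \<theta>_def mult.assoc [symmetric] powr_add [symmetric])
  finally show False using u(2) by simp
qed

text \<open>Freezes the frequency-dependent constant of the tail at a lower bound s of the
  frequency, so that the exponent can be evaluated in pure powers.\<close>

lemma Lp_mass_tail_freq:
  assumes I: "finite I" "I \<subseteq> {m..}" and \<kappa>: "1 < \<kappa>" "\<kappa> \<le> q / 2" and y: "0 < y"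
    and s: "0 < s" "s \<le> freq m"
    and a: "2 * a \<le> (y / ((2 / s) powr (q / 2 - \<kappa>) * decay_const \<kappa>)) powr (2 / q)"
  shows "emeasure hermite_gauss {u. ennreal y \<le> Lp_mass q I u} \<le> ennreal (2 * exp (q / 2) * exp (- a))"
proof -
  have q: "q > 0" using \<kappa> by simp
  define S where "S = (2 / freq m) powr (q / 2 - \<kappa>) * decay_const \<kappa>"
  define S' where "S' = (2 / s) powr (q / 2 - \<kappa>) * decay_const \<kappa>"
  have S: "0 < S" using decay_const_pos[OF \<kappa>(1)] by (simp add: S_def)
  have "2 / freq m \<le> 2 / s" using s by (intro divide_left_mono) auto
  then have SS': "S \<le> S'" unfolding S_def S'_def using decay_const_pos[OF \<kappa>(1)] \<kappa>
    by (intro mult_right_mono powr_mono2) auto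
  have "y / S' \<le> y / S" using y S SS' by (intro divide_left_mono) auto
  then have "(y / S') powr (2 / q) \<le> (y / S) powr (2 / q)" using y S SS' q by (intro powr_mono2) auto
  with a have "2 * a \<le> (y / S) powr (2 / q)" unfolding S'_def by linarith
  then have e: "exp (- ((y / S) powr (2 / q)) / 2) \<le> exp (- a)" by simp
  have "emeasure hermite_gauss {u. ennreal y \<le> Lp_mass q I u} \<le> ennreal (2 * exp (q / 2) * exp (- ((y / S) powr (2 / q)) / 2))"
    by (rule Lp_mass_tail[OF I(1) q S _ y]) (unfold S_def, rule nn_integral_green_diag[OF I \<kappa>])
  also have "\<dots> \<le> ennreal (2 * exp (q / 2) * exp (- a))" using e by (intro ennreal_leI mult_left_mono) auto
  finally show ?thesis .
qed

text \<open>The ranges are cut at \<open>\<lambda> ~ s\<^bsup>2b\<^esup>\<close> and \<open>\<lambda> ~ s\<^bsup>\<beta>/2\<^esup>\<close>, and the middle field at height \<open>s\<^bsup>b\<^esup>\<close>, where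
  \<open>1/4 < b < 1/(p - 2)\<close>; such a \<open>b\<close> exists exactly when \<open>p < 6\<close>.\<close>

lemma weight_tail:
  assumes p: "2 < p" "p < 6" and K: "0 < K" and a: "0 < a"
  shows "\<exists>C\<ge>0. \<forall>N. \<forall>s\<ge>0. emeasure hermite_gauss {u. \<bar>wick {0..N} u\<bar> \<le> K \<and> ennreal s \<le> Lp_mass p {0..N} u} \<le> ennreal (C * exp (- a * s))"
proof -
  define b where "b = (1 / 4 + 1 / (p - 2)) / 2"
  have b4: "1 / 4 < b" and bp: "b * (p - 2) < 1"
  proof -
    have "1 / 4 < 1 / (p - 2)" using p by (simp add: field_simps)
    then show "1 / 4 < b" by (simp add: b_def)
    have "b < 1 / (p - 2)" using \<open>1 / 4 < 1 / (p - 2)\<close> by (simp add: b_def)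
    then show "b * (p - 2) < 1" using p by (simp add: field_simps)
  qed
  \<comment> \<open>The exponent of the middle tail is of order s^e2, and e2 tends to 4 b > 1 as q
    grows; this q is already large enough for e2 > 1.\<close>
  define q where "q = max 8 (2 * b * (p + 4) / (4 * b - 1))"
  have q: "8 \<le> q" "p \<le> q" using p by (auto simp: q_def)
  \<comment> \<open>Chosen so that \<beta>/2 times p/2 - \<kappa> equals p: the high range then
    gains a factor s^p, which makes its tail exponent (1 + p) 2/p exceed 1. Also \<beta> > 1, as the
    lower tail of the mass requires.\<close>
  define \<beta> where "\<beta> = 8 * p / (p - 2)"
  have \<beta>: "4 * b \<le> \<beta>" "1 < \<beta>"
  proof -
    have "4 * (b * (p - 2)) \<le> 4 * 1" using bp by (intro mult_left_mono) auto
    also have "\<dots> \<le> 8 * p" using p by simp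
    finally show "4 * b \<le> \<beta>" using p by (simp add: \<beta>_def field_simps)
    show "1 < \<beta>" using p by (simp add: \<beta>_def field_simps)
  qed
  define \<kappa> where "\<kappa> = (p + 2) / 4"
  have \<kappa>: "1 < \<kappa>" "\<kappa> \<le> p / 2" "p / 2 - \<kappa> = (p - 2) / 4" using p by (auto simp: \<kappa>_def field_simps)
  define \<theta> where "\<theta> = 4 powr (- p) / 3"
  have \<theta>: "\<theta> > 0" by (simp add: \<theta>_def)
  define \<eta> where "\<eta> = (1 - b * (p - 2)) / p"
  have \<eta>: "\<eta> > 0" "b * (p - 2) + \<eta> < 1" "(2 * b + \<eta>) * ((p - 2) / 2) + \<eta> < 1"
  proof -
    show "\<eta> > 0" using bp p by (simp add: \<eta>_def)
    have pe: "\<eta> * p = 1 - b * (p - 2)" using p by (simp add: \<eta>_def)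
    have "\<eta> * 1 < \<eta> * p" using \<open>\<eta> > 0\<close> p by (intro mult_strict_left_mono) auto
    then show "b * (p - 2) + \<eta> < 1" using pe by simp
    have "(2 * b + \<eta>) * ((p - 2) / 2) + \<eta> = b * (p - 2) + \<eta> * p / 2" by (simp add: field_simps)
    also have "\<dots> < 1"
    proof -
      have "x + (1 - x) / 2 < 1" if "x < 1" for x :: real using that by (simp add: field_simps)
      from this[OF bp] show ?thesis unfolding pe .
    qed
    finally show "(2 * b + \<eta>) * ((p - 2) / 2) + \<eta> < 1" .
  qed
  define e2 where "e2 = (b * (q - p) + 1 + 2 * b * (q / 2 - 2)) * (2 / q)"
  have e2: "1 < e2"
  proof -
    have "2 * b * (p + 4) \<le> (4 * b - 1) * q" using b4 by (simp add: q_def field_simps max_def)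
    then have "q < 2 * (b * (q - p) + 1 + 2 * b * (q / 2 - 2))" by (simp add: algebra_simps)
    then show ?thesis using q by (simp add: e2_def field_simps)
  qed
  define c2 where "c2 = \<theta> / 2 / (2 powr (q / 2 - 2) * decay_const 2)"
  define c3 where "c3 = \<theta> / (2 powr (p / 2 - \<kappa>) * decay_const \<kappa>)"
  have c2: "c2 > 0" and c3: "c3 > 0" using \<theta> decay_const_pos[of 2] decay_const_pos[OF \<kappa>(1)] by (auto simp: c2_def c3_def)
  \<comment> \<open>After s \<ge> 1 the conditions are, in order: logarithm absorbed, low range,
    bounded part of the middle range, lower tail of the mass, middle tail, high tail.\<close>
  have "eventually (\<lambda>s. 1 \<le> s \<and> (K + 4 + ln 3) + \<beta> * ln s \<le> s powr \<eta> \<and>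
      6 powr ((p - 2) / 2) * s powr ((2 * b + \<eta>) * ((p - 2) / 2) + \<eta>) < \<theta> * s powr 1 \<and>
      1 * s powr (b * (p - 2) + \<eta>) < \<theta> / 2 * s powr 1 \<and>
      a * s powr 1 < 1 * s powr \<beta> \<and>
      2 * a * s powr 1 < c2 powr (2 / q) * s powr e2 \<and>
      2 * a * s powr 1 < c3 powr (2 / p) * s powr ((1 + p) * (2 / p))) at_top"
    using \<eta> \<theta> \<beta> e2 c2 c3 p
    by (intro eventually_conj eventually_ge_at_top eventually_ln_le_powr eventually_mult_powr_less) (auto simp: field_simps)
  then obtain s0 where s0: "\<forall>s\<ge>s0. 1 \<le> s \<and> (K + 4 + ln 3) + \<beta> * ln s \<le> s powr \<eta> \<and>
      6 powr ((p - 2) / 2) * s powr ((2 * b + \<eta>) * ((p - 2) / 2) + \<eta>) < \<theta> * s powr 1 \<and>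
      1 * s powr (b * (p - 2) + \<eta>) < \<theta> / 2 * s powr 1 \<and>
      a * s powr 1 < 1 * s powr \<beta> \<and>
      2 * a * s powr 1 < c2 powr (2 / q) * s powr e2 \<and>
      2 * a * s powr 1 < c3 powr (2 / p) * s powr ((1 + p) * (2 / p))"
    unfolding eventually_at_top_linorder by (elim exE)
  define C1 where "C1 = 1 + 2 * exp (q / 2) + 2 * exp (p / 2)"
  have large: "emeasure hermite_gauss {u. \<bar>wick {0..N} u\<bar> \<le> K \<and> ennreal s \<le> Lp_mass p {0..N} u} \<le> ennreal (C1 * exp (- a * s))"
    if s: "s \<ge> s0" for N s
  proof -
    note S0 = s0[rule_format, OF s]
    have s1: "1 \<le> s" by (rule S0[THEN conjunct1])
    then have one: "s powr 1 = s" by simp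
    note S = S0[unfolded one mult_1]
    \<comment> \<open>Frequencies grow like the square root of the index, so the index s^(4 b)
      corresponds to the frequency s^(2 b).\<close>
    define m1 where "m1 = nat \<lceil>s powr (4 * b)\<rceil>"
    define m2 where "m2 = nat \<lceil>s powr \<beta>\<rceil>"
    have ge1: "1 \<le> s powr r" if "r \<ge> 0" for r using s1 that by (rule ge_one_powr_ge_zero)
    have m1: "s powr (4 * b) \<le> real m1" "real m1 \<le> 2 * s powr (4 * b)"
      unfolding m1_def using ge1[of "4 * b"] b4 by linarith+
    have m2: "s powr \<beta> \<le> real m2" "real m2 \<le> 2 * s powr \<beta>"
      unfolding m2_def using ge1[of \<beta>] \<beta> by linarith+
    have m12: "m1 \<le> m2" unfolding m1_def m2_def using \<beta> s1 by (intro nat_mono ceiling_mono powr_mono) auto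
    have f1: "s powr (2 * b) \<le> freq m1" "freq m1 \<le> 3 * s powr (2 * b)"
    proof -
      have sq: "(s powr (2 * b))\<^sup>2 = s powr (4 * b)" using s1 by (simp add: powr_power)
      show "s powr (2 * b) \<le> freq m1"
        by (rule power2_le_imp_le) (use sq m1 in \<open>auto simp: freq_power2\<close>)
      show "freq m1 \<le> 3 * s powr (2 * b)"
        by (rule power2_le_imp_le) (use sq m1 ge1[of "4 * b"] b4 in \<open>auto simp: freq_power2 power_mult_distrib\<close>)
    qed
    have f2: "s powr (\<beta> / 2) \<le> freq m2"
    proof (rule power2_le_imp_le)
      have "(s powr (\<beta> / 2))\<^sup>2 = s powr \<beta>" using s1 by (simp add: powr_power)
      then show "(s powr (\<beta> / 2))\<^sup>2 \<le> (freq m2)\<^sup>2" using m2 by (simp add: freq_power2)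
    qed simp
    define Q where "Q = K + 4 + ln (real m2 + 1)"
    have Q: "0 < Q" "Q \<le> s powr \<eta>"
    proof -
      have "0 \<le> ln (real m2 + 1)" by (intro ln_ge_zero) simp
      then show "0 < Q" using K unfolding Q_def by linarith
      have "ln (real m2 + 1) \<le> ln (3 * s powr \<beta>)"
        using m2 ge1[of \<beta>] \<beta> by (subst ln_le_cancel_iff) auto
      also have "\<dots> = ln 3 + \<beta> * ln s" using s1 by (simp add: ln_mult ln_powr)
      finally show "Q \<le> s powr \<eta>" using S by (simp add: Q_def)
    qed
    have low: "sqrt (2 * freq m1 * Q) powr (p - 2) * Q < \<theta> * s"
    proof -
      have "sqrt (2 * freq m1 * Q) powr (p - 2) = (2 * freq m1 * Q) powr ((p - 2) / 2)"
        using Q by (simp add: powr_half_sqrt [symmetric] powr_powr)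
      also have "\<dots> \<le> (6 * s powr (2 * b + \<eta>)) powr ((p - 2) / 2)"
      proof (intro powr_mono2)
        have "freq m1 * Q \<le> (3 * s powr (2 * b)) * s powr \<eta>" using f1 Q by (intro mult_mono) auto
        then show "2 * freq m1 * Q \<le> 6 * s powr (2 * b + \<eta>)" by (simp add: powr_add mult_ac)
      qed (use p Q in auto)
      also have "\<dots> = 6 powr ((p - 2) / 2) * s powr ((2 * b + \<eta>) * ((p - 2) / 2))"
        by (simp add: powr_mult powr_powr)
      finally have "sqrt (2 * freq m1 * Q) powr (p - 2) * Q \<le> 6 powr ((p - 2) / 2) * s powr ((2 * b + \<eta>) * ((p - 2) / 2)) * s powr \<eta>"
        using Q by (intro mult_mono) auto
      also have "\<dots> = 6 powr ((p - 2) / 2) * s powr ((2 * b + \<eta>) * ((p - 2) / 2) + \<eta>)"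
        by (simp only: powr_add mult.assoc)
      also have "\<dots> < \<theta> * s" using S by blast
      finally show ?thesis .
    qed
    have mid: "(s powr b) powr (p - 2) * Q \<le> \<theta> / 2 * s"
    proof -
      have "(s powr b) powr (p - 2) * Q \<le> s powr (b * (p - 2)) * s powr \<eta>"
        unfolding powr_powr using Q by (intro mult_left_mono) auto
      also have "\<dots> = s powr (b * (p - 2) + \<eta>)" by (simp only: powr_add)
      finally show ?thesis using S by linarith
    qed
    define I2 where "I2 = {0..N} \<inter> {m1..<m2}"
    define I3 where "I3 = {0..N} \<inter> {m2..}"
    have I: "finite I2" "I2 \<subseteq> {m1..}" "finite I3" "I3 \<subseteq> {m2..}" by (auto simp: I2_def I3_def)
    define y2 where "y2 = (s powr b) powr (q - p) * (\<theta> / 2 * s)"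
    define E1 where "E1 = {u. wick I3 u \<le> - 3}"
    define E2 where "E2 = {u. ennreal y2 \<le> Lp_mass q I2 u}"
    define E3 where "E3 = {u. ennreal (\<theta> * s) \<le> Lp_mass p I3 u}"
    have Em: "E1 \<in> G.events" "E2 \<in> G.events" "E3 \<in> G.events"
    proof -
      have "{u \<in> space hermite_gauss. wick I3 u \<le> - 3} \<in> G.events" "{u \<in> space hermite_gauss. ennreal y2 \<le> Lp_mass q I2 u} \<in> G.events"
        "{u \<in> space hermite_gauss. ennreal (\<theta> * s) \<le> Lp_mass p I3 u} \<in> G.events" by measurable
      then show "E1 \<in> G.events" "E2 \<in> G.events" "E3 \<in> G.events" by (simp_all add: E1_def E2_def E3_def)
    qed
    have sub: "{u. \<bar>wick {0..N} u\<bar> \<le> K \<and> ennreal s \<le> Lp_mass p {0..N} u} \<subseteq> E1 \<union> (E2 \<union> E3)"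
    proof
      fix u assume u: "u \<in> {u. \<bar>wick {0..N} u\<bar> \<le> K \<and> ennreal s \<le> Lp_mass p {0..N} u}"
      have "wick I3 u \<le> - 3 \<or> ennreal ((s powr b) powr (q - p) * (4 powr (- p) / 6 * s)) \<le> Lp_mass q I2 u \<or> ennreal (4 powr (- p) / 3 * s) \<le> Lp_mass p I3 u"
        unfolding I2_def I3_def
        by (rule tail_inclusion[where Q = Q and K = K])
           (use p q m12 s1 K u low mid in \<open>auto simp: Q_def \<theta>_def\<close>)
      then show "u \<in> E1 \<union> (E2 \<union> E3)" by (auto simp: E1_def E2_def E3_def y2_def \<theta>_def)
    qed
    have P1: "emeasure hermite_gauss E1 \<le> ennreal (exp (- (a * s)))"
    proof -
      have "emeasure hermite_gauss E1 \<le> ennreal (exp (- (freq m2)\<^sup>2))"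
        unfolding E1_def by (rule wick_lower_tail[OF I(3,4)])
      also have "\<dots> \<le> ennreal (exp (- (a * s)))"
      proof -
        have "a * s \<le> (freq m2)\<^sup>2" using S m2 by (simp add: freq_power2)
        then show ?thesis by (intro ennreal_leI) simp
      qed
      finally show ?thesis .
    qed
    have P2: "emeasure hermite_gauss E2 \<le> ennreal (2 * exp (q / 2) * exp (- (a * s)))"
      unfolding E2_def
    proof (rule Lp_mass_tail_freq[OF I(1,2), where \<kappa> = 2 and s = "s powr (2 * b)"])
      have "y2 / ((2 / s powr (2 * b)) powr (q / 2 - 2) * decay_const 2) = c2 * s powr (b * (q - p) + 1 + 2 * b * (q / 2 - 2))"
      proof -
        have "(2 / s powr (2 * b)) powr (q / 2 - 2) = 2 powr (q / 2 - 2) / s powr (2 * b * (q / 2 - 2))"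
          by (simp add: powr_divide powr_powr)
        moreover have "s powr (b * (q - p) + 1 + 2 * b * (q / 2 - 2)) = s powr (b * (q - p)) * s * s powr (2 * b * (q / 2 - 2))"
          using s1 by (simp add: powr_add)
        ultimately show ?thesis by (simp add: y2_def c2_def powr_powr)
      qed
      then have "(y2 / ((2 / s powr (2 * b)) powr (q / 2 - 2) * decay_const 2)) powr (2 / q) = c2 powr (2 / q) * s powr e2"
        using c2 by (simp add: powr_mult powr_powr e2_def)
      then show "2 * (a * s) \<le> (y2 / ((2 / s powr (2 * b)) powr (q / 2 - 2) * decay_const 2)) powr (2 / q)" using S by simp
      show "0 < y2" using \<theta> s1 by (simp add: y2_def)
    qed (use q f1 s1 in auto)
    have P3: "emeasure hermite_gauss E3 \<le> ennreal (2 * exp (p / 2) * exp (- (a * s)))"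
      unfolding E3_def
    proof (rule Lp_mass_tail_freq[OF I(3,4) \<kappa>(1,2), where s = "s powr (\<beta> / 2)"])
      have "\<theta> * s / ((2 / s powr (\<beta> / 2)) powr (p / 2 - \<kappa>) * decay_const \<kappa>) = c3 * s powr (1 + p)"
      proof -
        have "\<beta> / 2 * (p / 2 - \<kappa>) = p" unfolding \<kappa>(3) \<beta>_def using p by (simp add: field_simps)
        then have "(2 / s powr (\<beta> / 2)) powr (p / 2 - \<kappa>) = 2 powr (p / 2 - \<kappa>) / s powr p"
          by (simp only: powr_divide powr_powr)
        moreover have "s powr (1 + p) = s * s powr p"
          using s1 by (simp add: powr_add)
        ultimately show ?thesis by (simp add: c3_def)
      qed
      then have "(\<theta> * s / ((2 / s powr (\<beta> / 2)) powr (p / 2 - \<kappa>) * decay_const \<kappa>)) powr (2 / p) = c3 powr (2 / p) * s powr ((1 + p) * (2 / p))"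
        using c3 by (simp add: powr_mult powr_powr)
      then show "2 * (a * s) \<le> (\<theta> * s / ((2 / s powr (\<beta> / 2)) powr (p / 2 - \<kappa>) * decay_const \<kappa>)) powr (2 / p)" using S by simp
    qed (use \<theta> f2 s1 in auto)
    have "emeasure hermite_gauss {u. \<bar>wick {0..N} u\<bar> \<le> K \<and> ennreal s \<le> Lp_mass p {0..N} u} \<le> emeasure hermite_gauss (E1 \<union> (E2 \<union> E3))"
      using sub Em by (intro emeasure_mono) auto
    also have "\<dots> \<le> emeasure hermite_gauss E1 + (emeasure hermite_gauss E2 + emeasure hermite_gauss E3)"
      using Em by (intro order_trans[OF emeasure_subadditive] add_left_mono emeasure_subadditive) auto
    also have "\<dots> \<le> ennreal (exp (- (a * s))) + (ennreal (2 * exp (q / 2) * exp (- (a * s))) + ennreal (2 * exp (p / 2) * exp (- (a * s))))"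
      by (intro add_mono P1 P2 P3)
    also have "\<dots> = ennreal (C1 * exp (- a * s))"
      by (simp add: C1_def distrib_right flip: ennreal_plus)
    finally show ?thesis .
  qed
  \<comment> \<open>The second summand covers s < s0 by making the bound at least 1.\<close>
  define C where "C = C1 + exp (a * \<bar>s0\<bar>)"
  have "emeasure hermite_gauss {u. \<bar>wick {0..N} u\<bar> \<le> K \<and> ennreal s \<le> Lp_mass p {0..N} u} \<le> ennreal (C * exp (- a * s))" if "s \<ge> 0" for N s
  proof (cases "s \<ge> s0")
    case True
    have "C1 * exp (- a * s) \<le> C * exp (- a * s)" by (intro mult_right_mono) (auto simp: C_def)
    then show ?thesis by (rule order_trans[OF large[OF True] ennreal_leI])
  next
    case False
    have "a * s \<le> a * \<bar>s0\<bar>" using False a by (intro mult_left_mono) auto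
    then have "1 \<le> exp (a * \<bar>s0\<bar>) * exp (- a * s)" by (simp add: exp_add [symmetric])
    also have "\<dots> \<le> C * exp (- a * s)" by (intro mult_right_mono) (auto simp: C_def C1_def add_nonneg_nonneg)
    finally have "ennreal 1 \<le> ennreal (C * exp (- a * s))" by (rule ennreal_leI)
    then show ?thesis using G.emeasure_le_1[of "{u. \<bar>wick {0..N} u\<bar> \<le> K \<and> ennreal s \<le> Lp_mass p {0..N} u}"] unfolding ennreal_1 by (rule order_trans[rotated])
  qed
  moreover have "C \<ge> 0" by (simp add: C_def C1_def)
  ultimately show ?thesis by blast
qed

text \<open>The L^p mass is layered by its integer part: the r-th power of the weight grows like exp
  (c s) with c = r/p, so a tail of rate c + 1 leaves a geometric series, uniformly in N.\<close>

lemma weight_trunc_moments: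
  assumes p: "2 < p" "p < 6" and K: "0 < K" and r: "0 < r"
  shows "\<exists>C. \<forall>N. (\<integral>\<^sup>+u. ennreal (weight_trunc hermite_gauss K p N u powr r) \<partial>hermite_gauss) \<le> ennreal C"
proof -
  define c where "c = r / p"
  have c: "c > 0" using r p by (simp add: c_def)
  obtain C where C: "C \<ge> 0" "\<And>N s. s \<ge> 0 \<Longrightarrow> emeasure hermite_gauss {u. \<bar>wick {0..N} u\<bar> \<le> K \<and> ennreal s \<le> Lp_mass p {0..N} u} \<le> ennreal (C * exp (- (c + 1) * s))"
    using weight_tail[OF p K, of "c + 1"] c by auto
  define h where "h k = exp c * C * exp (- 1) ^ k" for k
  have h: "summable h" unfolding h_def by (intro summable_mult summable_geometric) simp
  have "(\<integral>\<^sup>+u. ennreal (weight_trunc hermite_gauss K p N u powr r) \<partial>hermite_gauss) \<le> ennreal (suminf h)" for N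
  proof -
    define A where "A k = {u. \<bar>wick {0..N} u\<bar> \<le> K \<and> ennreal (real k) \<le> Lp_mass p {0..N} u}" for k
    have [measurable]: "A k \<in> G.events" for k
    proof -
      have "{u \<in> space hermite_gauss. \<bar>wick {0..N} u\<bar> \<le> K \<and> ennreal (real k) \<le> Lp_mass p {0..N} u} \<in> G.events" by measurable
      then show ?thesis by (simp add: A_def)
    qed
    have "ennreal (weight_trunc hermite_gauss K p N u powr r) \<le> (\<Sum>k. ennreal (exp (c * (real k + 1))) * indicator (A k) u)" for u
    proof (cases "\<bar>wick {0..N} u\<bar> \<le> K")
      case True
      define X where "X = enn2real (Lp_mass p {0..N} u)"
      have X: "Lp_mass p {0..N} u = ennreal X" "X \<ge> 0"
        using Lp_mass_finite[of p "{0..N}" u] p by (auto simp: X_def)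
      define k where "k = nat \<lfloor>X\<rfloor>"
      have k: "real k \<le> X" "X \<le> real k + 1" using X(2) unfolding k_def by linarith+
      have uA: "u \<in> A k" using True k X by (simp add: A_def ennreal_leI)
      have "weight_trunc hermite_gauss K p N u powr r = exp (c * X)"
        using True p by (simp add: weight_trunc_eq X_def [symmetric] powr_def c_def)
      also have "\<dots> \<le> exp (c * (real k + 1))" using k c by simp
      finally have "ennreal (weight_trunc hermite_gauss K p N u powr r) \<le> ennreal (exp (c * (real k + 1))) * indicator (A k) u"
        using uA by (simp add: ennreal_leI)
      also have "\<dots> \<le> (\<Sum>k. ennreal (exp (c * (real k + 1))) * indicator (A k) u)"
      proof -
        have "f k \<le> (\<Sum>k. f k)" for f :: "nat \<Rightarrow> ennreal"
          using sum_le_suminf[of f "{k}"] by auto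
        then show ?thesis .
      qed
      finally show ?thesis .
    next
      case False
      then show ?thesis using p by (simp add: weight_trunc_eq)
    qed
    then have "(\<integral>\<^sup>+u. ennreal (weight_trunc hermite_gauss K p N u powr r) \<partial>hermite_gauss) \<le> (\<integral>\<^sup>+u. (\<Sum>k. ennreal (exp (c * (real k + 1))) * indicator (A k) u) \<partial>hermite_gauss)"
      by (rule nn_integral_mono)
    also have "\<dots> = (\<Sum>k. \<integral>\<^sup>+u. ennreal (exp (c * (real k + 1))) * indicator (A k) u \<partial>hermite_gauss)"
      by (rule nn_integral_suminf) measurable
    also have "\<dots> = (\<Sum>k. ennreal (exp (c * (real k + 1))) * emeasure hermite_gauss (A k))"
      by (simp add: nn_integral_cmult_indicator)
    also have "\<dots> \<le> (\<Sum>k. ennreal (h k))"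
    proof (intro suminf_le)
      fix k
      have "ennreal (exp (c * (real k + 1))) * emeasure hermite_gauss (A k) \<le> ennreal (exp (c * (real k + 1))) * ennreal (C * exp (- (c + 1) * real k))"
        unfolding A_def by (intro mult_left_mono C) auto
      also have "\<dots> = ennreal (exp (c * (real k + 1)) * (C * exp (- (c + 1) * real k)))"
        by (rule ennreal_mult' [symmetric]) simp
      also have "exp (c * (real k + 1)) * (C * exp (- (c + 1) * real k)) = h k"
        by (simp add: h_def exp_of_nat_mult [symmetric] exp_add [symmetric] algebra_simps)
      finally show "ennreal (exp (c * (real k + 1))) * emeasure hermite_gauss (A k) \<le> ennreal (h k)" .
    qed auto
    also have "\<dots> = ennreal (suminf h)" using h C by (intro suminf_ennreal2) (auto simp: h_def)
    finally show ?thesis .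
  qed
  then show ?thesis by blast
qed

section \<open>Conclusion\<close>

text \<open>A form of Vitali's theorem: bounded moments of order 2 r give uniform integrability, and
  almost everywhere convergence along subsequences takes the place of convergence in
  measure.\<close>

lemma (in finite_measure) Lp_convergence_of_subsequences:
  fixes f :: "nat \<Rightarrow> 'a \<Rightarrow> real"
  assumes fm [measurable]: "\<And>n. f n \<in> borel_measurable M" and gm [measurable]: "g \<in> borel_measurable M" and r: "0 < r"
    and bound: "\<And>n. (\<integral>\<^sup>+x. ennreal (\<bar>f n x\<bar> powr (2 * r)) \<partial>M) \<le> ennreal C"
    and sub: "\<And>\<phi>::nat \<Rightarrow> nat. strict_mono \<phi> \<Longrightarrow> \<exists>\<psi>::nat \<Rightarrow> nat. strict_mono \<psi> \<and> (AE x in M. (\<lambda>k. f (\<phi> (\<psi> k)) x) \<longlonglongrightarrow> g x)"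
  shows "(\<integral>\<^sup>+x. ennreal (\<bar>g x\<bar> powr r) \<partial>M) < \<top>"
    and "(\<lambda>n. \<integral>\<^sup>+x. ennreal (\<bar>f n x - g x\<bar> powr r) \<partial>M) \<longlonglongrightarrow> 0"
proof -
  have gC: "(\<integral>\<^sup>+x. ennreal (\<bar>g x\<bar> powr (2 * r)) \<partial>M) \<le> ennreal C"
  proof -
    from sub[of id] obtain \<psi> :: "nat \<Rightarrow> nat" where "strict_mono \<psi>" and \<psi>: "AE x in M. (\<lambda>k. f (\<psi> k) x) \<longlonglongrightarrow> g x"
      by (auto simp: strict_mono_def)
    have "(\<integral>\<^sup>+x. ennreal (\<bar>g x\<bar> powr (2 * r)) \<partial>M) = (\<integral>\<^sup>+x. liminf (\<lambda>k. ennreal (\<bar>f (\<psi> k) x\<bar> powr (2 * r))) \<partial>M)"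
    proof (rule nn_integral_cong_AE, use \<psi> in eventually_elim)
      case (elim x)
      then have "(\<lambda>k. ennreal (\<bar>f (\<psi> k) x\<bar> powr (2 * r))) \<longlonglongrightarrow> ennreal (\<bar>g x\<bar> powr (2 * r))"
        using r by (intro tendsto_intros tendsto_ennrealI) auto
      from lim_imp_Liminf[OF sequentially_bot this] show ?case by simp
    qed
    also have "\<dots> \<le> liminf (\<lambda>k. \<integral>\<^sup>+x. ennreal (\<bar>f (\<psi> k) x\<bar> powr (2 * r)) \<partial>M)"
      by (rule nn_integral_liminf) measurable
    also have "\<dots> \<le> ennreal C"
      by (intro Liminf_le always_eventually allI bound sequentially_bot)
    finally show ?thesis .
  qed
  have pt: "w powr r \<le> L + w powr (2 * r) / L" if "0 \<le> w" "0 < L" for w L :: real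
  proof (cases "w powr r \<le> L")
    case False
    then have "w powr r * L \<le> w powr r * w powr r" by (intro mult_left_mono) auto
    then have "w powr r \<le> w powr (2 * r) / L" using that by (simp add: field_simps powr_add [symmetric])
    then show ?thesis using that by simp
  qed (use that in \<open>simp add: add_increasing2\<close>)
  show "(\<integral>\<^sup>+x. ennreal (\<bar>g x\<bar> powr r) \<partial>M) < \<top>"
  proof -
    have "(\<integral>\<^sup>+x. ennreal (\<bar>g x\<bar> powr r) \<partial>M) \<le> (\<integral>\<^sup>+x. 1 + ennreal (\<bar>g x\<bar> powr (2 * r)) \<partial>M)"
    proof (intro nn_integral_mono)
      fix x
      have "ennreal (\<bar>g x\<bar> powr r) \<le> ennreal (1 + \<bar>g x\<bar> powr (2 * r))"
        using pt[of "\<bar>g x\<bar>" 1] by (intro ennreal_leI) simp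
      then show "ennreal (\<bar>g x\<bar> powr r) \<le> 1 + ennreal (\<bar>g x\<bar> powr (2 * r))" by simp
    qed
    also have "\<dots> = emeasure M (space M) + (\<integral>\<^sup>+x. ennreal (\<bar>g x\<bar> powr (2 * r)) \<partial>M)"
      by (subst nn_integral_add) auto
    also have "\<dots> < \<top>" using gC by (auto simp: less_top[symmetric] top_unique)
    finally show ?thesis .
  qed
  define C' where "C' = 2 powr (2 * r) * (2 * \<bar>C\<bar>)"
  have C'0: "C' \<ge> 0" by (simp add: C'_def)
  have diff: "(\<integral>\<^sup>+x. ennreal (\<bar>f n x - g x\<bar> powr (2 * r)) \<partial>M) \<le> ennreal C'" for n
  proof -
    have "(\<integral>\<^sup>+x. ennreal (norm (f n x - g x) powr (2 * r)) \<partial>M) \<le>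
      ennreal ((1 + 1) powr (2 * r)) * (\<integral>\<^sup>+x. ennreal (norm (f n x) powr (2 * r)) \<partial>M) + ennreal ((1 + 1 / 1) powr (2 * r)) * (\<integral>\<^sup>+x. ennreal (norm ((f n x - g x) - f n x) powr (2 * r)) \<partial>M)"
      by (rule nn_integral_powr_triangle) (use r in auto)
    also have "\<dots> \<le> ennreal (2 powr (2 * r)) * ennreal \<bar>C\<bar> + ennreal (2 powr (2 * r)) * ennreal \<bar>C\<bar>"
      using bound[of n] gC by (auto intro!: add_mono mult_left_mono elim!: order_trans intro: ennreal_leI)
    also have "\<dots> = ennreal C'"
      by (simp add: C'_def ennreal_mult' [symmetric] flip: ennreal_plus)
    finally show ?thesis by simp
  qed
  show "(\<lambda>n. \<integral>\<^sup>+x. ennreal (\<bar>f n x - g x\<bar> powr r) \<partial>M) \<longlonglongrightarrow> 0"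
    unfolding ennreal_tendsto_0_iff'
  proof (intro allI impI)
    fix e :: real assume e: "e > 0"
    let ?I = "\<lambda>n. \<integral>\<^sup>+x. ennreal (\<bar>f n x - g x\<bar> powr r) \<partial>M"
    show "eventually (\<lambda>n. ?I n < ennreal e) sequentially"
    proof (rule ccontr)
      assume "\<not> eventually (\<lambda>n. ?I n < ennreal e) sequentially"
      then have "infinite {n. \<not> ?I n < ennreal e}"
        by (auto simp: eventually_sequentially infinite_nat_iff_unbounded_le)
      then obtain \<phi> :: "nat \<Rightarrow> nat" where \<phi>: "strict_mono \<phi>" "\<And>n. \<not> ?I (\<phi> n) < ennreal e"
        using infinite_enumerate by blast
      from sub[OF \<phi>(1)] obtain \<psi> :: "nat \<Rightarrow> nat" where \<psi>: "AE x in M. (\<lambda>k. f (\<phi> (\<psi> k)) x) \<longlonglongrightarrow> g x" by blast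
      \<comment> \<open>Above the height L the moment of order 2 r contributes at most C' / L \<le>
        e/4; below it dominated convergence applies.\<close>
      define L where "L = 4 * (C' + 1) / e"
      have L: "L > 0" "C' / L \<le> e / 4" using C'0 e by (auto simp: L_def field_simps)
      have "(\<lambda>k. \<integral>\<^sup>+x. ennreal (min (\<bar>f (\<phi> (\<psi> k)) x - g x\<bar> powr r) L) \<partial>M) \<longlonglongrightarrow> (\<integral>\<^sup>+x. 0 \<partial>M)"
      proof (rule nn_integral_dominated_convergence[where w = "\<lambda>_. ennreal L"])
        show "AE x in M. (\<lambda>k. ennreal (min (\<bar>f (\<phi> (\<psi> k)) x - g x\<bar> powr r) L)) \<longlonglongrightarrow> 0"
          using \<psi>
        proof eventually_elim
          case (elim x)
          have "(\<lambda>k. \<bar>f (\<phi> (\<psi> k)) x - g x\<bar> powr r) \<longlonglongrightarrow> 0 powr r"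
            using r tendsto_rabs[OF LIM_zero[OF elim]] by (intro tendsto_powr') auto
          from tendsto_min[OF this tendsto_const[of L]] have "(\<lambda>k. min (\<bar>f (\<phi> (\<psi> k)) x - g x\<bar> powr r) L) \<longlonglongrightarrow> 0"
            using r L by simp
          from tendsto_ennrealI[OF this] show ?case by simp
        qed
        show "(\<integral>\<^sup>+x. ennreal L \<partial>M) < \<infinity>" by (simp add: ennreal_mult_eq_top_iff less_top[symmetric])
      qed (auto intro!: ennreal_leI)
      then have "(\<lambda>k. \<integral>\<^sup>+x. ennreal (min (\<bar>f (\<phi> (\<psi> k)) x - g x\<bar> powr r) L) \<partial>M) \<longlonglongrightarrow> 0" by simp
      from ennreal_tendsto_0_less[OF this, of "e / 2"] e obtain k
        where k: "(\<integral>\<^sup>+x. ennreal (min (\<bar>f (\<phi> (\<psi> k)) x - g x\<bar> powr r) L) \<partial>M) < ennreal (e / 2)" by auto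
      let ?n = "\<phi> (\<psi> k)"
      have "?I ?n \<le> (\<integral>\<^sup>+x. ennreal (min (\<bar>f ?n x - g x\<bar> powr r) L) + ennreal (1 / L) * ennreal (\<bar>f ?n x - g x\<bar> powr (2 * r)) \<partial>M)"
      proof (intro nn_integral_mono)
        fix x
        let ?w = "\<bar>f ?n x - g x\<bar>"
        have "?w powr r \<le> min (?w powr r) L + 1 / L * ?w powr (2 * r)"
        proof (cases "?w powr r \<le> L")
          case False
          then have "?w powr r * L \<le> ?w powr r * ?w powr r" by (intro mult_left_mono) auto
          then have "?w powr r \<le> ?w powr (2 * r) / L" using L by (simp add: field_simps powr_add [symmetric])
          then show ?thesis using L False by (simp add: min_def)
        qed (use L in simp)
        then show "ennreal (?w powr r) \<le> ennreal (min (?w powr r) L) + ennreal (1 / L) * ennreal (?w powr (2 * r))"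
          using L by (simp add: ennreal_mult' [symmetric] ennreal_leI flip: ennreal_plus)
      qed
      also have "\<dots> = (\<integral>\<^sup>+x. ennreal (min (\<bar>f ?n x - g x\<bar> powr r) L) \<partial>M) + ennreal (1 / L) * (\<integral>\<^sup>+x. ennreal (\<bar>f ?n x - g x\<bar> powr (2 * r)) \<partial>M)"
        by (subst nn_integral_add) (auto simp: nn_integral_cmult)
      also have "\<dots> \<le> ennreal (e / 2) + ennreal (1 / L) * ennreal C'"
        by (intro add_mono mult_left_mono diff less_imp_le[OF k]) auto
      also have "\<dots> = ennreal (e / 2 + C' / L)"
        using L C'0 e by (simp add: ennreal_mult' [symmetric] flip: ennreal_plus)
      also have "\<dots> < ennreal e" by (rule ennreal_lessI[OF e]) (use L(2) e in linarith)
      finally show False using \<phi>(2)[of "\<psi> k"] by simp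
    qed
  qed
qed

section \<open>Functions known up to null sets\<close>

lemma density_cong_AE:
  assumes "AE x in M. f x = g x" shows "density M f = density M g"
proof -
  have "(\<integral>\<^sup>+x. f x * indicator A x \<partial>M) = (\<integral>\<^sup>+x. g x * indicator A x \<partial>M)" for A
    using assms by (intro nn_integral_cong_AE) auto
  then show ?thesis by (simp add: density_def)
qed

text \<open>Serves \<open>weight\<close>, which is built from a choice and an infimum and is known
  only to agree almost everywhere with a Borel function.\<close>

lemma borel_measurable_completion_AE:
  fixes f g :: "'a \<Rightarrow> 'b::topological_space"
  assumes eq: "AE x in M. f x = g x" and g: "g \<in> borel_measurable M"
  shows "f \<in> borel_measurable (completion M)"
proof (rule measurableI)
  fix S :: "'b set" assume S: "S \<in> sets borel"
  have g': "g \<in> borel_measurable (completion M)" using g by (rule measurable_completion)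
  have 1: "Measurable.pred (completion M) (\<lambda>x. f x \<noteq> g x)"
    by (rule sets_completion_AE) (use eq in auto)
  have 2: "Measurable.pred (completion M) (\<lambda>x. f x \<in> S \<and> f x \<noteq> g x)"
    by (rule sets_completion_AE) (use eq in auto)
  have 3: "Measurable.pred (completion M) (\<lambda>x. g x \<in> S)"
    using g' S by measurable
  have "Measurable.pred (completion M) (\<lambda>x. (g x \<in> S \<and> \<not> f x \<noteq> g x) \<or> (f x \<in> S \<and> f x \<noteq> g x))"
    using 1 2 3 by measurable
  moreover have "((g x \<in> S \<and> \<not> f x \<noteq> g x) \<or> (f x \<in> S \<and> f x \<noteq> g x)) = (f x \<in> S)" for x by auto
  ultimately show "f -` S \<inter> space (completion M) \<in> sets (completion M)"
    by (simp add: pred_def vimage_def Int_def conj_commute)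
qed auto

lemma weight_trunc_nonneg: "0 \<le> weight_trunc \<mu> K p N u"
  by (simp add: weight_trunc_def)

lemma critical_case:
  assumes K: "K > 0" and p: "p \<ge> 6"
  shows "(SUP N. Z_trunc hermite_gauss K p N) = \<top>" "(SUP N. Lp_norm hermite_gauss 1 (weight_trunc hermite_gauss K p N)) = \<top>"
    "Z_full hermite_gauss K p = \<top>"
    "\<not> (\<exists>c::ennreal. prob_space (scale_measure c (density hermite_gauss (\<lambda>u. ennreal (weight hermite_gauss K p u)))))"
proof -
  have p1: "p \<ge> 1" "p > 2" using p by auto
  note [measurable] = weight_trunc_measurable[OF p1(1)]
  show sup: "(SUP N. Z_trunc hermite_gauss K p N) = \<top>"
  proof (rule ccontr)
    assume "(SUP N. Z_trunc hermite_gauss K p N) \<noteq> \<top>"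
    then obtain c where c: "(SUP N. Z_trunc hermite_gauss K p N) = ennreal c" "c \<ge> 0" by (cases "SUP N. Z_trunc hermite_gauss K p N") auto
    obtain R N0 where R: "\<And>N. N \<ge> N0 \<Longrightarrow> ennreal (c + 1) \<le> (\<integral>\<^sup>+u. ennreal (min (weight_trunc hermite_gauss K p N u) R) \<partial>hermite_gauss)"
      using truncated_weight_unbounded[OF p K, of "c + 1"] by blast
    have "ennreal (c + 1) \<le> Z_trunc hermite_gauss K p N0"
      unfolding Z_trunc_def by (rule order_trans[OF R[OF order_refl]]) (intro nn_integral_mono ennreal_leI, simp)
    also have "\<dots> \<le> ennreal c" unfolding c(1) [symmetric] by (rule SUP_upper) simp
    finally show False using c by (simp add: ennreal_le_iff)
  qed
  have "Lp_norm hermite_gauss 1 (weight_trunc hermite_gauss K p N) = Z_trunc hermite_gauss K p N" for N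
    unfolding Lp_norm_def Let_def Z_trunc_def by (simp add: weight_trunc_nonneg enn2real_nonneg less_top)
  with sup show "(SUP N. Lp_norm hermite_gauss 1 (weight_trunc hermite_gauss K p N)) = \<top>" by simp
  obtain F where Fm [measurable]: "F \<in> borel_measurable hermite_gauss" and F: "AE u in hermite_gauss. weight hermite_gauss K p u = F u"
    and sub: "\<And>\<phi>::nat \<Rightarrow> nat. strict_mono \<phi> \<Longrightarrow> \<exists>\<psi>::nat \<Rightarrow> nat. strict_mono \<psi> \<and> (AE u in hermite_gauss. (\<lambda>k. weight_trunc hermite_gauss K p (\<phi> (\<psi> k)) u) \<longlonglongrightarrow> F u)"
    using weight_convergence[OF p1(2), of K] by blast
  from sub[of id] obtain \<psi> :: "nat \<Rightarrow> nat" where \<psi>: "strict_mono \<psi>" "AE u in hermite_gauss. (\<lambda>k. weight_trunc hermite_gauss K p (\<psi> k) u) \<longlonglongrightarrow> F u"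
    by (auto simp: strict_mono_def)
  have ZF: "Z_full hermite_gauss K p = (\<integral>\<^sup>+u. ennreal (F u) \<partial>hermite_gauss)"
    unfolding Z_full_def using F by (intro nn_integral_cong_AE) auto
  have "ennreal C \<le> (\<integral>\<^sup>+u. ennreal (F u) \<partial>hermite_gauss)" for C
  proof -
    obtain R N0 where R: "R > 0" "\<And>N. N \<ge> N0 \<Longrightarrow> ennreal C \<le> (\<integral>\<^sup>+u. ennreal (min (weight_trunc hermite_gauss K p N u) R) \<partial>hermite_gauss)"
      using truncated_weight_unbounded[OF p K, of C] by blast
    have "(\<lambda>k. \<integral>\<^sup>+u. ennreal (min (weight_trunc hermite_gauss K p (\<psi> k) u) R) \<partial>hermite_gauss) \<longlonglongrightarrow> (\<integral>\<^sup>+u. ennreal (min (F u) R) \<partial>hermite_gauss)"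
    proof (rule nn_integral_dominated_convergence[where w = "\<lambda>_. ennreal R"])
      show "AE u in hermite_gauss. (\<lambda>k. ennreal (min (weight_trunc hermite_gauss K p (\<psi> k) u) R)) \<longlonglongrightarrow> ennreal (min (F u) R)"
        using \<psi>(2) by eventually_elim (intro tendsto_ennrealI tendsto_min tendsto_const)
    qed (auto intro!: ennreal_leI simp: G.emeasure_space_1[simplified])
    moreover have "ennreal C \<le> (\<integral>\<^sup>+u. ennreal (min (weight_trunc hermite_gauss K p (\<psi> k) u) R) \<partial>hermite_gauss)" if "k \<ge> N0" for k
      using that seq_suble[OF \<psi>(1), of k] by (intro R) simp
    ultimately have "ennreal C \<le> (\<integral>\<^sup>+u. ennreal (min (F u) R) \<partial>hermite_gauss)"
      by (intro LIMSEQ_le_const) auto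
    also have "\<dots> \<le> (\<integral>\<^sup>+u. ennreal (F u) \<partial>hermite_gauss)" by (intro nn_integral_mono ennreal_leI) simp
    finally show ?thesis .
  qed
  then have Ftop: "(\<integral>\<^sup>+u. ennreal (F u) \<partial>hermite_gauss) = \<top>"
  proof (cases "\<integral>\<^sup>+u. ennreal (F u) \<partial>hermite_gauss")
    case (real c)
    assume "\<And>C. ennreal C \<le> (\<integral>\<^sup>+u. ennreal (F u) \<partial>hermite_gauss)"
    from this[of "c + 1"] show ?thesis using real by (simp add: ennreal_le_iff)
  qed auto
  then show "Z_full hermite_gauss K p = \<top>" using ZF by simp
  show "\<not> (\<exists>c::ennreal. prob_space (scale_measure c (density hermite_gauss (\<lambda>u. ennreal (weight hermite_gauss K p u)))))"
  proof
    assume "\<exists>c::ennreal. prob_space (scale_measure c (density hermite_gauss (\<lambda>u. ennreal (weight hermite_gauss K p u))))"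
    then obtain c where "prob_space (scale_measure c (density hermite_gauss (\<lambda>u. ennreal (weight hermite_gauss K p u))))" ..
    then interpret S: prob_space "scale_measure c (density hermite_gauss (\<lambda>u. ennreal (weight hermite_gauss K p u)))" .
    have "density hermite_gauss (\<lambda>u. ennreal (weight hermite_gauss K p u)) = density hermite_gauss (\<lambda>u. ennreal (F u))"
      using F by (intro density_cong_AE) auto
    then have "1 = c * emeasure (density hermite_gauss (\<lambda>u. ennreal (F u))) UNIV"
      using S.emeasure_space_1 by (simp add: space_scale_measure)
    also have "emeasure (density hermite_gauss (\<lambda>u. ennreal (F u))) UNIV = (\<integral>\<^sup>+u. ennreal (F u) \<partial>hermite_gauss)"
      using emeasure_density[of "\<lambda>u. ennreal (F u)" hermite_gauss "space hermite_gauss"] sets.top[of hermite_gauss] by simp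
    \<comment> \<open>With infinite total mass the scaled mass is 0 for c = 0 and infinite
      otherwise, never 1.\<close>
    finally show False unfolding Ftop by (cases "c = 0") (auto simp: ennreal_mult_top)
  qed
qed

lemma subcritical_case:
  assumes K: "K > 0" and p: "2 < p" "p < 6"
  shows "r \<ge> 1 \<Longrightarrow> (SUP N. Lp_norm hermite_gauss r (weight_trunc hermite_gauss K p N)) < \<top>"
    and "r \<ge> 1 \<Longrightarrow> tendsto_Lp hermite_gauss r (weight_trunc hermite_gauss K p) (weight hermite_gauss K p)"
    and "prob_space (rho hermite_gauss K p)"
    and "(\<lambda>N. total_variation_dist (rho_trunc hermite_gauss K p N) (rho hermite_gauss K p)) \<longlonglongrightarrow> 0"
    and "absolutely_continuous hermite_gauss (rho hermite_gauss K p)"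
proof -
  have p1: "p \<ge> 1" "p > 2" using p by auto
  let ?w = "weight_trunc hermite_gauss K p"
  note [measurable] = weight_trunc_measurable[OF p1(1)]
  obtain F where Fm [measurable]: "F \<in> borel_measurable hermite_gauss" and F: "AE u in hermite_gauss. weight hermite_gauss K p u = F u"
    and F0: "\<And>u. F u \<ge> 0"
    and sub: "\<And>\<phi>::nat \<Rightarrow> nat. strict_mono \<phi> \<Longrightarrow> \<exists>\<psi>::nat \<Rightarrow> nat. strict_mono \<psi> \<and> (AE u in hermite_gauss. (\<lambda>k. ?w (\<phi> (\<psi> k)) u) \<longlonglongrightarrow> F u)"
    using weight_convergence[OF p1(2), of K] by blast
  have mom: "\<exists>C\<ge>0. \<forall>N. (\<integral>\<^sup>+u. ennreal (\<bar>?w N u\<bar> powr s) \<partial>hermite_gauss) \<le> ennreal C" if s: "s > 0" for s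
  proof -
    obtain C where C: "\<And>N. (\<integral>\<^sup>+u. ennreal (?w N u powr s) \<partial>hermite_gauss) \<le> ennreal C"
      using weight_trunc_moments[OF p K s] by blast
    have "(\<integral>\<^sup>+u. ennreal (\<bar>?w N u\<bar> powr s) \<partial>hermite_gauss) \<le> ennreal \<bar>C\<bar>" for N
      using order_trans[OF C ennreal_leI[OF abs_ge_self]] by (simp add: weight_trunc_nonneg)
    then show ?thesis by (intro exI[of _ "\<bar>C\<bar>"]) simp
  qed
  have lim: "(\<integral>\<^sup>+u. ennreal (\<bar>F u\<bar> powr s) \<partial>hermite_gauss) < \<top>"
    "(\<lambda>N. \<integral>\<^sup>+u. ennreal (\<bar>?w N u - F u\<bar> powr s) \<partial>hermite_gauss) \<longlonglongrightarrow> 0" if s: "s > 0" for s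
  proof -
    obtain C where "\<And>N. (\<integral>\<^sup>+u. ennreal (\<bar>?w N u\<bar> powr (2 * s)) \<partial>hermite_gauss) \<le> ennreal C"
      using mom[of "2 * s"] s by auto
    note * = G.Lp_convergence_of_subsequences[of ?w F s, OF weight_trunc_measurable[OF p1(1)] Fm s this sub]
    show "(\<integral>\<^sup>+u. ennreal (\<bar>F u\<bar> powr s) \<partial>hermite_gauss) < \<top>"
      "(\<lambda>N. \<integral>\<^sup>+u. ennreal (\<bar>?w N u - F u\<bar> powr s) \<partial>hermite_gauss) \<longlonglongrightarrow> 0" by (rule *, assumption)+
  qed
  { assume r: "r \<ge> 1"
    then have r0: "r > 0" by simp
    obtain C where C: "C \<ge> 0" "\<And>N. (\<integral>\<^sup>+u. ennreal (\<bar>?w N u\<bar> powr r) \<partial>hermite_gauss) \<le> ennreal C"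
      using mom[OF r0] by auto
    have le: "Lp_norm hermite_gauss r (?w N) \<le> ennreal ((C + 1) powr (1 / r))" for N
    proof -
      have "(\<integral>\<^sup>+u. ennreal (norm (?w N u) powr r) \<partial>hermite_gauss) < ennreal (((C + 1) powr (1 / r)) powr r)"
        using C r0 by (auto simp: powr_powr ennreal_less_iff intro: le_less_trans[OF C(2)])
      then have "Lp_norm hermite_gauss r (?w N) < ennreal ((C + 1) powr (1 / r))"
        using C(1) r0 by (subst Lp_norm_less_iff) auto
      then show ?thesis by simp
    qed
    then have "(SUP N. Lp_norm hermite_gauss r (?w N)) \<le> ennreal ((C + 1) powr (1 / r))" by (intro SUP_least)
    then show "(SUP N. Lp_norm hermite_gauss r (?w N)) < \<top>" by (rule order_le_less_trans) simp
    have "(\<integral>\<^sup>+u. ennreal (norm (weight hermite_gauss K p u) powr r) \<partial>hermite_gauss) = (\<integral>\<^sup>+u. ennreal (\<bar>F u\<bar> powr r) \<partial>hermite_gauss)"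
      using F by (intro nn_integral_cong_AE) auto
    moreover have "(\<integral>\<^sup>+u. ennreal (norm (?w N u - weight hermite_gauss K p u) powr r) \<partial>hermite_gauss) = (\<integral>\<^sup>+u. ennreal (\<bar>?w N u - F u\<bar> powr r) \<partial>hermite_gauss)" for N
      using F by (intro nn_integral_cong_AE) auto
    ultimately show "tendsto_Lp hermite_gauss r ?w (weight hermite_gauss K p)"
      using lim[OF r0] r0 borel_measurable_completion_AE[OF F Fm] C(2)
      by (auto simp: tendsto_Lp_def in_Lp_def Lp_norm_tendsto_0_iff Lp_norm_finite_iff
            intro!: measurable_completion intro: order_le_less_trans[OF C(2)])
  }
  have Fi: "integrable hermite_gauss F"
    using lim(1)[of 1] F0 by (intro integrableI_nonneg) auto
  have wi: "integrable hermite_gauss (?w N)" for N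
  proof -
    obtain C where "(\<integral>\<^sup>+u. ennreal (\<bar>?w N u\<bar> powr 1) \<partial>hermite_gauss) \<le> ennreal C" using mom[of 1] by auto
    then have "(\<integral>\<^sup>+u. ennreal (?w N u) \<partial>hermite_gauss) \<le> ennreal C" by (simp add: weight_trunc_nonneg)
    then have "(\<integral>\<^sup>+u. ennreal (?w N u) \<partial>hermite_gauss) < \<infinity>" by (rule order_le_less_trans) simp
    then show ?thesis by (intro integrableI_nonneg) (auto simp: weight_trunc_nonneg)
  qed
  define d where "d N = (\<integral>u. \<bar>?w N u - F u\<bar> \<partial>hermite_gauss)" for N
  have d0: "d N \<ge> 0" for N by (simp add: d_def)
  have di: "integrable hermite_gauss (\<lambda>u. \<bar>?w N u - F u\<bar>)" for N using wi Fi by auto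
  have dlim: "d \<longlonglongrightarrow> 0"
  proof -
    have "(\<integral>\<^sup>+u. ennreal (\<bar>?w N u - F u\<bar> powr 1) \<partial>hermite_gauss) = ennreal (d N)" for N
      unfolding d_def using di by (simp add: nn_integral_eq_integral)
    then have "(\<lambda>N. ennreal (d N)) \<longlonglongrightarrow> ennreal 0" using lim(2)[of 1] by simp
    then show ?thesis using d0 by (subst (asm) tendsto_ennreal_iff) auto
  qed
  define z where "z = (\<integral>u. F u \<partial>hermite_gauss)"
  define zN where "zN N = (\<integral>u. ?w N u \<partial>hermite_gauss)" for N
  have zd: "\<bar>zN N - z\<bar> \<le> d N" for N
  proof -
    have "zN N - z = (\<integral>u. ?w N u - F u \<partial>hermite_gauss)" unfolding zN_def z_def using wi Fi by simp
    then show ?thesis unfolding d_def by simp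
  qed
  \<comment> \<open>The small ball with m = 0 bounds the normalizing constants from below, uniformly
    for large N, because the exponential factor is at least 1.\<close>
  obtain c N0 where c: "c > 0" "\<And>N. N \<ge> N0 \<Longrightarrow> c \<le> G.prob {u. \<bar>wick {0..N} u + 0\<bar> \<le> K}"
    using wick_small_ball[OF K, of 0] by auto
  have zc: "c \<le> zN N" if "N \<ge> N0" for N
  proof -
    have E: "{u. \<bar>wick {0..N} u\<bar> \<le> K} \<in> G.events"
    proof -
      have "{u \<in> space hermite_gauss. \<bar>wick {0..N} u\<bar> \<le> K} \<in> G.events" by measurable
      then show ?thesis by simp
    qed
    have "c \<le> G.prob {u. \<bar>wick {0..N} u\<bar> \<le> K}" using c(2)[OF that] by simp
    also have "\<dots> = (\<integral>u. indicator {u. \<bar>wick {0..N} u\<bar> \<le> K} u \<partial>hermite_gauss)" using E by simp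
    also have "\<dots> \<le> zN N" unfolding zN_def
    proof (rule integral_mono[OF _ wi])
      show "integrable hermite_gauss (indicator {u. \<bar>wick {0..N} u\<bar> \<le> K} :: _ \<Rightarrow> real)"
        using E by (intro integrable_real_indicator) (auto simp: less_top[symmetric])
      fix u
      have "1 \<le> exp (1 / p * enn2real (Lp_mass p {0..N} u))" using p by simp
      then show "indicator {u. \<bar>wick {0..N} u\<bar> \<le> K} u \<le> ?w N u"
        using p by (auto simp: weight_trunc_eq indicator_def)
    qed
    finally show ?thesis .
  qed
  have z: "z > 0"
  proof -
    have "zN \<longlonglongrightarrow> z"
      using dlim zd by (intro LIM_zero_cancel[OF Lim_null_comparison[OF _ dlim]]) auto
    then have "c \<le> z" by (rule LIMSEQ_le_const) (use zc in auto)
    then show ?thesis using c by simp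
  qed
  have Zf: "Z_full hermite_gauss K p = ennreal z"
  proof -
    have "Z_full hermite_gauss K p = (\<integral>\<^sup>+u. ennreal (F u) \<partial>hermite_gauss)"
      unfolding Z_full_def using F by (intro nn_integral_cong_AE) auto
    then show ?thesis using Fi F0 by (simp add: nn_integral_eq_integral z_def)
  qed
  have Zt: "Z_trunc hermite_gauss K p N = ennreal (zN N)" for N
    unfolding Z_trunc_def zN_def using wi by (simp add: nn_integral_eq_integral weight_trunc_nonneg)
  have rho: "rho hermite_gauss K p = density hermite_gauss (\<lambda>u. ennreal (F u / z))"
    unfolding rho_def Zf using F z F0 by (intro density_cong_AE) (auto simp: divide_ennreal)
  have meas: "measure (density hermite_gauss (\<lambda>u. ennreal (h u / y))) A = (\<integral>u. h u * indicator A u \<partial>hermite_gauss) / y"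
    "integrable hermite_gauss (\<lambda>u. h u * indicator A u)"
    if h: "integrable hermite_gauss h" "\<And>u. h u \<ge> 0" and y: "y > 0" and A: "A \<in> sets hermite_gauss" for h y A
  proof -
    have [measurable]: "h \<in> borel_measurable hermite_gauss" using h by simp
    show i: "integrable hermite_gauss (\<lambda>u. h u * indicator A u)"
      using integrable_mult_indicator[OF A h(1)] by (simp add: mult.commute)
    have "emeasure (density hermite_gauss (\<lambda>u. ennreal (h u / y))) A = (\<integral>\<^sup>+u. ennreal (h u / y) * indicator A u \<partial>hermite_gauss)"
      using A by (intro emeasure_density) auto
    also have "\<dots> = (\<integral>\<^sup>+u. ennreal (h u * indicator A u / y) \<partial>hermite_gauss)"
      by (intro nn_integral_cong) (auto simp: indicator_def)
    also have "\<dots> = ennreal (\<integral>u. h u * indicator A u / y \<partial>hermite_gauss)"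
      using i h y by (intro nn_integral_eq_integral) auto
    finally show "measure (density hermite_gauss (\<lambda>u. ennreal (h u / y))) A = (\<integral>u. h u * indicator A u \<partial>hermite_gauss) / y"
      using h y by (simp add: measure_def)
  qed
  show "prob_space (rho hermite_gauss K p)"
  proof (rule prob_spaceI)
    have "emeasure (rho hermite_gauss K p) (space (rho hermite_gauss K p)) = (\<integral>\<^sup>+u. ennreal (F u / z) \<partial>hermite_gauss)"
      unfolding rho using emeasure_density[of "\<lambda>u. ennreal (F u / z)" hermite_gauss "space hermite_gauss"] sets.top[of hermite_gauss] by simp
    also have "\<dots> = ennreal (\<integral>u. F u / z \<partial>hermite_gauss)"
      using Fi F0 z by (intro nn_integral_eq_integral) auto
    also have "\<dots> = 1" using z by (simp add: z_def)
    finally show "emeasure (rho hermite_gauss K p) (space (rho hermite_gauss K p)) = 1" .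
  qed
  show "absolutely_continuous hermite_gauss (rho hermite_gauss K p)"
    unfolding rho by (rule absolutely_continuousI_density) measurable
  have tv: "total_variation_dist (rho_trunc hermite_gauss K p N) (rho hermite_gauss K p) \<le> ennreal (2 * d N / c)" if N: "N \<ge> N0" for N
  proof -
    have zN: "zN N > 0" using zc[OF N] c by simp
    have rt: "rho_trunc hermite_gauss K p N = density hermite_gauss (\<lambda>u. ennreal (?w N u / zN N))"
      unfolding rho_trunc_def Zt using zN by (simp add: divide_ennreal weight_trunc_nonneg)
    have "\<bar>measure (rho_trunc hermite_gauss K p N) A - measure (rho hermite_gauss K p) A\<bar> \<le> 2 * d N / c" if A: "A \<in> sets hermite_gauss" for A
    proof -
      define x where "x = (\<integral>u. ?w N u * indicator A u \<partial>hermite_gauss)"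
      define y where "y = (\<integral>u. F u * indicator A u \<partial>hermite_gauss)"
      have i: "integrable hermite_gauss (\<lambda>u. ?w N u * indicator A u)" "integrable hermite_gauss (\<lambda>u. F u * indicator A u)"
        using meas(2)[OF wi weight_trunc_nonneg zN A] meas(2)[OF Fi F0 z A] by auto
      have xy: "\<bar>x - y\<bar> \<le> d N"
      proof -
        have "x - y = (\<integral>u. ?w N u * indicator A u - F u * indicator A u \<partial>hermite_gauss)" unfolding x_def y_def using i by simp
        also have "\<bar>\<dots>\<bar> \<le> (\<integral>u. \<bar>?w N u * indicator A u - F u * indicator A u\<bar> \<partial>hermite_gauss)" by (rule integral_abs_bound)
        also have "\<dots> \<le> d N" unfolding d_def
          using i di by (intro integral_mono) (auto simp: indicator_def)
        finally show ?thesis .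
      qed
      have y0: "0 \<le> y" "y \<le> z" unfolding y_def z_def
        using i Fi F0 by (auto intro!: integral_mono integral_nonneg_AE simp: indicator_def)
      \<comment> \<open>Separates the change of the unnormalized measure from that of the
        normalizing constant; each contributes at most d N / zN N.\<close>
      have "x / zN N - y / z = (x - y) / zN N + (y / z) * ((z - zN N) / zN N)"
        using zN z by (simp add: field_simps)
      then have "\<bar>x / zN N - y / z\<bar> \<le> \<bar>x - y\<bar> / zN N + (y / z) * (\<bar>z - zN N\<bar> / zN N)"
        using abs_triangle_ineq[of "(x - y) / zN N" "(y / z) * ((z - zN N) / zN N)"] zN z y0 by (simp add: abs_mult)
      also have "\<dots> \<le> d N / zN N + 1 * (d N / zN N)"
        using xy zd[of N] y0 z zN by (intro add_mono mult_mono divide_right_mono) (auto simp: abs_minus_commute)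
      also have "\<dots> = 2 * d N / zN N" by simp
      also have "\<dots> \<le> 2 * d N / c" using zc[OF N] c d0 zN by (intro divide_left_mono) auto
      finally show ?thesis
        unfolding rt rho meas(1)[OF wi weight_trunc_nonneg zN A] meas(1)[OF Fi F0 z A] x_def y_def .
    qed
    then show ?thesis unfolding total_variation_dist_def
      by (intro SUP_least ennreal_leI) (simp add: rho_trunc_def)
  qed
  show "(\<lambda>N. total_variation_dist (rho_trunc hermite_gauss K p N) (rho hermite_gauss K p)) \<longlonglongrightarrow> 0"
  proof (rule tendsto_sandwich[OF _ _ tendsto_const])
    show "eventually (\<lambda>N. total_variation_dist (rho_trunc hermite_gauss K p N) (rho hermite_gauss K p) \<le> ennreal (2 * d N / c)) sequentially"
      using tv by (auto simp: eventually_sequentially)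
    have "(\<lambda>N. 2 * d N / c) \<longlonglongrightarrow> 0" using tendsto_mult_right_zero[OF dlim, of "2 / c"] by simp
    from tendsto_ennrealI[OF this] show "(\<lambda>N. ennreal (2 * d N / c)) \<longlonglongrightarrow> 0" by simp
  qed auto
qed

theorem theorem1p4:
  fixes M :: "'a measure" and g :: "nat \<Rightarrow> 'a \<Rightarrow> complex"
    and \<mu> :: "(nat \<Rightarrow> complex) measure"
  assumes "prob_space M"
    and "prob_space.indep_vars M (\<lambda>_. borel) g UNIV"
    and "\<And>n. std_complex_gaussian M (g n)"
    and "\<mu> = gauss_law M g"
  shows
    "(\<forall>K p :: real. K > 0 \<and> 2 < p \<and> p < 6 \<longrightarrow>
        (\<forall>r::real. r \<ge> 1 \<longrightarrow>
           (SUP N. Lp_norm \<mu> r (weight_trunc \<mu> K p N)) < \<top> \<and>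
           tendsto_Lp \<mu> r (weight_trunc \<mu> K p) (weight \<mu> K p)) \<and>
        prob_space (rho \<mu> K p) \<and>
        (\<lambda>N. total_variation_dist (rho_trunc \<mu> K p N) (rho \<mu> K p)) \<longlonglongrightarrow> 0 \<and>
        absolutely_continuous \<mu> (rho \<mu> K p))
   \<and> (\<forall>K p :: real. K > 0 \<and> p \<ge> 6 \<longrightarrow>
        (SUP N. Z_trunc \<mu> K p N) = \<top> \<and>
        (SUP N. Lp_norm \<mu> 1 (weight_trunc \<mu> K p N)) = \<top> \<and>
        Z_full \<mu> K p = \<top> \<and>
        \<not> (\<exists>c::ennreal. prob_space (scale_measure c (density \<mu> (\<lambda>u. ennreal (weight \<mu> K p u))))))"
proof -
  have \<mu>: "\<mu> = hermite_gauss" using assms by (simp add: gauss_law_eq)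
  show ?thesis unfolding \<mu>
    by (intro conjI allI impI; (elim conjE)?) (simp_all add: subcritical_case critical_case)
qed

end
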